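(* Let $(a,b)\subset\mathbb{R}$ be a finite interval and let $p,q,r$ be Lebesgue measurable functions on $(a,b)$ with $r>0$ a.e., $r\in L^1((a,b);dx)$; $p>0$ a.e., $1/p\in L^1((a,b);dx)$; $q$ real-valued a.e., $q\in L^1((a,b);dx)$. Let $\varphi\in[0,\pi)$ and $R\in SL(2,\mathbb{R})$, consider the self-adjoint operator $T_{\varphi,R}$ with coupled boundary conditions, and suppose the multiplicity $m_0$ of zero as an eigenvalue of $T_{\varphi,R}$ satisfies $m_0\in\{0,1\}$. Put $$a_0=e^{i\varphi}\big(R_{12}\theta_0^{[1]}(b)-R_{22}\theta_0(b)+R_{21}\phi_0(b)-R_{11}\phi_0^{[1]}(b)\big)+e^{2i\varphi}+1,$$ $$a_k=e^{i\varphi}\big(R_{12}\theta_k^{[1]}(b)-R_{22}\theta_k(b)+R_{21}\phi_k(b)-R_{11}\phi_k^{[1]}(b)\big),\quad k\in\mathbb{N}.$$ Then for all $n\in\mathbb{N}$, $$\zeta(n;T_{\varphi,R})=-\operatorname{Res}\left[z^{-n}\frac{d}{dz}\ln(F_{\varphi,R}(z));\ z=0\right]=-n\,b_n,$$ where, for $m_0=0$, $$b_1=\frac{a_1}{a_0},\qquad b_j=\frac{a_j}{a_0}-\sum_{\ell=1}^{j-1}\frac{\ell}{j}\,\frac{a_{j-\ell}}{a_0}\,b_\ell,\quad j\ge2,$$ and, for $m_0=1$, $$b_1=\frac{a_2}{a_1},\qquad b_j=\frac{a_{j+1}}{a_1}-\sum_{\ell=1}^{j-1}\frac{\ell}{j}\,\frac{a_{j-\ell+1}}{a_1}\,b_\ell,\quad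 j\ge2.$$ In particular, if zero is not an eigenvalue of $T_{\varphi,R}$, then $$\operatorname{tr}_{L^2((a,b);r\,dx)}\big(T_{\varphi,R}^{-1}\big)=\zeta(1;T_{\varphi,R})=\frac{-e^{i\varphi}\big(R_{12}\theta_1^{[1]}(b)-R_{22}\theta_1(b)+R_{21}\phi_1(b)-R_{11}\phi_1^{[1]}(b)\big)}{e^{i\varphi}\big(R_{12}\theta_0^{[1]}(b)-R_{22}\theta_0(b)+R_{21}\phi_0(b)-R_{11}\phi_0^{[1]}(b)\big)+e^{2i\varphi}+1}.$$
   Context: The differential expression is $\tau=\frac{1}{r(x)}\left[-\frac{d}{dx}p(x)\frac{d}{dx}+q(x)\right]$ on $(a,b)$; $y^{[1]}=py'$. In $L^2((a,b);r\,dx)$, $T_{max}f=\tau f$ with $\mathrm{dom}(T_{max})=\{g\in L^2((a,b);r\,dx)\mid g,g^{[1]}\in AC([a,b]),\ \tau g\in L^2((a,b);r\,dx)\}$. $T_{\varphi,R}$ is the restriction of $T_{max}$ to those $g$ with $\begin{pmatrix}g(b)\\ g^{[1]}(b)\end{pmatrix}=e^{i\varphi}R\begin{pmatrix}g(a)\\ g^{[1]}(a)\end{pmatrix}$; it is self-adjoint, bounded from below, with purely discrete spectrum. $\theta(z,x,a),\phi(z,x,a)$ are the solutions of $\tau y=zy$ with $\theta(z,a,a)=\phi^{[1]}(z,a,a)=1$, $\theta^{[1]}(z,a,a)=\phi(z,a,a)=0$, and $$F_{\varphi,R}(z)=e^{i\varphi}\big(R_{12}\theta^{[1]}(z,b,a)-R_{22}\theta(z,b,a)+R_{21}\phi(z,b,a)-R_{11}\phi^{[1]}(z,b,a)\big)+e^{2i\varphi}+1.$$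 Coefficients: let $g(0,x,x')=\theta(0,x,a)\phi(0,x',a)-\theta(0,x',a)\phi(0,x,a)$ and $g^{[1]}(0,x,x')=\theta^{[1]}(0,x,a)\phi(0,x',a)-\theta(0,x',a)\phi^{[1]}(0,x,a)$. Set $\phi_0(x)=\phi(0,x,a)$, $\phi_0^{[1]}(x)=\phi^{[1]}(0,x,a)$ and, for $k\ge1$, $\phi_k(x)=\int_a^x r(t)\,g(0,x,t)\,\phi_{k-1}(t)\,dt$, $\phi_k^{[1]}(x)=\int_a^x r(t)\,g^{[1]}(0,x,t)\,\phi_{k-1}(t)\,dt$; define $\theta_k,\theta_k^{[1]}$ in the same way with $\theta$ in place of $\phi$ (i.e. $\theta_0(x)=\theta(0,x,a)$, $\theta_0^{[1]}(x)=\theta^{[1]}(0,x,a)$, $\theta_k(x)=\int_a^x r(t)g(0,x,t)\theta_{k-1}(t)dt$, $\theta_k^{[1]}(x)=\int_a^x r(t)g^{[1]}(0,x,t)\theta_{k-1}(t)dt$). These are the coefficients in the power series $\phi(z,x,a)=\sum_m z^m\phi_m(x)$, etc., in $z$. $\zeta(s;T)=\sum_{\lambda_j\ne0}\lambda_j^{-s}$, the sum over all nonzero eigenvalues of $T$ counted with multiplicity ($\mathrm{Re}(s)>1/2$). $\frac{d}{dz}\ln F$ means $F'/F$. *)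

theory Defs
  imports "HOL-Complex_Analysis.Complex_Analysis" "HOL-Library.Function_Algebras"
begin

unbundle no fps_syntax

text \<open>Complex-valued functions as a complex vector space, to have a notion of dimension.\<close>

definition cfun_scale :: "complex \<Rightarrow> (real \<Rightarrow> complex) \<Rightarrow> real \<Rightarrow> complex" where
  "cfun_scale c f = (\<lambda>x. c * f x)"

global_interpretation cfun: vector_space cfun_scale
  by unfold_locales (simp_all add: cfun_scale_def fun_eq_iff distrib_left distrib_right)


section \<open>The Hilbert space of square-integrable functions\<close>

text \<open>
  Elements of the Hilbert space are represented by square-integrable functions, equality being
  equality almost everywhere. In particular linearity of operators is required only up to
  null sets; together with boundedness this makes an operator compatible with equality
  almost everywhere.
\<close>

definition L2 :: "real measure \<Rightarrow> (real \<Rightarrow> complex) set" where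
  "L2 M = {f. f \<in> borel_measurable M \<and> integrable M (\<lambda>x. (norm (f x))\<^sup>2)}"

definition l2_inner :: "real measure \<Rightarrow> (real \<Rightarrow> complex) \<Rightarrow> (real \<Rightarrow> complex) \<Rightarrow> complex" where
  "l2_inner M f g = (\<integral>x. cnj (f x) * g x \<partial>M)"

definition l2_norm :: "real measure \<Rightarrow> (real \<Rightarrow> complex) \<Rightarrow> real" where
  "l2_norm M f = sqrt (\<integral>x. (norm (f x))\<^sup>2 \<partial>M)"

definition orthonormal_basis :: "real measure \<Rightarrow> (real \<Rightarrow> complex) set \<Rightarrow> bool" where
  "orthonormal_basis M E \<longleftrightarrow>
     E \<subseteq> L2 M \<and>
     (\<forall>e\<in>E. \<forall>f\<in>E. l2_inner M e f = (if e = f then 1 else 0)) \<and>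
     (\<forall>f\<in>L2 M. (\<forall>e\<in>E. l2_inner M e f = 0) \<longrightarrow> (AE x in M. f x = 0))"

definition bounded_operator ::
    "real measure \<Rightarrow> ((real \<Rightarrow> complex) \<Rightarrow> real \<Rightarrow> complex) \<Rightarrow> bool" where
  "bounded_operator M A \<longleftrightarrow>
     (\<forall>f\<in>L2 M. A f \<in> L2 M) \<and>
     (\<forall>f\<in>L2 M. \<forall>g\<in>L2 M. \<forall>c d. AE x in M.
        A (\<lambda>t. c * f t + d * g t) x = c * A f x + d * A g x) \<and>
     (\<exists>C. \<forall>f\<in>L2 M. l2_norm M (A f) \<le> C * l2_norm M f)"

text \<open>
  A bounded operator is of trace class iff the sums of its diagonal entries converge
  unconditionally for every orthonormal basis; the value is then the same for all bases and is
  the trace.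
\<close>

definition has_trace ::
    "real measure \<Rightarrow> ((real \<Rightarrow> complex) \<Rightarrow> real \<Rightarrow> complex) \<Rightarrow> complex \<Rightarrow> bool" where
  "has_trace M A t \<longleftrightarrow>
     bounded_operator M A \<and>
     (\<forall>E. orthonormal_basis M E \<longrightarrow> ((\<lambda>e. l2_inner M e (A e)) has_sum t) E)"


section \<open>Absolute continuity and the Sturm--Liouville differential expression\<close>

definition AC_on :: "real \<Rightarrow> real \<Rightarrow> (real \<Rightarrow> complex) \<Rightarrow> bool" where
  "AC_on a b f \<longleftrightarrow>
     (\<forall>\<epsilon>>0. \<exists>\<delta>>0. \<forall>(n::nat) s t.
        (\<forall>i<n. a \<le> s i \<and> s i \<le> t i \<and> t i \<le> b) \<and>
        (\<forall>i<n. \<forall>j<n. i \<noteq> j \<longrightarrow> {s i<..<t i} \<inter> {s j<..<t j} = {}) \<and>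
        (\<Sum>i<n. t i - s i) < \<delta> \<longrightarrow>
        (\<Sum>i<n. norm (f (t i) - f (s i))) < \<epsilon>)"

text \<open>
  A function on the compact interval is encoded by its extension by zero. Thus an element of the
  domain of the differential operator is determined as a function, being the unique continuous
  representative of its class in the Hilbert space.
\<close>

definition AC_fun :: "real \<Rightarrow> real \<Rightarrow> (real \<Rightarrow> complex) set" where
  "AC_fun a b = {f. AC_on a b f \<and> (\<forall>x. x \<notin> {a..b} \<longrightarrow> f x = 0)}"

definition is_quasi_deriv ::
    "real \<Rightarrow> real \<Rightarrow> (real \<Rightarrow> real) \<Rightarrow> (real \<Rightarrow> complex) \<Rightarrow> (real \<Rightarrow> complex) \<Rightarrow> bool" where
  "is_quasi_deriv a b p g u \<longleftrightarrow>
     (AE x in lebesgue_on {a<..<b}.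
        g differentiable (at x) \<and> u x = of_real (p x) * vector_derivative g (at x))"

text \<open>
  The quasi-derivative \<open>p g'\<close> is defined almost everywhere; \<open>quasi_deriv\<close> is its absolutely
  continuous representative, which gives a meaning to its boundary values.
\<close>

definition quasi_deriv :: "real \<Rightarrow> real \<Rightarrow> (real \<Rightarrow> real) \<Rightarrow> (real \<Rightarrow> complex) \<Rightarrow> real \<Rightarrow> complex" where
  "quasi_deriv a b p g = (THE u. u \<in> AC_fun a b \<and> is_quasi_deriv a b p g u)"

definition sl_tau ::
    "real \<Rightarrow> real \<Rightarrow> (real \<Rightarrow> real) \<Rightarrow> (real \<Rightarrow> real) \<Rightarrow> (real \<Rightarrow> real) \<Rightarrow>
     (real \<Rightarrow> complex) \<Rightarrow> real \<Rightarrow> complex" where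
  "sl_tau a b p q r g x =
     (- vector_derivative (quasi_deriv a b p g) (at x) + of_real (q x) * g x) / of_real (r x)"

text \<open>
  The functions \<open>g\<close> such that \<open>g\<close> and its quasi-derivative are absolutely continuous. The
  differentiability almost everywhere demanded here and in \<open>is_quasi_deriv\<close> is automatic for
  absolutely continuous functions; it makes explicit that the totalised \<open>vector_derivative\<close>
  is a genuine derivative almost everywhere.
\<close>

definition sl_regular :: "real \<Rightarrow> real \<Rightarrow> (real \<Rightarrow> real) \<Rightarrow> (real \<Rightarrow> complex) set" where
  "sl_regular a b p =
     {g \<in> AC_fun a b. \<exists>u\<in>AC_fun a b. is_quasi_deriv a b p g u \<and>
        (AE x in lebesgue_on {a<..<b}. u differentiable (at x))}"

definition sl_solution ::
    "real \<Rightarrow> real \<Rightarrow> (real \<Rightarrow> real) \<Rightarrow> (real \<Rightarrow> real) \<Rightarrow> (real \<Rightarrow> real) \<Rightarrow>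
     complex \<Rightarrow> (real \<Rightarrow> complex) \<Rightarrow> bool" where
  "sl_solution a b p q r z y \<longleftrightarrow>
     y \<in> sl_regular a b p \<and> (AE x in lebesgue_on {a<..<b}. sl_tau a b p q r y x = z * y x)"


section \<open>The operators\<close>

definition sl_measure :: "real \<Rightarrow> real \<Rightarrow> (real \<Rightarrow> real) \<Rightarrow> real measure" where
  "sl_measure a b r = density (lebesgue_on {a<..<b}) (\<lambda>x. ennreal (r x))"

definition dom_max ::
    "real \<Rightarrow> real \<Rightarrow> (real \<Rightarrow> real) \<Rightarrow> (real \<Rightarrow> real) \<Rightarrow> (real \<Rightarrow> real) \<Rightarrow> (real \<Rightarrow> complex) set" where
  "dom_max a b p q r =
     {g \<in> L2 (sl_measure a b r). g \<in> sl_regular a b p \<and>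
        sl_tau a b p q r g \<in> L2 (sl_measure a b r)}"

text \<open>The domain of the restriction of \<open>sl_tau\<close> given by the coupled boundary conditions.\<close>

definition dom_coupled ::
    "real \<Rightarrow> real \<Rightarrow> (real \<Rightarrow> real) \<Rightarrow> (real \<Rightarrow> real) \<Rightarrow> (real \<Rightarrow> real) \<Rightarrow>
     real \<Rightarrow> real^2^2 \<Rightarrow> (real \<Rightarrow> complex) set" where
  "dom_coupled a b p q r \<phi> R =
     {g \<in> dom_max a b p q r.
        g b = cis \<phi> * (of_real (R$1$1) * g a + of_real (R$1$2) * quasi_deriv a b p g a) \<and>
        quasi_deriv a b p g b =
          cis \<phi> * (of_real (R$2$1) * g a + of_real (R$2$2) * quasi_deriv a b p g a)}"

definition eigenspace ::
    "real \<Rightarrow> real \<Rightarrow> (real \<Rightarrow> real) \<Rightarrow> (real \<Rightarrow> real) \<Rightarrow> (real \<Rightarrow> real) \<Rightarrow>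
     real \<Rightarrow> real^2^2 \<Rightarrow> complex \<Rightarrow> (real \<Rightarrow> complex) set" where
  "eigenspace a b p q r \<phi> R \<mu> =
     {g \<in> dom_coupled a b p q r \<phi> R.
        AE x in sl_measure a b r. sl_tau a b p q r g x = \<mu> * g x}"

definition eigenvalues ::
    "real \<Rightarrow> real \<Rightarrow> (real \<Rightarrow> real) \<Rightarrow> (real \<Rightarrow> real) \<Rightarrow> (real \<Rightarrow> real) \<Rightarrow>
     real \<Rightarrow> real^2^2 \<Rightarrow> complex set" where
  "eigenvalues a b p q r \<phi> R = {\<mu>. \<exists>g\<in>eigenspace a b p q r \<phi> R \<mu>. g \<noteq> 0}"

definition eig_mult ::
    "real \<Rightarrow> real \<Rightarrow> (real \<Rightarrow> real) \<Rightarrow> (real \<Rightarrow> real) \<Rightarrow> (real \<Rightarrow> real) \<Rightarrow>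
     real \<Rightarrow> real^2^2 \<Rightarrow> complex \<Rightarrow> nat" where
  "eig_mult a b p q r \<phi> R \<mu> = cfun.dim (eigenspace a b p q r \<phi> R \<mu>)"

text \<open>
  The branch of the complex power is the principal one; the choice only matters for negative
  eigenvalues and non-integer \<open>s\<close>.
\<close>

definition zeta_term ::
    "real \<Rightarrow> real \<Rightarrow> (real \<Rightarrow> real) \<Rightarrow> (real \<Rightarrow> real) \<Rightarrow> (real \<Rightarrow> real) \<Rightarrow>
     real \<Rightarrow> real^2^2 \<Rightarrow> complex \<Rightarrow> complex \<Rightarrow> complex" where
  "zeta_term a b p q r \<phi> R s \<mu> = of_nat (eig_mult a b p q r \<phi> R \<mu>) * \<mu> powr (- s)"

definition spectral_zeta ::
    "real \<Rightarrow> real \<Rightarrow> (real \<Rightarrow> real) \<Rightarrow> (real \<Rightarrow> real) \<Rightarrow> (real \<Rightarrow> real) \<Rightarrow>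
     real \<Rightarrow> real^2^2 \<Rightarrow> complex \<Rightarrow> complex" where
  "spectral_zeta a b p q r \<phi> R s =
     (\<Sum>\<^sub>\<infinity>\<mu>\<in>eigenvalues a b p q r \<phi> R - {0}. zeta_term a b p q r \<phi> R s \<mu>)"

text \<open>
  The inverse of the coupled operator maps \<open>f\<close> to the unique preimage in the domain; this is a
  sensible definition only where such a preimage exists and is unique.
\<close>

definition op_inverse ::
    "real \<Rightarrow> real \<Rightarrow> (real \<Rightarrow> real) \<Rightarrow> (real \<Rightarrow> real) \<Rightarrow> (real \<Rightarrow> real) \<Rightarrow>
     real \<Rightarrow> real^2^2 \<Rightarrow> (real \<Rightarrow> complex) \<Rightarrow> real \<Rightarrow> complex" where
  "op_inverse a b p q r \<phi> R f =
     (THE g. g \<in> dom_coupled a b p q r \<phi> R \<and>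
        (AE x in sl_measure a b r. sl_tau a b p q r g x = f x))"


section \<open>Fundamental solutions and the characteristic function\<close>

definition sl_ivp ::
    "real \<Rightarrow> real \<Rightarrow> (real \<Rightarrow> real) \<Rightarrow> (real \<Rightarrow> real) \<Rightarrow> (real \<Rightarrow> real) \<Rightarrow>
     complex \<Rightarrow> complex \<Rightarrow> complex \<Rightarrow> real \<Rightarrow> complex" where
  "sl_ivp a b p q r c d z =
     (THE y. sl_solution a b p q r z y \<and> y a = c \<and> quasi_deriv a b p y a = d)"

definition sl_theta ::
    "real \<Rightarrow> real \<Rightarrow> (real \<Rightarrow> real) \<Rightarrow> (real \<Rightarrow> real) \<Rightarrow> (real \<Rightarrow> real) \<Rightarrow> complex \<Rightarrow> real \<Rightarrow> complex" where
  "sl_theta a b p q r = sl_ivp a b p q r 1 0"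

definition sl_phi ::
    "real \<Rightarrow> real \<Rightarrow> (real \<Rightarrow> real) \<Rightarrow> (real \<Rightarrow> real) \<Rightarrow> (real \<Rightarrow> real) \<Rightarrow> complex \<Rightarrow> real \<Rightarrow> complex" where
  "sl_phi a b p q r = sl_ivp a b p q r 0 1"

definition sl_theta1 ::
    "real \<Rightarrow> real \<Rightarrow> (real \<Rightarrow> real) \<Rightarrow> (real \<Rightarrow> real) \<Rightarrow> (real \<Rightarrow> real) \<Rightarrow> complex \<Rightarrow> real \<Rightarrow> complex" where
  "sl_theta1 a b p q r z = quasi_deriv a b p (sl_theta a b p q r z)"

definition sl_phi1 ::
    "real \<Rightarrow> real \<Rightarrow> (real \<Rightarrow> real) \<Rightarrow> (real \<Rightarrow> real) \<Rightarrow> (real \<Rightarrow> real) \<Rightarrow> complex \<Rightarrow> real \<Rightarrow> complex" where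
  "sl_phi1 a b p q r z = quasi_deriv a b p (sl_phi a b p q r z)"

definition bc_form ::
    "real \<Rightarrow> real^2^2 \<Rightarrow> complex \<Rightarrow> complex \<Rightarrow> complex \<Rightarrow> complex \<Rightarrow> complex" where
  "bc_form \<phi> R th1 th ph ph1 =
     cis \<phi> * (of_real (R$1$2) * th1 - of_real (R$2$2) * th
              + of_real (R$2$1) * ph - of_real (R$1$1) * ph1)"

definition char_fun ::
    "real \<Rightarrow> real \<Rightarrow> (real \<Rightarrow> real) \<Rightarrow> (real \<Rightarrow> real) \<Rightarrow> (real \<Rightarrow> real) \<Rightarrow>
     real \<Rightarrow> real^2^2 \<Rightarrow> complex \<Rightarrow> complex" where
  "char_fun a b p q r \<phi> R z =
     bc_form \<phi> R (sl_theta1 a b p q r z b) (sl_theta a b p q r z b)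
       (sl_phi a b p q r z b) (sl_phi1 a b p q r z b) + cis (2 * \<phi>) + 1"

definition green0 ::
    "real \<Rightarrow> real \<Rightarrow> (real \<Rightarrow> real) \<Rightarrow> (real \<Rightarrow> real) \<Rightarrow> (real \<Rightarrow> real) \<Rightarrow> real \<Rightarrow> real \<Rightarrow> complex" where
  "green0 a b p q r x x' =
     sl_theta a b p q r 0 x * sl_phi a b p q r 0 x' - sl_theta a b p q r 0 x' * sl_phi a b p q r 0 x"

definition green0_1 ::
    "real \<Rightarrow> real \<Rightarrow> (real \<Rightarrow> real) \<Rightarrow> (real \<Rightarrow> real) \<Rightarrow> (real \<Rightarrow> real) \<Rightarrow> real \<Rightarrow> real \<Rightarrow> complex" where
  "green0_1 a b p q r x x' =
     sl_theta1 a b p q r 0 x * sl_phi a b p q r 0 x' - sl_theta a b p q r 0 x' * sl_phi1 a b p q r 0 x"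

primrec iter_coeff ::
    "real \<Rightarrow> real \<Rightarrow> (real \<Rightarrow> real) \<Rightarrow> (real \<Rightarrow> real) \<Rightarrow> (real \<Rightarrow> real) \<Rightarrow>
     (real \<Rightarrow> complex) \<Rightarrow> nat \<Rightarrow> real \<Rightarrow> complex" where
  "iter_coeff a b p q r y 0 = y"
| "iter_coeff a b p q r y (Suc k) =
     (\<lambda>x. LINT t:{a<..<x}|lebesgue. of_real (r t) * green0 a b p q r x t * iter_coeff a b p q r y k t)"

primrec iter_coeff1 ::
    "real \<Rightarrow> real \<Rightarrow> (real \<Rightarrow> real) \<Rightarrow> (real \<Rightarrow> real) \<Rightarrow> (real \<Rightarrow> real) \<Rightarrow>
     (real \<Rightarrow> complex) \<Rightarrow> nat \<Rightarrow> real \<Rightarrow> complex" where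
  "iter_coeff1 a b p q r y 0 = quasi_deriv a b p y"
| "iter_coeff1 a b p q r y (Suc k) =
     (\<lambda>x. LINT t:{a<..<x}|lebesgue. of_real (r t) * green0_1 a b p q r x t * iter_coeff a b p q r y k t)"

definition theta_k ::
    "real \<Rightarrow> real \<Rightarrow> (real \<Rightarrow> real) \<Rightarrow> (real \<Rightarrow> real) \<Rightarrow> (real \<Rightarrow> real) \<Rightarrow> nat \<Rightarrow> real \<Rightarrow> complex" where
  "theta_k a b p q r = iter_coeff a b p q r (sl_theta a b p q r 0)"

definition theta1_k ::
    "real \<Rightarrow> real \<Rightarrow> (real \<Rightarrow> real) \<Rightarrow> (real \<Rightarrow> real) \<Rightarrow> (real \<Rightarrow> real) \<Rightarrow> nat \<Rightarrow> real \<Rightarrow> complex" where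
  "theta1_k a b p q r = iter_coeff1 a b p q r (sl_theta a b p q r 0)"

definition phi_k ::
    "real \<Rightarrow> real \<Rightarrow> (real \<Rightarrow> real) \<Rightarrow> (real \<Rightarrow> real) \<Rightarrow> (real \<Rightarrow> real) \<Rightarrow> nat \<Rightarrow> real \<Rightarrow> complex" where
  "phi_k a b p q r = iter_coeff a b p q r (sl_phi a b p q r 0)"

definition phi1_k ::
    "real \<Rightarrow> real \<Rightarrow> (real \<Rightarrow> real) \<Rightarrow> (real \<Rightarrow> real) \<Rightarrow> (real \<Rightarrow> real) \<Rightarrow> nat \<Rightarrow> real \<Rightarrow> complex" where
  "phi1_k a b p q r = iter_coeff1 a b p q r (sl_phi a b p q r 0)"

definition bc_coeff ::
    "real \<Rightarrow> real \<Rightarrow> (real \<Rightarrow> real) \<Rightarrow> (real \<Rightarrow> real) \<Rightarrow> (real \<Rightarrow> real) \<Rightarrow>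
     real \<Rightarrow> real^2^2 \<Rightarrow> nat \<Rightarrow> complex" where
  "bc_coeff a b p q r \<phi> R k =
     bc_form \<phi> R (theta1_k a b p q r k b) (theta_k a b p q r k b)
       (phi_k a b p q r k b) (phi1_k a b p q r k b)"

end

theory Submission imports Defs begin

text \<open>
  The coupled problem is inverted by an explicit continuous Green kernel, so its inverse is a compact
  symmetric operator and there is an orthonormal basis of eigenfunctions; a quadratic form estimate
  bounds the eigenvalues from below. Averaging the kernel over fine partitions identifies
  \<open>\<Sum> 1 / \<lambda>\<close> with the integral of the kernel over the diagonal, which is \<open>- F'(0) / F(0)\<close>, as long as all
  eigenvalues are positive. Replacing \<open>q\<close> by \<open>q - \<mu> r\<close> shifts the spectrum, so
  \<open>F' / F = - \<Sum> 1 / (\<lambda> - \<mu>)\<close> for all real \<open>\<mu>\<close> below the spectrum, and by analytic continuation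
  near \<open>0\<close> as well; neither Hadamard factorisation nor a comparison of the multiplicity of an eigenvalue
  with the order of a zero of \<open>F\<close> is needed. Comparing Taylor coefficients in
  \<open>z F' = m\<^sub>0 F - z F \<Sum> 1 / (\<lambda> - z)\<close>, summed over the nonzero eigenvalues, gives Newton's recursion.
\<close>

section \<open>Absolute continuity and Lebesgue differentiation\<close>

text \<open>The coefficients are merely integrable, so derivatives exist only almost everywhere.
  Arguments therefore run on integral identities (\<open>prim\<close>) for the pair
  \<open>(y, p y')\<close>; pointwise derivatives serve only to pass between these identities and
  the definitions. Positivity of the spectrum is what makes the trace formula elementary: the
  weights that a partition assigns to the eigenfunctions lie in [0, 1] and tend to 1, so sums of
  nonnegative terms can be sandwiched, and the eigenfunction expansion is only ever tested against
  cell averages. The lower bound makes this situation reachable by a shift. The identity for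
  \<open>z F'\<close> holds at \<open>z = 0\<close> for a cheap reason: either the eigenvalue 0 is
  absent or its eigenfunction forces \<open>F 0 = 0\<close>. For multiplicity 1 the division by
  \<open>A 1\<close> is justified by the recursion itself: if \<open>A 1\<close> were 0, all Taylor
  coefficients of \<open>F\<close> would vanish, although \<open>F\<close> has no zero below the
  spectrum.\<close>

text \<open>Henstock's lemma bounds the total length of a disjoint family of intervals on which the difference
  quotients of the integral are off by \<open>c\<close>; the Vitali covering theorem selects such a family.\<close>

lemma negligible_slow_points:
  fixes f :: "real \<Rightarrow> 'a::euclidean_space"
  assumes f: "f integrable_on {a..b}" and c: "c > 0"
  defines "D \<equiv> \<lambda>x y. norm (\<bar>y - x\<bar> *\<^sub>R f x - integral {min x y..max x y} f)"
  shows "negligible {x. \<forall>\<delta>>0. \<exists>y\<in>{a..b}. x \<in> {a..b} \<and> y \<noteq> x \<and> \<bar>y - x\<bar> < \<delta> \<and> D x y \<ge> c * \<bar>y - x\<bar>}"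
    (is "negligible ?E")
  unfolding negligible_outer_le
proof (intro allI impI)
  fix e :: real assume e: "e > 0"
  \<comment> \<open>Every bad interval of length h contributes at least \<open>c * h\<close> to
    Henstock's sum, and Vitali's covering enlarges radii by 5; hence the factor
    \<open>c / 5\<close>.\<close>
  define e' where "e' = c * e / 5"
  have e': "e' > 0" using e c by (simp add: e'_def)
  obtain \<gamma> where \<gamma>: "gauge \<gamma>"
    and H: "\<And>p. \<lbrakk>p tagged_partial_division_of (cbox a b); \<gamma> fine p\<rbrakk> \<Longrightarrow>
             sum (\<lambda>(x,k). norm(measure lborel k *\<^sub>R f x - integral k f)) p < e'"
    using Henstock_lemma[of f a b e'] f e' by auto
  define I :: "real \<times> real \<Rightarrow> real set" where "I = (\<lambda>(x,y). {min x y..max x y})"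
  \<comment> \<open>Each index keeps a tag and the other endpoint, so a finite disjoint subfamily is
    itself a tagged partial division subordinate to the gauge.\<close>
  define K where "K = {(x,y). x \<in> {a..b} \<and> y \<in> {a..b} \<and> y \<noteq> x \<and> {min x y..max x y} \<subseteq> \<gamma> x \<and> D x y \<ge> c * \<bar>y - x\<bar>}"
  define m where "m = (\<lambda>(x,y). (x + y) / 2 :: real)"
  define \<rho> where "\<rho> = (\<lambda>(x,y). \<bar>y - x\<bar> / 2 :: real)"
  have cb: "cball (m i) (\<rho> i) = I i" for i
    by (cases i) (auto simp: m_def \<rho>_def I_def cball_eq_atLeastAtMost min_def max_def abs_if field_simps)
  have "?E \<subseteq> (\<Union>i\<in>K. cball (m i) (\<rho> i))"
  proof
    fix x assume x: "x \<in> ?E"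
    obtain d where d: "d > 0" "ball x d \<subseteq> \<gamma> x"
      using \<gamma> unfolding gauge_def by (meson openE)
    obtain y where y: "y \<in> {a..b}" "x \<in> {a..b}" "y \<noteq> x" "\<bar>y - x\<bar> < d" "D x y \<ge> c * \<bar>y - x\<bar>"
      using x d(1) by blast
    have "{min x y..max x y} \<subseteq> ball x d"
      using y(4) by (auto simp: dist_real_def min_def max_def split: if_splits)
    then have "(x,y) \<in> K" using y d by (auto simp: K_def)
    moreover have "x \<in> cball (m (x,y)) (\<rho> (x,y))" unfolding cb by (auto simp: I_def)
    ultimately show "x \<in> (\<Union>i\<in>K. cball (m i) (\<rho> i))" by blast
  qed
  moreover have "0 < \<rho> i \<and> \<rho> i \<le> b - a" if "i \<in> K" for i
    using that by (auto simp: K_def \<rho>_def)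
  ultimately obtain C where C: "countable C" "C \<subseteq> K"
     "pairwise (\<lambda>i j. disjnt (cball (m i) (\<rho> i)) (cball (m j) (\<rho> j))) C"
     "?E \<subseteq> (\<Union>i\<in>C. cball (m i) (5 * \<rho> i))"
    by (rule Vitali_covering_lemma_cballs[where S="?E" and K=K and a=m and r=\<rho> and B="b - a"])
  have fin: "measure lebesgue (\<Union>i\<in>C'. cball (m i) (5 * \<rho> i)) \<le> e" if C': "C' \<subseteq> C" "finite C'" for C'
  proof -
    define p where "p = (\<lambda>i. (fst i, I i)) ` C'"
    have dis: "I i \<inter> I j = {}" if "i \<in> C'" "j \<in> C'" "i \<noteq> j" for i j
      using C(3) C' that unfolding pairwise_def cb disjnt_def by (meson subsetD)
    have fI: "fst i \<in> I i" for i by (cases i) (auto simp: I_def)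
    have inj: "inj_on (\<lambda>i. (fst i, I i)) C'"
      using dis fI by (intro inj_onI) (metis disjoint_iff prod.inject)
    have IK: "I i \<subseteq> {a..b} \<and> (\<exists>u v. I i = cbox u v) \<and> I i \<subseteq> \<gamma> (fst i)" if "i \<in> C'" for i
    proof -
      have "i \<in> K" using that C' C by auto
      then show ?thesis by (cases i) (auto simp: K_def I_def min_def max_def split: if_splits)
    qed
    have pp: "x \<in> K \<and> K \<subseteq> cbox a b \<and> (\<exists>u v. K = cbox u v)" if xK: "(x,K) \<in> p" for x K
    proof -
      obtain i where i: "i \<in> C'" "x = fst i" "K = I i" using xK unfolding p_def by blast
      then show ?thesis using IK[OF i(1)] fI[of i] by simp
    qed
    have "p tagged_partial_division_of (cbox a b)"
      unfolding tagged_partial_division_of_def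
    proof (intro conjI allI impI)
      show "finite p" using C' by (simp add: p_def)
    next
      fix x1 K1 x2 K2 assume "(x1, K1) \<in> p \<and> (x2, K2) \<in> p \<and> (x1, K1) \<noteq> (x2, K2)"
      then obtain i j where "i \<in> C'" "j \<in> C'" "K1 = I i" "K2 = I j" "i \<noteq> j" by (auto simp: p_def)
      then have "K1 \<inter> K2 = {}" using dis by blast
      then show "interior K1 \<inter> interior K2 = {}" using interior_subset by blast
    qed (use pp in blast)+
    moreover have "\<gamma> fine p" using IK by (auto simp: p_def fine_def)
    ultimately have sl: "sum (\<lambda>(x,k). norm(measure lborel k *\<^sub>R f x - integral k f)) p < e'" by (rule H)
    then have s1: "(\<Sum>i\<in>C'. D (fst i) (snd i)) < e'"
    proof -
      have "(case (fst i, I i) of (x,k) \<Rightarrow> norm (measure lborel k *\<^sub>R f x - integral k f)) = D (fst i) (snd i)" for i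
        by (cases i) (auto simp: I_def D_def min_def max_def)
      then have "(\<Sum>i\<in>C'. D (fst i) (snd i)) = sum (\<lambda>(x,k). norm (measure lborel k *\<^sub>R f x - integral k f)) p"
        unfolding p_def by (subst sum.reindex[OF inj]) (simp add: o_def)
      then show ?thesis using sl by simp
    qed
    have "measure lebesgue (\<Union>i\<in>C'. cball (m i) (5 * \<rho> i)) \<le> (\<Sum>i\<in>C'. measure lebesgue (cball (m i) (5 * \<rho> i)))"
      by (rule measure_UNION_le) (use C' in auto)
    also have "\<dots> \<le> (\<Sum>i\<in>C'. 5 / c * D (fst i) (snd i))"
    proof (rule sum_mono)
      fix i assume "i \<in> C'"
      then have "i \<in> K" using C' C by auto
      then have "c * \<bar>snd i - fst i\<bar> \<le> D (fst i) (snd i)" by (cases i) (auto simp: K_def)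
      moreover have "measure lebesgue (cball (m i) (5 * \<rho> i)) = 5 * \<bar>snd i - fst i\<bar>"
        by (cases i) (simp add: cball_eq_atLeastAtMost \<rho>_def)
      ultimately show "measure lebesgue (cball (m i) (5 * \<rho> i)) \<le> 5 / c * D (fst i) (snd i)"
        using c by (simp add: field_simps)
    qed
    also have "\<dots> \<le> 5 / c * e'" unfolding sum_distrib_left[symmetric]
      using s1 c by (intro mult_left_mono) auto
    also have "\<dots> = e" using c by (simp add: e'_def)
    finally show ?thesis .
  qed
  show "\<exists>T. ?E \<subseteq> T \<and> T \<in> lmeasurable \<and> measure lebesgue T \<le> e"
  proof (intro exI conjI)
    show "(\<Union>i\<in>C. cball (m i) (5 * \<rho> i)) \<in> lmeasurable"
      by (rule fmeasurable_UN_bound[where B=e]) (use C fin in auto)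
    show "measure lebesgue (\<Union>i\<in>C. cball (m i) (5 * \<rho> i)) \<le> e"
      by (rule measure_UN_bound[where B=e]) (use C fin in auto)
  qed (use C in auto)
qed

text \<open>A point outside the exceptional sets for the thresholds \<open>1 / Suc n\<close> has,
  for every threshold, a neighbourhood in which all difference quotients are close to
  \<open>f x\<close>. The set where the derivative fails thus lies in a countable union of null
  sets.\<close>

lemma Lebesgue_differentiation:
  fixes f :: "real \<Rightarrow> 'a::euclidean_space"
  assumes f: "f integrable_on {a..b}"
  shows "negligible {x \<in> {a<..<b}. \<not> ((\<lambda>x. integral {a..x} f) has_vector_derivative f x) (at x)}"
proof -
  define D where "D \<equiv> \<lambda>x y. norm (\<bar>y - x\<bar> *\<^sub>R f x - integral {min x y..max x y} f)"
  define E where "E = (\<lambda>n::nat. {x. \<forall>\<delta>>0. \<exists>y\<in>{a..b}. x \<in> {a..b} \<and> y \<noteq> x \<and> \<bar>y - x\<bar> < \<delta> \<and> D x y \<ge> (1 / Suc n) * \<bar>y - x\<bar>})"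
  have "negligible (E n)" for n
    unfolding E_def D_def by (rule negligible_slow_points[OF f]) simp
  then have "negligible (\<Union>n. E n)"
    by (intro negligible_countable_Union) auto
  moreover have "x \<in> (\<Union>n. E n)" if x: "x \<in> {a<..<b}" and nd: "\<not> ((\<lambda>x. integral {a..x} f) has_vector_derivative f x) (at x)" for x
  proof (rule ccontr)
    assume nE: "x \<notin> (\<Union>n. E n)"
    have "((\<lambda>x. integral {a..x} f) has_vector_derivative f x) (at x)"
      unfolding has_vector_derivative_def has_derivative_at_alt
    proof (intro conjI allI impI)
      show "bounded_linear (\<lambda>z. z *\<^sub>R f x)" by (rule bounded_linear_scaleR_left)
      fix e :: real assume "e > 0"
      then obtain n where n: "1 / Suc n < e" using nat_approx_posE by metis
      have "x \<notin> E n" using nE by blast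
      then have "\<exists>d>0. \<forall>y\<in>{a..b}. y \<noteq> x \<longrightarrow> \<bar>y - x\<bar> < d \<longrightarrow> \<not> (1 / Suc n) * \<bar>y - x\<bar> \<le> D x y"
        using x unfolding E_def by fastforce
      then obtain d where d: "d > 0" "\<And>y. \<lbrakk>y \<in> {a..b}; y \<noteq> x; \<bar>y - x\<bar> < d\<rbrakk> \<Longrightarrow> D x y < (1 / Suc n) * \<bar>y - x\<bar>"
        unfolding not_le by blast
      define d' where "d' = min d (min (x - a) (b - x))"
      have "norm (integral {a..y} f - integral {a..x} f - (y - x) *\<^sub>R f x) \<le> e * norm (y - x)"
        if y: "norm (y - x) < d'" for y
      proof (cases "y = x")
        case False
        have yab: "y \<in> {a..b}" using y by (auto simp: d'_def abs_if split: if_splits)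
        have "norm (integral {a..y} f - integral {a..x} f - (y - x) *\<^sub>R f x) = D x y"
        proof (cases "x \<le> y")
          case True
          have "integral {a..x} f + integral {x..y} f = integral {a..y} f"
            using True x yab f by (intro Henstock_Kurzweil_Integration.integral_combine integrable_subinterval_real[OF f]) auto
          then have "integral {a..y} f - integral {a..x} f - (y - x) *\<^sub>R f x = - ((y - x) *\<^sub>R f x - integral {x..y} f)"
            by (simp add: algebra_simps)
          then show ?thesis using True
            by (simp only: norm_minus_cancel) (simp add: D_def min_def max_def)
        next
          case False
          have "integral {a..y} f + integral {y..x} f = integral {a..x} f"
            using False x yab f by (intro Henstock_Kurzweil_Integration.integral_combine integrable_subinterval_real[OF f]) auto
          then have "integral {a..y} f - integral {a..x} f - (y - x) *\<^sub>R f x = (x - y) *\<^sub>R f x - integral {y..x} f"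
            by (simp add: algebra_simps)
          then show ?thesis using False
            by (simp add: D_def min_def max_def)
        qed
        also have "\<dots> \<le> (1 / Suc n) * \<bar>y - x\<bar>"
          using d(2)[of y] yab False y by (auto simp: d'_def intro: less_imp_le)
        also have "\<dots> \<le> e * norm (y - x)" using n mult_right_mono[of "1 / Suc n" e "\<bar>y - x\<bar>"] by simp
        finally show ?thesis .
      qed auto
      moreover have "d' > 0" using d x by (auto simp: d'_def)
      ultimately show "\<exists>d>0. \<forall>y. norm (y - x) < d \<longrightarrow>
          norm (integral {a..y} f - integral {a..x} f - (y - x) *\<^sub>R f x) \<le> e * norm (y - x)" by blast
    qed
    with nd show False by blast
  qed
  ultimately show ?thesis by (elim negligible_subset) blast
qed

section \<open>Absolutely continuous functions and their derivatives\<close>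

lemma AE_lebesgue_on_iff_negligible:
  assumes "S \<in> sets lebesgue"
  shows "(AE x in lebesgue_on S. P x) \<longleftrightarrow> negligible {x \<in> S. \<not> P x}"
proof -
  have "(AE x in lebesgue_on S. P x) \<longleftrightarrow> (AE x in lebesgue. x \<in> S \<longrightarrow> P x)"
    using assms by (simp add: AE_restrict_space_iff)
  also have "\<dots> \<longleftrightarrow> negligible {x \<in> S. \<not> P x}"
  proof
    assume "AE x in lebesgue. x \<in> S \<longrightarrow> P x"
    then obtain N where "N \<in> null_sets lebesgue" "{x \<in> space lebesgue. \<not> (x \<in> S \<longrightarrow> P x)} \<subseteq> N"
      unfolding eventually_ae_filter by blast
    then show "negligible {x \<in> S. \<not> P x}"
      unfolding negligible_iff_null_sets[symmetric] by (rule_tac negligible_subset) auto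
  next
    assume "negligible {x \<in> S. \<not> P x}"
    then show "AE x in lebesgue. x \<in> S \<longrightarrow> P x"
      unfolding negligible_iff_null_sets by (rule AE_I') auto
  qed
  finally show ?thesis .
qed

text \<open>Truncation: apart from an error \<open>e / 2\<close> the integrand is bounded by some
  \<open>n\<close>, and a function bounded by \<open>n\<close> integrates to at most
  \<open>n\<close> times the measure of the set.\<close>

lemma absolute_continuity_integral:
  fixes F :: "real \<Rightarrow> complex"
  assumes F: "set_integrable lebesgue S F" and e: "e > 0" and S: "S \<in> sets lebesgue"
  obtains d where "d > 0"
    "\<And>A. \<lbrakk>A \<in> lmeasurable; A \<subseteq> S; measure lebesgue A < d\<rbrakk> \<Longrightarrow> (LINT x:A|lebesgue. norm (F x)) < e"
proof -
  define g where "g = (\<lambda>x. indicator S x * norm (F x))"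
  have g: "integrable lebesgue g"
    using integrable_norm[OF F[unfolded set_integrable_def]] by (simp add: g_def)
  have g0: "g x \<ge> 0" for x by (simp add: g_def)
  have gm: "g \<in> borel_measurable lebesgue" using g by (rule borel_measurable_integrable)
  have gi: "integrable lebesgue (\<lambda>x. min (g x) (real n))" for n
    by (rule Bochner_Integration.integrable_bound[OF g]) (use gm g0 in auto)
  have "(\<lambda>n. \<integral>x. min (g x) (real n) \<partial>lebesgue) \<longlonglongrightarrow> (\<integral>x. g x \<partial>lebesgue)"
  proof (rule integral_dominated_convergence[where w=g])
    show "AE x in lebesgue. (\<lambda>n. min (g x) (real n)) \<longlonglongrightarrow> g x"
    proof (rule AE_I2)
      fix x
      obtain n0 :: nat where "g x \<le> real n0" using real_arch_simple by blast
      then have "\<forall>n\<ge>n0. min (g x) (real n) = g x" by auto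
      then show "(\<lambda>n. min (g x) (real n)) \<longlonglongrightarrow> g x"
        by (intro tendsto_eventually) (auto simp: eventually_sequentially)
    qed
  qed (use g gm g0 in auto)
  then obtain n where n: "\<bar>(\<integral>x. min (g x) (real n) \<partial>lebesgue) - (\<integral>x. g x \<partial>lebesgue)\<bar> < e / 2"
    using e by (auto simp: LIMSEQ_def dist_real_def dest!: spec[of _ "e/2"])
  show ?thesis
  proof (rule that[of "e / (2 * (real n + 1))"])
    show "e / (2 * (real n + 1)) > 0" using e by simp
    fix A assume A: "A \<in> lmeasurable" "A \<subseteq> S" "measure lebesgue A < e / (2 * (real n + 1))"
    have iA: "integrable lebesgue (indicator A :: real \<Rightarrow> real)" using A(1) unfolding fmeasurable_def by (auto intro: integrable_real_indicator)
    have "(LINT x:A|lebesgue. norm (F x)) \<le> (\<integral>x. (g x - min (g x) (real n)) + real n * indicator A x \<partial>lebesgue)"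
      unfolding set_lebesgue_integral_def
    proof (rule Bochner_Integration.integral_mono)
      have "integrable lebesgue (\<lambda>x. indicator A x * g x)"
        by (rule Bochner_Integration.integrable_bound[OF g]) (use A gm g0 in \<open>auto split: split_indicator\<close>)
      moreover have "(\<lambda>x. indicator A x * g x) = (\<lambda>x. indicator A x *\<^sub>R norm (F x))"
        using A by (auto simp: g_def fun_eq_iff split: split_indicator)
      ultimately show "integrable lebesgue (\<lambda>x. indicator A x *\<^sub>R norm (F x))" by simp
      show "integrable lebesgue (\<lambda>x. (g x - min (g x) (real n)) + real n * indicator A x)"
        using g gi iA by auto
      show "indicator A x *\<^sub>R norm (F x) \<le> (g x - min (g x) (real n)) + real n * indicator A x" for x
        using A by (auto simp: g_def split: split_indicator)
    qed
    also have "\<dots> = (\<integral>x. g x \<partial>lebesgue) - (\<integral>x. min (g x) (real n) \<partial>lebesgue) + real n * measure lebesgue A"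
      using g gi iA A by (simp add: fmeasurable_def)
    also have "\<dots> < e / 2 + e / 2"
    proof -
      have "real n * measure lebesgue A \<le> (real n + 1) * measure lebesgue A" by (simp add: algebra_simps)
      also have "\<dots> < e / 2" using A(3) by (simp add: field_simps)
      finally show ?thesis using n by linarith
    qed
    finally show "(LINT x:A|lebesgue. norm (F x)) < e" by simp
  qed
qed

lemma measure_disjoint_open_intervals:
  fixes s t :: "'i \<Rightarrow> real"
  assumes "finite I" "\<And>i. i \<in> I \<Longrightarrow> s i \<le> t i"
    and "\<And>i j. \<lbrakk>i \<in> I; j \<in> I; i \<noteq> j\<rbrakk> \<Longrightarrow> {s i<..<t i} \<inter> {s j<..<t j} = {}"
  shows "measure lebesgue (\<Union>i\<in>I. {s i<..<t i}) = (\<Sum>i\<in>I. t i - s i)"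
    and "(\<Union>i\<in>I. {s i<..<t i}) \<in> lmeasurable"
proof -
  have "measure lebesgue (\<Union>i\<in>I. {s i<..<t i}) = (\<Sum>i\<in>I. measure lebesgue {s i<..<t i})"
    by (rule measure_finite_Union) (use assms in \<open>auto simp: disjoint_family_on_def\<close>)
  then show "measure lebesgue (\<Union>i\<in>I. {s i<..<t i}) = (\<Sum>i\<in>I. t i - s i)" using assms by simp
  show "(\<Union>i\<in>I. {s i<..<t i}) \<in> lmeasurable"
    by (rule fmeasurable.finite_UN) (use assms in auto)
qed

text \<open>The definition counts intervals by initial segments of nat. A free index type lets the
  tagged intervals of a division serve as indices directly, and the unit type give
  continuity.\<close>

lemma AC_on_finite:
  assumes f: "AC_on a b f" and e: "e > 0"
  shows "\<exists>d>0. \<forall>(I::'i set) s t. finite I \<longrightarrow> (\<forall>i\<in>I. a \<le> s i \<and> s i \<le> t i \<and> t i \<le> b) \<longrightarrow>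
      (\<forall>i\<in>I. \<forall>j\<in>I. i \<noteq> j \<longrightarrow> {s i<..<t i} \<inter> {s j<..<t j} = {}) \<longrightarrow>
      (\<Sum>i\<in>I. t i - s i) < d \<longrightarrow> (\<Sum>i\<in>I. norm (f (t i) - f (s i))) < e"
proof -
  obtain d where d: "d > 0" "\<forall>(n::nat) s t. (\<forall>i<n. a \<le> s i \<and> s i \<le> t i \<and> t i \<le> b) \<and>
        (\<forall>i<n. \<forall>j<n. i \<noteq> j \<longrightarrow> {s i<..<t i} \<inter> {s j<..<t j} = {}) \<and>
        (\<Sum>i<n. t i - s i) < d \<longrightarrow> (\<Sum>i<n. norm (f (t i) - f (s i))) < e"
    using f e unfolding AC_on_def by blast
  show ?thesis
  proof (rule exI[of _ d], rule conjI[OF d(1)], intro allI impI)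
    fix I :: "'i set" and s t :: "'i \<Rightarrow> real"
    assume *: "finite I" "\<forall>i\<in>I. a \<le> s i \<and> s i \<le> t i \<and> t i \<le> b"
      "\<forall>i\<in>I. \<forall>j\<in>I. i \<noteq> j \<longrightarrow> {s i<..<t i} \<inter> {s j<..<t j} = {}"
      "(\<Sum>i\<in>I. t i - s i) < d"
    obtain h where h: "bij_betw h {..<card I} I" 
      using ex_bij_betw_nat_finite[OF *(1)] by (auto simp: atLeast0LessThan)
    have hI: "h i \<in> I" if "i < card I" for i using h that by (auto simp: bij_betw_def)
    have hinj: "h i \<noteq> h j" if "i < card I" "j < card I" "i \<noteq> j" for i j
      using h that by (auto simp: bij_betw_def inj_on_def)
    have "(\<Sum>i<card I. norm (f (t (h i)) - f (s (h i)))) < e"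
    proof (rule d(2)[rule_format, of "card I" "s \<circ> h" "t \<circ> h", unfolded o_def], intro conjI allI impI)
      show "(\<Sum>i<card I. t (h i) - s (h i)) < d"
        using *(4) sum.reindex_bij_betw[OF h, of "\<lambda>i. t i - s i"] by simp
      show "{s (h i)<..<t (h i)} \<inter> {s (h j)<..<t (h j)} = {}" if "i < card I" "j < card I" "i \<noteq> j" for i j
        using *(3) hI[OF that(1)] hI[OF that(2)] hinj[OF that] by blast
    qed (use *(2) hI in blast)+
    then show "(\<Sum>i\<in>I. norm (f (t i) - f (s i))) < e"
      using sum.reindex_bij_betw[OF h, of "\<lambda>i. norm (f (t i) - f (s i))"] by simp
  qed
qed

lemma AC_on_continuous_on:
  assumes "AC_on a b f"
  shows "continuous_on {a..b} f"
  unfolding continuous_on_iff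
proof (intro ballI allI impI)
  fix x e :: real assume x: "x \<in> {a..b}" and e: "e > 0"
  obtain d where d: "d > 0"
    "\<forall>(I::unit set) s t. finite I \<longrightarrow> (\<forall>i\<in>I. a \<le> s i \<and> s i \<le> t i \<and> t i \<le> b) \<longrightarrow>
      (\<forall>i\<in>I. \<forall>j\<in>I. i \<noteq> j \<longrightarrow> {s i<..<t i} \<inter> {s j<..<t j} = {}) \<longrightarrow>
      (\<Sum>i\<in>I. t i - s i) < d \<longrightarrow> (\<Sum>i\<in>I. norm (f (t i) - f (s i))) < e"
    using AC_on_finite[where 'i="unit", OF assms e] by blast
  show "\<exists>d>0. \<forall>y\<in>{a..b}. dist y x < d \<longrightarrow> dist (f y) (f x) < e"
  proof (intro exI conjI ballI impI)
    fix y assume y: "y \<in> {a..b}" "dist y x < d"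
    have "(\<Sum>i\<in>(UNIV::unit set). norm (f (max x y) - f (min x y))) < e"
      by (rule d(2)[rule_format, of UNIV "\<lambda>_. min x y" "\<lambda>_. max x y"])
        (use x y in \<open>auto simp: dist_real_def min_def max_def split: if_splits\<close>)
    then have "norm (f (max x y) - f (min x y)) < e" by simp
    then show "dist (f y) (f x) < e"
      by (auto simp: dist_norm min_def max_def norm_minus_commute split: if_splits)
  qed (use d in auto)
qed

lemma AC_on_subinterval: "AC_on a b f \<Longrightarrow> a \<le> c \<Longrightarrow> d \<le> b \<Longrightarrow> AC_on c d f"
  unfolding AC_on_def
proof (intro allI impI)
  fix e :: real
  assume *: "\<forall>\<epsilon>>0. \<exists>\<delta>>0. \<forall>(n::nat) s t.
        (\<forall>i<n. a \<le> s i \<and> s i \<le> t i \<and> t i \<le> b) \<and>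
        (\<forall>i<n. \<forall>j<n. i \<noteq> j \<longrightarrow> {s i<..<t i} \<inter> {s j<..<t j} = {}) \<and>
        (\<Sum>i<n. t i - s i) < \<delta> \<longrightarrow> (\<Sum>i<n. norm (f (t i) - f (s i))) < \<epsilon>"
    and e: "e > 0" and cd: "a \<le> c" "d \<le> b"
  from *[rule_format, OF e] obtain \<delta> where \<delta>: "\<delta> > 0" "\<forall>(n::nat) s t.
        (\<forall>i<n. a \<le> s i \<and> s i \<le> t i \<and> t i \<le> b) \<and>
        (\<forall>i<n. \<forall>j<n. i \<noteq> j \<longrightarrow> {s i<..<t i} \<inter> {s j<..<t j} = {}) \<and>
        (\<Sum>i<n. t i - s i) < \<delta> \<longrightarrow> (\<Sum>i<n. norm (f (t i) - f (s i))) < e" by blast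
  show "\<exists>\<delta>>0. \<forall>(n::nat) s t.
        (\<forall>i<n. c \<le> s i \<and> s i \<le> t i \<and> t i \<le> d) \<and>
        (\<forall>i<n. \<forall>j<n. i \<noteq> j \<longrightarrow> {s i<..<t i} \<inter> {s j<..<t j} = {}) \<and>
        (\<Sum>i<n. t i - s i) < \<delta> \<longrightarrow> (\<Sum>i<n. norm (f (t i) - f (s i))) < e"
    by (rule exI[of _ \<delta>], rule conjI[OF \<delta>(1)], intro allI impI, elim conjE, rule \<delta>(2)[rule_format])
      (use cd in \<open>auto intro: order_trans\<close>)
qed

text \<open>The null set of bad points is hidden in an open set of measure below \<delta>, where
  absolute continuity controls the increments; at all other points the derivative 0 makes increments
  at most \<open>e\<close> times the length. One gauge enforces both, and \<open>f b - f a\<close>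
  telescopes over a fine division.\<close>

lemma AC_on_zero_derivative:
  assumes ab: "a \<le> b" and f: "AC_on a b f"
    and N: "negligible {x \<in> {a<..<b}. \<not> (f has_vector_derivative 0) (at x)}"
  shows "f b = f a"
proof -
  \<comment> \<open>The hypothesis concerns interior points only, so the endpoints join the null
    set.\<close>
  define N' where "N' = {x \<in> {a<..<b}. \<not> (f has_vector_derivative 0) (at x)} \<union> {a, b}"
  have "negligible {a, b}" by simp
  then have N': "negligible N'" using N unfolding N'_def by (rule negligible_Un[rotated])
  have "norm (f b - f a) \<le> e + e * (b - a)" if e: "e > 0" for e
  proof -
    obtain \<delta> where \<delta>: "\<delta> > 0"
    "\<forall>(I::(real \<times> real set) set) s t. finite I \<longrightarrow> (\<forall>i\<in>I. a \<le> s i \<and> s i \<le> t i \<and> t i \<le> b) \<longrightarrow>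
      (\<forall>i\<in>I. \<forall>j\<in>I. i \<noteq> j \<longrightarrow> {s i<..<t i} \<inter> {s j<..<t j} = {}) \<longrightarrow>
      (\<Sum>i\<in>I. t i - s i) < \<delta> \<longrightarrow> (\<Sum>i\<in>I. norm (f (t i) - f (s i))) < e"
      using AC_on_finite[where 'i="(real \<times> real set)", OF f e] by blast
    have N's: "N' \<in> null_sets lebesgue" using N' by (simp add: negligible_iff_null_sets)
    obtain U where U: "open U" "N' \<subseteq> U" "U - N' \<in> lmeasurable" "emeasure lebesgue (U - N') < ennreal \<delta>"
      using sets_lebesgue_outer_open[OF null_setsD2[OF N's] \<delta>(1)] by blast
    have Um: "U \<in> lmeasurable"
      using fmeasurable.Un[OF U(3) negligible_imp_measurable[OF N']] U(2) by (simp add: Un_absorb2)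
    have "measure lebesgue U = measure lebesgue (U - N')"
      using N's U(1) by (intro measure_Diff_null_set[symmetric]) auto
    then have mU: "measure lebesgue U < \<delta>"
      using U(3,4) \<delta>(1) by (simp add: emeasure_eq_measure2 ennreal_less_iff)
    have "\<exists>d>0. x \<in> {a..b} - N' \<longrightarrow> (\<forall>y. norm (y - x) < d \<longrightarrow> norm (f y - f x) \<le> e * norm (y - x))" for x
    proof (cases "x \<in> {a..b} - N'")
      case True
      then have "(f has_vector_derivative 0) (at x)" by (auto simp: N'_def)
      then have "\<exists>d>0. \<forall>y. norm (y - x) < d \<longrightarrow> norm (f y - f x) \<le> e * norm (y - x)"
        using e unfolding has_vector_derivative_def has_derivative_at_alt by simp
      then show ?thesis by blast
    qed (auto intro: exI[of _ 1])
    then obtain d where d: "\<And>x. d x > 0" "\<And>x y. \<lbrakk>x \<in> {a..b} - N'; norm (y - x) < d x\<rbrakk> \<Longrightarrow> norm (f y - f x) \<le> e * norm (y - x)"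
      by metis
    \<comment> \<open>Tags in the null set force their intervals into \<open>U\<close>; all other
      tags force small increments.\<close>
    define g where "g = (\<lambda>x. if x \<in> N' then U else ball x (d x))"
    have "gauge g" using U d by (auto simp: gauge_def g_def)
    then obtain p where p: "p tagged_division_of {a..b}" "g fine p" by (rule fine_division_exists_real)
    have fp: "finite p" using p(1) by (rule tagged_division_of_finite)
    have K: "a \<le> Inf K \<and> Inf K \<le> x \<and> x \<le> Sup K \<and> Sup K \<le> b \<and> K = {Inf K..Sup K} \<and> K \<subseteq> g x"
      if xK: "(x, K) \<in> p" for x K
    proof -
      obtain u v where uv: "K = cbox u v" "x \<in> K" "K \<subseteq> {a..b}" using tagged_division_ofD(2,3,4)[OF p(1) xK] by blast
      then have "u \<le> v" by auto
      then show ?thesis using uv p(2) xK by (auto simp: fine_def)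
    qed
    have dis: "{Inf (snd i)<..<Sup (snd i)} \<inter> {Inf (snd j)<..<Sup (snd j)} = {}"
      if "i \<in> p" "j \<in> p" "i \<noteq> j" for i j
    proof -
      obtain x1 K1 x2 K2 where [simp]: "i = (x1, K1)" "j = (x2, K2)" by (cases i, cases j) auto
      have "interior K1 \<inter> interior K2 = {}" using tagged_division_ofD(5)[OF p(1)] that by auto
      moreover have "interior K1 = {Inf K1<..<Sup K1}" "interior K2 = {Inf K2<..<Sup K2}"
        using K[of x1 K1] K[of x2 K2] that by (auto intro: interior_atLeastAtMost_real dest: arg_cong[of _ _ interior])
      ultimately show ?thesis by simp
    qed
    have K': "Inf (snd i) \<le> Sup (snd i)" if "i \<in> p" for i
      using K[of "fst i" "snd i"] that by auto
    define q where "q = {i \<in> p. fst i \<in> N'}"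
    have qp: "q \<subseteq> p" "finite q" using fp by (auto simp: q_def)
    have "(\<Sum>i\<in>q. norm (f (Sup (snd i)) - f (Inf (snd i)))) < e"
    proof (rule \<delta>(2)[rule_format])
      show "a \<le> Inf (snd i) \<and> Inf (snd i) \<le> Sup (snd i) \<and> Sup (snd i) \<le> b" if "i \<in> q" for i
        using K[of "fst i" "snd i"] that qp by auto
      have "(\<Sum>i\<in>q. Sup (snd i) - Inf (snd i)) = measure lebesgue (\<Union>i\<in>q. {Inf (snd i)<..<Sup (snd i)})"
        by (rule measure_disjoint_open_intervals(1)[symmetric]) (use K' dis qp in blast)+
      also have "\<dots> \<le> measure lebesgue U"
      proof (rule measure_mono_fmeasurable)
        show "(\<Union>i\<in>q. {Inf (snd i)<..<Sup (snd i)}) \<subseteq> U"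
        proof (rule UN_least)
          fix i assume i: "i \<in> q"
          have "snd i \<subseteq> U" using K[of "fst i" "snd i"] i by (auto simp: q_def g_def)
          moreover have "snd i = {Inf (snd i)..Sup (snd i)}" using K[of "fst i" "snd i"] i by (auto simp: q_def)
          ultimately show "{Inf (snd i)<..<Sup (snd i)} \<subseteq> U" using greaterThanLessThan_subseteq_atLeastAtMost_iff by (metis order_trans order_refl)
        qed
        show "(\<Union>i\<in>q. {Inf (snd i)<..<Sup (snd i)}) \<in> sets lebesgue"
          by (intro sets.finite_UN qp) simp
      qed (rule Um)
      finally show "(\<Sum>i\<in>q. Sup (snd i) - Inf (snd i)) < \<delta>" using mU by simp
      show "{Inf (snd i)<..<Sup (snd i)} \<inter> {Inf (snd j)<..<Sup (snd j)} = {}" if "i \<in> q" "j \<in> q" "i \<noteq> j" for i j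
        using that qp by (intro dis) auto
    qed (rule qp)
    moreover have "(\<Sum>i\<in>p-q. norm (f (Sup (snd i)) - f (Inf (snd i)))) \<le> e * (b - a)"
    proof -
      have "(\<Sum>i\<in>p-q. norm (f (Sup (snd i)) - f (Inf (snd i)))) \<le> (\<Sum>i\<in>p-q. e * (Sup (snd i) - Inf (snd i)))"
      proof (rule sum_mono)
        fix i assume i: "i \<in> p - q"
        obtain x k where [simp]: "i = (x, k)" by (cases i)
        have x: "x \<in> {a..b} - N'" and k: "k \<subseteq> ball x (d x)" and kk: "Inf k \<le> x" "x \<le> Sup k" "k = {Inf k..Sup k}"
          using i K[of x k] by (auto simp: q_def g_def)
        have "Inf k \<in> {Inf k..Sup k}" "Sup k \<in> {Inf k..Sup k}" using kk(1,2) by auto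
        then have m: "Inf k \<in> k" "Sup k \<in> k" using kk(3) by blast+
        have md: "norm (Sup k - x) < d x" "norm (Inf k - x) < d x"
          using m k by (auto simp: subset_iff dist_real_def abs_minus_commute)
        have "norm (f (Sup k) - f x) \<le> e * norm (Sup k - x)" "norm (f (Inf k) - f x) \<le> e * norm (Inf k - x)"
          using d(2)[OF x md(1)] d(2)[OF x md(2)] by auto
        moreover have "norm (f (Sup k) - f (Inf k)) \<le> norm (f (Sup k) - f x) + norm (f (Inf k) - f x)"
          using norm_triangle_ineq4[of "f (Sup k) - f x" "f (Inf k) - f x"] by simp
        ultimately show "norm (f (Sup (snd i)) - f (Inf (snd i))) \<le> e * (Sup (snd i) - Inf (snd i))"
          using kk by (simp add: algebra_simps)
      qed
      also have "\<dots> \<le> (\<Sum>i\<in>p. e * (Sup (snd i) - Inf (snd i)))"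
        using K' e fp by (intro sum_mono2) auto
      also have "\<dots> = e * (b - a)"
        using additive_tagged_division_1[OF ab p(1), of "\<lambda>x. x"]
        by (simp add: case_prod_unfold sum_distrib_left[symmetric])
      finally show ?thesis .
    qed
    moreover have "norm (f b - f a) \<le> (\<Sum>i\<in>p. norm (f (Sup (snd i)) - f (Inf (snd i))))"
    proof -
      have "f b - f a = (\<Sum>i\<in>p. f (Sup (snd i)) - f (Inf (snd i)))"
        using additive_tagged_division_1[OF ab p(1), of f] by (simp add: case_prod_unfold)
      then show ?thesis by (simp add: norm_sum)
    qed
    moreover have "(\<Sum>i\<in>p. norm (f (Sup (snd i)) - f (Inf (snd i)))) = 
      (\<Sum>i\<in>p-q. norm (f (Sup (snd i)) - f (Inf (snd i)))) + (\<Sum>i\<in>q. norm (f (Sup (snd i)) - f (Inf (snd i))))"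
      using qp fp by (intro sum.subset_diff) auto
    ultimately show ?thesis by linarith
  qed
  note * = this
  have "norm (f b - f a) \<le> 0"
  proof (rule field_le_epsilon)
    fix e :: real assume "e > 0"
    \<comment> \<open>The bound \<open>e + e * (b - a)\<close> is \<open>e\<close> times this
      number, so it is applied to \<open>e / k\<close>.\<close>
    define k where "k = 1 + (b - a)"
    have k: "k > 0" using ab by (simp add: k_def)
    have "e / k + e / k * (b - a) = e / k * k" unfolding k_def by (simp only: distrib_left mult_1_right)
    also have "\<dots> = e" using k by simp
    finally have "e / k + e / k * (b - a) = e" .
    moreover have "e / k > 0" using k \<open>e > 0\<close> by simp
    ultimately show "norm (f b - f a) \<le> 0 + e" using *[of "e / k"] by simp
  qed
  then show ?thesis by simp
qed

text \<open>Pairs an indefinite integral with a chosen density, which is determined up to null sets.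
  Integrability is demanded because the integral of a non-integrable function defaults to 0, which
  could turn constants into primitives of such functions.\<close>

definition prim :: "real \<Rightarrow> real \<Rightarrow> (real \<Rightarrow> complex) \<Rightarrow> (real \<Rightarrow> complex) \<Rightarrow> bool" where
  "prim a b f F \<longleftrightarrow> integrable (lebesgue_on {a<..<b}) F \<and>
     (\<forall>x\<in>{a..b}. f x = f a + (LINT t:{a<..<x}|lebesgue. F t))"

lemma integrable_lebesgue_on_iff:
  fixes F :: "real \<Rightarrow> 'a::{banach, second_countable_topology}"
  shows "integrable (lebesgue_on {a<..<b}) F \<longleftrightarrow> set_integrable lebesgue {a<..<b} F"
  by (simp add: integrable_restrict_space set_integrable_def)

lemma integrable_lebesgue_on_subset:
  fixes F :: "real \<Rightarrow> 'a::{banach, second_countable_topology}"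
  assumes "integrable (lebesgue_on {a<..<b}) F" "{u<..<v} \<subseteq> {a<..<b}"
  shows "set_integrable lebesgue {u<..<v} F"
  using assms set_integrable_subset[of lebesgue "{a<..<b}" F "{u<..<v}"]
  unfolding integrable_lebesgue_on_iff by simp

lemma set_integral_eq_integral_Icc:
  fixes F :: "real \<Rightarrow> 'a::euclidean_space"
  assumes "integrable (lebesgue_on {a<..<b}) F" "a \<le> u" "v \<le> b"
  shows "(LINT t:{u<..<v}|lebesgue. F t) = integral {u..v} F" "F integrable_on {u..v}"
proof -
  have "set_integrable lebesgue {u<..<v} F"
    by (rule integrable_lebesgue_on_subset[OF assms(1)]) (use assms in auto)
  from set_lebesgue_integral_eq_integral[OF this]
  show "(LINT t:{u<..<v}|lebesgue. F t) = integral {u..v} F" "F integrable_on {u..v}"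
    by (auto simp: integral_open_interval_real integrable_on_Icc_iff_Ioo)
qed

lemma primD:
  assumes "prim a b f F"
  shows "integrable (lebesgue_on {a<..<b}) F" "\<And>x. x \<in> {a..b} \<Longrightarrow> f x = f a + integral {a..x} F"
proof -
  show F: "integrable (lebesgue_on {a<..<b}) F" using assms unfolding prim_def by blast
  fix x assume x: "x \<in> {a..b}"
  have "f x = f a + (LINT t:{a<..<x}|lebesgue. F t)" using assms x unfolding prim_def by blast
  also have "(LINT t:{a<..<x}|lebesgue. F t) = integral {a..x} F"
    using x by (intro set_integral_eq_integral_Icc(1)[OF F]) auto
  finally show "f x = f a + integral {a..x} F" .
qed

lemma prim_diff:
  assumes "prim a b f F" "a \<le> u" "u \<le> v" "v \<le> b"
  shows "f v - f u = (LINT t:{u<..<v}|lebesgue. F t)"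
proof -
  note F = primD(1)[OF assms(1)] and f = primD(2)[OF assms(1)]
  have "integral {a..u} F + integral {u..v} F = integral {a..v} F"
    by (rule Henstock_Kurzweil_Integration.integral_combine)
      (use assms set_integral_eq_integral_Icc(2)[OF F] in auto)
  then show ?thesis
    using f[of u] f[of v] assms set_integral_eq_integral_Icc(1)[OF F, of u v] by (simp add: algebra_simps)
qed

lemma prim_has_vector_derivative:
  assumes "prim a b f F"
  shows "AE x in lebesgue_on {a<..<b}. (f has_vector_derivative F x) (at x)"
proof -
  note F = primD(1)[OF assms] and f = primD(2)[OF assms]
  have "(f has_vector_derivative F x) (at x)"
    if "((\<lambda>x. integral {a..x} F) has_vector_derivative F x) (at x)" "x \<in> {a<..<b}" for x
  proof (rule has_vector_derivative_transform_within_open[of "\<lambda>x. f a + integral {a..x} F" _ _ "{a<..<b}"])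
    show "((\<lambda>x. f a + integral {a..x} F) has_vector_derivative F x) (at x)"
      using has_vector_derivative_add[OF has_vector_derivative_const that(1), of "f a"] by simp
    show "f a + integral {a..y} F = f y" if "y \<in> {a<..<b}" for y using f[of y] that by simp
  qed (use that in auto)
  then show ?thesis
    by (subst AE_lebesgue_on_iff_negligible, simp, intro negligible_subset[OF Lebesgue_differentiation[OF set_integral_eq_integral_Icc(2)[OF F, of a b]]]) auto
qed

lemma prim_AC_on:
  assumes "prim a b f F"
  shows "AC_on a b f"
  unfolding AC_on_def
proof (intro allI impI)
  fix e :: real assume e: "e > 0"
  have F: "integrable (lebesgue_on {a<..<b}) F" using assms unfolding prim_def by blast
  obtain d where d: "d > 0"
    "\<And>A. \<lbrakk>A \<in> lmeasurable; A \<subseteq> {a<..<b}; measure lebesgue A < d\<rbrakk> \<Longrightarrow> (LINT x:A|lebesgue. norm (F x)) < e"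
    using absolute_continuity_integral[OF F[unfolded integrable_lebesgue_on_iff] e]
      borel_open[of "{a<..<b}"] lebesgue_openin by (metis (no_types, lifting) open_greaterThanLessThan sets_completionI_sets sets_lborel)
  show "\<exists>\<delta>>0. \<forall>(n::nat) s t. (\<forall>i<n. a \<le> s i \<and> s i \<le> t i \<and> t i \<le> b) \<and>
        (\<forall>i<n. \<forall>j<n. i \<noteq> j \<longrightarrow> {s i<..<t i} \<inter> {s j<..<t j} = {}) \<and>
        (\<Sum>i<n. t i - s i) < \<delta> \<longrightarrow> (\<Sum>i<n. norm (f (t i) - f (s i))) < e"
  proof (rule exI[of _ d], rule conjI[OF d(1)], intro allI impI, elim conjE)
    fix n :: nat and s t :: "nat \<Rightarrow> real"
    assume st: "\<forall>i<n. a \<le> s i \<and> s i \<le> t i \<and> t i \<le> b"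
      and dis: "\<forall>i<n. \<forall>j<n. i \<noteq> j \<longrightarrow> {s i<..<t i} \<inter> {s j<..<t j} = {}"
      and le: "(\<Sum>i<n. t i - s i) < d"
    have m: "measure lebesgue (\<Union>i\<in>{..<n}. {s i<..<t i}) = (\<Sum>i<n. t i - s i)"
      "(\<Union>i\<in>{..<n}. {s i<..<t i}) \<in> lmeasurable"
      by (rule measure_disjoint_open_intervals; use st dis in blast)+
    have si: "set_integrable lebesgue {s i<..<t i} F" if "i < n" for i
      by (rule integrable_lebesgue_on_subset[OF F]) (use st that in \<open>auto simp: greaterThanLessThan_subseteq_greaterThanLessThan\<close>)
    have "(\<Sum>i<n. norm (f (t i) - f (s i))) \<le> (\<Sum>i<n. (LINT x:{s i<..<t i}|lebesgue. norm (F x)))"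
    proof (rule sum_mono)
      fix i assume "i \<in> {..<n}"
      then have "f (t i) - f (s i) = (LINT x:{s i<..<t i}|lebesgue. F x)"
        using st by (intro prim_diff[OF assms]) auto
      then show "norm (f (t i) - f (s i)) \<le> (LINT x:{s i<..<t i}|lebesgue. norm (F x))"
        using set_integral_norm_bound[OF si] \<open>i \<in> {..<n}\<close> by simp
    qed
    also have "\<dots> = (LINT x:(\<Union>i\<in>{..<n}. {s i<..<t i})|lebesgue. norm (F x))"
      using si dis by (intro set_integral_finite_Union[symmetric] set_integrable_norm) (auto simp: disjoint_family_on_def)
    also have "\<dots> < e"
      by (rule d(2)) (use m le st in \<open>fastforce+\<close>)
    finally show "(\<Sum>i<n. norm (f (t i) - f (s i))) < e" .
  qed
qed

lemma AC_on_diff: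
  assumes "AC_on a b f" "AC_on a b g"
  shows "AC_on a b (\<lambda>x. f x - g x)"
  unfolding AC_on_def
proof (intro allI impI)
  fix e :: real assume e: "e > 0"
  let ?P = "\<lambda>f e d. \<forall>(n::nat) s t. (\<forall>i<n. a \<le> s i \<and> s i \<le> t i \<and> t i \<le> b) \<and>
        (\<forall>i<n. \<forall>j<n. i \<noteq> j \<longrightarrow> {s i<..<t i} \<inter> {s j<..<t j} = {}) \<and>
        (\<Sum>i<n. t i - s i) < d \<longrightarrow> (\<Sum>i<n. norm (f (t i) - f (s i) :: complex)) < e"
  obtain d1 where d1: "d1 > 0" "?P f (e/2) d1" using assms(1)[unfolded AC_on_def, rule_format, OF half_gt_zero[OF e]] by blast
  obtain d2 where d2: "d2 > 0" "?P g (e/2) d2" using assms(2)[unfolded AC_on_def, rule_format, OF half_gt_zero[OF e]] by blast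
  show "\<exists>d>0. ?P (\<lambda>x. f x - g x) e d"
  proof (rule exI[of _ "min d1 d2"], rule conjI, use d1 d2 in simp, intro allI impI, elim conjE)
    fix n :: nat and s t :: "nat \<Rightarrow> real"
    assume st: "\<forall>i<n. a \<le> s i \<and> s i \<le> t i \<and> t i \<le> b"
      "\<forall>i<n. \<forall>j<n. i \<noteq> j \<longrightarrow> {s i<..<t i} \<inter> {s j<..<t j} = {}" "(\<Sum>i<n. t i - s i) < min d1 d2"
    have "(\<Sum>i<n. norm (f (t i) - f (s i))) < e/2" by (rule d1(2)[rule_format]) (use st in simp)
    moreover have "(\<Sum>i<n. norm (g (t i) - g (s i))) < e/2" by (rule d2(2)[rule_format]) (use st in simp)
    moreover have "(\<Sum>i<n. norm (f (t i) - g (t i) - (f (s i) - g (s i)))) \<le> (\<Sum>i<n. norm (f (t i) - f (s i)) + norm (g (t i) - g (s i)))"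
    proof (rule sum_mono)
      fix i show "norm (f (t i) - g (t i) - (f (s i) - g (s i))) \<le> norm (f (t i) - f (s i)) + norm (g (t i) - g (s i))"
        using norm_triangle_ineq4[of "f (t i) - f (s i)" "g (t i) - g (s i)"] by (simp add: algebra_simps)
    qed
    ultimately show "(\<Sum>i<n. norm (f (t i) - g (t i) - (f (s i) - g (s i)))) < e" by (simp add: sum.distrib)
  qed
qed

lemma AC_on_mult:
  assumes f: "AC_on a b f" and g: "AC_on a b g"
  shows "AC_on a b (\<lambda>x. f x * g x)"
  unfolding AC_on_def
proof (intro allI impI)
  fix e :: real assume e: "e > 0"
  let ?P = "\<lambda>f e d. \<forall>(n::nat) s t. (\<forall>i<n. a \<le> s i \<and> s i \<le> t i \<and> t i \<le> b) \<and>
        (\<forall>i<n. \<forall>j<n. i \<noteq> j \<longrightarrow> {s i<..<t i} \<inter> {s j<..<t j} = {}) \<and>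
        (\<Sum>i<n. t i - s i) < d \<longrightarrow> (\<Sum>i<n. norm (f (t i) - f (s i) :: complex)) < e"
  have "bounded (f ` {a..b})" "bounded (g ` {a..b})"
    by (intro compact_imp_bounded compact_continuous_image AC_on_continuous_on f g compact_Icc)+
  then obtain B1 B2 where B: "\<forall>x\<in>{a..b}. norm (f x) \<le> B1" "\<forall>x\<in>{a..b}. norm (g x) \<le> B2"
    unfolding bounded_iff by blast
  define B where "B = \<bar>B1\<bar> + \<bar>B2\<bar> + 1"
  have B: "norm (f x) \<le> B" "norm (g x) \<le> B" if "x \<in> {a..b}" for x
    using B(1)[rule_format, OF that] B(2)[rule_format, OF that] by (auto simp: B_def)
  have B0: "B > 0" by (simp add: B_def)
  have e2: "e / (2 * B) > 0" using e B0 by simp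
  obtain d1 where d1: "d1 > 0" "?P f (e/(2*B)) d1" using f[unfolded AC_on_def, rule_format, OF e2] by blast
  obtain d2 where d2: "d2 > 0" "?P g (e/(2*B)) d2" using g[unfolded AC_on_def, rule_format, OF e2] by blast
  show "\<exists>d>0. ?P (\<lambda>x. f x * g x) e d"
  proof (rule exI[of _ "min d1 d2"], rule conjI, use d1 d2 in simp, intro allI impI, elim conjE)
    fix n :: nat and s t :: "nat \<Rightarrow> real"
    assume st: "\<forall>i<n. a \<le> s i \<and> s i \<le> t i \<and> t i \<le> b"
      "\<forall>i<n. \<forall>j<n. i \<noteq> j \<longrightarrow> {s i<..<t i} \<inter> {s j<..<t j} = {}" "(\<Sum>i<n. t i - s i) < min d1 d2"
    have "(\<Sum>i<n. norm (f (t i) - f (s i))) < e/(2*B)" by (rule d1(2)[rule_format]) (use st in simp)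
    moreover have "(\<Sum>i<n. norm (g (t i) - g (s i))) < e/(2*B)" by (rule d2(2)[rule_format]) (use st in simp)
    moreover have "(\<Sum>i<n. norm (f (t i) * g (t i) - f (s i) * g (s i))) \<le> (\<Sum>i<n. B * (norm (f (t i) - f (s i)) + norm (g (t i) - g (s i))))"
    proof (rule sum_mono)
      fix i assume "i \<in> {..<n}"
      then have i: "s i \<in> {a..b}" "t i \<in> {a..b}" using st(1) by force+
      have "f (t i) * g (t i) - f (s i) * g (s i) = (f (t i) - f (s i)) * g (t i) + f (s i) * (g (t i) - g (s i))"
        by (simp add: algebra_simps)
      also have "norm \<dots> \<le> norm (f (t i) - f (s i)) * norm (g (t i)) + norm (f (s i)) * norm (g (t i) - g (s i))"
        by (metis norm_mult norm_triangle_ineq)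
      also have "\<dots> \<le> norm (f (t i) - f (s i)) * B + B * norm (g (t i) - g (s i))"
        using B i by (intro add_mono mult_left_mono mult_right_mono) auto
      finally show "norm (f (t i) * g (t i) - f (s i) * g (s i)) \<le> B * (norm (f (t i) - f (s i)) + norm (g (t i) - g (s i)))"
        by (simp add: algebra_simps)
    qed
    ultimately have "(\<Sum>i<n. norm (f (t i) * g (t i) - f (s i) * g (s i))) \<le> B * ((\<Sum>i<n. norm (f (t i) - f (s i))) + (\<Sum>i<n. norm (g (t i) - g (s i))))"
      by (simp only: sum.distrib sum_distrib_left[symmetric])
    also have "\<dots> < B * (e/(2*B) + e/(2*B))"
      using \<open>(\<Sum>i<n. norm (f (t i) - f (s i))) < e/(2*B)\<close> \<open>(\<Sum>i<n. norm (g (t i) - g (s i))) < e/(2*B)\<close> B0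
      by (intro mult_strict_left_mono add_strict_mono)
    also have "\<dots> = e" using B0 by simp
    finally show "(\<Sum>i<n. norm (f (t i) * g (t i) - f (s i) * g (s i))) < e" .
  qed
qed

text \<open>Subtracting the indefinite integral of \<open>F\<close> leaves an absolutely continuous
  function with derivative 0 almost everywhere, hence a constant. This is how the derivatives in the
  definition of the operator become integral identities.\<close>

lemma AC_on_imp_prim:
  assumes f: "AC_on a b f" and F: "integrable (lebesgue_on {a<..<b}) F"
    and d: "AE x in lebesgue_on {a<..<b}. (f has_vector_derivative F x) (at x)"
  shows "prim a b f F"
  unfolding prim_def
proof (intro conjI ballI F)
  fix x assume x: "x \<in> {a..b}"
  define G where "G = (\<lambda>x. LINT t:{a<..<x}|lebesgue. F t)"
  have Ga: "G a = 0" by (simp add: G_def set_lebesgue_integral_def)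
  have G: "prim a b G F" unfolding prim_def Ga using F by (simp add: G_def)
  have "AC_on a x (\<lambda>x. f x - G x)"
    using AC_on_diff[OF f prim_AC_on[OF G]] x by (elim AC_on_subinterval) auto
  moreover have "AE x in lebesgue_on {a<..<b}. ((\<lambda>x. f x - G x) has_vector_derivative 0) (at x)"
    using d prim_has_vector_derivative[OF G]
  proof eventually_elim
    case (elim x) then show ?case using has_vector_derivative_diff[of f "F x" "at x" G "F x"] by simp
  qed
  then have "negligible {x \<in> {a<..<b}. \<not> ((\<lambda>x. f x - G x) has_vector_derivative 0) (at x)}"
    by (simp add: AE_lebesgue_on_iff_negligible)
  then have "negligible {y \<in> {a<..<x}. \<not> ((\<lambda>x. f x - G x) has_vector_derivative 0) (at y)}"
    by (rule negligible_subset) (use x in auto)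
  ultimately have "f x - G x = f a - G a" using x by (intro AC_on_zero_derivative) auto
  then show "f x = f a + (LINT t:{a<..<x}|lebesgue. F t)" using Ga by (simp add: G_def algebra_simps)
qed

section \<open>Calculus of primitives\<close>

lemma prim_continuous_on: "prim a b f F \<Longrightarrow> continuous_on {a..b} f"
  by (intro AC_on_continuous_on prim_AC_on)

lemma continuous_on_measurable_lebesgue_on:
  fixes g :: "real \<Rightarrow> 'a::euclidean_space"
  assumes "continuous_on {a..b} g"
  shows "g \<in> borel_measurable (lebesgue_on {a<..<b})"
  by (rule continuous_imp_measurable_on_sets_lebesgue)
    (auto intro: continuous_on_subset[OF assms])

lemma continuous_on_Icc_bounded:
  fixes g :: "real \<Rightarrow> 'a::real_normed_vector"
  assumes "continuous_on {a..b} g"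
  obtains C where "C > 0" "\<And>x. x \<in> {a..b} \<Longrightarrow> norm (g x) \<le> C"
  using compact_imp_bounded[OF compact_continuous_image[OF assms compact_Icc]] bounded_pos[of "g ` {a..b}"]
  by auto

lemma integrable_bounded_mult:
  fixes F g :: "real \<Rightarrow> 'a::{real_normed_field, euclidean_space}"
  assumes F: "integrable (lebesgue_on {a<..<b}) F" and gm: "g \<in> borel_measurable (lebesgue_on {a<..<b})"
    and C: "\<And>x. x \<in> {a<..<b} \<Longrightarrow> norm (g x) \<le> C"
  shows "integrable (lebesgue_on {a<..<b}) (\<lambda>x. g x * F x)"
proof (rule Bochner_Integration.integrable_bound)
  show "integrable (lebesgue_on {a<..<b}) (\<lambda>x. C * norm (F x))"
    by (intro integrable_mult_right integrable_norm F)
  show "(\<lambda>x. g x * F x) \<in> borel_measurable (lebesgue_on {a<..<b})"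
    by (intro borel_measurable_times gm borel_measurable_integrable F)
  show "AE x in lebesgue_on {a<..<b}. norm (g x * F x) \<le> norm (C * norm (F x))"
  proof (rule AE_I2)
    fix x assume "x \<in> space (lebesgue_on {a<..<b})"
    then have "norm (g x) \<le> C" using C by simp
    then have "norm (g x) * norm (F x) \<le> C * norm (F x)" "C \<ge> 0"
      by (auto intro: mult_right_mono order_trans[OF norm_ge_zero])
    then show "norm (g x * F x) \<le> norm (C * norm (F x))"
      by (simp add: norm_mult)
  qed
qed

lemma integrable_continuous_mult:
  fixes F g :: "real \<Rightarrow> 'a::{real_normed_field, euclidean_space}"
  assumes F: "integrable (lebesgue_on {a<..<b}) F" and g: "continuous_on {a..b} g"
  shows "integrable (lebesgue_on {a<..<b}) (\<lambda>x. g x * F x)"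
proof -
  obtain C where "\<And>x. x \<in> {a..b} \<Longrightarrow> norm (g x) \<le> C" using continuous_on_Icc_bounded[OF g] by blast
  then have "\<And>x. x \<in> {a<..<b} \<Longrightarrow> norm (g x) \<le> C" by simp
  then show ?thesis
    by (rule integrable_bounded_mult[OF F continuous_on_measurable_lebesgue_on[OF g]])
qed

lemma prim_eq: "prim a b f F \<Longrightarrow> x \<in> {a..b} \<Longrightarrow> f x = f a + (LINT t:{a<..<x}|lebesgue. F t)"
  unfolding prim_def by blast

text \<open>Dominated convergence on every subinterval passes the integral identity to the limit. It
  is the source of termwise integration of series and, with constant sequences, of invariance under
  changes on null sets.\<close>

lemma prim_LIMSEQ:
  assumes g: "\<And>n. prim a b (g n) (G n)" and lim: "\<And>x. x \<in> {a..b} \<Longrightarrow> (\<lambda>n. g n x) \<longlonglongrightarrow> h x"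
    and H: "integrable (lebesgue_on {a<..<b}) H"
    and m: "G' \<in> borel_measurable (lebesgue_on {a<..<b})"
    and L: "AE x in lebesgue_on {a<..<b}. (\<lambda>n. G n x) \<longlonglongrightarrow> G' x"
    and B: "\<And>n. AE x in lebesgue_on {a<..<b}. norm (G n x) \<le> H x"
  shows "prim a b h G'"
  unfolding prim_def
proof (intro conjI ballI)
  have Gi: "integrable (lebesgue_on {a<..<b}) (G n)" for n by (rule primD(1)[OF g])
  show "integrable (lebesgue_on {a<..<b}) G'"
    by (rule integrable_dominated_convergence[OF m _ H L B]) (use Gi in auto)
  fix x assume x: "x \<in> {a..b}"
  have eq: "(LINT t:{a<..<x}|lebesgue. F t) = (\<integral>t. indicator {a<..<x} t *\<^sub>R F t \<partial>lebesgue_on {a<..<b})" for F :: "real \<Rightarrow> complex"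
    unfolding set_lebesgue_integral_def using x
    by (subst integral_restrict_space) (auto intro!: Bochner_Integration.integral_cong split: split_indicator)
  have "(\<lambda>n. LINT t:{a<..<x}|lebesgue. G n t) \<longlonglongrightarrow> (LINT t:{a<..<x}|lebesgue. G' t)"
    unfolding eq
  proof (rule integral_dominated_convergence[where w=H])
    have [measurable]: "{a<..<x} \<in> sets (lebesgue_on {a<..<b})"
      using x by (auto simp: sets_restrict_space image_iff intro!: bexI[of _ "{a<..<x}"])
    show "(\<lambda>t. indicator {a<..<x} t *\<^sub>R G' t) \<in> borel_measurable (lebesgue_on {a<..<b})"
      using m by measurable
    show "(\<lambda>t. indicator {a<..<x} t *\<^sub>R G n t) \<in> borel_measurable (lebesgue_on {a<..<b})" for n
      using borel_measurable_integrable[OF Gi] by measurable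
    show "AE t in lebesgue_on {a<..<b}. (\<lambda>n. indicator {a<..<x} t *\<^sub>R G n t) \<longlonglongrightarrow> indicator {a<..<x} t *\<^sub>R G' t"
      using L by eventually_elim (intro tendsto_intros)
    show "AE t in lebesgue_on {a<..<b}. norm (indicator {a<..<x} t *\<^sub>R G n t) \<le> H t" for n
      using B[of n] by eventually_elim (auto split: split_indicator intro: order_trans[OF norm_ge_zero])
  qed (rule H)
  then have "(\<lambda>n. g n a + (LINT t:{a<..<x}|lebesgue. G n t)) \<longlonglongrightarrow> h a + (LINT t:{a<..<x}|lebesgue. G' t)"
    using lim[of a] x by (intro tendsto_add) auto
  moreover have "(\<lambda>n. g n a + (LINT t:{a<..<x}|lebesgue. G n t)) = (\<lambda>n. g n x)"
    by (rule ext, rule prim_eq[OF g x, symmetric])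
  ultimately show "h x = h a + (LINT t:{a<..<x}|lebesgue. G' t)"
    using lim[OF x] LIMSEQ_unique by metis
qed

lemma prim_cong:
  assumes f: "prim a b f F" and g: "\<And>x. x \<in> {a..b} \<Longrightarrow> g x = f x"
    and m: "G \<in> borel_measurable (lebesgue_on {a<..<b})" and G: "AE x in lebesgue_on {a<..<b}. G x = F x"
  shows "prim a b g G"
  by (rule prim_LIMSEQ[where g="\<lambda>_. f" and G="\<lambda>_. F" and H="\<lambda>x. norm (F x)"])
    (use assms primD(1)[OF f] in auto)

lemma prim_const: "prim a b (\<lambda>x. c) (\<lambda>x. 0)"
  by (simp add: prim_def set_lebesgue_integral_def)

lemma prim_bounded_linear:
  assumes L: "bounded_linear L" and f: "prim a b f F"
  shows "prim a b (\<lambda>x. L (f x)) (\<lambda>x. L (F x))"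
  unfolding prim_def
proof (intro conjI ballI)
  show "integrable (lebesgue_on {a<..<b}) (\<lambda>x. L (F x))"
    by (rule integrable_bounded_linear[OF L primD(1)[OF f]])
  fix x assume x: "x \<in> {a..b}"
  have i: "set_integrable lebesgue {a<..<x} F"
    using x by (intro integrable_lebesgue_on_subset[OF primD(1)[OF f]]) auto
  have "L (f x) = L (f a + (LINT t:{a<..<x}|lebesgue. F t))" using prim_eq[OF f x] by (rule arg_cong)
  also have "\<dots> = L (f a) + L (LINT t:{a<..<x}|lebesgue. F t)"
    by (simp add: linear_add[OF bounded_linear.linear[OF L]])
  also have "L (LINT t:{a<..<x}|lebesgue. F t) = (LINT t:{a<..<x}|lebesgue. L (F t))"
    using integral_bounded_linear[OF L i[unfolded set_integrable_def]]
    by (simp add: set_lebesgue_integral_def linear_cmul[OF bounded_linear.linear[OF L]])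
  finally show "L (f x) = L (f a) + (LINT t:{a<..<x}|lebesgue. L (F t))" .
qed

lemmas prim_cnj = prim_bounded_linear[OF bounded_linear_cnj]
lemmas prim_cmult = prim_bounded_linear[OF bounded_linear_mult_right]
lemmas prim_uminus = prim_bounded_linear[OF bounded_linear_minus[OF bounded_linear_ident]]

lemma prim_add:
  assumes f: "prim a b f F" and g: "prim a b g G"
  shows "prim a b (\<lambda>x. f x + g x) (\<lambda>x. F x + G x)"
  unfolding prim_def
proof (intro conjI ballI)
  show "integrable (lebesgue_on {a<..<b}) (\<lambda>x. F x + G x)"
    by (intro Bochner_Integration.integrable_add primD(1)[OF f] primD(1)[OF g])
  fix x assume x: "x \<in> {a..b}"
  have i: "set_integrable lebesgue {a<..<x} F" "set_integrable lebesgue {a<..<x} G"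
    using x by (intro integrable_lebesgue_on_subset[OF primD(1)[OF f]] integrable_lebesgue_on_subset[OF primD(1)[OF g]]; auto)+
  have "f x = f a + (LINT t:{a<..<x}|lebesgue. F t)" "g x = g a + (LINT t:{a<..<x}|lebesgue. G t)"
    using prim_eq[OF f x] prim_eq[OF g x] .
  then show "f x + g x = f a + g a + (LINT t:{a<..<x}|lebesgue. F t + G t)"
    using set_integral_add(2)[OF i] by (simp only: ac_simps)
qed

lemma prim_minus:
  assumes f: "prim a b f F" and g: "prim a b g G"
  shows "prim a b (\<lambda>x. f x - g x) (\<lambda>x. F x - G x)"
  using prim_add[OF f prim_uminus[OF g]] by simp

lemma prim_sum:
  assumes "\<And>i. i \<in> I \<Longrightarrow> prim a b (f i) (F i)"
  shows "prim a b (\<lambda>x. \<Sum>i\<in>I. f i x) (\<lambda>x. \<Sum>i\<in>I. F i x)"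
  using assms by (induction I rule: infinite_finite_induct) (auto intro: prim_add prim_const)

text \<open>The product of absolutely continuous functions is absolutely continuous and the product
  rule holds almost everywhere. The Wronskian, the Lagrange identity and the energy identity are all
  instances.\<close>

lemma prim_mult:
  assumes f: "prim a b f F" and g: "prim a b g G"
  shows "prim a b (\<lambda>x. f x * g x) (\<lambda>x. F x * g x + f x * G x)"
proof (rule AC_on_imp_prim)
  show "AC_on a b (\<lambda>x. f x * g x)" by (intro AC_on_mult prim_AC_on[OF f] prim_AC_on[OF g])
  show "integrable (lebesgue_on {a<..<b}) (\<lambda>x. F x * g x + f x * G x)"
    using integrable_continuous_mult[OF primD(1)[OF f] prim_continuous_on[OF g]]
      integrable_continuous_mult[OF primD(1)[OF g] prim_continuous_on[OF f]]
    by (simp add: mult.commute)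
  show "AE x in lebesgue_on {a<..<b}. ((\<lambda>x. f x * g x) has_vector_derivative F x * g x + f x * G x) (at x)"
    using prim_has_vector_derivative[OF f] prim_has_vector_derivative[OF g]
  proof eventually_elim
    case (elim x)
    then show ?case using has_vector_derivative_mult[of f "F x" x UNIV g "G x"] by (simp add: add.commute)
  qed
qed

lemma prim_unique:
  assumes f: "prim a b f F" and g: "prim a b g G" and "\<And>x. x \<in> {a..b} \<Longrightarrow> f x = g x"
  shows "AE x in lebesgue_on {a<..<b}. F x = G x"
proof -
  have "AE x in lebesgue_on {a<..<b}. x \<in> {a<..<b}" by (rule AE_I2) simp
  then show ?thesis using prim_has_vector_derivative[OF f] prim_has_vector_derivative[OF g]
  proof eventually_elim
    case (elim x)
    have "(g has_vector_derivative F x) (at x)"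
      by (rule has_vector_derivative_transform_within_open[OF elim(2), of "{a<..<b}"]) (use elim assms(3) in auto)
    then show ?case using elim(3) vector_derivative_unique_at by blast
  qed
qed

lemma prim_integral:
  assumes "prim a b f F" "a \<le> b"
  shows "(\<integral>t. F t \<partial>lebesgue_on {a<..<b}) = f b - f a"
  using prim_diff[OF assms(1), of a b] assms(2)
  by (simp add: integral_restrict_space set_lebesgue_integral_def)

lemma prim_indefinite:
  assumes "integrable (lebesgue_on {a<..<b}) F"
  shows "prim a b (\<lambda>x. c + (LINT t:{a<..<x}|lebesgue. F t)) F"
  using assms by (simp add: prim_def set_lebesgue_integral_def)

lemma prim_power:
  assumes f: "prim a b f F"
  shows "prim a b (\<lambda>x. f x ^ Suc n) (\<lambda>x. of_nat (Suc n) * f x ^ n * F x)"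
proof (induction n)
  case (Suc n)
  show ?case using prim_mult[OF f Suc] by (simp add: algebra_simps)
qed (use f in simp)

text \<open>If \<open>W\<close> is the primitive of \<kappa>, then
  \<open>W ^ Suc k / fact (Suc k)\<close> is that of \<open>W ^ k / fact k * \<kappa>\<close>, so
  each integration earns one more factorial although \<kappa> is only integrable.\<close>

lemma Volterra_iteration_bound:
  fixes \<kappa> :: "real \<Rightarrow> real" and v :: "nat \<Rightarrow> real \<Rightarrow> real"
  assumes \<kappa>: "integrable (lebesgue_on {a<..<b}) \<kappa>" and \<kappa>0: "AE x in lebesgue_on {a<..<b}. \<kappa> x \<ge> 0"
    and v: "\<And>k. continuous_on {a..b} (v k)" and v0: "\<And>x. x \<in> {a..b} \<Longrightarrow> v 0 x \<le> C"
    and vS: "\<And>k x. x \<in> {a..b} \<Longrightarrow> v (Suc k) x \<le> (LINT t:{a<..<x}|lebesgue. v k t * \<kappa> t)"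
    and x: "x \<in> {a..b}"
  shows "v k x \<le> C * (LINT t:{a<..<x}|lebesgue. \<kappa> t) ^ k / fact k"
  using x
proof (induction k arbitrary: x)
  case (Suc k)
  define W where "W = (\<lambda>x. LINT t:{a<..<x}|lebesgue. \<kappa> t)"
  have \<kappa>c: "integrable (lebesgue_on {a<..<b}) (\<lambda>x. complex_of_real (\<kappa> x))" using \<kappa> by simp
  \<comment> \<open>\<open>prim\<close> speaks of complex functions; the real primitive is passed
    through \<open>complex_of_real\<close> and back.\<close>
  have W: "prim a b (\<lambda>x. complex_of_real (W x)) (\<lambda>x. of_real (\<kappa> x))"
    using prim_indefinite[OF \<kappa>c, of 0] by (simp add: W_def set_integral_complex_of_real)
  have Wc: "continuous_on {a..b} W"
    using continuous_on_Re[OF prim_continuous_on[OF W]] by simp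
  have P: "prim a b (\<lambda>x. complex_of_real (C * W x ^ Suc k / fact (Suc k))) (\<lambda>x. of_real (C * W x ^ k / fact k * \<kappa> x))"
    using prim_cmult[OF prim_power[OF W, of k], of "of_real (C / fact (Suc k))"]
    by (simp add: field_simps del: of_nat_Suc)
  have Wa: "W a = 0" by (simp add: W_def set_lebesgue_integral_def)
  have "complex_of_real (C * W x ^ Suc k / fact (Suc k)) = (LINT t:{a<..<x}|lebesgue. complex_of_real (C * W t ^ k / fact k * \<kappa> t))"
    using prim_diff[OF P, of a x] Suc.prems Wa by simp
  then have eq: "C * W x ^ Suc k / fact (Suc k) = (LINT t:{a<..<x}|lebesgue. C * W t ^ k / fact k * \<kappa> t)"
    by (simp only: set_integral_complex_of_real of_real_eq_iff)
  have "v (Suc k) x \<le> (LINT t:{a<..<x}|lebesgue. v k t * \<kappa> t)" by (rule vS[OF Suc.prems])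
  also have "\<dots> \<le> (LINT t:{a<..<x}|lebesgue. C * W t ^ k / fact k * \<kappa> t)"
    unfolding set_lebesgue_integral_def
  proof (rule integral_mono_AE)
    have sub: "{a<..<x} \<subseteq> {a<..<b}" using Suc.prems by auto
    show "integrable lebesgue (\<lambda>t. indicator {a<..<x} t *\<^sub>R (v k t * \<kappa> t))"
      using integrable_lebesgue_on_subset[OF integrable_continuous_mult[OF \<kappa> v] sub]
      by (simp add: set_integrable_def)
    have "continuous_on {a..b} (\<lambda>t. C * W t ^ k / fact k)" by (intro continuous_intros Wc) auto
    from integrable_lebesgue_on_subset[OF integrable_continuous_mult[OF \<kappa> this] sub]
    show "integrable lebesgue (\<lambda>t. indicator {a<..<x} t *\<^sub>R (C * W t ^ k / fact k * \<kappa> t))"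
      by (simp add: set_integrable_def)
    have "AE t in lebesgue. t \<in> {a<..<b} \<longrightarrow> \<kappa> t \<ge> 0" using \<kappa>0 by (simp add: AE_restrict_space_iff)
    then show "AE t in lebesgue. indicator {a<..<x} t *\<^sub>R (v k t * \<kappa> t) \<le> indicator {a<..<x} t *\<^sub>R (C * W t ^ k / fact k * \<kappa> t)"
    proof eventually_elim
      case (elim t)
      show ?case
      proof (cases "t \<in> {a<..<x}")
        case True
        then have "v k t \<le> C * W t ^ k / fact k" "\<kappa> t \<ge> 0"
          using Suc.IH[of t] Suc.prems elim by (auto simp: W_def)
        then show ?thesis using True mult_right_mono[of "v k t" "C * W t ^ k / fact k" "\<kappa> t"] by simp
      qed simp
    qed
  qed
  also have "\<dots> = C * W x ^ Suc k / fact (Suc k)" by (rule eq[symmetric])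
  finally show ?case by (simp only: W_def)
qed (use v0 in simp)

text \<open>Two kinds of majorant: the functions are bounded by constants \<open>c k\<close>, but
  the densities contain the unbounded coefficients and are bounded by \<open>d k\<close> times one
  integrable function.\<close>

lemma prim_suminf:
  assumes f: "\<And>k. prim a b (f k) (F k)"
    and fb: "\<And>k x. x \<in> {a..b} \<Longrightarrow> norm (f k x) \<le> c k" and c: "summable c"
    and Fb: "\<And>k. AE x in lebesgue_on {a<..<b}. norm (F k x) \<le> d k * H x"
    and d: "summable d" "\<And>k. d k \<ge> 0"
    and H: "integrable (lebesgue_on {a<..<b}) H"
  shows "prim a b (\<lambda>x. \<Sum>k. f k x) (\<lambda>x. \<Sum>k. F k x)"
proof (rule prim_LIMSEQ[where g="\<lambda>n x. \<Sum>k<n. f k x" and G="\<lambda>n x. \<Sum>k<n. F k x" and H="\<lambda>x. suminf d * norm (H x)"])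
  show "prim a b (\<lambda>x. \<Sum>k<n. f k x) (\<lambda>x. \<Sum>k<n. F k x)" for n
    by (intro prim_sum f)
  show "(\<lambda>n. \<Sum>k<n. f k x) \<longlonglongrightarrow> (\<Sum>k. f k x)" if "x \<in> {a..b}" for x
    by (intro summable_LIMSEQ summable_comparison_test'[OF c]) (use fb that in auto)
  show "integrable (lebesgue_on {a<..<b}) (\<lambda>x. suminf d * norm (H x))"
    by (intro integrable_mult_right integrable_norm H)
  show "(\<lambda>x. \<Sum>k. F k x) \<in> borel_measurable (lebesgue_on {a<..<b})"
    using borel_measurable_integrable[OF primD(1)[OF f]] by measurable
  have all: "AE x in lebesgue_on {a<..<b}. \<forall>k. norm (F k x) \<le> d k * norm (H x)"
    unfolding AE_all_countable
  proof
    fix k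
    show "AE x in lebesgue_on {a<..<b}. norm (F k x) \<le> d k * norm (H x)"
      using Fb[of k]
    proof eventually_elim
      case (elim x)
      have "d k * H x \<le> d k * norm (H x)" using d(2)[of k] by (intro mult_left_mono) auto
      then show ?case using elim by linarith
    qed
  qed
  show "AE x in lebesgue_on {a<..<b}. (\<lambda>n. \<Sum>k<n. F k x) \<longlonglongrightarrow> (\<Sum>k. F k x)"
    using all
  proof eventually_elim
    case (elim x)
    show ?case
      by (intro summable_LIMSEQ summable_comparison_test'[OF summable_mult2[OF d(1), of "norm (H x)"]])
        (use elim in auto)
  qed
  show "AE x in lebesgue_on {a<..<b}. norm (\<Sum>k<n. F k x) \<le> suminf d * norm (H x)" for n
    using all
  proof eventually_elim
    case (elim x)
    have "norm (\<Sum>k<n. F k x) \<le> (\<Sum>k<n. d k * norm (H x))"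
      using elim by (intro sum_norm_le) auto
    also have "\<dots> = (\<Sum>k<n. d k) * norm (H x)" by (simp add: sum_distrib_right)
    also have "\<dots> \<le> suminf d * norm (H x)"
      using d by (intro mult_right_mono sum_le_suminf) auto
    finally show ?case .
  qed
qed

lemma summable_exp_bound: "summable (\<lambda>k. C * K ^ k / fact k :: real)"
  using summable_mult[OF summable_exp[of K], of C] by (simp add: field_simps)

text \<open>The points of disagreement in the open interval form an open set, and a negligible open
  set is empty; continuity then covers the endpoints.\<close>

lemma continuous_AE_eq:
  fixes f g :: "real \<Rightarrow> complex"
  assumes "a < b" and f: "continuous_on {a..b} f" and g: "continuous_on {a..b} g"
    and ae: "AE x in lebesgue_on {a<..<b}. f x = g x" and x: "x \<in> {a..b}"
  shows "f x = g x"
proof -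
  define S where "S = {x \<in> {a<..<b}. f x - g x \<in> - {0}}"
  have "open S"
    unfolding S_def
    by (rule continuous_open_preimage[unfolded vimage_def Int_def, simplified])
      (auto intro!: continuous_intros continuous_on_subset[OF f] continuous_on_subset[OF g])
  moreover have "negligible S"
    using ae by (simp add: AE_lebesgue_on_iff_negligible S_def)
  ultimately have "S = {}" using open_not_negligible by blast
  then have "\<And>y. y \<in> {a<..<b} \<Longrightarrow> f y - g y = 0" by (auto simp: S_def)
  moreover have "continuous_on (closure {a<..<b}) (\<lambda>x. f x - g x)"
    using assms by (auto intro!: continuous_intros)
  moreover have "x \<in> closure {a<..<b}" using assms by simp
  ultimately have "f x - g x = 0"
    using continuous_constant_on_closure[of "{a<..<b}" "\<lambda>x. f x - g x" 0 x] by blast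
  then show ?thesis by simp
qed

lemma prim_eqI: "prim a b f F \<Longrightarrow> (\<And>x. g x = f x) \<Longrightarrow> (\<And>x. G x = F x) \<Longrightarrow> prim a b g G"
  by (metis ext)

section \<open>The Sturm--Liouville system\<close>

locale sturm_liouville =
  fixes a b :: real and p q r :: "real \<Rightarrow> real"
  assumes ab: "a < b"
    and p_measurable: "p \<in> borel_measurable (lebesgue_on {a<..<b})"
    and q_measurable: "q \<in> borel_measurable (lebesgue_on {a<..<b})"
    and r_measurable: "r \<in> borel_measurable (lebesgue_on {a<..<b})"
    and r_pos: "AE x in lebesgue_on {a<..<b}. r x > 0"
    and r_integrable: "integrable (lebesgue_on {a<..<b}) r"
    and p_pos: "AE x in lebesgue_on {a<..<b}. p x > 0"
    and p_integrable: "integrable (lebesgue_on {a<..<b}) (\<lambda>x. 1 / p x)"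
    and q_integrable: "integrable (lebesgue_on {a<..<b}) q"
begin

abbreviation "N \<equiv> lebesgue_on {a<..<b}"
abbreviation "M \<equiv> sl_measure a b r"

text \<open>The inhomogeneous equation \<open>\<tau> y = h\<close> as a first order system, with \<open>u = p y'\<close>.\<close>

definition sys :: "(real \<Rightarrow> complex) \<Rightarrow> (real \<Rightarrow> complex) \<Rightarrow> (real \<Rightarrow> complex) \<Rightarrow> bool" where
  "sys h y u \<longleftrightarrow> prim a b y (\<lambda>x. u x / of_real (p x)) \<and>
     prim a b u (\<lambda>x. of_real (q x) * y x - of_real (r x) * h x)"

text \<open>The same encoding as in \<open>AC_fun\<close>: vanishing off the compact interval makes
  equality on \<open>{a..b}\<close> plain equality, as the definite descriptions of the solutions
  require.\<close>

definition supp :: "(real \<Rightarrow> complex) \<Rightarrow> bool" where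
  "supp f \<longleftrightarrow> (\<forall>x. x \<notin> {a..b} \<longrightarrow> f x = 0)"

definition trunc :: "(real \<Rightarrow> complex) \<Rightarrow> real \<Rightarrow> complex" where
  "trunc f x = (if x \<in> {a..b} then f x else 0)"

lemma supp_trunc [simp]: "supp (trunc f)" by (simp add: supp_def trunc_def)
lemma trunc_in [simp]: "x \<in> {a..b} \<Longrightarrow> trunc f x = f x" by (simp add: trunc_def)

lemma supp_ext: "supp f \<Longrightarrow> supp g \<Longrightarrow> (\<And>x. x \<in> {a..b} \<Longrightarrow> f x = g x) \<Longrightarrow> f = g"
  unfolding supp_def by (metis ext)

lemma AE_in: "AE x in N. x \<in> {a<..<b}" by (rule AE_I2) simp

lemma AE_M_iff: "(AE x in M. P x) \<longleftrightarrow> (AE x in N. P x)"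
proof -
  have "(AE x in M. P x) \<longleftrightarrow> (AE x in N. 0 < ennreal (r x) \<longrightarrow> P x)"
    unfolding sl_measure_def by (subst AE_density) (use r_measurable in auto)
  also have "\<dots> \<longleftrightarrow> (AE x in N. P x)"
  proof
    assume "AE x in N. 0 < ennreal (r x) \<longrightarrow> P x"
    then show "AE x in N. P x" using r_pos by eventually_elim simp
  qed (auto elim: eventually_mono)
  finally show ?thesis .
qed

lemma measurable_M: "f \<in> borel_measurable M \<longleftrightarrow> f \<in> borel_measurable N"
  by (simp add: sl_measure_def measurable_def)

lemma r_nonneg: "AE x in N. 0 \<le> r x"
  using r_pos by eventually_elim simp

lemma integrable_M:
  fixes f :: "real \<Rightarrow> 'a::{banach, second_countable_topology}"
  assumes "f \<in> borel_measurable N"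
  shows "integrable M f \<longleftrightarrow> integrable N (\<lambda>x. r x *\<^sub>R f x)"
  unfolding sl_measure_def by (rule integrable_density[OF assms r_measurable r_nonneg])

lemma integral_M:
  fixes f :: "real \<Rightarrow> 'a::{banach, second_countable_topology}"
  assumes "f \<in> borel_measurable N"
  shows "(\<integral>x. f x \<partial>M) = (\<integral>x. r x *\<^sub>R f x \<partial>N)"
  unfolding sl_measure_def by (rule integral_density[OF assms r_measurable r_nonneg])

lemma finite_measure_M: "finite_measure M"
proof
  have "emeasure M (space M) = (\<integral>\<^sup>+x. ennreal (r x) \<partial>N)"
    unfolding sl_measure_def using r_measurable
    by (subst emeasure_density) (auto intro!: nn_integral_cong simp: space_restrict_space split: split_indicator)
  also have "\<dots> = ennreal (\<integral>x. r x \<partial>N)" by (rule nn_integral_eq_integral[OF r_integrable r_nonneg])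
  finally show "emeasure M (space M) \<noteq> \<infinity>" by simp
qed

text \<open>The weighted measure is finite, so square integrable functions are integrable against
  \<open>r\<close>; this makes them admissible right hand sides of the system.\<close>

lemma L2_integrable:
  assumes "f \<in> L2 M"
  shows "integrable N (\<lambda>x. of_real (r x) * f x)" "f \<in> borel_measurable N"
proof -
  interpret finite_measure M by (rule finite_measure_M)
  have f: "f \<in> borel_measurable M" "integrable M (\<lambda>x. (norm (f x))\<^sup>2)" using assms by (auto simp: L2_def)
  have "integrable M f"
  proof (rule Bochner_Integration.integrable_bound)
    show "integrable M (\<lambda>x. 1 + (norm (f x))\<^sup>2)" using f by auto
    show "AE x in M. norm (f x) \<le> norm (1 + (norm (f x))\<^sup>2)"
    proof (rule AE_I2)
      fix x
      have "2 * norm (f x) \<le> 1 + (norm (f x))\<^sup>2" using sum_squares_bound[of 1 "norm (f x)"] by simp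
      then show "norm (f x) \<le> norm (1 + (norm (f x))\<^sup>2)" using norm_ge_zero[of "f x"] by (simp del: norm_ge_zero)
    qed
  qed (use f in auto)
  then show "integrable N (\<lambda>x. of_real (r x) * f x)"
    using integrable_M[of f] f(1) by (simp add: measurable_M scaleR_conv_of_real)
  show "f \<in> borel_measurable N" using f(1) by (simp add: measurable_M)
qed

lemma L2_bounded:
  fixes f :: "real \<Rightarrow> complex"
  assumes "f \<in> borel_measurable N" and C: "\<And>x. x \<in> {a<..<b} \<Longrightarrow> norm (f x) \<le> C"
  shows "f \<in> L2 M"
proof -
  interpret finite_measure M by (rule finite_measure_M)
  have "integrable M (\<lambda>x. (norm (f x))\<^sup>2)"
  proof (rule integrable_const_bound[where B="C\<^sup>2"])
    show "AE x in M. norm ((norm (f x))\<^sup>2) \<le> C\<^sup>2" unfolding AE_M_iff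
      by (rule AE_I2) (auto intro!: power_mono C)
  qed (use assms(1) in \<open>simp add: measurable_M\<close>)
  then show ?thesis using assms by (simp add: L2_def measurable_M)
qed

lemma L2_continuous:
  assumes "continuous_on {a..b} f" shows "f \<in> L2 M"
proof -
  obtain C where "\<And>x. x \<in> {a..b} \<Longrightarrow> norm (f x) \<le> C" using continuous_on_Icc_bounded[OF assms] by blast
  then have "\<And>x. x \<in> {a<..<b} \<Longrightarrow> norm (f x) \<le> C" by simp
  then show ?thesis by (rule L2_bounded[OF continuous_on_measurable_lebesgue_on[OF assms]])
qed

lemma AC_fun_iff: "f \<in> AC_fun a b \<longleftrightarrow> AC_on a b f \<and> supp f"
  by (simp add: AC_fun_def supp_def)

text \<open>Two candidates agree almost everywhere and are continuous, so they agree on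
  \<open>{a..b}\<close>; this unlocks the definite description.\<close>

lemma quasi_deriv_eqI:
  assumes u: "u \<in> AC_fun a b" "is_quasi_deriv a b p g u"
  shows "quasi_deriv a b p g = u"
  unfolding quasi_deriv_def
proof (rule the_equality)
  fix v assume v: "v \<in> AC_fun a b \<and> is_quasi_deriv a b p g v"
  have "AE x in N. v x = u x"
    using u(2) conjunct2[OF v] unfolding is_quasi_deriv_def by eventually_elim simp
  then have "v x = u x" if "x \<in> {a..b}" for x
    using u v that by (intro continuous_AE_eq[OF ab]) (auto simp: AC_fun_iff intro: AC_on_continuous_on)
  then show "v = u" using u v by (auto simp: AC_fun_iff intro: supp_ext)
qed (use u in blast)

lemma inverse_p_integrable: "integrable N (\<lambda>x. 1 / complex_of_real (p x))"
proof -
  have "integrable N (\<lambda>x. complex_of_real (1 / p x))" using p_integrable by (rule integrable_of_real)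
  then show ?thesis by simp
qed

lemma div_p_integrable:
  assumes "continuous_on {a..b} u"
  shows "integrable N (\<lambda>x. u x / complex_of_real (p x))"
  using integrable_continuous_mult[OF inverse_p_integrable assms] by simp

lemma mult_q_integrable:
  assumes "continuous_on {a..b} u"
  shows "integrable N (\<lambda>x. complex_of_real (q x) * u x)"
  using integrable_continuous_mult[OF integrable_of_real[OF q_integrable] assms] by (simp add: mult.commute)

lemma mult_r_integrable:
  assumes "continuous_on {a..b} u"
  shows "integrable N (\<lambda>x. complex_of_real (r x) * u x)"
  using integrable_continuous_mult[OF integrable_of_real[OF r_integrable] assms] by (simp add: mult.commute)

lemma sl_regularD:
  assumes "g \<in> sl_regular a b p"
  defines "u \<equiv> quasi_deriv a b p g"
  shows "u \<in> AC_fun a b" "g \<in> AC_fun a b" "prim a b g (\<lambda>x. u x / of_real (p x))"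
    "AE x in N. u differentiable (at x)" "is_quasi_deriv a b p g u"
proof -
  obtain u' where u': "u' \<in> AC_fun a b" "is_quasi_deriv a b p g u'" "AE x in N. u' differentiable (at x)"
    and g: "g \<in> AC_fun a b"
    using assms(1) unfolding sl_regular_def by blast
  have "u = u'" unfolding u_def by (rule quasi_deriv_eqI[OF u'(1,2)])
  then show u: "u \<in> AC_fun a b" "g \<in> AC_fun a b" "AE x in N. u differentiable (at x)" "is_quasi_deriv a b p g u"
    using u' g by auto
  show "prim a b g (\<lambda>x. u x / of_real (p x))"
  proof (rule AC_on_imp_prim)
    show "AC_on a b g" using g by (simp add: AC_fun_iff)
    show "integrable N (\<lambda>x. u x / of_real (p x))"
      using u by (intro div_p_integrable AC_on_continuous_on) (simp add: AC_fun_iff)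
    show "AE x in N. (g has_vector_derivative u x / of_real (p x)) (at x)"
      using u(4) p_pos unfolding is_quasi_deriv_def
      by eventually_elim (use vector_derivative_works in force)
  qed
qed

text \<open>This and the converse \<open>regular_imp_sys\<close> translate between derivatives
  almost everywhere and integral equations. Positivity of \<open>p\<close> and \<open>r\<close>
  almost everywhere makes the divisions harmless.\<close>

lemma sys_imp_regular:
  assumes s: "sys h g u" and g: "supp g" and u: "supp u"
  shows "g \<in> sl_regular a b p" "quasi_deriv a b p g = u" "AE x in N. sl_tau a b p q r g x = h x"
proof -
  have g': "prim a b g (\<lambda>x. u x / of_real (p x))"
    and u': "prim a b u (\<lambda>x. of_real (q x) * g x - of_real (r x) * h x)" using s by (auto simp: sys_def)
  have AC: "g \<in> AC_fun a b" "u \<in> AC_fun a b" using g u g' u' by (auto simp: AC_fun_iff intro: prim_AC_on)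
  have q: "is_quasi_deriv a b p g u"
    unfolding is_quasi_deriv_def using prim_has_vector_derivative[OF g'] p_pos
    by eventually_elim (auto simp: vector_derivative_at differentiableI_vector)
  show qd: "quasi_deriv a b p g = u" by (rule quasi_deriv_eqI[OF AC(2) q])
  have "AE x in N. u differentiable (at x)"
    using prim_has_vector_derivative[OF u'] by eventually_elim (rule differentiableI_vector)
  then show "g \<in> sl_regular a b p" using AC q by (auto simp: sl_regular_def)
  show "AE x in N. sl_tau a b p q r g x = h x"
    using prim_has_vector_derivative[OF u'] r_pos
    by eventually_elim (simp add: sl_tau_def qd vector_derivative_at)
qed

lemma regular_imp_sys:
  assumes g: "g \<in> sl_regular a b p" and h: "AE x in N. sl_tau a b p q r g x = h x"
    and rh: "integrable N (\<lambda>x. of_real (r x) * h x)"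
  shows "sys h g (quasi_deriv a b p g)" "supp g" "supp (quasi_deriv a b p g)"
proof -
  note G = sl_regularD[OF g]
  show "supp g" "supp (quasi_deriv a b p g)" using G by (auto simp: AC_fun_iff)
  have gc: "continuous_on {a..b} g" using G by (intro AC_on_continuous_on) (simp add: AC_fun_iff)
  have "prim a b (quasi_deriv a b p g) (\<lambda>x. of_real (q x) * g x - of_real (r x) * h x)"
  proof (rule AC_on_imp_prim)
    show "AC_on a b (quasi_deriv a b p g)" using G by (simp add: AC_fun_iff)
    show "integrable N (\<lambda>x. of_real (q x) * g x - of_real (r x) * h x)"
      by (intro Bochner_Integration.integrable_diff mult_q_integrable gc rh)
    show "AE x in N. (quasi_deriv a b p g has_vector_derivative of_real (q x) * g x - of_real (r x) * h x) (at x)"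
      using G(4) r_pos h
    proof eventually_elim
      case (elim x)
      then have "vector_derivative (quasi_deriv a b p g) (at x) = of_real (q x) * g x - of_real (r x) * h x"
        by (simp add: sl_tau_def field_simps)
      then show ?case using elim(1) vector_derivative_works by metis
    qed
  qed
  then show "sys h g (quasi_deriv a b p g)" using G by (simp add: sys_def)
qed

lemma sys_cong:
  assumes "sys h y u" "\<And>x. x \<in> {a..b} \<Longrightarrow> y' x = y x" "\<And>x. x \<in> {a..b} \<Longrightarrow> u' x = u x"
    and h: "AE x in N. h' x = h x" and hm: "h' \<in> borel_measurable N"
  shows "sys h' y' u'"
proof -
  have s: "prim a b y (\<lambda>x. u x / of_real (p x))" "prim a b u (\<lambda>x. of_real (q x) * y x - of_real (r x) * h x)"
    using assms(1) by (auto simp: sys_def)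
  have yc: "continuous_on {a..b} y'" "continuous_on {a..b} u'"
    using continuous_on_cong[of "{a..b}" _ y' y, OF refl assms(2)] prim_continuous_on[OF s(1)]
      continuous_on_cong[of "{a..b}" _ u' u, OF refl assms(3)] prim_continuous_on[OF s(2)] by auto
  have [measurable]: "y' \<in> borel_measurable N" "u' \<in> borel_measurable N"
    by (rule continuous_on_measurable_lebesgue_on yc)+
  have "prim a b y' (\<lambda>x. u' x / of_real (p x))"
    by (rule prim_cong[OF s(1) assms(2)]) (use p_measurable assms(3) in \<open>auto intro!: AE_I2\<close>)
  moreover have "prim a b u' (\<lambda>x. of_real (q x) * y' x - of_real (r x) * h' x)"
  proof (rule prim_cong[OF s(2) assms(3)])
    show "(\<lambda>x. of_real (q x) * y' x - of_real (r x) * h' x) \<in> borel_measurable N"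
      using q_measurable r_measurable hm by measurable
    show "AE x in N. of_real (q x) * y' x - of_real (r x) * h' x = of_real (q x) * y x - of_real (r x) * h x"
      using AE_in h by eventually_elim (use assms(2) in auto)
  qed
  ultimately show ?thesis by (simp add: sys_def)
qed

lemma sysD:
  assumes "sys h y u"
  shows "prim a b y (\<lambda>x. u x / of_real (p x))"
    "prim a b u (\<lambda>x. of_real (q x) * y x - of_real (r x) * h x)"
  using assms by (auto simp: sys_def)

lemma sys_add:
  assumes "sys h y u" "sys h' y' u'"
  shows "sys (\<lambda>x. h x + h' x) (\<lambda>x. y x + y' x) (\<lambda>x. u x + u' x)"
  unfolding sys_def
proof
  show "prim a b (\<lambda>x. y x + y' x) (\<lambda>x. (u x + u' x) / of_real (p x))"
    by (rule prim_eqI[OF prim_add[OF sysD(1)[OF assms(1)] sysD(1)[OF assms(2)]]]) (simp_all add: add_divide_distrib)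
  show "prim a b (\<lambda>x. u x + u' x) (\<lambda>x. of_real (q x) * (y x + y' x) - of_real (r x) * (h x + h' x))"
    by (rule prim_eqI[OF prim_add[OF sysD(2)[OF assms(1)] sysD(2)[OF assms(2)]]]) (simp_all add: algebra_simps)
qed

lemma sys_cmult:
  assumes "sys h y u"
  shows "sys (\<lambda>x. c * h x) (\<lambda>x. c * y x) (\<lambda>x. c * u x)"
  unfolding sys_def
proof
  show "prim a b (\<lambda>x. c * y x) (\<lambda>x. c * u x / of_real (p x))"
    by (rule prim_eqI[OF prim_cmult[OF sysD(1)[OF assms], of c]]) simp_all
  show "prim a b (\<lambda>x. c * u x) (\<lambda>x. of_real (q x) * (c * y x) - of_real (r x) * (c * h x))"
    by (rule prim_eqI[OF prim_cmult[OF sysD(2)[OF assms], of c]]) (simp_all add: algebra_simps)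
qed

lemma sys_cnj:
  assumes "sys h y u"
  shows "sys (\<lambda>x. cnj (h x)) (\<lambda>x. cnj (y x)) (\<lambda>x. cnj (u x))"
  unfolding sys_def
proof
  show "prim a b (\<lambda>x. cnj (y x)) (\<lambda>x. cnj (u x) / of_real (p x))"
    by (rule prim_eqI[OF prim_cnj[OF sysD(1)[OF assms]]]) simp_all
  show "prim a b (\<lambda>x. cnj (u x)) (\<lambda>x. of_real (q x) * cnj (y x) - of_real (r x) * cnj (h x))"
    by (rule prim_eqI[OF prim_cnj[OF sysD(2)[OF assms]]]) simp_all
qed

lemma sys_continuous:
  assumes "sys h y u"
  shows "continuous_on {a..b} y" "continuous_on {a..b} u"
  using assms by (auto simp: sys_def intro: prim_continuous_on)

end

section \<open>Solutions of the system: existence and uniqueness\<close>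

lemma suminf_shift:
  fixes f :: "nat \<Rightarrow> 'a::real_normed_vector"
  assumes "summable f"
  shows "summable (\<lambda>k. case k of 0 \<Rightarrow> 0 | Suc j \<Rightarrow> f j)" "(\<Sum>k. case k of 0 \<Rightarrow> 0 | Suc j \<Rightarrow> f j) = suminf f"
proof -
  have "(\<lambda>k. case Suc k of 0 \<Rightarrow> 0 | Suc j \<Rightarrow> f j) sums suminf f" using summable_sums[OF assms] by simp
  then have "(\<lambda>k. case k of 0 \<Rightarrow> 0 | Suc j \<Rightarrow> f j) sums suminf f" by (subst (asm) sums_Suc_iff) simp
  then show "summable (\<lambda>k. case k of 0 \<Rightarrow> 0 | Suc j \<Rightarrow> f j)" "(\<Sum>k. case k of 0 \<Rightarrow> 0 | Suc j \<Rightarrow> f j) = suminf f"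
    by (auto simp: sums_iff)
qed

lemma norm_set_integral_le:
  fixes F :: "real \<Rightarrow> complex" and G :: "real \<Rightarrow> real"
  assumes F: "integrable (lebesgue_on {a<..<b}) F" and G: "integrable (lebesgue_on {a<..<b}) G"
    and x: "x \<in> {a..b}" and le: "\<And>t. t \<in> {a<..<b} \<Longrightarrow> norm (F t) \<le> G t"
  shows "norm (LINT t:{a<..<x}|lebesgue. F t) \<le> (LINT t:{a<..<x}|lebesgue. G t)"
proof -
  have sub: "{a<..<x} \<subseteq> {a<..<b}" using x by auto
  note Fs = integrable_lebesgue_on_subset[OF F sub] and Gs = integrable_lebesgue_on_subset[OF G sub]
  have "norm (LINT t:{a<..<x}|lebesgue. F t) \<le> (LINT t:{a<..<x}|lebesgue. norm (F t))"
    by (rule set_integral_norm_bound[OF Fs])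
  also have "\<dots> \<le> (LINT t:{a<..<x}|lebesgue. G t)"
    by (rule set_integral_mono[OF set_integrable_norm[OF Fs] Gs]) (use le sub in auto)
  finally show ?thesis .
qed

lemma Volterra_uniform_bound:
  fixes \<kappa> :: "real \<Rightarrow> real" and v :: "nat \<Rightarrow> real \<Rightarrow> real"
  assumes \<kappa>: "integrable (lebesgue_on {a<..<b}) \<kappa>" and \<kappa>0: "\<And>x. \<kappa> x \<ge> 0"
    and v: "\<And>k. continuous_on {a..b} (v k)" and v0: "\<And>x. x \<in> {a..b} \<Longrightarrow> v 0 x \<le> C" and C: "C \<ge> 0"
    and vS: "\<And>k x. x \<in> {a..b} \<Longrightarrow> v (Suc k) x \<le> (LINT t:{a<..<x}|lebesgue. v k t * \<kappa> t)"
    and x: "x \<in> {a..b}"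
  shows "v k x \<le> C * (LINT t:{a<..<b}|lebesgue. \<kappa> t) ^ k / fact k"
proof -
  have s: "set_integrable lebesgue {a<..<x} \<kappa>" "set_integrable lebesgue {a<..<b} \<kappa>"
    using x by (auto intro!: integrable_lebesgue_on_subset[OF \<kappa>])
  have le: "(LINT t:{a<..<x}|lebesgue. \<kappa> t) \<le> (LINT t:{a<..<b}|lebesgue. \<kappa> t)"
    unfolding set_lebesgue_integral_def
    by (rule Bochner_Integration.integral_mono)
      (use s x \<kappa>0 in \<open>auto simp: set_integrable_def split: split_indicator\<close>)
  have "(LINT t:{a<..<x}|lebesgue. \<kappa> t) \<ge> 0"
    unfolding set_lebesgue_integral_def by (rule Bochner_Integration.integral_nonneg) (use \<kappa>0 in auto)
  then have "(LINT t:{a<..<x}|lebesgue. \<kappa> t) ^ k \<le> (LINT t:{a<..<b}|lebesgue. \<kappa> t) ^ k"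
    by (intro power_mono le)
  moreover have "v k x \<le> C * (LINT t:{a<..<x}|lebesgue. \<kappa> t) ^ k / fact k"
    by (rule Volterra_iteration_bound[OF \<kappa> _ v v0 vS x]) (use \<kappa>0 in auto)
  ultimately show ?thesis
    using mult_left_mono[OF _ C] by (smt (verit, best) divide_right_mono fact_ge_zero)
qed

context sturm_liouville begin

text \<open>\<open>V\<close>, \<open>Z\<close>, \<open>X\<close> are kept separate from
  \<open>U\<close>, \<open>Y\<close> so that one lemma serves two recursions: Picard iteration,
  where \<open>V\<close> and \<open>Z\<close> are index shifts of \<open>U\<close> and
  \<open>Y\<close>, and the expansion in \<open>z\<close>, where \<open>X\<close> is the shifted
  sequence.\<close>

lemma sys_suminf:
  assumes Y: "\<And>k. prim a b (Y k) (\<lambda>x. V k x / of_real (p x))"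
    and U: "\<And>k. prim a b (U k) (\<lambda>x. of_real (q x) * Z k x - of_real (r x) * X k x)"
    and B: "summable B" "\<And>k x. x \<in> {a..b} \<Longrightarrow> norm (Y k x) \<le> B k" "\<And>k x. x \<in> {a..b} \<Longrightarrow> norm (U k x) \<le> B k"
      "\<And>k x. x \<in> {a..b} \<Longrightarrow> norm (V k x) \<le> B k" "\<And>k x. x \<in> {a..b} \<Longrightarrow> norm (Z k x) \<le> B k"
      "\<And>k x. x \<in> {a..b} \<Longrightarrow> norm (X k x) \<le> B k"
    and VU: "\<And>x. x \<in> {a..b} \<Longrightarrow> (\<Sum>k. V k x) = (\<Sum>k. U k x)"
    and ZY: "\<And>x. x \<in> {a..b} \<Longrightarrow> (\<Sum>k. Z k x) = (\<Sum>k. Y k x)"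
    and Xm: "\<And>k. X k \<in> borel_measurable N"
  shows "sys (\<lambda>x. \<Sum>k. X k x) (\<lambda>x. \<Sum>k. Y k x) (\<lambda>x. \<Sum>k. U k x)"
proof -
  have B0: "B k \<ge> 0" for k using order_trans[OF norm_ge_zero B(2)[of a k]] ab by simp
  have sm: "summable (\<lambda>k. V k x)" "summable (\<lambda>k. Z k x)" "summable (\<lambda>k. X k x)" if "x \<in> {a..b}" for x
    by (rule summable_comparison_test'[OF B(1)], use B that in auto)+
  have "prim a b (\<lambda>x. \<Sum>k. Y k x) (\<lambda>x. \<Sum>k. V k x / of_real (p x))"
  proof (rule prim_suminf[OF Y B(2,1) _ B(1) B0])
    show "integrable N (\<lambda>x. norm (1 / complex_of_real (p x)))"
      by (intro integrable_norm inverse_p_integrable)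
    show "AE x in N. norm (V k x / of_real (p x)) \<le> B k * norm (1 / complex_of_real (p x))" for k
      using AE_in by eventually_elim (use B(4)[of _ k] in \<open>auto simp: norm_divide intro!: divide_right_mono\<close>)
  qed auto
  note 1 = this
  have [measurable]: "Y k \<in> borel_measurable N" "U k \<in> borel_measurable N" for k
    by (intro continuous_on_measurable_lebesgue_on prim_continuous_on[OF Y] prim_continuous_on[OF U])+
  have "prim a b (\<lambda>x. \<Sum>k. Y k x) (\<lambda>x. (\<Sum>k. U k x) / of_real (p x))"
  proof (rule prim_cong[OF 1])
    show "(\<lambda>x. (\<Sum>k. U k x) / complex_of_real (p x)) \<in> borel_measurable N"
      using p_measurable by measurable
    show "AE x in N. (\<Sum>k. U k x) / complex_of_real (p x) = (\<Sum>k. V k x / complex_of_real (p x))"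
      using AE_in by eventually_elim (use sm VU in \<open>simp add: suminf_divide\<close>)
  qed auto
  moreover
  have "prim a b (\<lambda>x. \<Sum>k. U k x) (\<lambda>x. \<Sum>k. of_real (q x) * Z k x - of_real (r x) * X k x)"
  proof (rule prim_suminf[OF U B(3,1) _ B(1) B0])
    show "integrable N (\<lambda>x. \<bar>q x\<bar> + \<bar>r x\<bar>)" using q_integrable r_integrable by auto
    show "AE x in N. norm (of_real (q x) * Z k x - of_real (r x) * X k x) \<le> B k * (\<bar>q x\<bar> + \<bar>r x\<bar>)" for k
      using AE_in
    proof eventually_elim
      case (elim x)
      have "norm (of_real (q x) * Z k x - of_real (r x) * X k x) \<le> \<bar>q x\<bar> * norm (Z k x) + \<bar>r x\<bar> * norm (X k x)"
        using norm_triangle_ineq4[of "of_real (q x) * Z k x" "of_real (r x) * X k x"] by (simp add: norm_mult)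
      also have "\<dots> \<le> \<bar>q x\<bar> * B k + \<bar>r x\<bar> * B k"
        using B(5,6)[of x k] elim by (intro add_mono mult_left_mono) auto
      finally show ?case by (simp add: algebra_simps)
    qed
  qed auto
  note 2 = this
  have "prim a b (\<lambda>x. \<Sum>k. U k x) (\<lambda>x. of_real (q x) * (\<Sum>k. Y k x) - of_real (r x) * (\<Sum>k. X k x))"
  proof (rule prim_cong[OF 2])
    show "(\<lambda>x. of_real (q x) * (\<Sum>k. Y k x) - of_real (r x) * (\<Sum>k. X k x)) \<in> borel_measurable N"
      using q_measurable r_measurable Xm by measurable
    show "AE x in N. of_real (q x) * (\<Sum>k. Y k x) - of_real (r x) * (\<Sum>k. X k x) = (\<Sum>k. of_real (q x) * Z k x - of_real (r x) * X k x)"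
      using AE_in
    proof eventually_elim
      case (elim x)
      then have x: "x \<in> {a..b}" by simp
      have "(\<Sum>k. of_real (q x) * Z k x - of_real (r x) * X k x) = (\<Sum>k. of_real (q x) * Z k x) - (\<Sum>k. of_real (r x) * X k x)"
        by (rule suminf_diff[symmetric]; intro summable_mult sm x)
      also have "\<dots> = of_real (q x) * (\<Sum>k. Z k x) - of_real (r x) * (\<Sum>k. X k x)"
        by (simp only: suminf_mult[OF sm(2)[OF x]] suminf_mult[OF sm(3)[OF x]])
      finally show ?case using ZY[OF x] by simp
    qed
  qed auto
  ultimately show ?thesis by (simp add: sys_def)
qed

text \<open>The terms of the Picard series at spectral parameter 0. Solutions for other parameters
  come from the power series in \<open>z\<close>, whose coefficients build on these.\<close>

primrec picard :: "complex \<Rightarrow> complex \<Rightarrow> nat \<Rightarrow> (real \<Rightarrow> complex) \<times> (real \<Rightarrow> complex)" where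
  "picard c d 0 = (\<lambda>_. c, \<lambda>_. d)"
| "picard c d (Suc k) = (\<lambda>x. LINT t:{a<..<x}|lebesgue. snd (picard c d k) t / of_real (p t),
      \<lambda>x. LINT t:{a<..<x}|lebesgue. of_real (q t) * fst (picard c d k) t)"

lemma picard_continuous:
  "continuous_on {a..b} (fst (picard c d k)) \<and> continuous_on {a..b} (snd (picard c d k))"
proof (induction k)
  case (Suc k)
  then show ?case
    using prim_continuous_on[OF prim_indefinite[OF div_p_integrable, of "snd (picard c d k)" 0]]
      prim_continuous_on[OF prim_indefinite[OF mult_q_integrable, of "fst (picard c d k)" 0]] by simp
qed auto

lemma homogeneous_exists: "\<exists>y u. sys (\<lambda>_. 0) y u \<and> y a = c \<and> u a = d"
proof -
  define Y where "Y = (\<lambda>k. fst (picard c d k))"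
  define U where "U = (\<lambda>k. snd (picard c d k))"
  have Yc: "continuous_on {a..b} (Y k)" and Uc: "continuous_on {a..b} (U k)" for k
    using picard_continuous by (auto simp: Y_def U_def)
  have Y0: "Y 0 = (\<lambda>_. c)" and U0: "U 0 = (\<lambda>_. d)" by (auto simp: Y_def U_def)
  have YS: "Y (Suc k) = (\<lambda>x. LINT t:{a<..<x}|lebesgue. U k t / of_real (p t))"
    and US: "U (Suc k) = (\<lambda>x. LINT t:{a<..<x}|lebesgue. of_real (q t) * Y k t)" for k by (auto simp: Y_def U_def)
  \<comment> \<open>Bounds the coefficient matrix of the first order system, so each iteration is
    one Volterra step for \<open>norm (Y k x) + norm (U k x)\<close>.\<close>
  define \<kappa> where "\<kappa> = (\<lambda>x. \<bar>1 / p x\<bar> + \<bar>q x\<bar>)"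
  have \<kappa>: "integrable N \<kappa>" unfolding \<kappa>_def using p_integrable q_integrable by (intro Bochner_Integration.integrable_add integrable_abs)
  define v where "v = (\<lambda>k x. norm (Y k x) + norm (U k x))"
  have vc: "continuous_on {a..b} (v k)" for k unfolding v_def by (intro continuous_intros Yc Uc)
  define C where "C = norm c + norm d"
  define B where "B = (\<lambda>k. C * (LINT t:{a<..<b}|lebesgue. \<kappa> t) ^ k / fact k)"
  have vB: "v k x \<le> B k" if x: "x \<in> {a..b}" for k x
    unfolding B_def
  proof (rule Volterra_uniform_bound[OF \<kappa>, where v=v and C=C])
    fix k x assume x: "x \<in> {a..b}"
    have i1: "integrable N (\<lambda>t. norm (U k t / of_real (p t)))" "integrable N (\<lambda>t. norm (of_real (q t) * Y k t))"
      by (intro integrable_norm div_p_integrable mult_q_integrable Yc Uc)+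
    have sub: "{a<..<x} \<subseteq> {a<..<b}" using x by auto
    have "v (Suc k) x \<le> (LINT t:{a<..<x}|lebesgue. norm (U k t / of_real (p t))) + (LINT t:{a<..<x}|lebesgue. norm (of_real (q t) * Y k t))"
      unfolding v_def YS US
      by (intro add_mono norm_set_integral_le[OF _ _ x] i1 div_p_integrable mult_q_integrable Yc Uc) auto
    also have "\<dots> = (LINT t:{a<..<x}|lebesgue. norm (U k t / of_real (p t)) + norm (of_real (q t) * Y k t))"
      by (rule set_integral_add(2)[symmetric]; rule integrable_lebesgue_on_subset[OF _ sub], rule i1)
    also have "\<dots> \<le> (LINT t:{a<..<x}|lebesgue. v k t * \<kappa> t)"
    proof (rule set_integral_mono)
      show "set_integrable lebesgue {a<..<x} (\<lambda>t. norm (U k t / of_real (p t)) + norm (of_real (q t) * Y k t))"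
        by (intro set_integral_add; rule integrable_lebesgue_on_subset[OF _ sub], rule i1)
      show "set_integrable lebesgue {a<..<x} (\<lambda>t. v k t * \<kappa> t)"
        by (rule integrable_lebesgue_on_subset[OF integrable_continuous_mult[OF \<kappa> vc] sub])
      fix t
      show "norm (U k t / of_real (p t)) + norm (of_real (q t) * Y k t) \<le> v k t * \<kappa> t"
        by (simp add: v_def \<kappa>_def norm_divide norm_mult distrib_left distrib_right mult.commute)
    qed
    finally show "v (Suc k) x \<le> (LINT t:{a<..<x}|lebesgue. v k t * \<kappa> t)" .
  qed (use x vc[unfolded v_def] in \<open>auto simp: C_def v_def \<kappa>_def Y0 U0\<close>)
  have sB: "summable B" unfolding B_def by (rule summable_exp_bound)
  have YB: "norm (Y k x) \<le> B k" and UB: "norm (U k x) \<le> B k" if "x \<in> {a..b}" for k x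
    using vB[OF that, of k] norm_ge_zero[of "Y k x"] norm_ge_zero[of "U k x"] unfolding v_def by linarith+
  have B0: "B k \<ge> 0" for k using order_trans[OF norm_ge_zero YB[of a k]] ab by simp
  have sY: "summable (\<lambda>k. Y k x)" and sU: "summable (\<lambda>k. U k x)" if "x \<in> {a..b}" for x
    by (rule summable_comparison_test'[OF sB], use YB UB that in auto)+
  \<comment> \<open>The density of \<open>Y (Suc k)\<close> involves \<open>U k\<close> and vice
    versa, hence the shift; the terms of index 0 are constant and have density 0.\<close>
  define V where "V = (\<lambda>k x. case k of 0 \<Rightarrow> 0 | Suc j \<Rightarrow> U j x)"
  define Z where "Z = (\<lambda>k x. case k of 0 \<Rightarrow> 0 | Suc j \<Rightarrow> Y j x)"
  define B' where "B' = (\<lambda>k. B k + (case k of 0 \<Rightarrow> 0 | Suc j \<Rightarrow> B j))"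
  have BB: "B k \<le> B' k" "0 \<le> B' k" for k using B0 by (auto simp: B'_def split: nat.split)
  have "sys (\<lambda>x. \<Sum>k. 0) (\<lambda>x. \<Sum>k. Y k x) (\<lambda>x. \<Sum>k. U k x)"
  proof (rule sys_suminf[where V=V and Z=Z and B=B'])
    show "prim a b (Y k) (\<lambda>x. V k x / of_real (p x))" for k
      using prim_indefinite[OF div_p_integrable[OF Uc], of 0] prim_const[of a b c]
      by (cases k) (simp_all add: V_def Y0 YS)
    show "prim a b (U k) (\<lambda>x. of_real (q x) * Z k x - of_real (r x) * 0)" for k
      using prim_indefinite[OF mult_q_integrable[OF Yc], of 0] prim_const[of a b d]
      by (cases k) (simp_all add: Z_def U0 US)
    show "summable B'" unfolding B'_def by (intro summable_add sB suminf_shift)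
    show "norm (V k x) \<le> B' k" "norm (Z k x) \<le> B' k" if "x \<in> {a..b}" for k x
      using UB[OF that] YB[OF that] B0 by (auto simp: V_def Z_def B'_def intro: add_increasing split: nat.split)
    show "(\<Sum>k. V k x) = (\<Sum>k. U k x)" if "x \<in> {a..b}" for x
      unfolding V_def by (rule suminf_shift[OF sU[OF that]])
    show "(\<Sum>k. Z k x) = (\<Sum>k. Y k x)" if "x \<in> {a..b}" for x
      unfolding Z_def by (rule suminf_shift[OF sY[OF that]])
  qed (use BB order_trans[OF YB BB(1)] order_trans[OF UB BB(1)] in auto)
  moreover have "(\<Sum>k. Y k a) = c" 
  proof -
    have "Y (Suc k) a = 0" for k by (simp add: YS set_lebesgue_integral_def)
    then show ?thesis using suminf_split_head[OF sY[of a]] ab Y0 by simp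
  qed
  moreover have "(\<Sum>k. U k a) = d" 
  proof -
    have "U (Suc k) a = 0" for k by (simp add: US set_lebesgue_integral_def)
    then show ?thesis using suminf_split_head[OF sU[of a]] ab U0 by simp
  qed
  ultimately show ?thesis by (auto simp: suminf_zero)
qed

text \<open>The constant sequence with value \<open>norm (y x) + norm (u x)\<close> satisfies the
  hypotheses of the Volterra estimate, so this sum lies below \<open>C * K ^ k / fact k\<close> for
  every \<open>k\<close>, where \<open>K\<close> is the integral of \<kappa>.\<close>

lemma homogeneous_unique:
  assumes s: "sys (\<lambda>x. z * y x) y u" and ya: "y a = 0" and ua: "u a = 0" and x: "x \<in> {a..b}"
  shows "y x = 0 \<and> u x = 0"
proof -
  note c = sys_continuous[OF s]
  define \<kappa> where "\<kappa> = (\<lambda>x. \<bar>1 / p x\<bar> + (\<bar>q x\<bar> + norm z * \<bar>r x\<bar>))"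
  have \<kappa>: "integrable N \<kappa>" unfolding \<kappa>_def using p_integrable q_integrable r_integrable
    by (intro Bochner_Integration.integrable_add integrable_abs integrable_mult_right)
  define v where "v = (\<lambda>x. norm (y x) + norm (u x))"
  have vc: "continuous_on {a..b} v" unfolding v_def by (intro continuous_intros c)
  obtain C where C: "C > 0" "\<And>x. x \<in> {a..b} \<Longrightarrow> norm (v x) \<le> C" using continuous_on_Icc_bounded[OF vc] by blast
  have "v x \<le> C * (LINT t:{a<..<b}|lebesgue. \<kappa> t) ^ k / fact k" for k
  proof (rule Volterra_uniform_bound[OF \<kappa>, where v="\<lambda>_. v" and C=C])
    fix x assume x: "x \<in> {a..b}"
    have i1: "integrable N (\<lambda>t. norm (u t / of_real (p t)))" "integrable N (\<lambda>t. norm (of_real (q t) * y t - of_real (r t) * (z * y t)))"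
      using primD(1)[OF sysD(1)[OF s]] primD(1)[OF sysD(2)[OF s]] by auto
    have sub: "{a<..<x} \<subseteq> {a<..<b}" using x by auto
    have eq: "y x = (LINT t:{a<..<x}|lebesgue. u t / of_real (p t))" "u x = (LINT t:{a<..<x}|lebesgue. of_real (q t) * y t - of_real (r t) * (z * y t))"
      using prim_eq[OF sysD(1)[OF s] x] prim_eq[OF sysD(2)[OF s] x] ya ua by auto
    have "v x \<le> (LINT t:{a<..<x}|lebesgue. norm (u t / of_real (p t))) + (LINT t:{a<..<x}|lebesgue. norm (of_real (q t) * y t - of_real (r t) * (z * y t)))"
      unfolding v_def by (subst (1) eq(1), subst (1) eq(2))
        (intro add_mono norm_set_integral_le[OF _ _ x] i1 primD(1)[OF sysD(1)[OF s]] primD(1)[OF sysD(2)[OF s]] order_refl)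
    also have "\<dots> = (LINT t:{a<..<x}|lebesgue. norm (u t / of_real (p t)) + norm (of_real (q t) * y t - of_real (r t) * (z * y t)))"
      by (rule set_integral_add(2)[symmetric]; rule integrable_lebesgue_on_subset[OF _ sub], rule i1)
    also have "\<dots> \<le> (LINT t:{a<..<x}|lebesgue. v t * \<kappa> t)"
    proof (rule set_integral_mono)
      show "set_integrable lebesgue {a<..<x} (\<lambda>t. norm (u t / of_real (p t)) + norm (of_real (q t) * y t - of_real (r t) * (z * y t)))"
        by (intro set_integral_add; rule integrable_lebesgue_on_subset[OF _ sub], rule i1)
      show "set_integrable lebesgue {a<..<x} (\<lambda>t. v t * \<kappa> t)"
        by (rule integrable_lebesgue_on_subset[OF integrable_continuous_mult[OF \<kappa> vc] sub])
      fix t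
      have "norm (of_real (q t) * y t - of_real (r t) * (z * y t)) \<le> \<bar>q t\<bar> * norm (y t) + \<bar>r t\<bar> * (norm z * norm (y t))"
        using norm_triangle_ineq4[of "of_real (q t) * y t" "of_real (r t) * (z * y t)"] by (simp add: norm_mult)
      also have "\<dots> = norm (y t) * (\<bar>q t\<bar> + norm z * \<bar>r t\<bar>)" by (simp add: algebra_simps)
      also have "\<dots> \<le> v t * (\<bar>q t\<bar> + norm z * \<bar>r t\<bar>)" by (intro mult_right_mono) (auto simp: v_def)
      moreover have "norm (u t / of_real (p t)) \<le> v t * \<bar>1 / p t\<bar>"
        by (auto simp: v_def norm_divide intro!: divide_right_mono)
      ultimately show "norm (u t / of_real (p t)) + norm (of_real (q t) * y t - of_real (r t) * (z * y t)) \<le> v t * \<kappa> t"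
        unfolding \<kappa>_def distrib_left[of "v t" "\<bar>1 / p t\<bar>"] by linarith
    qed
    finally show "v x \<le> (LINT t:{a<..<x}|lebesgue. v t * \<kappa> t)" .
  qed (use x C vc in \<open>auto simp: \<kappa>_def v_def\<close>)
  moreover have "(\<lambda>k. C * (LINT t:{a<..<b}|lebesgue. \<kappa> t) ^ k / fact k) \<longlonglongrightarrow> 0"
    by (rule summable_LIMSEQ_zero[OF summable_exp_bound])
  ultimately have "v x \<le> 0" by (intro tendsto_lowerbound[of _ 0 sequentially]) auto
  then show ?thesis unfolding v_def by (smt (verit) norm_ge_zero norm_le_zero_iff)
qed

lemma sl_solution_iff:
  "sl_solution a b p q r z y \<longleftrightarrow> supp y \<and> supp (quasi_deriv a b p y) \<and> sys (\<lambda>x. z * y x) y (quasi_deriv a b p y)"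
proof
  assume s: "sl_solution a b p q r z y"
  then have y: "y \<in> sl_regular a b p" and t: "AE x in N. sl_tau a b p q r y x = z * y x"
    by (auto simp: sl_solution_def)
  have yc: "continuous_on {a..b} y" using sl_regularD(2)[OF y] by (intro AC_on_continuous_on) (simp add: AC_fun_iff)
  have "integrable N (\<lambda>x. of_real (r x) * (z * y x))"
    by (intro mult_r_integrable continuous_intros yc)
  from regular_imp_sys[OF y t this]
  show "supp y \<and> supp (quasi_deriv a b p y) \<and> sys (\<lambda>x. z * y x) y (quasi_deriv a b p y)" by blast
next
  assume *: "supp y \<and> supp (quasi_deriv a b p y) \<and> sys (\<lambda>x. z * y x) y (quasi_deriv a b p y)"
  with sys_imp_regular[of "\<lambda>x. z * y x" y "quasi_deriv a b p y"] show "sl_solution a b p q r z y"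
    by (auto simp: sl_solution_def)
qed

lemma sys_trunc:
  assumes "sys (\<lambda>x. z * y x) y u"
  shows "sys (\<lambda>x. z * trunc y x) (trunc y) (trunc u)"
proof (rule sys_cong[OF assms])
  have "continuous_on {a..b} (trunc y)"
    using sys_continuous(1)[OF assms] by (subst continuous_on_cong[OF refl trunc_in]) auto
  then have [measurable]: "trunc y \<in> borel_measurable N" by (rule continuous_on_measurable_lebesgue_on)
  show "(\<lambda>x. z * trunc y x) \<in> borel_measurable N" by measurable
  show "AE x in N. z * trunc y x = z * y x" using AE_in by eventually_elim simp
qed auto

lemma sys_diff_zero:
  assumes "sys (\<lambda>x. z * y x) y u" "sys (\<lambda>x. z * y' x) y' u'" "y a = y' a" "u a = u' a" "x \<in> {a..b}"
  shows "y x = y' x \<and> u x = u' x"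
  using homogeneous_unique[of z "\<lambda>x. y x + (-1) * y' x" "\<lambda>x. u x + (-1) * u' x" x]
    sys_add[OF assms(1) sys_cmult[OF assms(2), of "-1"]] assms(3-5)
  by (simp add: algebra_simps)

lemma sl_ivp_eq:
  assumes s: "sys (\<lambda>x. z * y x) y u" and c: "y a = c" "u a = d"
  shows "sl_ivp a b p q r c d z = trunc y" "quasi_deriv a b p (sl_ivp a b p q r c d z) = trunc u"
proof -
  have aa: "a \<in> {a..b}" using ab by simp
  note t = sys_trunc[OF s]
  note R = sys_imp_regular[OF t supp_trunc supp_trunc]
  show 1: "sl_ivp a b p q r c d z = trunc y"
    unfolding sl_ivp_def
  proof (rule the_equality)
    show "sl_solution a b p q r z (trunc y) \<and> trunc y a = c \<and> quasi_deriv a b p (trunc y) a = d"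
      using t c aa by (simp add: sl_solution_iff R(2))
    fix y' assume y': "sl_solution a b p q r z y' \<and> y' a = c \<and> quasi_deriv a b p y' a = d"
    then have "sys (\<lambda>x. z * y' x) y' (quasi_deriv a b p y')" "supp y'" by (auto simp: sl_solution_iff)
    then show "y' = trunc y"
      using sys_diff_zero[OF _ t] y' c aa by (intro supp_ext) auto
  qed
  show "quasi_deriv a b p (sl_ivp a b p q r c d z) = trunc u" unfolding 1 by (rule R(2))
qed

lemma ivp_eq:
  assumes s: "sys (\<lambda>x. z * y x) y u" and c: "y a = c" "u a = d" and x: "x \<in> {a..b}"
  shows "sl_ivp a b p q r c d z x = y x" "quasi_deriv a b p (sl_ivp a b p q r c d z) x = u x"
  using sl_ivp_eq[OF s c] x by simp_all

lemma ivp0: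
  fixes c d :: complex
  defines "y \<equiv> sl_ivp a b p q r c d 0"
  shows "sys (\<lambda>_. 0) y (quasi_deriv a b p y)" "y a = c" "quasi_deriv a b p y a = d"
proof -
  obtain y' u' where s: "sys (\<lambda>_. 0) y' u'" "y' a = c" "u' a = d" using homogeneous_exists by blast
  then have s': "sys (\<lambda>x. 0 * y' x) y' u'" by simp
  have aa: "a \<in> {a..b}" using ab by simp
  show "sys (\<lambda>_. 0) y (quasi_deriv a b p y)" unfolding y_def sl_ivp_eq(2)[OF s' s(2,3)] unfolding sl_ivp_eq(1)[OF s' s(2,3)]
    using sys_trunc[OF s'] by simp
  show "y a = c" "quasi_deriv a b p y a = d" unfolding y_def using ivp_eq[OF s' s(2,3) aa] s by auto
qed

section \<open>Fundamental system at spectral parameter 0 and expansion in \<open>z\<close>\<close>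

abbreviation "\<theta> \<equiv> sl_theta a b p q r 0"
abbreviation "\<theta>' \<equiv> sl_theta1 a b p q r 0"
abbreviation "\<phi> \<equiv> sl_phi a b p q r 0"
abbreviation "\<phi>' \<equiv> sl_phi1 a b p q r 0"

lemma theta_sys: "sys (\<lambda>_. 0) \<theta> \<theta>'" "\<theta> a = 1" "\<theta>' a = 0"
  unfolding sl_theta_def sl_theta1_def by (rule ivp0)+

lemma phi_sys: "sys (\<lambda>_. 0) \<phi> \<phi>'" "\<phi> a = 0" "\<phi>' a = 1"
  unfolding sl_phi_def sl_phi1_def by (rule ivp0)+

lemmas theta_cont = sys_continuous[OF theta_sys(1)]
lemmas phi_cont = sys_continuous[OF phi_sys(1)]

lemma wronskian:
  assumes "x \<in> {a..b}"
  shows "\<theta> x * \<phi>' x - \<theta>' x * \<phi> x = 1"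
proof -
  have "prim a b (\<lambda>x. \<theta> x * \<phi>' x - \<theta>' x * \<phi> x) (\<lambda>x. 0)"
    by (rule prim_eqI[OF prim_minus[OF prim_mult[OF sysD(1)[OF theta_sys(1)] sysD(2)[OF phi_sys(1)]]
       prim_mult[OF sysD(2)[OF theta_sys(1)] sysD(1)[OF phi_sys(1)]]]]) (simp_all add: algebra_simps)
  from prim_eq[OF this assms] show ?thesis using theta_sys phi_sys by (simp add: set_lebesgue_integral_def)
qed

text \<open>Since \<open>green0\<close> splits into products, the integrals are
  \<open>\<theta> I1 - \<phi> I2\<close> and \<open>\<theta>' I1 - \<phi>' I2\<close>. On
  differentiation the terms with the derivatives of \<open>I1\<close> and \<open>I2\<close> cancel
  in the first and combine to \<open>- r h\<close> times the Wronskian in the second.\<close>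

lemma variation_of_parameters:
  assumes h: "integrable N (\<lambda>x. of_real (r x) * h x)"
  shows "sys h (\<lambda>x. LINT t:{a<..<x}|lebesgue. of_real (r t) * green0 a b p q r x t * h t)
    (\<lambda>x. LINT t:{a<..<x}|lebesgue. of_real (r t) * green0_1 a b p q r x t * h t)" (is "sys h ?y ?u")
proof -
  define I1 where "I1 = (\<lambda>x. LINT t:{a<..<x}|lebesgue. \<phi> t * (of_real (r t) * h t))"
  define I2 where "I2 = (\<lambda>x. LINT t:{a<..<x}|lebesgue. \<theta> t * (of_real (r t) * h t))"
  have i: "integrable N (\<lambda>t. \<phi> t * (of_real (r t) * h t))" "integrable N (\<lambda>t. \<theta> t * (of_real (r t) * h t))"
    by (intro integrable_continuous_mult h phi_cont theta_cont)+
  have P: "prim a b I1 (\<lambda>t. \<phi> t * (of_real (r t) * h t))" "prim a b I2 (\<lambda>t. \<theta> t * (of_real (r t) * h t))"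
    using prim_indefinite[OF i(1), of 0] prim_indefinite[OF i(2), of 0] by (simp_all add: I1_def I2_def)
  have eq: "?y x = \<theta> x * I1 x - \<phi> x * I2 x" "?u x = \<theta>' x * I1 x - \<phi>' x * I2 x" if x: "x \<in> {a..b}" for x
  proof -
    have sub: "{a<..<x} \<subseteq> {a<..<b}" using x by auto
    note si = integrable_lebesgue_on_subset[OF i(1) sub] integrable_lebesgue_on_subset[OF i(2) sub]
    have *: "(LINT t:{a<..<x}|lebesgue. A * (\<phi> t * (of_real (r t) * h t)) - B * (\<theta> t * (of_real (r t) * h t))) = A * I1 x - B * I2 x" for A B
      unfolding I1_def I2_def by (subst set_integral_diff) (use si in auto)
    show "?y x = \<theta> x * I1 x - \<phi> x * I2 x" unfolding *[symmetric] by (simp add: green0_def algebra_simps)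
    show "?u x = \<theta>' x * I1 x - \<phi>' x * I2 x" unfolding *[symmetric] by (simp add: green0_1_def algebra_simps)
  qed
  have yp: "prim a b (\<lambda>x. \<theta> x * I1 x - \<phi> x * I2 x) (\<lambda>x. (\<theta>' x * I1 x - \<phi>' x * I2 x) / of_real (p x))"
    by (rule prim_eqI[OF prim_minus[OF prim_mult[OF sysD(1)[OF theta_sys(1)] P(1)] prim_mult[OF sysD(1)[OF phi_sys(1)] P(2)]]])
      (simp_all add: algebra_simps diff_divide_distrib)
  have up0: "prim a b (\<lambda>x. \<theta>' x * I1 x - \<phi>' x * I2 x)
      (\<lambda>x. of_real (q x) * (\<theta> x * I1 x - \<phi> x * I2 x) - of_real (r x) * h x * (\<theta> x * \<phi>' x - \<theta>' x * \<phi> x))"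
    by (rule prim_eqI[OF prim_minus[OF prim_mult[OF sysD(2)[OF theta_sys(1)] P(1)] prim_mult[OF sysD(2)[OF phi_sys(1)] P(2)]]])
      (simp_all add: algebra_simps)
  have qi: "integrable N (\<lambda>x. of_real (q x) * (\<theta> x * I1 x - \<phi> x * I2 x) - of_real (r x) * h x)"
    by (intro Bochner_Integration.integrable_diff mult_q_integrable h prim_continuous_on[OF yp])
  have up: "prim a b (\<lambda>x. \<theta>' x * I1 x - \<phi>' x * I2 x)
      (\<lambda>x. of_real (q x) * (\<theta> x * I1 x - \<phi> x * I2 x) - of_real (r x) * h x)"
    by (rule prim_cong[OF up0 refl borel_measurable_integrable[OF qi]])
      (use AE_in in \<open>eventually_elim\<close>, use wronskian in simp)
  have "sys h (\<lambda>x. \<theta> x * I1 x - \<phi> x * I2 x) (\<lambda>x. \<theta>' x * I1 x - \<phi>' x * I2 x)"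
    using yp up by (simp add: sys_def)
  note s = this
  have yc: "continuous_on {a..b} ?y" "continuous_on {a..b} ?u"
    using sys_continuous[OF s] by (subst continuous_on_cong[OF refl eq(1)] continuous_on_cong[OF refl eq(2)]; simp)+
  have "integrable N (\<lambda>x. of_real (q x) * ?y x - of_real (r x) * h x)"
    by (intro Bochner_Integration.integrable_diff mult_q_integrable h yc)
  note m2 = borel_measurable_integrable[OF this]
  note m1 = borel_measurable_integrable[OF div_p_integrable[OF yc(2)]]
  show ?thesis unfolding sys_def
  proof
    show "prim a b ?y (\<lambda>x. ?u x / of_real (p x))"
      by (rule prim_cong[OF yp eq(1) m1]) (assumption, use AE_in in \<open>eventually_elim\<close>, use eq(2) in simp)
    show "prim a b ?u (\<lambda>x. of_real (q x) * ?y x - of_real (r x) * h x)"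
      by (rule prim_cong[OF up eq(2) m2]) (assumption, use AE_in in \<open>eventually_elim\<close>, use eq(1) in simp)
  qed
qed

context fixes c d :: complex begin

abbreviation "Yk \<equiv> iter_coeff a b p q r (sl_ivp a b p q r c d 0)"
abbreviation "Uk \<equiv> iter_coeff1 a b p q r (sl_ivp a b p q r c d 0)"

text \<open>Comparison of powers in \<open>\<tau> y = z y\<close>: the zeroth coefficient solves the
  homogeneous equation, and every other one has its predecessor as right hand side.\<close>

lemma iter_sys: "sys (case k of 0 \<Rightarrow> \<lambda>_. 0 | Suc j \<Rightarrow> Yk j) (Yk k) (Uk k)"
proof (induction k)
  case 0 show ?case using ivp0(1) by simp
next
  case (Suc k)
  show ?case using variation_of_parameters[OF mult_r_integrable[OF sys_continuous(1)[OF Suc]]] by simp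
qed

lemma iter_at_a: "Yk k a = (if k = 0 then c else 0)" "Uk k a = (if k = 0 then d else 0)"
  using ivp0(2,3) by (cases k; simp add: set_lebesgue_integral_def)+

lemma iter_bound: "\<exists>C K. \<forall>x\<in>{a..b}. \<forall>k. norm (Yk k x) \<le> C * K ^ k / fact k \<and> norm (Uk k x) \<le> C * K ^ k / fact k"
proof -
  obtain C1 where C1: "C1 > 0" "\<And>x. x \<in> {a..b} \<Longrightarrow> norm (\<theta> x) \<le> C1" using continuous_on_Icc_bounded[OF theta_cont(1)] by blast
  obtain C2 where C2: "C2 > 0" "\<And>x. x \<in> {a..b} \<Longrightarrow> norm (\<theta>' x) \<le> C2" using continuous_on_Icc_bounded[OF theta_cont(2)] by blast
  obtain C3 where C3: "C3 > 0" "\<And>x. x \<in> {a..b} \<Longrightarrow> norm (\<phi> x) \<le> C3" using continuous_on_Icc_bounded[OF phi_cont(1)] by blast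
  obtain C4 where C4: "C4 > 0" "\<And>x. x \<in> {a..b} \<Longrightarrow> norm (\<phi>' x) \<le> C4" using continuous_on_Icc_bounded[OF phi_cont(2)] by blast
  define G where "G = (C1 + C2) * C3 + C1 * (C3 + C4)"
  have G0: "G \<ge> 0" using C1 C2 C3 C4 by (simp add: G_def)
  have GG: "C1 * C3 + C1 * C3 + (C2 * C3 + C1 * C4) = G" by (simp add: G_def algebra_simps)
  have g: "norm (green0 a b p q r x t) \<le> G" "norm (green0_1 a b p q r x t) \<le> G" if "x \<in> {a..b}" "t \<in> {a..b}" for x t
  proof -
    have p: "C1 * C3 \<ge> 0" "C2 * C3 \<ge> 0" "C1 * C4 \<ge> 0" using C1 C2 C3 C4 by auto
    have "norm (green0 a b p q r x t) \<le> norm (\<theta> x) * norm (\<phi> t) + norm (\<theta> t) * norm (\<phi> x)"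
      unfolding green0_def by (metis norm_mult norm_triangle_ineq4)
    also have "\<dots> \<le> C1 * C3 + C1 * C3" using C1 C3 that by (intro add_mono mult_mono) auto
    finally show "norm (green0 a b p q r x t) \<le> G" using p GG by linarith
    have "norm (green0_1 a b p q r x t) \<le> norm (\<theta>' x) * norm (\<phi> t) + norm (\<theta> t) * norm (\<phi>' x)"
      unfolding green0_1_def by (metis norm_mult norm_triangle_ineq4)
    also have "\<dots> \<le> C2 * C3 + C1 * C4" using C1 C2 C3 C4 that by (intro add_mono mult_mono) auto
    finally show "norm (green0_1 a b p q r x t) \<le> G" using p GG by linarith
  qed
  \<comment> \<open>Both components are bounded by the integral of
    \<open>G * \<bar>r t\<bar> * norm (Yk k t)\<close>, which gives the factor 2.\<close>
  define \<kappa> where "\<kappa> = (\<lambda>x. 2 * G * \<bar>r x\<bar>)"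
  have \<kappa>: "integrable N \<kappa>" unfolding \<kappa>_def using r_integrable by (intro integrable_mult_right integrable_abs)
  define v where "v = (\<lambda>k x. norm (Yk k x) + norm (Uk k x))"
  have vc: "continuous_on {a..b} (v k)" for k unfolding v_def by (intro continuous_intros sys_continuous[OF iter_sys])
  obtain C where C: "C > 0" "\<And>x. x \<in> {a..b} \<Longrightarrow> norm (v 0 x) \<le> C" using continuous_on_Icc_bounded[OF vc] by blast
  have Yc: "continuous_on {a..b} (Yk k)" for k by (rule sys_continuous[OF iter_sys])
  have tm: "\<theta> \<in> borel_measurable N" "\<phi> \<in> borel_measurable N"
    by (rule continuous_on_measurable_lebesgue_on theta_cont phi_cont)+
  have "v k x \<le> C * (LINT t:{a<..<b}|lebesgue. \<kappa> t) ^ k / fact k" if x: "x \<in> {a..b}" for k x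
  proof (rule Volterra_uniform_bound[OF \<kappa>, where v=v and C=C])
    fix k x assume x: "x \<in> {a..b}"
    have gm: "(\<lambda>t. green0 a b p q r x t) \<in> borel_measurable N" "(\<lambda>t. green0_1 a b p q r x t) \<in> borel_measurable N"
      unfolding green0_def green0_1_def using tm by measurable
    have i: "integrable N (\<lambda>t. of_real (r t) * green0 a b p q r x t * Yk k t)" "integrable N (\<lambda>t. of_real (r t) * green0_1 a b p q r x t * Yk k t)"
      using integrable_bounded_mult[OF mult_r_integrable[OF Yc] gm(1), of G k] integrable_bounded_mult[OF mult_r_integrable[OF Yc] gm(2), of G k]
        g x by (simp_all add: ac_simps)
    have iY: "integrable N (\<lambda>t. G * \<bar>r t\<bar> * norm (Yk k t))"
      using integrable_mult_right[OF integrable_norm[OF mult_r_integrable[OF Yc[of k]]], of G] by (simp add: norm_mult mult.assoc)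
    have b: "norm (of_real (r t) * g * Yk k t) \<le> G * \<bar>r t\<bar> * norm (Yk k t)" if "norm g \<le> G" for g t
      using that by (auto simp: norm_mult mult.commute intro!: mult_right_mono)
    have sub: "{a<..<x} \<subseteq> {a<..<b}" using x by auto
    have "v (Suc k) x \<le> (LINT t:{a<..<x}|lebesgue. G * \<bar>r t\<bar> * norm (Yk k t)) + (LINT t:{a<..<x}|lebesgue. G * \<bar>r t\<bar> * norm (Yk k t))"
      unfolding v_def iter_coeff.simps iter_coeff1.simps
      by (intro add_mono norm_set_integral_le[OF _ _ x] i iY b g x) auto
    also have "\<dots> = (LINT t:{a<..<x}|lebesgue. \<kappa> t * norm (Yk k t))"
      by (simp add: \<kappa>_def mult.assoc)
    also have "\<dots> \<le> (LINT t:{a<..<x}|lebesgue. v k t * \<kappa> t)"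
    proof (rule set_integral_mono)
      show "set_integrable lebesgue {a<..<x} (\<lambda>t. \<kappa> t * norm (Yk k t))"
        using integrable_lebesgue_on_subset[OF iY sub] by (simp add: \<kappa>_def mult.assoc)
      show "set_integrable lebesgue {a<..<x} (\<lambda>t. v k t * \<kappa> t)"
        by (rule integrable_lebesgue_on_subset[OF integrable_continuous_mult[OF \<kappa> vc] sub])
      show "\<kappa> t * norm (Yk k t) \<le> v k t * \<kappa> t" for t
        using G0 by (subst mult.commute) (auto simp: \<kappa>_def v_def intro!: mult_right_mono)
    qed
    finally show "v (Suc k) x \<le> (LINT t:{a<..<x}|lebesgue. v k t * \<kappa> t)" .
    show "v 0 x \<le> C" using C(2)[OF x] by (simp add: v_def)
  qed (use x C vc G0 in \<open>auto simp: \<kappa>_def\<close>)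
  note vb = this
  have "norm (Yk k x) \<le> v k x" "norm (Uk k x) \<le> v k x" for k x by (auto simp: v_def)
  then show ?thesis using vb order_trans by meson
qed

text \<open>The series solves the equation termwise, and at \<open>a\<close> only its zeroth
  coefficient contributes, so it has the prescribed initial data. Existence for every
  \<open>z\<close> thus follows from existence at 0.\<close>

lemma ivp_expansion_aux:
  shows "\<exists>S U. sys (\<lambda>x. z * S x) S U \<and> S a = c \<and> U a = d \<and>
    (\<forall>x\<in>{a..b}. (\<lambda>k. z ^ k * Yk k x) sums S x \<and> (\<lambda>k. z ^ k * Uk k x) sums U x)"
proof -
  obtain C K where CK: "\<And>x k. x \<in> {a..b} \<Longrightarrow> norm (Yk k x) \<le> C * K ^ k / fact k" "\<And>x k. x \<in> {a..b} \<Longrightarrow> norm (Uk k x) \<le> C * K ^ k / fact k"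
    using iter_bound by blast
  define B where "B = (\<lambda>k. C * (norm z * K) ^ k / fact k)"
  have sB: "summable B" unfolding B_def by (rule summable_exp_bound)
  have YB: "norm (z ^ k * Yk k x) \<le> B k" and UB: "norm (z ^ k * Uk k x) \<le> B k" if "x \<in> {a..b}" for k x
    using mult_left_mono[OF CK(1)[OF that, of k], of "norm z ^ k"] mult_left_mono[OF CK(2)[OF that, of k], of "norm z ^ k"]
    by (simp_all add: B_def norm_mult norm_power power_mult_distrib ac_simps)
  have B0: "B k \<ge> 0" for k using order_trans[OF norm_ge_zero YB[of a k]] ab by simp
  have sY: "summable (\<lambda>k. z ^ k * Yk k x)" and sU: "summable (\<lambda>k. z ^ k * Uk k x)" if "x \<in> {a..b}" for x
    by (rule summable_comparison_test'[OF sB], use YB UB that in auto)+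
  define X where "X = (\<lambda>k x. case k of 0 \<Rightarrow> 0 | Suc j \<Rightarrow> z * (z ^ j * Yk j x))"
  define B' where "B' = (\<lambda>k. B k + (case k of 0 \<Rightarrow> 0 | Suc j \<Rightarrow> norm z * B j))"
  have BB: "B k \<le> B' k" for k using B0 by (auto simp: B'_def split: nat.split)
  have Yc: "continuous_on {a..b} (Yk k)" for k by (rule sys_continuous[OF iter_sys])
  have s: "sys (\<lambda>x. \<Sum>k. X k x) (\<lambda>x. \<Sum>k. z ^ k * Yk k x) (\<lambda>x. \<Sum>k. z ^ k * Uk k x)"
  proof (rule sys_suminf[where V="\<lambda>k x. z ^ k * Uk k x" and Z="\<lambda>k x. z ^ k * Yk k x" and B=B'])
    show "prim a b (\<lambda>x. z ^ k * Yk k x) (\<lambda>x. z ^ k * Uk k x / of_real (p x))" for k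
      by (rule sysD[OF sys_cmult[OF iter_sys]])
    show "prim a b (\<lambda>x. z ^ k * Uk k x) (\<lambda>x. of_real (q x) * (z ^ k * Yk k x) - of_real (r x) * X k x)" for k
      by (rule prim_eqI[OF sysD(2)[OF sys_cmult[OF iter_sys[of k], of "z ^ k"]]]) (auto simp: X_def split: nat.split)
    show "summable B'" unfolding B'_def by (intro summable_add sB suminf_shift summable_mult)
    show "norm (X k x) \<le> B' k" if "x \<in> {a..b}" for k x
      using YB[OF that] B0 by (auto simp: X_def B'_def norm_mult split: nat.split intro!: add_increasing mult_left_mono)
    show "X k \<in> borel_measurable N" for k
      using continuous_on_measurable_lebesgue_on[OF Yc] by (cases k) (auto simp: X_def)
  qed (use order_trans[OF YB BB] order_trans[OF UB BB] in auto)
  have sX: "(\<Sum>k. X k x) = z * (\<Sum>k. z ^ k * Yk k x)" if "x \<in> {a..b}" for x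
    unfolding X_def using suminf_shift(2)[OF summable_mult[OF sY[OF that], of z]] suminf_mult[OF sY[OF that], of z] by simp
  have "sys (\<lambda>x. z * (\<Sum>k. z ^ k * Yk k x)) (\<lambda>x. \<Sum>k. z ^ k * Yk k x) (\<lambda>x. \<Sum>k. z ^ k * Uk k x)"
  proof (rule sys_cong[OF s])
    show "AE x in N. z * (\<Sum>k. z ^ k * Yk k x) = (\<Sum>k. X k x)"
      using AE_in by eventually_elim (use sX in auto)
    show "(\<lambda>x. z * (\<Sum>k. z ^ k * Yk k x)) \<in> borel_measurable N"
      using continuous_on_measurable_lebesgue_on[OF Yc] by measurable
  qed auto
  moreover have "(\<Sum>k. z ^ k * Yk k a) = c" "(\<Sum>k. z ^ k * Uk k a) = d"
    using suminf_finite[of "{0}" "\<lambda>k. z ^ k * Yk k a"] suminf_finite[of "{0}" "\<lambda>k. z ^ k * Uk k a"] by (auto simp: iter_at_a ivp0)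
  moreover have "\<forall>x\<in>{a..b}. (\<lambda>k. z ^ k * Yk k x) sums (\<Sum>k. z ^ k * Yk k x) \<and> (\<lambda>k. z ^ k * Uk k x) sums (\<Sum>k. z ^ k * Uk k x)"
    using summable_sums[OF sY] summable_sums[OF sU] by blast
  ultimately show ?thesis
    by (intro exI[of _ "\<lambda>x. \<Sum>k. z ^ k * Yk k x"] exI[of _ "\<lambda>x. \<Sum>k. z ^ k * Uk k x"] conjI)
qed

lemma ivp_expansion:
  assumes "x \<in> {a..b}"
  shows "(\<lambda>k. z ^ k * Yk k x) sums sl_ivp a b p q r c d z x"
    "(\<lambda>k. z ^ k * Uk k x) sums quasi_deriv a b p (sl_ivp a b p q r c d z) x"
proof -
  obtain S U where S: "sys (\<lambda>x. z * S x) S U" "S a = c" "U a = d"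
    "\<forall>x\<in>{a..b}. (\<lambda>k. z ^ k * Yk k x) sums S x \<and> (\<lambda>k. z ^ k * Uk k x) sums U x"
    using ivp_expansion_aux by blast
  then show "(\<lambda>k. z ^ k * Yk k x) sums sl_ivp a b p q r c d z x"
    "(\<lambda>k. z ^ k * Uk k x) sums quasi_deriv a b p (sl_ivp a b p q r c d z) x"
    using ivp_eq[OF S(1-3) assms] assms by auto
qed

lemma ivp_sys:
  fixes z :: complex
  defines "y \<equiv> sl_ivp a b p q r c d z"
  shows "sys (\<lambda>x. z * y x) y (quasi_deriv a b p y)" "y a = c" "quasi_deriv a b p y a = d" "supp y" "supp (quasi_deriv a b p y)"
proof -
  obtain S U where S: "sys (\<lambda>x. z * S x) S U" "S a = c" "U a = d"
    using ivp_expansion_aux by blast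
  have aa: "a \<in> {a..b}" using ab by simp
  show "sys (\<lambda>x. z * y x) y (quasi_deriv a b p y)" "y a = c" "quasi_deriv a b p y a = d" "supp y" "supp (quasi_deriv a b p y)"
    unfolding y_def sl_ivp_eq(2)[OF S] unfolding sl_ivp_eq(1)[OF S] using sys_trunc[OF S(1)] S(2,3) aa by auto
qed

end

lemma char_fun_sums:
  "(\<lambda>k. z ^ k * (bc_coeff a b p q r \<phi>0 R k + (if k = 0 then cis (2 * \<phi>0) + 1 else 0))) sums char_fun a b p q r \<phi>0 R z"
proof -
  have bb: "b \<in> {a..b}" using ab by simp
  have "(\<lambda>k. z ^ k * bc_coeff a b p q r \<phi>0 R k) sums
     bc_form \<phi>0 R (sl_theta1 a b p q r z b) (sl_theta a b p q r z b) (sl_phi a b p q r z b) (sl_phi1 a b p q r z b)"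
  proof -
    have "(\<lambda>k. cis \<phi>0 * (of_real (R$1$2) * (z ^ k * theta1_k a b p q r k b) - of_real (R$2$2) * (z ^ k * theta_k a b p q r k b)
              + of_real (R$2$1) * (z ^ k * phi_k a b p q r k b) - of_real (R$1$1) * (z ^ k * phi1_k a b p q r k b))) sums
     bc_form \<phi>0 R (sl_theta1 a b p q r z b) (sl_theta a b p q r z b) (sl_phi a b p q r z b) (sl_phi1 a b p q r z b)"
      unfolding bc_form_def theta_k_def theta1_k_def phi_k_def phi1_k_def sl_theta_def sl_theta1_def sl_phi_def sl_phi1_def
      by (intro sums_mult sums_add sums_diff ivp_expansion bb)
    then show ?thesis by (simp add: bc_coeff_def bc_form_def algebra_simps)
  qed
  moreover have "(\<lambda>k. if k = 0 then cis (2 * \<phi>0) + 1 else 0) sums (cis (2 * \<phi>0) + 1)"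
    using sums_single[of 0 "\<lambda>_. cis (2 * \<phi>0) + 1"] by simp
  ultimately have "(\<lambda>k. z ^ k * bc_coeff a b p q r \<phi>0 R k + (if k = 0 then cis (2 * \<phi>0) + 1 else 0)) sums char_fun a b p q r \<phi>0 R z"
    unfolding char_fun_def add.assoc by (rule sums_add)
  then show ?thesis by (rule back_subst[where P="\<lambda>f. f sums _"]) (auto simp: fun_eq_iff algebra_simps)
qed

end

section \<open>Orthonormal bases of the Hilbert space\<close>

definition nsq :: "real measure \<Rightarrow> (real \<Rightarrow> complex) \<Rightarrow> real" where
  "nsq M f = (\<integral>x. (norm (f x))\<^sup>2 \<partial>M)"

lemma borel_measurable_cnj_fun [measurable]:
  "f \<in> borel_measurable M \<Longrightarrow> (\<lambda>x. cnj (f x)) \<in> borel_measurable M"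
  by (rule borel_measurable_continuous_on[of cnj]) (auto intro: continuous_intros)

lemma nsq_nonneg: "nsq M f \<ge> 0" by (simp add: nsq_def)

lemma l2_norm_eq: "l2_norm M f = sqrt (nsq M f)" by (simp add: l2_norm_def nsq_def)

lemma L2D: "f \<in> L2 M \<Longrightarrow> f \<in> borel_measurable M" "f \<in> L2 M \<Longrightarrow> integrable M (\<lambda>x. (norm (f x))\<^sup>2)"
  by (auto simp: L2_def)

lemma L2_zero [simp]: "(\<lambda>x. 0) \<in> L2 M" by (simp add: L2_def)

lemma L2_scale: "f \<in> L2 M \<Longrightarrow> (\<lambda>x. c * f x) \<in> L2 M"
  by (auto simp: L2_def norm_mult power_mult_distrib)

lemma L2_add:
  assumes "f \<in> L2 M" "g \<in> L2 M"
  shows "(\<lambda>x. f x + g x) \<in> L2 M"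
proof -
  note m = L2D(1)[OF assms(1)] L2D(1)[OF assms(2)]
  have "integrable M (\<lambda>x. (norm (f x + g x))\<^sup>2)"
  proof (rule Bochner_Integration.integrable_bound)
    show "integrable M (\<lambda>x. 2 * (norm (f x))\<^sup>2 + 2 * (norm (g x))\<^sup>2)"
      using L2D(2)[OF assms(1)] L2D(2)[OF assms(2)] by auto
    show "AE x in M. norm ((norm (f x + g x))\<^sup>2) \<le> norm (2 * (norm (f x))\<^sup>2 + 2 * (norm (g x))\<^sup>2)"
    proof (rule AE_I2)
      fix x
      have "(norm (f x + g x))\<^sup>2 \<le> (norm (f x) + norm (g x))\<^sup>2" by (intro power_mono norm_triangle_ineq norm_ge_zero)
      also have "\<dots> \<le> 2 * (norm (f x))\<^sup>2 + 2 * (norm (g x))\<^sup>2"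
        using sum_squares_bound[of "norm (f x)" "norm (g x)"] by (simp add: power2_sum)
      finally show "norm ((norm (f x + g x))\<^sup>2) \<le> norm (2 * (norm (f x))\<^sup>2 + 2 * (norm (g x))\<^sup>2)" by simp
    qed
  qed (use m in measurable)
  then show ?thesis using m by (simp add: L2_def)
qed

lemma L2_diff: "f \<in> L2 M \<Longrightarrow> g \<in> L2 M \<Longrightarrow> (\<lambda>x. f x - g x) \<in> L2 M"
  using L2_add[OF _ L2_scale[of g M "-1"], of f] by simp

lemma L2_sum: "(\<And>i. i \<in> I \<Longrightarrow> f i \<in> L2 M) \<Longrightarrow> (\<lambda>x. \<Sum>i\<in>I. f i x) \<in> L2 M"
  by (induction I rule: infinite_finite_induct) (auto intro: L2_add)

lemma L2_cong_AE:
  assumes "f \<in> L2 M" "g \<in> borel_measurable M" "AE x in M. g x = f x"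
  shows "g \<in> L2 M"
proof -
  have "integrable M (\<lambda>x. (norm (g x))\<^sup>2)"
  proof (rule integrable_cong_AE_imp[OF L2D(2)[OF assms(1)]])
    show "AE x in M. (norm (f x))\<^sup>2 = (norm (g x))\<^sup>2" using assms(3) by eventually_elim simp
  qed (use assms(2) in measurable)
  then show ?thesis using assms by (simp add: L2_def)
qed

lemma L2_integrable_mult:
  assumes "f \<in> L2 M" "g \<in> L2 M"
  shows "integrable M (\<lambda>x. cnj (f x) * g x)"
proof -
  note m = L2D(1)[OF assms(1)] L2D(1)[OF assms(2)]
  show ?thesis
  proof (rule Bochner_Integration.integrable_bound)
    show "integrable M (\<lambda>x. (norm (f x))\<^sup>2 + (norm (g x))\<^sup>2)"
      using L2D(2)[OF assms(1)] L2D(2)[OF assms(2)] by auto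
    show "AE x in M. norm (cnj (f x) * g x) \<le> norm ((norm (f x))\<^sup>2 + (norm (g x))\<^sup>2)"
    proof (rule AE_I2)
      fix x
      have "2 * (norm (f x) * norm (g x)) \<le> (norm (f x))\<^sup>2 + (norm (g x))\<^sup>2"
        using sum_squares_bound[of "norm (f x)" "norm (g x)"] by simp
      moreover have "0 \<le> norm (f x) * norm (g x)" by simp
      ultimately have "norm (f x) * norm (g x) \<le> (norm (f x))\<^sup>2 + (norm (g x))\<^sup>2" by linarith
      then show "norm (cnj (f x) * g x) \<le> norm ((norm (f x))\<^sup>2 + (norm (g x))\<^sup>2)" by (simp add: norm_mult)
    qed
  qed (use m in measurable)
qed

lemma inner_add_right:
  "\<lbrakk>f \<in> L2 M; g \<in> L2 M; h \<in> L2 M\<rbrakk> \<Longrightarrow> l2_inner M f (\<lambda>x. g x + h x) = l2_inner M f g + l2_inner M f h"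
  unfolding l2_inner_def by (simp add: distrib_left Bochner_Integration.integral_add L2_integrable_mult)

lemma inner_scale_right: "l2_inner M f (\<lambda>x. c * g x) = c * l2_inner M f g"
proof -
  have "(\<lambda>x. cnj (f x) * (c * g x)) = (\<lambda>x. c * (cnj (f x) * g x))" by (simp add: fun_eq_iff)
  then show ?thesis unfolding l2_inner_def by simp
qed

lemma inner_cnj: "l2_inner M g f = cnj (l2_inner M f g)"
proof -
  have "cnj (l2_inner M f g) = (\<integral>x. cnj (cnj (f x) * g x) \<partial>M)"
    unfolding l2_inner_def by (rule Bochner_Integration.integral_cnj[symmetric])
  also have "\<dots> = l2_inner M g f" unfolding l2_inner_def by (simp add: mult.commute)
  finally show ?thesis ..
qed

lemma inner_scale_left: "l2_inner M (\<lambda>x. c * f x) g = cnj c * l2_inner M f g"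
  unfolding l2_inner_def by (simp add: mult.assoc)

lemma inner_diff_right:
  "\<lbrakk>f \<in> L2 M; g \<in> L2 M; h \<in> L2 M\<rbrakk> \<Longrightarrow> l2_inner M f (\<lambda>x. g x - h x) = l2_inner M f g - l2_inner M f h"
  unfolding l2_inner_def by (simp add: right_diff_distrib Bochner_Integration.integral_diff L2_integrable_mult)

lemma inner_diff_left:
  "\<lbrakk>f \<in> L2 M; g \<in> L2 M; h \<in> L2 M\<rbrakk> \<Longrightarrow> l2_inner M (\<lambda>x. g x - h x) f = l2_inner M g f - l2_inner M h f"
  unfolding l2_inner_def by (simp add: left_diff_distrib Bochner_Integration.integral_diff L2_integrable_mult)

lemma inner_sum_right:
  assumes "f \<in> L2 M" "\<And>i. i \<in> I \<Longrightarrow> g i \<in> L2 M"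
  shows "l2_inner M f (\<lambda>x. \<Sum>i\<in>I. g i x) = (\<Sum>i\<in>I. l2_inner M f (g i))"
  unfolding l2_inner_def sum_distrib_left
  by (rule Bochner_Integration.integral_sum) (use assms in \<open>auto intro: L2_integrable_mult\<close>)

lemma inner_self: "l2_inner M f f = of_real (nsq M f)"
proof -
  have "cnj (f x) * f x = of_real ((norm (f x))\<^sup>2)" for x
    using complex_norm_square[of "f x"] by (simp add: mult.commute)
  then show ?thesis unfolding l2_inner_def nsq_def by (simp only: integral_complex_of_real)
qed

lemma inner_zero_AE:
  assumes "AE x in M. f x = 0"
  shows "l2_inner M g f = 0"
  unfolding l2_inner_def by (rule integral_eq_zero_AE) (use assms in eventually_elim, auto)

lemma nsq_eq_0_iff:
  assumes "f \<in> L2 M"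
  shows "nsq M f = 0 \<longleftrightarrow> (AE x in M. f x = 0)"
  unfolding nsq_def by (subst integral_nonneg_eq_0_iff_AE) (use L2D(2)[OF assms] in auto)

lemma nsq_scale: "nsq M (\<lambda>x. c * f x) = (norm c)\<^sup>2 * nsq M f"
  by (simp add: nsq_def norm_mult power_mult_distrib)

lemma nsq_diff:
  assumes "f \<in> L2 M" "g \<in> L2 M"
  shows "nsq M (\<lambda>x. f x - g x) = nsq M f - 2 * Re (l2_inner M f g) + nsq M g"
proof -
  have "complex_of_real (nsq M (\<lambda>x. f x - g x)) = l2_inner M f f - l2_inner M f g - cnj (l2_inner M f g) + l2_inner M g g"
    unfolding inner_self[symmetric] using assms
    by (simp add: inner_diff_left inner_diff_right L2_diff flip: inner_cnj)
  then have "nsq M (\<lambda>x. f x - g x) = Re (l2_inner M f f - l2_inner M f g - cnj (l2_inner M f g) + l2_inner M g g)"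
    by (metis Re_complex_of_real)
  then show ?thesis by (simp add: inner_self)
qed

lemma Cauchy_Schwarz_L2:
  assumes f: "f \<in> L2 M" and g: "g \<in> L2 M"
  shows "(norm (l2_inner M f g))\<^sup>2 \<le> nsq M f * nsq M g"
proof (cases "nsq M g = 0")
  case True
  then have "AE x in M. g x = 0" using nsq_eq_0_iff[OF g] by simp
  then show ?thesis using True by (simp add: inner_zero_AE)
next
  case False
  then have ng: "nsq M g > 0" using nsq_nonneg[of M g] by simp
  define c where "c = l2_inner M g f / of_real (nsq M g)"
  have "0 \<le> nsq M (\<lambda>x. f x - c * g x)" by (rule nsq_nonneg)
  also have "\<dots> = nsq M f - 2 * Re (c * l2_inner M f g) + (norm c)\<^sup>2 * nsq M g"
    using nsq_diff[OF f L2_scale[OF g], of c] by (simp add: inner_scale_right nsq_scale)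
  also have "c * l2_inner M f g = of_real ((norm (l2_inner M f g))\<^sup>2 / nsq M g)"
    unfolding c_def inner_cnj[of M g f] using complex_norm_square[of "l2_inner M f g"]
    by (simp add: mult.commute)
  also have "(norm c)\<^sup>2 * nsq M g = (norm (l2_inner M f g))\<^sup>2 / nsq M g"
    unfolding c_def inner_cnj[of M g f] using ng by (simp add: norm_divide power_divide power2_eq_square)
  finally have "(norm (l2_inner M f g))\<^sup>2 / nsq M g \<le> nsq M f" by simp
  then show ?thesis using ng by (simp add: field_simps)
qed

lemma norm_inner_le:
  assumes f: "f \<in> L2 M" and g: "g \<in> L2 M"
  shows "norm (l2_inner M f g) \<le> sqrt (nsq M f) * sqrt (nsq M g)"
  using real_sqrt_le_mono[OF Cauchy_Schwarz_L2[OF f g]] by (simp add: real_sqrt_mult)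

lemma nn_integral_nsq:
  assumes "f \<in> L2 M" shows "(\<integral>\<^sup>+x. ennreal ((norm (f x))\<^sup>2) \<partial>M) = ennreal (nsq M f)"
  unfolding nsq_def by (rule nn_integral_eq_integral[OF L2D(2)[OF assms]]) simp

text \<open>The weights \<open>2 ^ n\<close> leave the squared increments summable, because
  \<open>2 ^ n * (1/4) ^ n = (1/2) ^ n\<close>, and still force absolute convergence of the
  telescoping series at almost every point. Fatou's lemma transfers the rate to the limit.\<close>

lemma Riesz_Fischer:
  assumes f: "\<And>n. f n \<in> L2 M" and C: "\<And>m n. n \<le> m \<Longrightarrow> nsq M (\<lambda>x. f m x - f n x) \<le> (1/4) ^ n"
  obtains g where "g \<in> L2 M" "\<And>n. nsq M (\<lambda>x. f n x - g x) \<le> (1/4) ^ n"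
proof -
  note m[measurable] = L2D(1)[OF f]
  have d: "(\<lambda>x. f m x - f n x) \<in> L2 M" for m n by (intro L2_diff f)
  have "(\<integral>\<^sup>+x. (\<Sum>n. ennreal (2 ^ n * (norm (f (Suc n) x - f n x))\<^sup>2)) \<partial>M) \<le> (\<Sum>n. ennreal ((1/2) ^ n))"
  proof (subst nn_integral_suminf)
    show "(\<Sum>n. \<integral>\<^sup>+x. ennreal (2 ^ n * (norm (f (Suc n) x - f n x))\<^sup>2) \<partial>M) \<le> (\<Sum>n. ennreal ((1/2) ^ n))"
    proof (rule suminf_le)
      fix n
      have "(\<integral>\<^sup>+x. ennreal (2 ^ n * (norm (f (Suc n) x - f n x))\<^sup>2) \<partial>M) = ennreal (2 ^ n) * (\<integral>\<^sup>+x. ennreal ((norm (f (Suc n) x - f n x))\<^sup>2) \<partial>M)"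
        by (subst nn_integral_cmult[symmetric]) (auto simp: ennreal_mult)
      also have "\<dots> = ennreal (2 ^ n * nsq M (\<lambda>x. f (Suc n) x - f n x))"
        by (simp add: nn_integral_nsq[OF d] ennreal_mult nsq_nonneg)
      also have "\<dots> \<le> ennreal ((1/2) ^ n)"
      proof (rule ennreal_leI)
        have "2 ^ n * nsq M (\<lambda>x. f (Suc n) x - f n x) \<le> 2 ^ n * (1/4) ^ n" by (intro mult_left_mono C) auto
        also have "\<dots> = (1/2) ^ n" by (simp flip: power_mult_distrib)
        finally show "2 ^ n * nsq M (\<lambda>x. f (Suc n) x - f n x) \<le> (1/2) ^ n" .
      qed
      finally show "(\<integral>\<^sup>+x. ennreal (2 ^ n * (norm (f (Suc n) x - f n x))\<^sup>2) \<partial>M) \<le> ennreal ((1/2) ^ n)" .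
    qed auto
  qed measurable
  also have "\<dots> = ennreal (\<Sum>n. (1/2) ^ n)" by (rule suminf_ennreal2) (auto intro: summable_geometric)
  also have "\<dots> < \<infinity>" by simp
  finally have "AE x in M. (\<Sum>n. ennreal (2 ^ n * (norm (f (Suc n) x - f n x))\<^sup>2)) \<noteq> \<infinity>"
    by (intro nn_integral_PInf_AE) (auto simp: less_top)
  then have conv: "AE x in M. convergent (\<lambda>n. f n x)"
  proof eventually_elim
    case (elim x)
    have s: "summable (\<lambda>n. 2 ^ n * (norm (f (Suc n) x - f n x))\<^sup>2)"
      by (rule summable_suminf_not_top) (use elim in auto)
    have "summable (\<lambda>n. f (Suc n) x - f n x)"
    proof (rule summable_comparison_test')
      show "summable (\<lambda>n. (1/2) ^ n + 2 ^ n * (norm (f (Suc n) x - f n x))\<^sup>2)"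
        by (intro summable_add s summable_geometric) auto
      fix n :: nat
      define t where "t = norm (f (Suc n) x - f n x)"
      \<comment> \<open>The arithmetic-geometric mean in the form
        \<open>2 * t \<le> (1/2) ^ n + 2 ^ n * t^2\<close>, where both terms on the right are
        summable.\<close>
      have "2 ^ n * (2 * t) \<le> 1 + (2 ^ n * t)\<^sup>2" using sum_squares_bound[of 1 "2 ^ n * t"] by simp
      then have "2 ^ n * (2 * t) \<le> 2 ^ n * ((1/2) ^ n + 2 ^ n * t\<^sup>2)"
        by (simp add: algebra_simps power2_eq_square power_divide)
      then have "2 * t \<le> (1/2) ^ n + 2 ^ n * t\<^sup>2" by (rule mult_left_le_imp_le) simp
      moreover have "t \<ge> 0" by (simp add: t_def)
      ultimately show "norm (f (Suc n) x - f n x) \<le> (1/2) ^ n + 2 ^ n * (norm (f (Suc n) x - f n x))\<^sup>2"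
        unfolding t_def[symmetric] by linarith
    qed
    then have "convergent (\<lambda>n. f 0 x + (\<Sum>i<n. f (Suc i) x - f i x))"
      by (intro convergent_add convergent_const) (simp add: summable_iff_convergent)
    moreover have "(\<Sum>i<n. f (Suc i) x - f i x) = f n x - f 0 x" for n
      using sum_lessThan_telescope[of "\<lambda>i. f i x" n] by simp
    ultimately show ?case by simp
  qed
  define g where "g = (\<lambda>x. lim (\<lambda>n. f n x))"
  have gm[measurable]: "g \<in> borel_measurable M" unfolding g_def by measurable
  have bound: "(\<integral>\<^sup>+x. ennreal ((norm (f n x - g x))\<^sup>2) \<partial>M) \<le> ennreal ((1/4) ^ n)" for n
  proof -
    have "(\<integral>\<^sup>+x. ennreal ((norm (f n x - g x))\<^sup>2) \<partial>M) = (\<integral>\<^sup>+x. liminf (\<lambda>m. ennreal ((norm (f n x - f m x))\<^sup>2)) \<partial>M)"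
    proof (rule nn_integral_cong_AE)
      show "AE x in M. ennreal ((norm (f n x - g x))\<^sup>2) = liminf (\<lambda>m. ennreal ((norm (f n x - f m x))\<^sup>2))"
        using conv
      proof eventually_elim
        case (elim x)
        then have "(\<lambda>m. f m x) \<longlonglongrightarrow> g x" by (simp add: convergent_LIMSEQ_iff g_def)
        then have "(\<lambda>m. ennreal ((norm (f n x - f m x))\<^sup>2)) \<longlonglongrightarrow> ennreal ((norm (f n x - g x))\<^sup>2)"
          by (intro tendsto_intros)
        then show ?case by (intro lim_imp_Liminf[symmetric]) auto
      qed
    qed
    also have "\<dots> \<le> liminf (\<lambda>m. \<integral>\<^sup>+x. ennreal ((norm (f n x - f m x))\<^sup>2) \<partial>M)"
      by (rule nn_integral_liminf) measurable
    also have "\<dots> \<le> ennreal ((1/4) ^ n)"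
    proof (rule Liminf_le)
      have "(\<integral>\<^sup>+x. ennreal ((norm (f n x - f m x))\<^sup>2) \<partial>M) \<le> ennreal ((1/4) ^ n)" if "n \<le> m" for m
        using C[OF that] nn_integral_nsq[OF d, of n m] by (simp add: nsq_def norm_minus_commute ennreal_leI)
      then show "\<forall>\<^sub>F m in sequentially. (\<integral>\<^sup>+x. ennreal ((norm (f n x - f m x))\<^sup>2) \<partial>M) \<le> ennreal ((1/4) ^ n)"
        by (auto simp: eventually_sequentially)
    qed simp
    finally show ?thesis .
  qed
  have L: "(\<lambda>x. f n x - g x) \<in> L2 M" for n
  proof -
    have "integrable M (\<lambda>x. (norm (f n x - g x))\<^sup>2)"
      by (rule integrableI_bounded) (use bound[of n] in \<open>auto intro: le_less_trans\<close>)
    then show ?thesis by (simp add: L2_def)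
  qed
  show ?thesis
  proof (rule that)
    show "g \<in> L2 M" using L2_diff[OF f[of 0] L[of 0]] by simp
    show "nsq M (\<lambda>x. f n x - g x) \<le> (1/4) ^ n" for n
      using bound[of n] nn_integral_nsq[OF L, of n] by (simp add: nsq_nonneg)
  qed
qed

section \<open>Orthonormal systems, Bessel and Parseval\<close>

definition orthonormal :: "real measure \<Rightarrow> (real \<Rightarrow> complex) set \<Rightarrow> bool" where
  "orthonormal M E \<longleftrightarrow> E \<subseteq> L2 M \<and> (\<forall>e\<in>E. \<forall>f\<in>E. l2_inner M e f = (if e = f then 1 else 0))"

lemma orthonormal_sum_inner:
  assumes E: "orthonormal M E" and F: "finite F" "F \<subseteq> E" and e: "e \<in> E"
  shows "l2_inner M e (\<lambda>x. \<Sum>i\<in>F. c i * i x) = (if e \<in> F then c e else 0)"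
proof -
  have EL: "\<And>i. i \<in> E \<Longrightarrow> i \<in> L2 M" using E by (auto simp: orthonormal_def)
  have "l2_inner M e (\<lambda>x. \<Sum>i\<in>F. c i * i x) = (\<Sum>i\<in>F. l2_inner M e (\<lambda>x. c i * i x))"
    by (rule inner_sum_right) (use F e EL in \<open>auto intro: L2_scale\<close>)
  also have "\<dots> = (\<Sum>i\<in>F. if e = i then c i else 0)"
    by (rule sum.cong) (use E F e in \<open>auto simp: inner_scale_right orthonormal_def\<close>)
  finally show ?thesis using F by simp
qed

lemma orthonormal_nsq_sum:
  assumes E: "orthonormal M E" and F: "finite F" "F \<subseteq> E"
  shows "nsq M (\<lambda>x. \<Sum>i\<in>F. c i * i x) = (\<Sum>i\<in>F. (norm (c i))\<^sup>2)"
proof -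
  have EL: "\<And>i. i \<in> E \<Longrightarrow> i \<in> L2 M" using E by (auto simp: orthonormal_def)
  define S where "S = (\<lambda>x. \<Sum>i\<in>F. c i * i x)"
  have SL: "S \<in> L2 M" unfolding S_def by (intro L2_sum L2_scale EL) (use F in auto)
  have "complex_of_real (nsq M S) = (\<Sum>i\<in>F. l2_inner M S (\<lambda>x. c i * i x))"
    unfolding inner_self[symmetric] by (subst (2) S_def, rule inner_sum_right[OF SL]) (use F EL in \<open>auto intro: L2_scale\<close>)
  also have "\<dots> = (\<Sum>i\<in>F. of_real ((norm (c i))\<^sup>2))"
  proof (rule sum.cong)
    fix i assume i: "i \<in> F"
    have "l2_inner M S i = cnj (c i)"
      using orthonormal_sum_inner[OF E F, of i c] i F inner_cnj[of M S i] by (auto simp: S_def)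
    then show "l2_inner M S (\<lambda>x. c i * i x) = of_real ((norm (c i))\<^sup>2)"
      using complex_norm_square[of "c i"] by (simp add: inner_scale_right)
  qed simp
  finally show ?thesis unfolding S_def by (simp only: of_real_sum[symmetric] of_real_eq_iff)
qed

lemma orthonormal_residual:
  assumes E: "orthonormal M E" and F: "finite F" "F \<subseteq> E" and f: "f \<in> L2 M"
  shows "nsq M (\<lambda>x. f x - (\<Sum>e\<in>F. l2_inner M e f * e x)) = nsq M f - (\<Sum>e\<in>F. (norm (l2_inner M e f))\<^sup>2)"
proof -
  have EL: "\<And>i. i \<in> E \<Longrightarrow> i \<in> L2 M" using E by (auto simp: orthonormal_def)
  have SL: "(\<lambda>x. \<Sum>e\<in>F. l2_inner M e f * e x) \<in> L2 M" by (intro L2_sum L2_scale EL) (use F in auto)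
  have "l2_inner M f (\<lambda>x. \<Sum>e\<in>F. l2_inner M e f * e x) = (\<Sum>e\<in>F. l2_inner M f (\<lambda>x. l2_inner M e f * e x))"
    by (rule inner_sum_right[OF f]) (use F EL in \<open>auto intro: L2_scale\<close>)
  also have "\<dots> = of_real (\<Sum>e\<in>F. (norm (l2_inner M e f))\<^sup>2)"
    unfolding of_real_sum
  proof (rule sum.cong)
    fix e
    show "l2_inner M f (\<lambda>x. l2_inner M e f * e x) = of_real ((norm (l2_inner M e f))\<^sup>2)"
      using complex_norm_square[of "l2_inner M e f"] inner_cnj[of M f e] by (simp add: inner_scale_right)
  qed simp
  finally show ?thesis
    unfolding nsq_diff[OF f SL] orthonormal_nsq_sum[OF E F] by simp
qed

lemma Bessel:
  assumes E: "orthonormal M E" and F: "finite F" "F \<subseteq> E" and f: "f \<in> L2 M"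
  shows "(\<Sum>e\<in>F. (norm (l2_inner M e f))\<^sup>2) \<le> nsq M f"
  using orthonormal_residual[OF assms] nsq_nonneg[of M "\<lambda>x. f x - (\<Sum>e\<in>F. l2_inner M e f * e x)"] by linarith

lemma Bessel_summable:
  assumes E: "orthonormal M E" and f: "f \<in> L2 M"
  shows "(\<lambda>e. (norm (l2_inner M e f))\<^sup>2) summable_on E"
  by (rule nonneg_bdd_above_summable_on) (use Bessel[OF E _ _ f] in \<open>auto simp: bdd_above_def\<close>)

lemma orthonormal_basis_iff:
  "orthonormal_basis M E \<longleftrightarrow> orthonormal M E \<and> (\<forall>f\<in>L2 M. (\<forall>e\<in>E. l2_inner M e f = 0) \<longrightarrow> (AE x in M. f x = 0))"
  by (auto simp: orthonormal_basis_def orthonormal_def)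

text \<open>An orthonormal basis is defined by a trivial orthogonal complement, so the expansion has
  to be summed first: partial sums converge by Riesz-Fischer to some \<open>h\<close>, and
  \<open>f - h\<close> is orthogonal to \<open>E\<close>, hence null.\<close>

theorem Parseval:
  assumes B: "orthonormal_basis M E" and f: "f \<in> L2 M"
  shows "((\<lambda>e. (norm (l2_inner M e f))\<^sup>2) has_sum nsq M f) E"
proof -
  have E: "orthonormal M E" using B by (simp add: orthonormal_basis_iff)
  have EL: "\<And>i. i \<in> E \<Longrightarrow> i \<in> L2 M" using E by (auto simp: orthonormal_def)
  define w where "w = (\<lambda>e. (norm (l2_inner M e f))\<^sup>2)"
  define s where "s = infsum w E"
  have ws: "w summable_on E" unfolding w_def by (rule Bessel_summable[OF E f])
  have hs: "(w has_sum s) E" using ws by (simp add: s_def)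
  have le: "sum w F \<le> s" if "finite F" "F \<subseteq> E" for F
    unfolding s_def by (rule finite_sum_le_infsum[OF ws that]) (simp add: w_def)
  have "\<exists>F. finite F \<and> F \<subseteq> E \<and> s - sum w F \<le> (1/4) ^ n / 2" for n :: nat
  proof -
    have "\<forall>\<^sub>F F in finite_subsets_at_top E. dist (sum w F) s < (1/4) ^ n / 2"
      using hs unfolding has_sum_def by (rule tendstoD) simp
    then obtain F where "finite F" "F \<subseteq> E" "dist (sum w F) s < (1/4) ^ n / 2"
      unfolding eventually_finite_subsets_at_top by blast
    moreover have "s - sum w F \<le> \<bar>sum w F - s\<bar>" by simp
    ultimately have "s - sum w F \<le> (1/4) ^ n / 2" unfolding dist_real_def by linarith
    then show ?thesis using \<open>finite F\<close> \<open>F \<subseteq> E\<close> by blast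
  qed
  \<comment> \<open>These sets are not nested; the halves leave room for both parts of the symmetric
    difference of \<open>F m\<close> and \<open>F n\<close>.\<close>
  then obtain F where F: "\<And>n. finite (F n)" "\<And>n. F n \<subseteq> E" "\<And>n. s - sum w (F n) \<le> (1/4) ^ n / 2" by metis
  define c where "c = (\<lambda>e. l2_inner M e f)"
  define g where "g = (\<lambda>n x. \<Sum>e\<in>F n. c e * e x)"
  have gL: "g n \<in> L2 M" for n unfolding g_def by (intro L2_sum L2_scale EL) (use F in auto)
  have diff: "sum w (F m - F n) \<le> (1/4) ^ n / 2" for m n
  proof -
    have "sum w (F m - F n) + sum w (F n) = sum w (F m \<union> F n)"
      using F by (subst sum.union_disjoint[symmetric]) auto
    also have "\<dots> \<le> s" by (rule le) (use F in auto)
    finally show ?thesis using F(3)[of n] by linarith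
  qed
  have "nsq M (\<lambda>x. g m x - g n x) \<le> (1/4) ^ n" if "n \<le> m" for m n
  proof -
    define d where "d = (\<lambda>e. if e \<in> F m then if e \<in> F n then 0 else c e else - c e)"
    have "(\<lambda>x. g m x - g n x) = (\<lambda>x. \<Sum>e\<in>F m \<union> F n. d e * e x)"
    proof
      fix x
      have "g m x = (\<Sum>e\<in>F m \<union> F n. if e \<in> F m then c e * e x else 0)"
        unfolding g_def using F by (subst sum.inter_restrict[symmetric]) (auto intro: sum.cong)
      moreover have "g n x = (\<Sum>e\<in>F m \<union> F n. if e \<in> F n then c e * e x else 0)"
        unfolding g_def using F by (subst sum.inter_restrict[symmetric]) (auto intro: sum.cong)
      ultimately show "g m x - g n x = (\<Sum>e\<in>F m \<union> F n. d e * e x)"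
        by (simp only: sum_subtractf[symmetric]) (auto intro!: sum.cong simp: d_def)
    qed
    then have "nsq M (\<lambda>x. g m x - g n x) = (\<Sum>e\<in>F m \<union> F n. (norm (d e))\<^sup>2)"
      using orthonormal_nsq_sum[OF E, of "F m \<union> F n" d] F by auto
    also have "\<dots> = (\<Sum>e\<in>(F m - F n) \<union> (F n - F m). w e)"
      by (rule sum.mono_neutral_cong_right) (use F in \<open>auto simp: d_def w_def c_def\<close>)
    also have "\<dots> = sum w (F m - F n) + sum w (F n - F m)"
      by (rule sum.union_disjoint) (use F in auto)
    also have "\<dots> \<le> (1/4) ^ n / 2 + (1/4) ^ m / 2" by (intro add_mono diff)
    also have "\<dots> \<le> (1/4) ^ n" using power_decreasing[OF that, of "1/4::real"] by (simp add: field_simps) 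
    finally show ?thesis .
  qed
  then obtain h where h: "h \<in> L2 M" "\<And>n. nsq M (\<lambda>x. g n x - h x) \<le> (1/4) ^ n"
    using Riesz_Fischer[of g M, OF gL] by blast
  have z: "(\<lambda>n. (1/4::real) ^ n) \<longlonglongrightarrow> 0" by (rule LIMSEQ_power_zero) simp
  have fh: "(\<lambda>x. f x - h x) \<in> L2 M" by (intro L2_diff f h)
  have "l2_inner M e (\<lambda>x. f x - h x) = 0" if e: "e \<in> E" for e
  proof -
    have ne: "nsq M e = 1" using E e inner_self[of M e] by (simp add: orthonormal_def)
    have bd: "norm (l2_inner M e (\<lambda>x. f x - h x)) \<le> 2 * sqrt ((1/4) ^ n)" for n
    proof -
      have "l2_inner M e (\<lambda>x. f x - h x) = l2_inner M e (\<lambda>x. f x - g n x) + l2_inner M e (\<lambda>x. g n x - h x)"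
        using inner_add_right[OF EL[OF e] L2_diff[OF f gL] L2_diff[OF gL h(1)], of n n] by simp
      then have "norm (l2_inner M e (\<lambda>x. f x - h x)) \<le> norm (l2_inner M e (\<lambda>x. f x - g n x)) + norm (l2_inner M e (\<lambda>x. g n x - h x))"
        by (simp add: norm_triangle_ineq)
      also have "norm (l2_inner M e (\<lambda>x. g n x - h x)) \<le> sqrt ((1/4) ^ n)"
        using norm_inner_le[OF EL[OF e] L2_diff[OF gL h(1)], of n] h(2)[of n] ne
        by (auto intro: order_trans)
      also have "norm (l2_inner M e (\<lambda>x. f x - g n x)) \<le> sqrt ((1/4) ^ n)"
      proof -
        have eq: "l2_inner M e (\<lambda>x. f x - g n x) = c e - (if e \<in> F n then c e else 0)"
          using inner_diff_right[OF EL[OF e] f gL, of n] orthonormal_sum_inner[OF E F(1,2) e, of c n] by (simp add: g_def c_def)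
        have "(norm (c e))\<^sup>2 \<le> (1/4) ^ n" if "e \<notin> F n"
        proof -
          have "sum w (insert e (F n)) \<le> s" by (rule le) (use F e in auto)
          then have "w e \<le> (1/4) ^ n / 2" using that F(1,3)[of n] by simp
          moreover have "(1/4::real) ^ n > 0" by simp
          ultimately show ?thesis unfolding w_def c_def by linarith
        qed
        then show ?thesis unfolding eq by (auto intro: real_le_rsqrt)
      qed
      finally show ?thesis by simp
    qed
    have "(\<lambda>n. 2 * sqrt ((1/4::real) ^ n)) \<longlonglongrightarrow> 2 * sqrt 0" by (intro tendsto_intros z)
    then have "(\<lambda>n. 2 * sqrt ((1/4::real) ^ n)) \<longlonglongrightarrow> 0" by (simp only: real_sqrt_zero mult_zero_right)
    from tendsto_lowerbound[OF this, of "norm (l2_inner M e (\<lambda>x. f x - h x))"]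
    have "norm (l2_inner M e (\<lambda>x. f x - h x)) \<le> 0" using bd by simp
    then show ?thesis by simp
  qed
  then have ae: "AE x in M. f x - h x = 0" using B fh by (auto simp: orthonormal_basis_iff)
  have "nsq M f - s \<le> (1/4) ^ n" for n
  proof -
    have "nsq M (\<lambda>x. f x - g n x) = nsq M (\<lambda>x. g n x - h x)"
      unfolding nsq_def
    proof (rule integral_cong_AE)
      show "AE x in M. (norm (f x - g n x))\<^sup>2 = (norm (g n x - h x))\<^sup>2"
        using ae by eventually_elim (simp add: norm_minus_commute)
    qed (use L2D(1)[OF f] L2D(1)[OF gL] L2D(1)[OF h(1)] in measurable)
    then have "nsq M f - sum w (F n) \<le> (1/4) ^ n"
      using orthonormal_residual[OF E F(1,2) f, of n] h(2)[of n] by (simp add: g_def c_def w_def)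
    then show ?thesis using le[OF F(1,2), of n] by linarith
  qed
  then have "nsq M f - s \<le> 0" by (intro tendsto_lowerbound[OF z]) auto
  moreover have "s \<le> nsq M f" unfolding s_def
    by (rule infsum_le_finite_sums[OF ws]) (use Bessel[OF E _ _ f] in \<open>auto simp: w_def\<close>)
  ultimately have "s = nsq M f" by simp
  then show ?thesis using hs by (simp add: w_def)
qed

text \<open>Replacing \<open>f\<close> by its partial sum over \<open>F\<close> costs at most the
  norm of the residual times the norm of \<open>g\<close>, and Parseval sends the residual to
  0.\<close>

theorem Parseval_inner:
  assumes B: "orthonormal_basis M E" and f: "f \<in> L2 M" and g: "g \<in> L2 M"
  shows "((\<lambda>e. cnj (l2_inner M e f) * l2_inner M e g) has_sum l2_inner M f g) E"
proof -
  have E: "orthonormal M E" using B by (simp add: orthonormal_basis_iff)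
  have EL: "\<And>i. i \<in> E \<Longrightarrow> i \<in> L2 M" using E by (auto simp: orthonormal_def)
  have lim: "((\<lambda>F. sqrt (nsq M f - (\<Sum>e\<in>F. (norm (l2_inner M e f))\<^sup>2)) * sqrt (nsq M g)) \<longlongrightarrow> sqrt (nsq M f - nsq M f) * sqrt (nsq M g)) (finite_subsets_at_top E)"
    by (intro tendsto_intros Parseval[OF B f, unfolded has_sum_def])
  have "((\<lambda>F. (\<Sum>e\<in>F. cnj (l2_inner M e f) * l2_inner M e g) - l2_inner M f g) \<longlongrightarrow> 0) (finite_subsets_at_top E)"
  proof (rule Lim_null_comparison)
    show "((\<lambda>F. sqrt (nsq M f - (\<Sum>e\<in>F. (norm (l2_inner M e f))\<^sup>2)) * sqrt (nsq M g)) \<longlongrightarrow> 0) (finite_subsets_at_top E)"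
      using lim by simp
    show "\<forall>\<^sub>F F in finite_subsets_at_top E. norm ((\<Sum>e\<in>F. cnj (l2_inner M e f) * l2_inner M e g) - l2_inner M f g)
        \<le> sqrt (nsq M f - (\<Sum>e\<in>F. (norm (l2_inner M e f))\<^sup>2)) * sqrt (nsq M g)"
    proof (rule eventually_finite_subsets_at_top_weakI)
      fix F assume F: "finite F" "F \<subseteq> E"
      define P where "P = (\<lambda>x. \<Sum>e\<in>F. l2_inner M e f * e x)"
      have PL: "P \<in> L2 M" unfolding P_def by (intro L2_sum L2_scale EL) (use F in auto)
      have "l2_inner M g P = (\<Sum>e\<in>F. l2_inner M g (\<lambda>x. l2_inner M e f * e x))"
        unfolding P_def by (rule inner_sum_right[OF g]) (use F EL in \<open>auto intro: L2_scale\<close>)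
      then have "l2_inner M P g = (\<Sum>e\<in>F. cnj (l2_inner M e f) * cnj (l2_inner M g e))"
        unfolding inner_cnj[of M P g] by (simp add: inner_scale_right)
      also have "\<dots> = (\<Sum>e\<in>F. cnj (l2_inner M e f) * l2_inner M e g)"
        by (simp only: inner_cnj[of M _ g, symmetric])
      finally have "l2_inner M (\<lambda>x. f x - P x) g = l2_inner M f g - (\<Sum>e\<in>F. cnj (l2_inner M e f) * l2_inner M e g)"
        by (simp add: inner_diff_left[OF g f PL])
      then show "norm ((\<Sum>e\<in>F. cnj (l2_inner M e f) * l2_inner M e g) - l2_inner M f g)
        \<le> sqrt (nsq M f - (\<Sum>e\<in>F. (norm (l2_inner M e f))\<^sup>2)) * sqrt (nsq M g)"
        using norm_inner_le[OF L2_diff[OF f PL] g] orthonormal_residual[OF E F f]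
        by (simp add: P_def norm_minus_commute)
    qed
  qed
  then show ?thesis unfolding has_sum_def by (rule LIM_zero_cancel)
qed

text \<open>Completeness of Lebesgue measure. For an element of the domain \<open>sl_tau\<close> is
  known only up to null sets, yet it has to be measurable to lie in \<open>L2\<close>.\<close>

lemma borel_measurable_lebesgue_on_AE:
  fixes f g :: "real \<Rightarrow> complex"
  assumes S: "S \<in> sets lebesgue" and f: "f \<in> borel_measurable (lebesgue_on S)" and ae: "AE x in lebesgue_on S. f x = g x"
  shows "g \<in> borel_measurable (lebesgue_on S)"
proof -
  have "(\<lambda>x. if x \<in> S then f x else 0) \<in> borel_measurable lebesgue"
    using f S by (simp add: borel_measurable_if)
  moreover have "AE x in lebesgue. (if x \<in> S then f x else 0) = (if x \<in> S then g x else 0)"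
    using ae S by (auto simp: AE_restrict_space_iff elim: eventually_mono)
  ultimately have "(\<lambda>x. if x \<in> S then g x else 0) \<in> borel_measurable lebesgue"
    by (rule borel_measurable_AE)
  then show ?thesis using S by (simp add: borel_measurable_if)
qed

section \<open>The coupled operator and its lower bound\<close>

text \<open>The phase is written \<alpha> because \<phi> already abbreviates a solution in this
  context.\<close>

locale coupled = sturm_liouville a b p q r for a b p q r +
  fixes \<alpha> :: real and R :: "real^2^2"
  assumes det_R: "det R = 1"
begin

lemma det_R': "R$1$1 * R$2$2 - R$1$2 * R$2$1 = 1"
  using det_R by (simp add: det_2)

definition bc :: "(real \<Rightarrow> complex) \<Rightarrow> (real \<Rightarrow> complex) \<Rightarrow> bool" where
  "bc y u \<longleftrightarrow> y b = cis \<alpha> * (of_real (R$1$1) * y a + of_real (R$1$2) * u a) \<and>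
     u b = cis \<alpha> * (of_real (R$2$1) * y a + of_real (R$2$2) * u a)"

text \<open>\<open>trel h y u\<close>: \<open>y\<close> is in the domain of the coupled operator, which maps it to \<open>h\<close>, and \<open>u\<close> is its
  quasi-derivative.\<close>

definition trel :: "(real \<Rightarrow> complex) \<Rightarrow> (real \<Rightarrow> complex) \<Rightarrow> (real \<Rightarrow> complex) \<Rightarrow> bool" where
  "trel h y u \<longleftrightarrow> h \<in> L2 M \<and> supp y \<and> supp u \<and> sys h y u \<and> bc y u"

lemma trel_L2:
  assumes "trel h y u" shows "h \<in> L2 M" "y \<in> L2 M" "u \<in> L2 M"
  using assms sys_continuous[of h y u] by (auto simp: trel_def intro: L2_continuous)

text \<open>From here on \<open>trel\<close> stands in for the definition of the domain, with the
  quasi-derivative carried along as an explicit component.\<close>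

lemma dom_coupled_iff:
  assumes "h \<in> L2 M"
  shows "g \<in> dom_coupled a b p q r \<alpha> R \<and> (AE x in M. sl_tau a b p q r g x = h x) \<longleftrightarrow> trel h g (quasi_deriv a b p g)"
proof
  assume *: "g \<in> dom_coupled a b p q r \<alpha> R \<and> (AE x in M. sl_tau a b p q r g x = h x)"
  then have g: "g \<in> sl_regular a b p" and bc: "bc g (quasi_deriv a b p g)"
    and h: "AE x in N. sl_tau a b p q r g x = h x"
    by (auto simp: dom_coupled_def dom_max_def bc_def AE_M_iff)
  show "trel h g (quasi_deriv a b p g)"
    using regular_imp_sys[OF g h L2_integrable(1)[OF assms]] bc assms by (simp add: trel_def)
next
  assume t: "trel h g (quasi_deriv a b p g)"
  then have s: "sys h g (quasi_deriv a b p g)" "supp g" "supp (quasi_deriv a b p g)" by (auto simp: trel_def)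
  note R = sys_imp_regular[OF s]
  have "sl_tau a b p q r g \<in> borel_measurable N"
    by (rule borel_measurable_lebesgue_on_AE[OF _ L2_integrable(2)[OF assms]])
      (use R(3) in \<open>auto elim: eventually_mono\<close>)
  then have "sl_tau a b p q r g \<in> L2 M"
    by (intro L2_cong_AE[OF assms]) (use R(3) in \<open>auto simp: measurable_M AE_M_iff\<close>)
  then show "g \<in> dom_coupled a b p q r \<alpha> R \<and> (AE x in M. sl_tau a b p q r g x = h x)"
    using R trel_L2[OF t] t by (auto simp: dom_coupled_def dom_max_def trel_def bc_def AE_M_iff)
qed

lemma trel_imp_dom:
  assumes "trel h g u"
  shows "g \<in> dom_coupled a b p q r \<alpha> R" "AE x in M. sl_tau a b p q r g x = h x" "quasi_deriv a b p g = u"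
proof -
  have "quasi_deriv a b p g = u" using sys_imp_regular(2)[of h g u] assms by (auto simp: trel_def)
  then show "g \<in> dom_coupled a b p q r \<alpha> R" "AE x in M. sl_tau a b p q r g x = h x" "quasi_deriv a b p g = u"
    using dom_coupled_iff[OF trel_L2(1)[OF assms], of g] assms by auto
qed

lemma trel_add:
  assumes "trel h y u" "trel h' y' u'"
  shows "trel (\<lambda>x. h x + h' x) (\<lambda>x. y x + y' x) (\<lambda>x. u x + u' x)"
  using assms sys_add[of h y u h' y' u'] by (auto simp: trel_def supp_def bc_def algebra_simps intro: L2_add)

lemma trel_cmult:
  assumes "trel h y u"
  shows "trel (\<lambda>x. c * h x) (\<lambda>x. c * y x) (\<lambda>x. c * u x)"
  using assms sys_cmult[of h y u c] by (auto simp: trel_def supp_def bc_def algebra_simps intro: L2_scale)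

lemma trel_sum:
  assumes "\<And>i. i \<in> I \<Longrightarrow> trel (h i) (y i) (u i)"
  shows "trel (\<lambda>x. \<Sum>i\<in>I. h i x) (\<lambda>x. \<Sum>i\<in>I. y i x) (\<lambda>x. \<Sum>i\<in>I. u i x)"
  using assms
proof (induction I rule: infinite_finite_induct)
  case (insert i I)
  then show ?case using trel_add[of "h i" "y i" "u i"] by simp
qed (auto simp: trel_def supp_def bc_def sys_def prim_const)

lemma inner_M:
  assumes "f \<in> L2 M" "g \<in> L2 M"
  shows "l2_inner M f g = (\<integral>x. of_real (r x) * (cnj (f x) * g x) \<partial>N)"
    "integrable N (\<lambda>x. of_real (r x) * (cnj (f x) * g x))"
proof -
  have m: "(\<lambda>x. cnj (f x) * g x) \<in> borel_measurable N"
    using L2_integrable(2)[OF assms(1)] L2_integrable(2)[OF assms(2)] by measurable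
  show "l2_inner M f g = (\<integral>x. of_real (r x) * (cnj (f x) * g x) \<partial>N)"
    unfolding l2_inner_def integral_M[OF m] by (simp add: scaleR_conv_of_real)
  show "integrable N (\<lambda>x. of_real (r x) * (cnj (f x) * g x))"
    using L2_integrable_mult[OF assms] integrable_M[OF m] by (simp add: scaleR_conv_of_real)
qed

lemma nsq_M:
  assumes "f \<in> L2 M"
  shows "nsq M f = (\<integral>x. r x * (norm (f x))\<^sup>2 \<partial>N)" "integrable N (\<lambda>x. r x * (norm (f x))\<^sup>2)"
proof -
  have m: "(\<lambda>x. (norm (f x))\<^sup>2) \<in> borel_measurable N" using L2_integrable(2)[OF assms] by measurable
  show "nsq M f = (\<integral>x. r x * (norm (f x))\<^sup>2 \<partial>N)" unfolding nsq_def integral_M[OF m] by simp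
  show "integrable N (\<lambda>x. r x * (norm (f x))\<^sup>2)" using L2D(2)[OF assms] integrable_M[OF m] by simp
qed

lemma cis_cnj: "cnj (cis \<alpha>) * cis \<alpha> = 1"
  by (simp add: cis_cnj cis_mult)

text \<open>A matrix of determinant 1 preserves the symplectic form \<open>u y' - y u'\<close>.
  Conjugates enter as independent ring elements, with \<open>E\<close> the conjugate of the phase
  \<open>e\<close>, so that \<open>E * e\<close> becomes 1.\<close>

lemma symplectic_identity:
  fixes A B C D :: "'c::comm_ring_1"
  shows "(E * (C * y + D * u)) * (e * (A * y' + B * u')) - (E * (A * y + B * u)) * (e * (C * y' + D * u'))
    = (E * e) * ((A * D - B * C) * (u * y' - y * u'))"
  by (simp add: algebra_simps)

text \<open>Lagrange's identity: up to sign the difference of the inner products is the boundary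
  form at \<open>b\<close> minus the one at \<open>a\<close>, and the boundary conditions make these
  two equal.\<close>

lemma trel_symmetric:
  assumes t: "trel h y u" and t': "trel h' y' u'"
  shows "l2_inner M y h' = l2_inner M h y'"
proof -
  have s: "sys h y u" "sys h' y' u'" and B: "bc y u" "bc y' u'" using assms by (auto simp: trel_def)
  note c = sys_cnj[OF s(1)]
  have P: "prim a b (\<lambda>x. cnj (u x) * y' x - cnj (y x) * u' x)
      (\<lambda>x. of_real (r x) * (cnj (y x) * h' x) - of_real (r x) * (cnj (h x) * y' x))"
    by (rule prim_eqI[OF prim_minus[OF prim_mult[OF sysD(2)[OF c] sysD(1)[OF s(2)]] prim_mult[OF sysD(1)[OF c] sysD(2)[OF s(2)]]]])
      (simp_all add: algebra_simps)
  have "(\<integral>x. of_real (r x) * (cnj (y x) * h' x) - of_real (r x) * (cnj (h x) * y' x) \<partial>N) =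
      (cnj (u b) * y' b - cnj (y b) * u' b) - (cnj (u a) * y' a - cnj (y a) * u' a)"
    using prim_integral[OF P] ab by simp
  also have "cnj (u b) * y' b - cnj (y b) * u' b = (cnj (cis \<alpha>) * cis \<alpha>) *
     ((of_real (R$1$1) * of_real (R$2$2) - of_real (R$1$2) * of_real (R$2$1)) * (cnj (u a) * y' a - cnj (y a) * u' a))"
    unfolding conjunct1[OF B(1)[unfolded bc_def]] conjunct2[OF B(1)[unfolded bc_def]]
      conjunct1[OF B(2)[unfolded bc_def]] conjunct2[OF B(2)[unfolded bc_def]]
      complex_cnj_mult complex_cnj_add complex_cnj_complex_of_real by (rule symplectic_identity)
  also have "\<dots> = cnj (u a) * y' a - cnj (y a) * u' a"
    unfolding cis_cnj of_real_mult[symmetric] of_real_diff[symmetric] det_R' by simp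
  finally have "(\<integral>x. of_real (r x) * (cnj (y x) * h' x) - of_real (r x) * (cnj (h x) * y' x) \<partial>N) = 0" by simp
  then show ?thesis
    using inner_M[OF trel_L2(2)[OF t] trel_L2(1)[OF t']] inner_M[OF trel_L2(1)[OF t] trel_L2(2)[OF t']]
    by (simp add: Bochner_Integration.integral_diff)
qed

lemma nsq_zero_imp:
  assumes c: "continuous_on {a..b} y" and s: "supp y" and z: "nsq M y = 0"
  shows "y = (\<lambda>_. 0)"
proof (rule supp_ext[OF s])
  have "AE x in N. y x = 0" using z nsq_eq_0_iff[OF L2_continuous[OF c]] by (simp add: AE_M_iff)
  then show "y x = 0" if "x \<in> {a..b}" for x
    by (intro continuous_AE_eq[OF ab c _ _ that]) auto
qed (simp add: supp_def)

lemma eigen_real: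
  assumes t: "trel (\<lambda>x. \<mu> * y x) y u" and y: "y \<noteq> (\<lambda>_. 0)"
  shows "\<mu> \<in> \<real>"
proof -
  have "\<mu> * of_real (nsq M y) = cnj \<mu> * of_real (nsq M y)"
    using trel_symmetric[OF t t] by (simp add: inner_scale_left inner_scale_right inner_self)
  moreover have "nsq M y \<noteq> 0"
    using nsq_zero_imp[of y] y t sys_continuous(1)[of _ y u] by (auto simp: trel_def)
  ultimately have "\<mu> = cnj \<mu>" by simp
  then show ?thesis by (metis Reals_cnj_iff)
qed

text \<open>The quadratic form: only the values of \<open>y\<close> enter the boundary terms, up to a constant.\<close>

lemma boundary_bound:
  "\<exists>C\<ge>0. \<forall>y u. bc y u \<longrightarrow> norm (cnj (y b) * u b - cnj (y a) * u a) \<le> C * ((norm (y a))\<^sup>2 + (norm (y b))\<^sup>2)"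
proof (cases "R$1$2 = 0")
  \<comment> \<open>Here \<open>R$1$1 * R$2$2 = 1\<close>, so the terms containing
    \<open>u a\<close> cancel exactly and only \<open>y a\<close> remains.\<close>
  case True
  show ?thesis
  proof (intro exI[of _ "\<bar>R$1$1 * R$2$1\<bar>"] conjI allI impI)
    fix y u assume B: "bc y u"
    have "cnj (y b) * u b = (cnj (cis \<alpha>) * cis \<alpha>) * (of_real (R$1$1) * cnj (y a) * (of_real (R$2$1) * y a + of_real (R$2$2) * u a))"
      unfolding conjunct1[OF B[unfolded bc_def]] conjunct2[OF B[unfolded bc_def]] using True by simp
    also have "\<dots> = of_real (R$1$1 * R$2$1) * (cnj (y a) * y a) + of_real (R$1$1 * R$2$2) * (cnj (y a) * u a)"
      unfolding cis_cnj of_real_mult by (simp add: algebra_simps)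
    also have "R$1$1 * R$2$2 = 1" using det_R' True by simp
    finally have "cnj (y b) * u b - cnj (y a) * u a = of_real (R$1$1 * R$2$1) * (cnj (y a) * y a)" by simp
    then have "norm (cnj (y b) * u b - cnj (y a) * u a) = \<bar>R$1$1 * R$2$1\<bar> * (norm (y a))\<^sup>2"
      by (simp add: norm_mult power2_eq_square abs_mult)
    also have "\<dots> \<le> \<bar>R$1$1 * R$2$1\<bar> * ((norm (y a))\<^sup>2 + (norm (y b))\<^sup>2)" by (intro mult_left_mono) auto
    finally show "norm (cnj (y b) * u b - cnj (y a) * u a) \<le> \<bar>R$1$1 * R$2$1\<bar> * ((norm (y a))\<^sup>2 + (norm (y b))\<^sup>2)" .
  qed simp
next
  \<comment> \<open>The first boundary condition can be solved for \<open>u a\<close>, which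
    expresses both \<open>u a\<close> and \<open>u b\<close> through the boundary values of
    \<open>y\<close>.\<close>
  case False
  define k where "k = 1 / \<bar>R$1$2\<bar>"
  have k0: "k \<ge> 0" by (simp add: k_def)
  define C where "C = k * (1 + \<bar>R$1$1\<bar>) * (1 + \<bar>R$2$2\<bar>) + \<bar>R$2$1\<bar>"
  have C0: "C \<ge> 0" using k0 by (simp add: C_def)
  show ?thesis
  proof (intro exI[of _ "2 * C"] conjI allI impI)
    fix y u assume B: "bc y u"
    define Y where "Y = norm (y a) + norm (y b)"
    have "cnj (cis \<alpha>) * y b = (cnj (cis \<alpha>) * cis \<alpha>) * (of_real (R$1$1) * y a + of_real (R$1$2) * u a)"
      using B unfolding bc_def by simp
    then have "of_real (R$1$2) * u a = cnj (cis \<alpha>) * y b - of_real (R$1$1) * y a" unfolding cis_cnj by simp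
    then have ua: "u a = (cnj (cis \<alpha>) * y b - of_real (R$1$1) * y a) / of_real (R$1$2)" using False by (simp add: field_simps)
    have "norm (u a) = k * norm (cnj (cis \<alpha>) * y b - of_real (R$1$1) * y a)" unfolding ua by (simp add: norm_divide k_def)
    also have "\<dots> \<le> k * (norm (y b) + \<bar>R$1$1\<bar> * norm (y a))"
      using norm_triangle_ineq4[of "cnj (cis \<alpha>) * y b" "of_real (R$1$1) * y a"] k0
      by (intro mult_left_mono) (simp_all add: norm_mult)
    also have "\<dots> \<le> k * ((1 + \<bar>R$1$1\<bar>) * Y)"
      using k0 by (intro mult_left_mono) (simp_all add: Y_def algebra_simps)
    finally have ua': "norm (u a) \<le> k * (1 + \<bar>R$1$1\<bar>) * Y" by (simp add: mult.assoc)
    have "norm (u b) = norm (of_real (R$2$1) * y a + of_real (R$2$2) * u a)"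
      using B unfolding bc_def by (simp add: norm_mult)
    also have "\<dots> \<le> \<bar>R$2$1\<bar> * norm (y a) + \<bar>R$2$2\<bar> * norm (u a)"
      using norm_triangle_ineq[of "of_real (R$2$1) * y a" "of_real (R$2$2) * u a"] by (simp add: norm_mult)
    also have "\<dots> \<le> \<bar>R$2$1\<bar> * Y + \<bar>R$2$2\<bar> * (k * (1 + \<bar>R$1$1\<bar>) * Y)"
      by (intro add_mono mult_left_mono ua') (auto simp: Y_def)
    finally have ub': "norm (u b) \<le> \<bar>R$2$1\<bar> * Y + \<bar>R$2$2\<bar> * (k * (1 + \<bar>R$1$1\<bar>) * Y)" .
    have Y0: "Y \<ge> 0" by (simp add: Y_def)
    have CY: "C * Y = (\<bar>R$2$1\<bar> * Y + \<bar>R$2$2\<bar> * (k * (1 + \<bar>R$1$1\<bar>) * Y)) + k * (1 + \<bar>R$1$1\<bar>) * Y"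
      by (simp add: C_def algebra_simps)
    have "0 \<le> \<bar>R$2$1\<bar> * Y" "0 \<le> \<bar>R$2$2\<bar> * (k * (1 + \<bar>R$1$1\<bar>) * Y)" "0 \<le> k * (1 + \<bar>R$1$1\<bar>) * Y"
      using Y0 k0 by auto
    then have le: "norm (u a) \<le> C * Y" "norm (u b) \<le> C * Y" using ua' ub' CY by linarith+
    have "norm (cnj (y b) * u b - cnj (y a) * u a) \<le> norm (y b) * norm (u b) + norm (y a) * norm (u a)"
      using norm_triangle_ineq4[of "cnj (y b) * u b" "cnj (y a) * u a"] by (simp add: norm_mult)
    also have "\<dots> \<le> norm (y b) * (C * Y) + norm (y a) * (C * Y)" by (intro add_mono mult_left_mono le) auto
    also have "\<dots> = C * Y\<^sup>2" by (simp add: Y_def power2_eq_square algebra_simps)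
    also have "\<dots> \<le> C * (2 * ((norm (y a))\<^sup>2 + (norm (y b))\<^sup>2))"
      using sum_squares_bound[of "norm (y a)" "norm (y b)"] C0
      by (intro mult_left_mono) (simp_all add: Y_def power2_sum)
    finally show "norm (cnj (y b) * u b - cnj (y a) * u a) \<le> 2 * C * ((norm (y a))\<^sup>2 + (norm (y b))\<^sup>2)" by (simp add: algebra_simps)
  qed (use C0 in simp)
qed

end

text \<open>Minimising the right hand side at \<open>s = X / D\<close> gives the claim; if
  \<open>D = 0\<close>, letting \<open>s\<close> grow forces \<open>X = 0\<close>. It extracts a
  Cauchy-Schwarz bound from weighted inequalities that hold under the integral.\<close>

lemma square_le_of_quadratic:
  fixes X D Q :: real
  assumes "X \<ge> 0" "D \<ge> 0" and q: "\<And>s. s \<ge> 0 \<Longrightarrow> 2 * s * X \<le> s\<^sup>2 * D + Q"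
  shows "X\<^sup>2 \<le> D * Q"
proof (cases "D = 0")
  case True
  have "X = 0"
  proof (rule ccontr)
    assume "X \<noteq> 0"
    then have X: "X > 0" using assms by simp
    have Q: "Q \<ge> 0" using q[of 0] by simp
    then show False using q[of "(Q + 1) / (2 * X)"] X True by simp
  qed
  then show ?thesis using True by simp
next
  case False
  then have D: "D > 0" using assms by simp
  have "2 * (X / D) * X \<le> (X / D)\<^sup>2 * D + Q" using q[of "X / D"] D assms by simp
  then show ?thesis using D by (simp add: field_simps power2_eq_square)
qed

lemma real_indefinite_integral:
  fixes F :: "real \<Rightarrow> real"
  assumes F: "integrable (lebesgue_on {a<..<b}) F"
  defines "P \<equiv> \<lambda>x. LINT t:{a<..<x}|lebesgue. F t"
  shows "continuous_on {a..b} P"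
    "\<And>u v. \<lbrakk>a \<le> u; u \<le> v; v \<le> b\<rbrakk> \<Longrightarrow> P v - P u = (LINT t:{u<..<v}|lebesgue. F t)"
proof -
  have "integrable (lebesgue_on {a<..<b}) (\<lambda>x. complex_of_real (F x))" using F by simp
  from prim_indefinite[OF this, of 0]
  have P: "prim a b (\<lambda>x. complex_of_real (P x)) (\<lambda>x. complex_of_real (F x))"
    by (simp add: P_def set_integral_complex_of_real)
  show "continuous_on {a..b} P" using continuous_on_Re[OF prim_continuous_on[OF P]] by simp
  show "P v - P u = (LINT t:{u<..<v}|lebesgue. F t)" if "a \<le> u" "u \<le> v" "v \<le> b" for u v
    using prim_diff[OF P that] unfolding set_integral_complex_of_real of_real_diff[symmetric] of_real_eq_iff .
qed

lemma set_integral_mono_set_lebesgue_on: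
  fixes F :: "real \<Rightarrow> real"
  assumes F: "integrable (lebesgue_on {a<..<b}) F" and nn: "\<And>t. F t \<ge> 0" and uv: "a \<le> u" "v \<le> b"
  shows "(LINT t:{u<..<v}|lebesgue. F t) \<le> (\<integral>t. F t \<partial>lebesgue_on {a<..<b})"
proof -
  have sub: "{u<..<v} \<subseteq> {a<..<b}" using uv by auto
  note s = integrable_lebesgue_on_subset[OF F sub] integrable_lebesgue_on_subset[OF F order_refl]
  have "(LINT t:{u<..<v}|lebesgue. F t) \<le> (LINT t:{a<..<b}|lebesgue. F t)"
    unfolding set_lebesgue_integral_def
    by (rule Bochner_Integration.integral_mono)
      (use s sub nn in \<open>auto simp: set_integrable_def split: split_indicator\<close>)
  then show ?thesis by (simp add: integral_restrict_space set_lebesgue_integral_def)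
qed

section \<open>Energy estimates\<close>

context sturm_liouville begin

lemma set_integral_r_pos:
  assumes "a \<le> u" "u < v" "v \<le> b"
  shows "(LINT t:{u<..<v}|lebesgue. \<bar>r t\<bar>) > 0"
proof -
  have sub: "{u<..<v} \<subseteq> {a<..<b}" using assms by auto
  have s: "set_integrable lebesgue {u<..<v} (\<lambda>t. \<bar>r t\<bar>)"
    by (rule integrable_lebesgue_on_subset[OF integrable_abs[OF r_integrable] sub])
  have "(LINT t:{u<..<v}|lebesgue. \<bar>r t\<bar>) \<noteq> 0"
  proof
    assume "(LINT t:{u<..<v}|lebesgue. \<bar>r t\<bar>) = 0"
    then have "AE t in lebesgue. indicator {u<..<v} t *\<^sub>R \<bar>r t\<bar> = 0"
      unfolding set_lebesgue_integral_def
      by (subst (asm) integral_nonneg_eq_0_iff_AE) (use s in \<open>auto simp: set_integrable_def\<close>)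
    moreover have "AE t in lebesgue. t \<in> {a<..<b} \<longrightarrow> r t > 0" using r_pos by (simp add: AE_restrict_space_iff)
    ultimately have "AE t in lebesgue. t \<notin> {u<..<v}"
      by eventually_elim (use sub in \<open>auto split: split_indicator_asm\<close>)
    then have "{u<..<v} \<in> null_sets lebesgue" by (subst (asm) AE_iff_null_sets[symmetric]) auto
    then show False using assms by (auto simp: null_sets_def)
  qed
  moreover have "(LINT t:{u<..<v}|lebesgue. \<bar>r t\<bar>) \<ge> 0"
    unfolding set_lebesgue_integral_def by (rule Bochner_Integration.integral_nonneg) simp
  ultimately show ?thesis by simp
qed

lemma energy_integrable:
  assumes "continuous_on {a..b} u"
  shows "integrable N (\<lambda>t. (norm (u t))\<^sup>2 * \<bar>1 / p t\<bar>)"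
    "integrable N (\<lambda>t. (norm (u t))\<^sup>2 * \<bar>r t\<bar>)" "integrable N (\<lambda>t. (norm (u t))\<^sup>2 * \<bar>q t\<bar>)"
  by (rule integrable_continuous_mult[OF integrable_abs[OF p_integrable]]
     integrable_continuous_mult[OF integrable_abs[OF r_integrable]]
     integrable_continuous_mult[OF integrable_abs[OF q_integrable]], intro continuous_intros assms)+

text \<open>Cauchy-Schwarz with weight \<open>1 / p\<close> for \<open>y' = u / p\<close>: one
  factor is the energy, the other the mass of \<open>1 / p\<close> between the two points, which is
  small when they are close.\<close>

lemma oscillation_bound:
  assumes y: "prim a b y (\<lambda>x. u x / of_real (p x))" and u: "continuous_on {a..b} u"
    and tx: "a \<le> t" "t \<le> x" "x \<le> b"
  shows "(norm (y x - y t))\<^sup>2 \<le> (\<integral>s. (norm (u s))\<^sup>2 * \<bar>1 / p s\<bar> \<partial>N) * (LINT s:{t<..<x}|lebesgue. \<bar>1 / p s\<bar>)"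
proof (rule square_le_of_quadratic)
  have sub: "{t<..<x} \<subseteq> {a<..<b}" using tx by auto
  note i1 = integrable_lebesgue_on_subset[OF energy_integrable(1)[OF u] sub]
  note i2 = integrable_lebesgue_on_subset[OF integrable_abs[OF p_integrable] sub]
  note i3 = integrable_lebesgue_on_subset[OF div_p_integrable[OF u] sub]
  show "(\<integral>s. (norm (u s))\<^sup>2 * \<bar>1 / p s\<bar> \<partial>N) \<ge> 0" by (rule Bochner_Integration.integral_nonneg) simp
  fix s :: real assume s: "s \<ge> 0"
  have "norm (y x - y t) \<le> (LINT \<tau>:{t<..<x}|lebesgue. norm (u \<tau> / of_real (p \<tau>)))"
    unfolding prim_diff[OF y tx] by (rule set_integral_norm_bound[OF i3])
  then have "2 * s * norm (y x - y t) \<le> 2 * s * (LINT \<tau>:{t<..<x}|lebesgue. norm (u \<tau> / of_real (p \<tau>)))"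
    using s by (intro mult_left_mono) auto
  also have "\<dots> = (LINT \<tau>:{t<..<x}|lebesgue. 2 * s * norm (u \<tau> / of_real (p \<tau>)))"
    by (rule set_integral_mult_right[symmetric])
  also have "\<dots> \<le> (LINT \<tau>:{t<..<x}|lebesgue. s\<^sup>2 * ((norm (u \<tau>))\<^sup>2 * \<bar>1 / p \<tau>\<bar>) + \<bar>1 / p \<tau>\<bar>)"
  proof (rule set_integral_mono)
    show "set_integrable lebesgue {t<..<x} (\<lambda>\<tau>. 2 * s * norm (u \<tau> / of_real (p \<tau>)))"
      by (rule set_integrable_mult_right[OF set_integrable_norm[OF i3]])
    show "set_integrable lebesgue {t<..<x} (\<lambda>\<tau>. s\<^sup>2 * ((norm (u \<tau>))\<^sup>2 * \<bar>1 / p \<tau>\<bar>) + \<bar>1 / p \<tau>\<bar>)"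
      by (intro set_integral_add set_integrable_mult_right i1 i2)
    fix \<tau>
    have "2 * (s * norm (u \<tau>)) \<le> (s * norm (u \<tau>))\<^sup>2 + 1"
      using sum_squares_bound[of "s * norm (u \<tau>)" 1] by simp
    then have "2 * (s * norm (u \<tau>)) * \<bar>1 / p \<tau>\<bar> \<le> ((s * norm (u \<tau>))\<^sup>2 + 1) * \<bar>1 / p \<tau>\<bar>"
      by (rule mult_right_mono) simp
    then show "2 * s * norm (u \<tau> / of_real (p \<tau>)) \<le> s\<^sup>2 * ((norm (u \<tau>))\<^sup>2 * \<bar>1 / p \<tau>\<bar>) + \<bar>1 / p \<tau>\<bar>"
      by (simp add: norm_divide power_mult_distrib add_divide_distrib field_simps)
  qed
  also have "\<dots> = s\<^sup>2 * (LINT \<tau>:{t<..<x}|lebesgue. (norm (u \<tau>))\<^sup>2 * \<bar>1 / p \<tau>\<bar>) + (LINT s:{t<..<x}|lebesgue. \<bar>1 / p s\<bar>)"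
    by (subst set_integral_add(2)[OF set_integrable_mult_right[OF i1] i2]) (simp only: set_integral_mult_right)
  also have "\<dots> \<le> s\<^sup>2 * (\<integral>s. (norm (u s))\<^sup>2 * \<bar>1 / p s\<bar> \<partial>N) + (LINT s:{t<..<x}|lebesgue. \<bar>1 / p s\<bar>)"
    using set_integral_mono_set_lebesgue_on[OF energy_integrable(1)[OF u], of t x] tx
    by (intro add_right_mono mult_left_mono) auto
  finally show "2 * s * norm (y x - y t) \<le> s\<^sup>2 * (\<integral>s. (norm (u s))\<^sup>2 * \<bar>1 / p s\<bar> \<partial>N) + (LINT s:{t<..<x}|lebesgue. \<bar>1 / p s\<bar>)" .
qed simp

text \<open>On a short window around \<open>x\<close> the oscillation of \<open>y\<close> costs
  little energy, so \<open>norm (y x)\<close> is controlled by an \<open>r\<close>-weighted average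
  of \<open>y\<close> there. Compactness bounds the masses of all windows from below, which makes
  \<open>C\<close> independent of \<open>x\<close>.\<close>

lemma sup_bound:
  assumes \<epsilon>: "\<epsilon> > 0"
  shows "\<exists>C\<ge>0. \<forall>y u. prim a b y (\<lambda>x. u x / of_real (p x)) \<longrightarrow> continuous_on {a..b} u \<longrightarrow>
    (\<forall>x\<in>{a..b}. (norm (y x))\<^sup>2 \<le> \<epsilon> * (\<integral>s. (norm (u s))\<^sup>2 * \<bar>1 / p s\<bar> \<partial>N) + C * (\<integral>s. (norm (y s))\<^sup>2 * \<bar>r s\<bar> \<partial>N))"
proof -
  define P where "P = (\<lambda>x. LINT t:{a<..<x}|lebesgue. \<bar>1 / p t\<bar>)"
  define Rf where "Rf = (\<lambda>x. LINT t:{a<..<x}|lebesgue. \<bar>r t\<bar>)"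
  have Pp: "continuous_on {a..b} P" "\<And>u v. \<lbrakk>a \<le> u; u \<le> v; v \<le> b\<rbrakk> \<Longrightarrow> P v - P u = (LINT t:{u<..<v}|lebesgue. \<bar>1 / p t\<bar>)"
    unfolding P_def by (rule real_indefinite_integral[OF integrable_abs[OF p_integrable]]; assumption)+
  have Rp: "continuous_on {a..b} Rf" "\<And>u v. \<lbrakk>a \<le> u; u \<le> v; v \<le> b\<rbrakk> \<Longrightarrow> Rf v - Rf u = (LINT t:{u<..<v}|lebesgue. \<bar>r t\<bar>)"
    unfolding Rf_def by (rule real_indefinite_integral[OF integrable_abs[OF r_integrable]]; assumption)+
  \<comment> \<open>The squared oscillation will enter with a factor 2, hence
    \<open>\<epsilon> / 2\<close> for the increments of \<open>P\<close>.\<close>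
  have "uniformly_continuous_on {a..b} P" using Pp(1) by (intro compact_uniformly_continuous) auto
  then obtain \<delta>0 where \<delta>0: "\<delta>0 > 0" "\<And>x x'. \<lbrakk>x \<in> {a..b}; x' \<in> {a..b}; dist x' x < \<delta>0\<rbrakk> \<Longrightarrow> dist (P x') (P x) < \<epsilon> / 2"
    unfolding uniformly_continuous_on_def using \<epsilon> by (metis half_gt_zero)
  \<comment> \<open>The windows are cut off at the ends of the interval but keep positive length,
    even around \<open>a\<close> and \<open>b\<close>.\<close>
  define lo where "lo = (\<lambda>x. max a (x - \<delta>0))"
  define hi where "hi = (\<lambda>x. min b (x + \<delta>0))"
  define \<rho> where "\<rho> = (\<lambda>x. Rf (hi x) - Rf (lo x))"
  have lohi: "a \<le> lo x \<and> lo x < hi x \<and> hi x \<le> b \<and> lo x \<in> {a..b} \<and> hi x \<in> {a..b}" if "x \<in> {a..b}" for x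
    using that ab \<delta>0(1) by (auto simp: lo_def hi_def)
  have \<rho>c: "continuous_on {a..b} \<rho>"
    unfolding \<rho>_def lo_def hi_def using lohi
    by (intro continuous_intros continuous_on_compose2[OF Rp(1)]) (auto simp: lo_def hi_def)
  have \<rho>e: "\<rho> x = (LINT t:{lo x<..<hi x}|lebesgue. \<bar>r t\<bar>)" if "x \<in> {a..b}" for x
    unfolding \<rho>_def by (rule Rp(2)) (use lohi[OF that] in auto)
  have \<rho>pos: "\<rho> x > 0" if "x \<in> {a..b}" for x
    unfolding \<rho>e[OF that] using lohi[OF that] by (intro set_integral_r_pos) auto
  obtain x0 where x0: "x0 \<in> {a..b}" "\<And>x. x \<in> {a..b} \<Longrightarrow> \<rho> x0 \<le> \<rho> x"
    using continuous_attains_inf[OF compact_Icc _ \<rho>c] ab by force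
  show ?thesis
  proof (intro exI[of _ "2 / \<rho> x0"] conjI allI impI ballI)
    show "0 \<le> 2 / \<rho> x0" using \<rho>pos[OF x0(1)] by simp
    fix y u x assume y: "prim a b y (\<lambda>x. u x / complex_of_real (p x))" and u: "continuous_on {a..b} u" and x: "x \<in> {a..b}"
    define D where "D = (\<integral>s. (norm (u s))\<^sup>2 * \<bar>1 / p s\<bar> \<partial>N)"
    define NN where "NN = (\<integral>s. (norm (y s))\<^sup>2 * \<bar>r s\<bar> \<partial>N)"
    have D0: "D \<ge> 0" unfolding D_def by (rule Bochner_Integration.integral_nonneg) simp
    have NN0: "NN \<ge> 0" unfolding NN_def by (rule Bochner_Integration.integral_nonneg) simp
    have osc: "(norm (y x))\<^sup>2 \<le> 2 * (norm (y t))\<^sup>2 + \<epsilon> * D" if t: "t \<in> {lo x<..<hi x}" for t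
    proof -
      have tab: "t \<in> {a..b}" and d: "dist t x < \<delta>0" using t lohi[OF x] by (auto simp: lo_def hi_def dist_real_def)
      have PP: "\<bar>P t - P x\<bar> \<le> \<epsilon> / 2" using \<delta>0(2)[OF x tab d] by (simp add: dist_real_def)
      have "(norm (y x - y t))\<^sup>2 \<le> D * (\<epsilon> / 2)"
      proof (cases "t \<le> x")
        case True
        have "(norm (y x - y t))\<^sup>2 \<le> D * (P x - P t)"
          using oscillation_bound[OF y u, of t x] Pp(2)[of t x] True x tab by (simp add: D_def)
        also have "\<dots> \<le> D * (\<epsilon> / 2)" by (intro mult_left_mono D0) (use PP in linarith)
        finally show ?thesis .
      next
        case False
        have "(norm (y t - y x))\<^sup>2 \<le> D * (P t - P x)"
          using oscillation_bound[OF y u, of x t] Pp(2)[of x t] False x tab by (simp add: D_def)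
        also have "\<dots> \<le> D * (\<epsilon> / 2)" by (intro mult_left_mono D0) (use PP in linarith)
        finally show ?thesis by (simp add: norm_minus_commute)
      qed
      moreover have "(norm (y x))\<^sup>2 \<le> 2 * (norm (y t))\<^sup>2 + 2 * (norm (y x - y t))\<^sup>2"
      proof -
        have "(norm (y x))\<^sup>2 \<le> (norm (y t) + norm (y x - y t))\<^sup>2"
          using norm_triangle_ineq[of "y t" "y x - y t"] by (intro power_mono) auto
        also have "\<dots> \<le> 2 * (norm (y t))\<^sup>2 + 2 * (norm (y x - y t))\<^sup>2"
          using sum_squares_bound[of "norm (y t)" "norm (y x - y t)"] by (simp add: power2_sum)
        finally show ?thesis .
      qed
      ultimately show ?thesis by (simp add: mult.commute)
    qed
    have sub: "{lo x<..<hi x} \<subseteq> {a<..<b}" using lohi[OF x] by auto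
    have yc: "continuous_on {a..b} y" by (rule prim_continuous_on[OF y])
    note iy = integrable_lebesgue_on_subset[OF energy_integrable(2)[OF yc] sub]
    note ir = integrable_lebesgue_on_subset[OF integrable_abs[OF r_integrable] sub]
    have "(norm (y x))\<^sup>2 * \<rho> x = (LINT t:{lo x<..<hi x}|lebesgue. (norm (y x))\<^sup>2 * \<bar>r t\<bar>)"
      unfolding \<rho>e[OF x] by (rule set_integral_mult_right[symmetric])
    also have "\<dots> \<le> (LINT t:{lo x<..<hi x}|lebesgue. 2 * ((norm (y t))\<^sup>2 * \<bar>r t\<bar>) + \<epsilon> * D * \<bar>r t\<bar>)"
    proof (rule set_integral_mono)
      show "set_integrable lebesgue {lo x<..<hi x} (\<lambda>t. (norm (y x))\<^sup>2 * \<bar>r t\<bar>)"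
        by (intro set_integrable_mult_right ir)
      show "set_integrable lebesgue {lo x<..<hi x} (\<lambda>t. 2 * ((norm (y t))\<^sup>2 * \<bar>r t\<bar>) + \<epsilon> * D * \<bar>r t\<bar>)"
        by (intro set_integral_add set_integrable_mult_right ir iy)
      show "(norm (y x))\<^sup>2 * \<bar>r t\<bar> \<le> 2 * ((norm (y t))\<^sup>2 * \<bar>r t\<bar>) + \<epsilon> * D * \<bar>r t\<bar>" if "t \<in> {lo x<..<hi x}" for t
        using mult_right_mono[OF osc[OF that], of "\<bar>r t\<bar>"] by (simp add: algebra_simps)
    qed
    also have "\<dots> = 2 * (LINT t:{lo x<..<hi x}|lebesgue. (norm (y t))\<^sup>2 * \<bar>r t\<bar>) + \<epsilon> * D * \<rho> x"
      unfolding \<rho>e[OF x] by (subst set_integral_add(2)) (auto intro!: set_integrable_mult_right ir iy)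
    also have "\<dots> \<le> 2 * NN + \<epsilon> * D * \<rho> x"
      using set_integral_mono_set_lebesgue_on[OF energy_integrable(2)[OF yc], of "lo x" "hi x"] lohi[OF x]
      by (simp add: NN_def)
    finally have "(norm (y x))\<^sup>2 \<le> \<epsilon> * D + 2 / \<rho> x * NN"
      using \<rho>pos[OF x] by (simp add: field_simps)
    also have "\<dots> \<le> \<epsilon> * D + 2 / \<rho> x0 * NN"
      using x0(2)[OF x] \<rho>pos[OF x0(1)] NN0 by (intro add_left_mono mult_right_mono divide_left_mono) auto
    finally show "(norm (y x))\<^sup>2 \<le> \<epsilon> * (\<integral>s. (norm (u s))\<^sup>2 * \<bar>1 / p s\<bar> \<partial>N) + 2 / \<rho> x0 * (\<integral>s. (norm (y s))\<^sup>2 * \<bar>r s\<bar> \<partial>N)"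
      by (simp add: D_def NN_def)
  qed
qed

end

context coupled begin

text \<open>Integrate the derivative of \<open>cnj y * u\<close>, which is
  \<open>\<bar>u\<bar>^2 / p + q \<bar>y\<bar>^2 - r * cnj y * h\<close>.\<close>

lemma energy_identity:
  assumes t: "trel h y u"
  shows "l2_inner M y h = of_real ((\<integral>s. (norm (u s))\<^sup>2 * \<bar>1 / p s\<bar> \<partial>N) + (\<integral>s. (norm (y s))\<^sup>2 * q s \<partial>N))
    - (cnj (y b) * u b - cnj (y a) * u a)"
proof -
  have s: "sys h y u" using t by (simp add: trel_def)
  note c = sys_cnj[OF s] and yu = sys_continuous[OF s]
  have P: "prim a b (\<lambda>x. cnj (y x) * u x)
      (\<lambda>x. of_real ((norm (u x))\<^sup>2 * (1 / p x) + (norm (y x))\<^sup>2 * q x) - of_real (r x) * (cnj (y x) * h x))"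
    by (rule prim_eqI[OF prim_mult[OF sysD(1)[OF c] sysD(2)[OF s]]])
      (simp_all add: complex_norm_square algebra_simps del: of_real_power)
  have i1: "integrable N (\<lambda>x. (norm (u x))\<^sup>2 * (1 / p x))" "integrable N (\<lambda>x. (norm (y x))\<^sup>2 * q x)"
    by (rule integrable_continuous_mult[OF p_integrable] integrable_continuous_mult[OF q_integrable], intro continuous_intros yu)+
  have i2: "integrable N (\<lambda>x. complex_of_real ((norm (u x))\<^sup>2 * (1 / p x) + (norm (y x))\<^sup>2 * q x))"
    by (intro integrable_of_real Bochner_Integration.integrable_add i1)
  have "(cnj (y b) * u b - cnj (y a) * u a) = (\<integral>x. of_real ((norm (u x))\<^sup>2 * (1 / p x) + (norm (y x))\<^sup>2 * q x) - of_real (r x) * (cnj (y x) * h x) \<partial>N)"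
    using prim_integral[OF P] ab by simp
  also have "\<dots> = (\<integral>x. complex_of_real ((norm (u x))\<^sup>2 * (1 / p x) + (norm (y x))\<^sup>2 * q x) \<partial>N) - l2_inner M y h"
    using inner_M[OF trel_L2(2,1)[OF t]] i2 by (simp only: Bochner_Integration.integral_diff)
  also have "(\<integral>x. complex_of_real ((norm (u x))\<^sup>2 * (1 / p x) + (norm (y x))\<^sup>2 * q x) \<partial>N)
     = of_real ((\<integral>x. (norm (u x))\<^sup>2 * (1 / p x) \<partial>N) + (\<integral>x. (norm (y x))\<^sup>2 * q x \<partial>N))"
    using i1 by (simp only: integral_complex_of_real Bochner_Integration.integral_add)
  also have "(\<integral>x. (norm (u x))\<^sup>2 * (1 / p x) \<partial>N) = (\<integral>x. (norm (u x))\<^sup>2 * \<bar>1 / p x\<bar> \<partial>N)"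
    by (rule integral_cong_AE) (use i1(1) energy_integrable(1)[OF yu(2)] p_pos in \<open>auto elim!: eventually_mono\<close>)
  finally show ?thesis by (simp add: algebra_simps)
qed

text \<open>The potential and the boundary terms are at most \<open>K\<close> times the squared
  supremum of \<open>y\<close>. The supremum bound with weight \<open>1 / (K + 1)\<close> charges at
  most the available energy for them, so the energy absorbs this part and only a multiple of
  \<open>nsq M y\<close> remains.\<close>

lemma lower_bound: "\<exists>c. \<forall>h y u. trel h y u \<longrightarrow> c * nsq M y \<le> Re (l2_inner M y h)"
proof -
  obtain C where C: "C \<ge> 0" "\<And>y u. bc y u \<Longrightarrow> norm (cnj (y b) * u b - cnj (y a) * u a) \<le> C * ((norm (y a))\<^sup>2 + (norm (y b))\<^sup>2)"
    using boundary_bound by blast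
  define Q where "Q = (\<integral>s. \<bar>q s\<bar> \<partial>N)"
  have Q0: "Q \<ge> 0" unfolding Q_def by (rule Bochner_Integration.integral_nonneg) simp
  \<comment> \<open>\<open>Q\<close> comes from the potential, \<open>2 * C\<close> from the
    boundary terms at the two endpoints.\<close>
  define K where "K = Q + 2 * C"
  have K0: "K \<ge> 0" using Q0 C by (simp add: K_def)
  have "1 / (K + 1) > 0" using K0 by simp
  from sup_bound[OF this] obtain C' where C': "C' \<ge> 0" "\<And>y u x. \<lbrakk>prim a b y (\<lambda>x. u x / of_real (p x)); continuous_on {a..b} u; x \<in> {a..b}\<rbrakk> \<Longrightarrow>
    (norm (y x))\<^sup>2 \<le> 1 / (K + 1) * (\<integral>s. (norm (u s))\<^sup>2 * \<bar>1 / p s\<bar> \<partial>N) + C' * (\<integral>s. (norm (y s))\<^sup>2 * \<bar>r s\<bar> \<partial>N)"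
    by blast
  have "- (K * C') * nsq M y \<le> Re (l2_inner M y h)" if t: "trel h y u" for h y u
  proof -
    have s: "sys h y u" and B: "bc y u" using t by (auto simp: trel_def)
    note yu = sys_continuous[OF s]
    define D where "D = (\<integral>s. (norm (u s))\<^sup>2 * \<bar>1 / p s\<bar> \<partial>N)"
    have D0: "D \<ge> 0" unfolding D_def by (rule Bochner_Integration.integral_nonneg) simp
    have NN: "(\<integral>s. (norm (y s))\<^sup>2 * \<bar>r s\<bar> \<partial>N) = nsq M y"
      unfolding nsq_M(1)[OF trel_L2(2)[OF t]]
      by (rule integral_cong_AE) (use nsq_M(2)[OF trel_L2(2)[OF t]] energy_integrable(2)[OF yu(1)] r_pos in \<open>auto elim!: eventually_mono\<close>)
    define S where "S = 1 / (K + 1) * D + C' * nsq M y"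
    have S: "(norm (y x))\<^sup>2 \<le> S" if "x \<in> {a..b}" for x
      using C'(2)[OF sysD(1)[OF s] yu(2) that] by (simp add: S_def D_def NN)
    have i: "integrable N (\<lambda>x. (norm (y x))\<^sup>2 * q x)" "integrable N (\<lambda>x. (norm (y x))\<^sup>2 * \<bar>q x\<bar>)"
      by (rule integrable_continuous_mult[OF q_integrable] integrable_continuous_mult[OF integrable_abs[OF q_integrable]], intro continuous_intros yu)+
    have "\<bar>\<integral>s. (norm (y s))\<^sup>2 * q s \<partial>N\<bar> \<le> (\<integral>s. \<bar>(norm (y s))\<^sup>2 * q s\<bar> \<partial>N)" by (rule integral_abs_bound)
    also have "\<dots> \<le> (\<integral>s. S * \<bar>q s\<bar> \<partial>N)"
      by (rule Bochner_Integration.integral_mono)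
        (use i q_integrable S in \<open>auto simp: abs_mult intro!: mult_right_mono\<close>)
    finally have qb: "\<bar>\<integral>s. (norm (y s))\<^sup>2 * q s \<partial>N\<bar> \<le> S * Q" by (simp add: Q_def)
    have "norm (cnj (y b) * u b - cnj (y a) * u a) \<le> C * ((norm (y a))\<^sup>2 + (norm (y b))\<^sup>2)" by (rule C(2)[OF B])
    also have "\<dots> \<le> C * (S + S)" using C ab by (intro mult_left_mono add_mono S) auto
    also have "C * (S + S) = 2 * C * S" by simp
    finally have "\<bar>Re (cnj (y b) * u b - cnj (y a) * u a)\<bar> \<le> 2 * C * S"
      using abs_Re_le_cmod[of "cnj (y b) * u b - cnj (y a) * u a"] by linarith
    then have "D - K * S \<le> Re (l2_inner M y h)"
      using qb unfolding energy_identity[OF t] D_def[symmetric] by (simp add: K_def algebra_simps)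
    moreover have "K * S = K / (K + 1) * D + K * C' * nsq M y" by (simp add: S_def algebra_simps)
    moreover have "K / (K + 1) * D \<le> 1 * D" using K0 D0 by (intro mult_right_mono) auto
    ultimately show ?thesis by simp
  qed
  then show ?thesis by blast
qed

section \<open>The Green kernel\<close>

abbreviation "A0 \<equiv> bc_coeff a b p q r \<alpha> R 0 + cis (2 * \<alpha>) + 1"

text \<open>The entries of \<open>cis \<alpha> R\<close> minus the fundamental matrix at
  \<open>b\<close>. Initial data annihilated by this matrix are exactly those of the solutions at
  spectral parameter 0 that meet the boundary conditions.\<close>

definition "B11 = cis \<alpha> * of_real (R$1$1) - \<theta> b"
definition "B12 = cis \<alpha> * of_real (R$1$2) - \<phi> b"
definition "B21 = cis \<alpha> * of_real (R$2$1) - \<theta>' b"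
definition "B22 = cis \<alpha> * of_real (R$2$2) - \<phi>' b"

lemma bc_coeff_0: "bc_coeff a b p q r \<alpha> R 0 = bc_form \<alpha> R (\<theta>' b) (\<theta> b) (\<phi> b) (\<phi>' b)"
  by (simp add: bc_coeff_def theta1_k_def theta_k_def phi_k_def phi1_k_def sl_theta1_def sl_phi1_def)

lemma char_fun_0: "char_fun a b p q r \<alpha> R 0 = A0"
  by (simp add: char_fun_def bc_coeff_0)

text \<open>The mixed terms of the determinant form the linear part of the characteristic function;
  the two pure ones are \<open>cis (2 * \<alpha>) * det R\<close> and the Wronskian, which is
  1.\<close>

lemma det_B: "B11 * B22 - B12 * B21 = A0"
proof -
  have e2: "cis (2 * \<alpha>) = cis \<alpha> * cis \<alpha>" by (simp add: cis_mult)
  have W: "\<theta> b * \<phi>' b - \<theta>' b * \<phi> b = 1" using wronskian[of b] ab by simp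
  have d: "complex_of_real (R$1$1) * of_real (R$2$2) - of_real (R$1$2) * of_real (R$2$1) = 1"
    unfolding of_real_mult[symmetric] of_real_diff[symmetric] det_R' by simp
  have "B11 * B22 - B12 * B21 = bc_form \<alpha> R (\<theta>' b) (\<theta> b) (\<phi> b) (\<phi>' b)
     + cis \<alpha> * cis \<alpha> * (of_real (R$1$1) * of_real (R$2$2) - of_real (R$1$2) * of_real (R$2$1))
     + (\<theta> b * \<phi>' b - \<theta>' b * \<phi> b)"
    unfolding B11_def B12_def B21_def B22_def bc_form_def by (simp add: algebra_simps)
  then show ?thesis unfolding W d bc_coeff_0 e2 by simp
qed

lemma homogeneous_solution:
  assumes s: "sys (\<lambda>_. 0) y u" and x: "x \<in> {a..b}"
  shows "y x = y a * \<theta> x + u a * \<phi> x" "u x = y a * \<theta>' x + u a * \<phi>' x"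
proof -
  have "sys (\<lambda>x. 0 * (y a * \<theta> x + u a * \<phi> x)) (\<lambda>x. y a * \<theta> x + u a * \<phi> x) (\<lambda>x. y a * \<theta>' x + u a * \<phi>' x)"
    using sys_add[OF sys_cmult[OF theta_sys(1), of "y a"] sys_cmult[OF phi_sys(1), of "u a"]] by simp
  moreover have "sys (\<lambda>x. 0 * y x) y u" using s by simp
  ultimately show "y x = y a * \<theta> x + u a * \<phi> x" "u x = y a * \<theta>' x + u a * \<phi>' x"
    using sys_diff_zero[of 0 y u _ _ x] x theta_sys phi_sys by auto
qed

lemma bc_homogeneous:
  assumes "y a = c" "u a = d" "y b = c * \<theta> b + d * \<phi> b + y1" "u b = c * \<theta>' b + d * \<phi>' b + u1"
  shows "bc y u \<longleftrightarrow> B11 * c + B12 * d = y1 \<and> B21 * c + B22 * d = u1"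
  unfolding bc_def assms B11_def B12_def B21_def B22_def by (auto simp: algebra_simps)

lemma trel_zero_unique:
  assumes A: "A0 \<noteq> 0" and t: "trel (\<lambda>_. 0) y u"
  shows "y = (\<lambda>_. 0)"
proof -
  have s: "sys (\<lambda>_. 0) y u" and B: "bc y u" and sp: "supp y" using t by (auto simp: trel_def)
  have bb: "b \<in> {a..b}" using ab by simp
  have "B11 * y a + B12 * u a = 0" "B21 * y a + B22 * u a = 0"
    using bc_homogeneous[of y "y a" u "u a" 0 0] homogeneous_solution[OF s bb] B by auto
  then have "(B11 * B22 - B12 * B21) * y a = 0" "(B11 * B22 - B12 * B21) * u a = 0" by algebra+
  then have "y a = 0" "u a = 0" using A det_B by auto
  then show ?thesis using homogeneous_solution(1)[OF s] sp by (intro supp_ext) (auto simp: supp_def)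
qed

lemma trel_diff:
  assumes "trel h y u" "trel h' y' u'"
  shows "trel (\<lambda>x. h x - h' x) (\<lambda>x. y x - y' x) (\<lambda>x. u x - u' x)"
  using trel_add[OF assms(1) trel_cmult[OF assms(2), of "-1"]] by simp

lemma trel_unique:
  assumes A: "A0 \<noteq> 0" and t: "trel h y u" "trel h y' u'"
  shows "y = y'"
  using trel_zero_unique[OF A, of "\<lambda>x. y x - y' x"] trel_diff[OF t] by (auto simp: fun_eq_iff)

lemma trel_zero_exists:
  assumes A: "A0 = 0"
  shows "\<exists>y u. trel (\<lambda>_. 0) y u \<and> y \<noteq> (\<lambda>_. 0)"
proof -
  have bb: "b \<in> {a..b}" and aa: "a \<in> {a..b}" using ab by auto
  have d: "B11 * B22 = B12 * B21" using det_B A by simp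
  \<comment> \<open>A kernel vector of the singular matrix: perpendicular to a nonzero row, or
    arbitrary if both rows vanish.\<close>
  obtain c1 c2 where c: "c1 \<noteq> 0 \<or> c2 \<noteq> 0" "B11 * c1 + B12 * c2 = 0" "B21 * c1 + B22 * c2 = 0"
  proof (cases "B11 = 0 \<and> B12 = 0")
    case True
    show ?thesis
    proof (cases "B21 = 0 \<and> B22 = 0")
      case T2: True
      show ?thesis by (rule that[of 1 1]) (use True T2 in auto)
    next
      case False
      show ?thesis by (rule that[of B22 "- B21"]) (use True False in auto)
    qed
  next
    case False
    show ?thesis by (rule that[of B12 "- B11"]) (use False d in \<open>auto simp: algebra_simps\<close>)
  qed
  define y where "y = trunc (\<lambda>x. c1 * \<theta> x + c2 * \<phi> x)"
  define u where "u = trunc (\<lambda>x. c1 * \<theta>' x + c2 * \<phi>' x)"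
  have s0: "sys (\<lambda>x. 0 * (c1 * \<theta> x + c2 * \<phi> x)) (\<lambda>x. c1 * \<theta> x + c2 * \<phi> x) (\<lambda>x. c1 * \<theta>' x + c2 * \<phi>' x)"
    using sys_add[OF sys_cmult[OF theta_sys(1), of c1] sys_cmult[OF phi_sys(1), of c2]] by simp
  have s: "sys (\<lambda>_. 0) y u" using sys_trunc[OF s0] by (simp add: y_def u_def)
  have v: "y a = c1" "u a = c2" "y b = c1 * \<theta> b + c2 * \<phi> b + 0" "u b = c1 * \<theta>' b + c2 * \<phi>' b + 0"
    using aa bb theta_sys phi_sys by (auto simp: y_def u_def)
  have "bc y u" using bc_homogeneous[of y c1 u c2, OF v] c by simp
  then have t: "trel (\<lambda>_. 0) y u" using s by (simp add: trel_def y_def u_def)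
  \<comment> \<open>If \<open>y\<close> vanished, so would its density \<open>u / p\<close>, hence
    \<open>u\<close> by continuity, and both initial values \<open>c1\<close> and \<open>c2\<close>
    would be 0.\<close>
  moreover have "y \<noteq> (\<lambda>_. 0)"
  proof
    assume y0: "y = (\<lambda>_. 0)"
    have "nsq M y = 0" by (simp add: y0 nsq_def)
    have "prim a b y (\<lambda>x. 0)" using prim_const[of a b 0] by (simp add: y0)
    have "u b = 0 \<and> u a = 0"
    proof -
      have "AE x in N. u x / of_real (p x) = 0"
        using prim_unique[OF sysD(1)[OF s] \<open>prim a b y (\<lambda>x. 0)\<close>] by simp
      then have "AE x in N. u x = 0" using p_pos by eventually_elim simp
      then show ?thesis using aa bb sys_continuous(2)[OF s]
        by (auto intro: continuous_AE_eq[OF ab _ continuous_on_const])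
    qed
    then show False using v(1,2) c(1) y0 by auto
  qed
  ultimately show ?thesis by blast
qed

abbreviation "g0 \<equiv> green0 a b p q r"
abbreviation "g1 \<equiv> green0_1 a b p q r"

text \<open>Cramer's rule: integrated against \<open>r * h\<close>, these two give the multiples of
  \<theta> and \<phi> that correct the variation of parameters solution so that it meets the
  boundary conditions.\<close>

definition "k1 t = (B22 * g0 b t - B12 * g1 b t) / A0"
definition "k2 t = (B11 * g1 b t - B21 * g0 b t) / A0"

definition green_kernel :: "real \<Rightarrow> real \<Rightarrow> complex" where
  "green_kernel x t = \<theta> x * k1 t + \<phi> x * k2 t + (if t < x then g0 x t else 0)"

definition green :: "(real \<Rightarrow> complex) \<Rightarrow> real \<Rightarrow> complex" where
  "green h = trunc (\<lambda>x. \<integral>t. green_kernel x t * (of_real (r t) * h t) \<partial>N)"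

lemma g_cont: "continuous_on {a..b} (g0 x)" "continuous_on {a..b} (g1 x)"
  unfolding green0_def green0_1_def by (intro continuous_intros theta_cont phi_cont)+

lemma k_cont: "continuous_on {a..b} k1" "continuous_on {a..b} k2"
  unfolding k1_def k2_def divide_inverse by (intro continuous_intros g_cont)+

text \<open>The jump in the definition does no harm, because \<open>g0\<close> vanishes on the
  diagonal where the two branches meet.\<close>

lemma kernel_continuous: "continuous_on ({a..b} \<times> {a..b}) (\<lambda>z. green_kernel (fst z) (snd z))"
proof -
  have *: "continuous_on ({a..b} \<times> {a..b}) (\<lambda>z. f (fst z))" "continuous_on ({a..b} \<times> {a..b}) (\<lambda>z. f (snd z))"
    if "continuous_on {a..b} f" for f :: "real \<Rightarrow> complex"
    by (auto intro!: continuous_on_compose2[OF that] continuous_intros)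
  have "continuous_on ({z \<in> {a..b} \<times> {a..b}. snd z \<le> fst z} \<union> {z \<in> {a..b} \<times> {a..b}. fst z \<le> snd z})
     (\<lambda>z. if snd z < fst z then g0 (fst z) (snd z) else 0)"
  proof (rule continuous_on_cases)
    have cl: "closed {z :: real \<times> real. snd z \<le> fst z}" "closed {z :: real \<times> real. fst z \<le> snd z}"
      by (intro closed_Collect_le continuous_intros)+
    have "closed ({a..b} \<times> {a..b} \<inter> {z. snd z \<le> fst z})" "closed ({a..b} \<times> {a..b} \<inter> {z. fst z \<le> snd z})"
      by (intro closed_Int closed_Times closed_atLeastAtMost cl)+
    then show "closed {z \<in> {a..b} \<times> {a..b}. snd z \<le> fst z}" "closed {z \<in> {a..b} \<times> {a..b}. fst z \<le> snd z}"
      by (simp_all add: Int_def)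
    have "continuous_on ({a..b} \<times> {a..b}) (\<lambda>z. g0 (fst z) (snd z))"
      unfolding green0_def by (intro continuous_intros * theta_cont phi_cont)
    then show "continuous_on {z \<in> {a..b} \<times> {a..b}. snd z \<le> fst z} (\<lambda>z. g0 (fst z) (snd z))"
      by (rule continuous_on_subset) auto
  qed (auto simp: green0_def)
  moreover have "{z \<in> {a..b} \<times> {a..b}. snd z \<le> fst z} \<union> {z \<in> {a..b} \<times> {a..b}. fst z \<le> snd z} = {a..b} \<times> {a..b}"
    by auto
  ultimately show ?thesis unfolding green_kernel_def by (auto intro!: continuous_intros * theta_cont phi_cont k_cont)
qed

lemma kernel_bounded: "\<exists>C>0. \<forall>x\<in>{a..b}. \<forall>t\<in>{a..b}. norm (green_kernel x t) \<le> C"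
proof -
  have "bounded ((\<lambda>z. green_kernel (fst z) (snd z)) ` ({a..b} \<times> {a..b}))"
    by (intro compact_imp_bounded compact_continuous_image kernel_continuous compact_Times compact_Icc)
  then obtain C where "C > 0" "\<forall>y\<in>(\<lambda>z. green_kernel (fst z) (snd z)) ` ({a..b} \<times> {a..b}). norm y \<le> C"
    unfolding bounded_pos by blast
  then show ?thesis by (intro exI[of _ C]) force
qed

lemma kernel_continuous_snd:
  assumes "x \<in> {a..b}" shows "continuous_on {a..b} (green_kernel x)"
proof -
  have "continuous_on {a..b} (\<lambda>t. (x, t))" by (intro continuous_on_Pair continuous_on_const continuous_on_id)
  moreover have "(\<lambda>t. (x, t)) ` {a..b} \<subseteq> {a..b} \<times> {a..b}" using assms by auto
  ultimately show ?thesis using continuous_on_compose2[OF kernel_continuous] by force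
qed

text \<open>The particular solution vanishes at \<open>a\<close> together with its quasi-derivative,
  so \<open>c1\<close> and \<open>c2\<close> are the initial data of the sum, and the boundary
  conditions become the linear system solved by Cramer's rule.\<close>

lemma green_trel:
  assumes A: "A0 \<noteq> 0" and h: "h \<in> L2 M"
  shows "\<exists>u. trel h (green h) u"
proof -
  note rh = L2_integrable(1)[OF h]
  have bb: "b \<in> {a..b}" and aa: "a \<in> {a..b}" using ab by auto
  define yp where "yp = (\<lambda>x. LINT t:{a<..<x}|lebesgue. of_real (r t) * g0 x t * h t)"
  define up where "up = (\<lambda>x. LINT t:{a<..<x}|lebesgue. of_real (r t) * g1 x t * h t)"
  have sp: "sys h yp up" unfolding yp_def up_def by (rule variation_of_parameters[OF rh])
  define c1 where "c1 = (\<integral>t. k1 t * (of_real (r t) * h t) \<partial>N)"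
  define c2 where "c2 = (\<integral>t. k2 t * (of_real (r t) * h t) \<partial>N)"
  have i: "integrable N (\<lambda>t. f t * (of_real (r t) * h t))" if "continuous_on {a..b} f" for f
    by (rule integrable_continuous_mult[OF rh that])
  have ypb: "yp b = (\<integral>t. g0 b t * (of_real (r t) * h t) \<partial>N)" "up b = (\<integral>t. g1 b t * (of_real (r t) * h t) \<partial>N)"
    by (simp_all add: yp_def up_def integral_restrict_space set_lebesgue_integral_def mult_ac)
  have c1e: "c1 = (B22 * yp b - B12 * up b) / A0"
  proof -
    have "c1 = (\<integral>t. (B22 / A0) * (g0 b t * (of_real (r t) * h t)) - (B12 / A0) * (g1 b t * (of_real (r t) * h t)) \<partial>N)"
      unfolding c1_def k1_def by (simp add: algebra_simps diff_divide_distrib)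
    also have "\<dots> = (B22 / A0) * yp b - (B12 / A0) * up b" unfolding ypb
      by (subst Bochner_Integration.integral_diff) (auto intro!: integrable_mult_right i g_cont simp del: times_divide_eq_left)
    finally show ?thesis by (simp add: diff_divide_distrib)
  qed
  have c2e: "c2 = (B11 * up b - B21 * yp b) / A0"
  proof -
    have "c2 = (\<integral>t. (B11 / A0) * (g1 b t * (of_real (r t) * h t)) - (B21 / A0) * (g0 b t * (of_real (r t) * h t)) \<partial>N)"
      unfolding c2_def k2_def by (simp add: algebra_simps diff_divide_distrib)
    also have "\<dots> = (B11 / A0) * up b - (B21 / A0) * yp b" unfolding ypb
      by (subst Bochner_Integration.integral_diff) (auto intro!: integrable_mult_right i g_cont simp del: times_divide_eq_left)
    finally show ?thesis by (simp add: diff_divide_distrib)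
  qed
  define y where "y = (\<lambda>x. c1 * \<theta> x + c2 * \<phi> x + yp x)"
  define u where "u = (\<lambda>x. c1 * \<theta>' x + c2 * \<phi>' x + up x)"
  have s: "sys h y u"
    using sys_add[OF sys_add[OF sys_cmult[OF theta_sys(1), of c1] sys_cmult[OF phi_sys(1), of c2]] sp]
    by (simp add: y_def u_def)
  have ya: "y a = c1" "u a = c2" using theta_sys phi_sys by (auto simp: y_def u_def yp_def up_def set_lebesgue_integral_def)
  have B: "B11 * c1 + B12 * c2 = yp b" "B21 * c1 + B22 * c2 = up b"
  proof -
    have "B11 * c1 + B12 * c2 = (B11 * B22 - B12 * B21) * yp b / A0" unfolding c1e c2e
      by (simp add: add_divide_distrib[symmetric] algebra_simps)
    then show "B11 * c1 + B12 * c2 = yp b" unfolding det_B using A by simp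
    have "B21 * c1 + B22 * c2 = (B11 * B22 - B12 * B21) * up b / A0" unfolding c1e c2e
      by (simp add: add_divide_distrib[symmetric] algebra_simps)
    then show "B21 * c1 + B22 * c2 = up b" unfolding det_B using A by simp
  qed
  have gy: "green h x = y x" if x: "x \<in> {a..b}" for x
  proof -
    have "{a<..<b} \<inter> {..<x} \<in> sets N" unfolding sets_restrict_space by (rule imageI) simp
    note ind = integrable_mult_indicator[OF this i[OF g_cont(1)[of x]]]
    have eq: "(if t < x then g0 x t else 0) * (of_real (r t) * h t) =
        indicator ({a<..<b} \<inter> {..<x}) t *\<^sub>R (g0 x t * (of_real (r t) * h t))" if "t \<in> space N" for t
      using that by (simp add: indicator_def)
    have i3: "integrable N (\<lambda>t. (if t < x then g0 x t else 0) * (of_real (r t) * h t))"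
      using ind by (subst Bochner_Integration.integrable_cong[OF refl eq])
    have "green h x = (\<integral>t. \<theta> x * (k1 t * (of_real (r t) * h t)) + \<phi> x * (k2 t * (of_real (r t) * h t))
        + (if t < x then g0 x t else 0) * (of_real (r t) * h t) \<partial>N)"
      using x by (simp add: green_def green_kernel_def algebra_simps)
    also have "\<dots> = \<theta> x * c1 + \<phi> x * c2 + (\<integral>t. (if t < x then g0 x t else 0) * (of_real (r t) * h t) \<partial>N)"
      unfolding c1_def c2_def
      by (subst Bochner_Integration.integral_add, intro Bochner_Integration.integrable_add integrable_mult_right i k_cont, rule i3,
        subst Bochner_Integration.integral_add, (intro integrable_mult_right i k_cont)+, simp)
    also have "(\<integral>t. (if t < x then g0 x t else 0) * (of_real (r t) * h t) \<partial>N) = yp x"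
      unfolding yp_def set_lebesgue_integral_def using x
      by (subst integral_restrict_space) (auto intro!: Bochner_Integration.integral_cong split: split_indicator)
    finally show ?thesis by (simp add: y_def mult.commute)
  qed
  have "sys h (green h) (trunc u)"
    by (rule sys_cong[OF s gy]) (use L2_integrable(2)[OF h] in auto)
  moreover have "bc (green h) (trunc u)"
    using bc_homogeneous[of "green h" c1 "trunc u" c2 "yp b" "up b"] gy aa bb ya B
    by (simp add: y_def u_def)
  moreover have "supp (green h)" by (simp add: green_def)
  ultimately show ?thesis using h unfolding trel_def by (intro exI[of _ "trunc u"]) simp
qed

lemma weighted_integral_bound:
  assumes h: "h \<in> L2 M" and kc: "continuous_on {a..b} k"
    and C: "\<And>t. t \<in> {a..b} \<Longrightarrow> norm (k t) \<le> C" and C0: "C \<ge> 0"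
  shows "norm (\<integral>t. k t * (of_real (r t) * h t) \<partial>N) \<le> C * sqrt (\<integral>t. r t \<partial>N) * sqrt (nsq M h)"
proof -
  define k' where "k' = (\<lambda>t. cnj (k t))"
  have kL: "k' \<in> L2 M" unfolding k'_def by (intro L2_continuous continuous_intros kc)
  have eq: "(\<integral>t. k t * (of_real (r t) * h t) \<partial>N) = l2_inner M k' h"
    unfolding inner_M(1)[OF kL h] by (simp add: k'_def mult.left_commute)
  have "nsq M k' \<le> (\<integral>t. C\<^sup>2 * r t \<partial>N)"
    unfolding nsq_M(1)[OF kL]
  proof (rule integral_mono_AE[OF nsq_M(2)[OF kL] integrable_mult_right[OF r_integrable]])
    show "AE t in N. r t * (norm (k' t))\<^sup>2 \<le> C\<^sup>2 * r t"
      using r_pos AE_in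
    proof eventually_elim
      case (elim t)
      have "(norm (k' t))\<^sup>2 \<le> C\<^sup>2" using C[of t] elim by (intro power_mono) (auto simp: k'_def)
      then show ?case using elim by (subst mult.commute) (auto intro: mult_right_mono)
    qed
  qed
  then have nk: "nsq M k' \<le> C\<^sup>2 * (\<integral>t. r t \<partial>N)" by simp
  have "norm (l2_inner M k' h) \<le> sqrt (nsq M k') * sqrt (nsq M h)" by (rule norm_inner_le[OF kL h])
  also have "\<dots> \<le> sqrt (C\<^sup>2 * (\<integral>t. r t \<partial>N)) * sqrt (nsq M h)"
    using nk by (intro mult_right_mono real_sqrt_le_mono) (auto simp: nsq_nonneg)
  finally show ?thesis unfolding eq using C0 by (simp add: real_sqrt_mult)
qed

text \<open>Both sides are linear in the moments of \<open>\<theta> * \<phi>\<close>,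
  \<open>\<theta> * \<theta>\<close> and \<open>\<phi> * \<phi>\<close> against \<open>r\<close>:
  the first Taylor coefficients because \<open>g0 b t\<close> and \<open>g1 b t\<close> are
  combinations of \<open>\<theta> t\<close> and \<open>\<phi> t\<close>, the kernel because its step
  part is absent on the diagonal.\<close>

lemma kernel_trace:
  assumes A: "A0 \<noteq> 0"
  shows "(\<integral>x. green_kernel x x * of_real (r x) \<partial>N) = - bc_coeff a b p q r \<alpha> R 1 / A0"
proof -
  define J where "J = (\<lambda>f :: real \<Rightarrow> complex. \<integral>x. f x * of_real (r x) \<partial>N)"
  have i: "integrable N (\<lambda>x. f x * of_real (r x))" if "continuous_on {a..b} f" for f :: "real \<Rightarrow> complex"
    using mult_r_integrable[OF that] by (simp add: mult.commute)
  have Jadd: "J (\<lambda>x. c * f x + d * f' x) = c * J f + d * J f'" if "continuous_on {a..b} f" "continuous_on {a..b} f'" for c d :: complex and f f'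
  proof -
    have "J (\<lambda>x. c * f x + d * f' x) = (\<integral>x. c * (f x * of_real (r x)) + d * (f' x * of_real (r x)) \<partial>N)"
      unfolding J_def by (simp add: algebra_simps)
    also have "\<dots> = c * J f + d * J f'" unfolding J_def
      by (subst Bochner_Integration.integral_add) (auto intro!: integrable_mult_right i that)
    finally show ?thesis .
  qed
  define P where "P = J (\<lambda>x. \<theta> x * \<phi> x)"
  define Q where "Q = J (\<lambda>x. \<theta> x * \<theta> x)"
  define S where "S = J (\<lambda>x. \<phi> x * \<phi> x)"
  have cP: "continuous_on {a..b} (\<lambda>x. \<theta> x * \<phi> x)" "continuous_on {a..b} (\<lambda>x. \<theta> x * \<theta> x)" "continuous_on {a..b} (\<lambda>x. \<phi> x * \<phi> x)"
    by (intro continuous_intros theta_cont phi_cont)+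
  have bb: "b \<in> {a..b}" using ab by simp
  have lint: "(LINT t:{a<..<b}|lebesgue. of_real (r t) * G t * f t) = J (\<lambda>t. f t * G t)" for G f :: "real \<Rightarrow> complex"
    by (simp add: J_def integral_restrict_space set_lebesgue_integral_def mult_ac)
  have th: "theta_k a b p q r 1 b = \<theta> b * P + (- \<phi> b) * Q" "theta1_k a b p q r 1 b = \<theta>' b * P + (- \<phi>' b) * Q"
    "phi_k a b p q r 1 b = \<theta> b * S + (- \<phi> b) * P" "phi1_k a b p q r 1 b = \<theta>' b * S + (- \<phi>' b) * P"
    unfolding P_def Q_def S_def Jadd[OF cP(1,2), symmetric] Jadd[OF cP(3,1), symmetric]
    by (simp_all only: theta_k_def theta1_k_def phi_k_def phi1_k_def One_nat_def iter_coeff.simps iter_coeff1.simps lint)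
      (intro arg_cong[where f=J] ext, simp add: green0_def green0_1_def algebra_simps)+
  have "green_kernel x x = (B22 * \<theta> b - B12 * \<theta>' b) / A0 * (\<theta> x * \<phi> x) + (B12 * \<phi>' b - B22 * \<phi> b) / A0 * (\<theta> x * \<theta> x)
     + ((B11 * \<theta>' b - B21 * \<theta> b) / A0 * (\<phi> x * \<phi> x) + (B21 * \<phi> b - B11 * \<phi>' b) / A0 * (\<theta> x * \<phi> x))" for x
  proof -
    have "green_kernel x x = (\<theta> x * (B22 * g0 b x - B12 * g1 b x) + \<phi> x * (B11 * g1 b x - B21 * g0 b x)) / A0"
      by (simp add: green_kernel_def k1_def k2_def add_divide_distrib)
    also have "\<theta> x * (B22 * g0 b x - B12 * g1 b x) + \<phi> x * (B11 * g1 b x - B21 * g0 b x) =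
      (B22 * \<theta> b - B12 * \<theta>' b) * (\<theta> x * \<phi> x) + (B12 * \<phi>' b - B22 * \<phi> b) * (\<theta> x * \<theta> x)
     + ((B11 * \<theta>' b - B21 * \<theta> b) * (\<phi> x * \<phi> x) + (B21 * \<phi> b - B11 * \<phi>' b) * (\<theta> x * \<phi> x))"
      by (simp add: green0_def green0_1_def algebra_simps)
    finally show ?thesis by (simp add: add_divide_distrib)
  qed
  note keq = this
  have J4: "J (\<lambda>x. c1 * (\<theta> x * \<phi> x) + c2 * (\<theta> x * \<theta> x) + (c3 * (\<phi> x * \<phi> x) + c4 * (\<theta> x * \<phi> x)))
     = c1 * P + c2 * Q + (c3 * S + c4 * P)" for c1 c2 c3 c4
  proof -
    have c: "continuous_on {a..b} (\<lambda>x. c1 * (\<theta> x * \<phi> x) + c2 * (\<theta> x * \<theta> x))"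
      "continuous_on {a..b} (\<lambda>x. c3 * (\<phi> x * \<phi> x) + c4 * (\<theta> x * \<phi> x))"
      by (intro continuous_intros theta_cont phi_cont)+
    show ?thesis using Jadd[OF c, of 1 1]
      unfolding Jadd[OF cP(1,2)] Jadd[OF cP(3,1)] P_def[symmetric] Q_def[symmetric] S_def[symmetric] mult_1 .
  qed
  have "J (\<lambda>x. green_kernel x x) = (B22 * \<theta> b - B12 * \<theta>' b) / A0 * P + (B12 * \<phi>' b - B22 * \<phi> b) / A0 * Q
     + ((B11 * \<theta>' b - B21 * \<theta> b) / A0 * S + (B21 * \<phi> b - B11 * \<phi>' b) / A0 * P)"
    unfolding keq by (rule J4)
  also have "\<dots> = ((B22 * \<theta> b - B12 * \<theta>' b) * P + (B12 * \<phi>' b - B22 * \<phi> b) * Q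
     + ((B11 * \<theta>' b - B21 * \<theta> b) * S + (B21 * \<phi> b - B11 * \<phi>' b) * P)) / A0"
    by (simp add: add_divide_distrib)
  \<comment> \<open>For each moment the products of two boundary values of the fundamental solutions
    cancel; what is left is linear in \<open>R\<close>.\<close>
  also have "(B22 * \<theta> b - B12 * \<theta>' b) * P + (B12 * \<phi>' b - B22 * \<phi> b) * Q
     + ((B11 * \<theta>' b - B21 * \<theta> b) * S + (B21 * \<phi> b - B11 * \<phi>' b) * P) = - bc_coeff a b p q r \<alpha> R 1"
    unfolding bc_coeff_def bc_form_def th B11_def B12_def B21_def B22_def by (simp add: algebra_simps)
  finally show ?thesis by (simp add: J_def)
qed

section \<open>Shifting the spectral parameter\<close>

lemma shift_coupled: "coupled a b p (\<lambda>x. q x - \<mu> * r x) r R"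
proof
  show "(\<lambda>x. q x - \<mu> * r x) \<in> borel_measurable N" using q_measurable r_measurable by measurable
  show "integrable N (\<lambda>x. q x - \<mu> * r x)" by (intro Bochner_Integration.integrable_diff integrable_mult_right q_integrable r_integrable)
qed (fact ab p_measurable r_measurable r_pos r_integrable p_pos p_integrable det_R)+

context fixes \<mu> :: real begin

interpretation S: coupled a b p "\<lambda>x. q x - \<mu> * r x" r \<alpha> R by (rule shift_coupled)

lemma sys_shift:
  fixes h y :: "real \<Rightarrow> complex"
  shows "S.sys (\<lambda>x. h x - \<mu> * y x) y u \<longleftrightarrow> sys h y u"
  unfolding sys_def S.sys_def by (simp add: algebra_simps)

lemma ivp_shift: "sl_ivp a b p (\<lambda>x. q x - \<mu> * r x) r c d z = sl_ivp a b p q r c d (z + \<mu>)"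
proof -
  note s = ivp_sys[where c=c and d=d and z="z + \<mu>"]
  define y where "y = sl_ivp a b p q r c d (z + \<mu>)"
  have "S.sys (\<lambda>x. (z + \<mu>) * y x - \<mu> * y x) y (quasi_deriv a b p y)"
    using sys_shift[of "\<lambda>x. (z + \<mu>) * y x" y] s(1) unfolding y_def by blast
  then have "S.sys (\<lambda>x. z * y x) y (quasi_deriv a b p y)" by (simp add: algebra_simps)
  from S.sl_ivp_eq(1)[OF this] s(2,3) have "sl_ivp a b p (\<lambda>x. q x - \<mu> * r x) r c d z = S.trunc y"
    by (simp add: y_def)
  also have "S.trunc y = y" using s(4) unfolding y_def by (auto simp: S.trunc_def supp_def fun_eq_iff)
  finally show ?thesis by (simp add: y_def)
qed

lemma char_fun_shift: "char_fun a b p (\<lambda>x. q x - \<mu> * r x) r \<alpha> R z = char_fun a b p q r \<alpha> R (z + \<mu>)"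
  by (simp add: char_fun_def sl_theta_def sl_theta1_def sl_phi_def sl_phi1_def ivp_shift)

lemma trel_shift:
  fixes h y :: "real \<Rightarrow> complex"
  shows "S.trel (\<lambda>x. h x - \<mu> * y x) y u \<longleftrightarrow> trel h y u"
proof -
  have "y \<in> L2 M \<Longrightarrow> (\<lambda>x. h x - \<mu> * y x) \<in> L2 M \<longleftrightarrow> h \<in> L2 M"
    using L2_add[of "\<lambda>x. h x - \<mu> * y x" M "\<lambda>x. \<mu> * y x"] L2_diff[of h M "\<lambda>x. \<mu> * y x"] L2_scale[of y M \<mu>] by auto
  moreover have "sys h y u \<Longrightarrow> y \<in> L2 M" by (intro L2_continuous sys_continuous)
  ultimately show ?thesis
    unfolding trel_def S.trel_def sys_shift by (auto simp: bc_def S.bc_def supp_def S.supp_def)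
qed

end

section \<open>Eigenfunction expansion\<close>

lemma trel_L2_cases: "trel h y u \<Longrightarrow> continuous_on {a..b} y \<and> supp y"
  by (auto simp: trel_def sys_continuous)

lemma trel_zero: "trel (\<lambda>_. 0) (\<lambda>_. 0) (\<lambda>_. 0)"
  by (simp add: trel_def supp_def bc_def sys_def prim_const)

lemma trel_y_zero:
  assumes "trel h (\<lambda>_. 0) u" shows "AE x in M. h x = 0"
  using trel_imp_dom(2)[OF assms] trel_imp_dom(2)[OF trel_zero] by eventually_elim simp

lemma green_eq:
  assumes A: "A0 \<noteq> 0" and t: "trel h y u"
  shows "green h = y"
  using green_trel[OF A trel_L2(1)[OF t]] trel_unique[OF A _ t] by blast

lemma green_L2:
  assumes "A0 \<noteq> 0" "h \<in> L2 M" shows "green h \<in> L2 M"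
  using green_trel[OF assms] trel_L2(2) by blast

lemma green_linear:
  assumes A: "A0 \<noteq> 0" and h: "h \<in> L2 M" "h' \<in> L2 M"
  shows "green (\<lambda>x. c * h x + d * h' x) = (\<lambda>x. c * green h x + d * green h' x)"
proof -
  obtain u u' where "trel h (green h) u" "trel h' (green h') u'" using green_trel[OF A] h by blast
  from trel_add[OF trel_cmult[OF this(1), of c] trel_cmult[OF this(2), of d]]
  show ?thesis by (rule green_eq[OF A])
qed

lemma green_symmetric:
  assumes A: "A0 \<noteq> 0" and h: "h \<in> L2 M" "h' \<in> L2 M"
  shows "l2_inner M (green h) h' = l2_inner M h (green h')"
  using green_trel[OF A h(1)] green_trel[OF A h(2)] trel_symmetric by blast

lemma green_sup_bound: "\<exists>C>0. \<forall>h\<in>L2 M. \<forall>x. norm (green h x) \<le> C * sqrt (nsq M h)"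
proof -
  obtain C where C: "C > 0" "\<And>x t. x \<in> {a..b} \<Longrightarrow> t \<in> {a..b} \<Longrightarrow> norm (green_kernel x t) \<le> C"
    using kernel_bounded by blast
  have r0: "(\<integral>t. r t \<partial>N) \<ge> 0" by (rule integral_nonneg_AE[OF r_nonneg])
  define D where "D = C * sqrt (\<integral>t. r t \<partial>N) + 1"
  have D: "D > 0" using C r0 by (simp add: D_def add_nonneg_pos)
  have "norm (green h x) \<le> D * sqrt (nsq M h)" if h: "h \<in> L2 M" for h x
  proof (cases "x \<in> {a..b}")
    case True
    then have "norm (green h x) \<le> C * sqrt (\<integral>t. r t \<partial>N) * sqrt (nsq M h)"
      using weighted_integral_bound[OF h kernel_continuous_snd[OF True], of C] C by (simp add: green_def)
    also have "\<dots> \<le> D * sqrt (nsq M h)" by (intro mult_right_mono) (auto simp: D_def nsq_nonneg)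
    finally show ?thesis .
  next
    case False
    then have "green h x = 0" unfolding green_def trunc_def by (rule if_not_P)
    then show ?thesis using D by (simp add: nsq_nonneg)
  qed
  then show ?thesis using D by blast
qed

text \<open>Uniform continuity of the kernel on the square yields a modulus of continuity common to
  all \<open>h\<close> in the unit ball. With the supremum bound this is the input for
  Arzela-Ascoli.\<close>

lemma green_equicontinuous:
  assumes e: "e > 0" and x: "x \<in> {a..b}"
  shows "\<exists>d>0. \<forall>h\<in>L2 M. nsq M h \<le> 1 \<longrightarrow> (\<forall>y\<in>{a..b}. norm (x - y) < d \<longrightarrow> norm (green h x - green h y) < e)"
proof -
  have r0: "(\<integral>t. r t \<partial>N) \<ge> 0" by (rule integral_nonneg_AE[OF r_nonneg])
  have sr0: "sqrt (\<integral>t. r t \<partial>N) + 1 > 0" using r0 by (intro add_nonneg_pos) simp_all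
  define \<eta> where "\<eta> = e / (sqrt (\<integral>t. r t \<partial>N) + 1)"
  have \<eta>: "\<eta> > 0" unfolding \<eta>_def using e sr0 by (rule divide_pos_pos)
  have "uniformly_continuous_on ({a..b} \<times> {a..b}) (\<lambda>z. green_kernel (fst z) (snd z))"
    by (intro compact_uniformly_continuous kernel_continuous compact_Times compact_Icc)
  then obtain d where d: "d > 0" "\<And>z z'. \<lbrakk>z \<in> {a..b} \<times> {a..b}; z' \<in> {a..b} \<times> {a..b}; dist z' z < d\<rbrakk> \<Longrightarrow>
      dist (green_kernel (fst z') (snd z')) (green_kernel (fst z) (snd z)) < \<eta>"
    unfolding uniformly_continuous_on_def using \<eta> by metis
  show ?thesis
  proof (rule exI[of _ d], intro conjI ballI impI d)
    fix h y assume h: "h \<in> L2 M" "nsq M h \<le> 1" and y: "y \<in> {a..b}" "norm (x - y) < d"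
    have k: "norm (green_kernel x t - green_kernel y t) \<le> \<eta>" if "t \<in> {a..b}" for t
      using d(2)[of "(y, t)" "(x, t)"] that x y by (auto simp: dist_Pair_Pair dist_norm)
    have i: "integrable N (\<lambda>t. green_kernel x t * (of_real (r t) * h t))" if "x \<in> {a..b}" for x
      by (rule integrable_continuous_mult[OF L2_integrable(1)[OF h(1)] kernel_continuous_snd[OF that]])
    have eq: "green h x - green h y = (\<integral>t. (green_kernel x t - green_kernel y t) * (of_real (r t) * h t) \<partial>N)"
      using x y i by (simp add: green_def left_diff_distrib Bochner_Integration.integral_diff)
    have "norm (green h x - green h y) \<le> \<eta> * sqrt (\<integral>t. r t \<partial>N) * sqrt (nsq M h)"
      unfolding eq by (rule weighted_integral_bound[OF h(1) continuous_on_diff[OF kernel_continuous_snd[OF x] kernel_continuous_snd[OF y(1)]] k])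
        (use \<eta> in simp_all)
    also have "\<dots> \<le> \<eta> * sqrt (\<integral>t. r t \<partial>N) * 1"
    proof (rule mult_left_mono)
      show "sqrt (nsq M h) \<le> 1" using h(2) by simp
      show "0 \<le> \<eta> * sqrt (\<integral>t. r t \<partial>N)" using \<eta> r0 by simp
    qed
    also have "\<dots> < \<eta> * (sqrt (\<integral>t. r t \<partial>N) + 1)" unfolding distrib_left mult_1_right using \<eta> by linarith
    also have "\<dots> = e" unfolding \<eta>_def using sr0 by simp
    finally show "norm (green h x - green h y) < e" .
  qed
qed

text \<open>The eigenvalue is left existential so that the notion is the same for every shift of
  \<open>q\<close>, which lets the basis be found after a shift.\<close>

definition eigenset :: "(real \<Rightarrow> complex) set \<Rightarrow> bool" where
  "eigenset U \<longleftrightarrow> orthonormal M U \<and> (\<forall>e\<in>U. \<exists>c u. trel (\<lambda>x. c * e x) e u)"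

text \<open>Zorn's lemma applies since any two elements of the union of a chain already lie in one
  member of the chain.\<close>

lemma maximal_eigenset: "\<exists>U. eigenset U \<and> (\<forall>V. eigenset V \<longrightarrow> U \<subseteq> V \<longrightarrow> V = U)"
proof -
  have "\<exists>U\<in>Collect eigenset. \<forall>V\<in>Collect eigenset. U \<subseteq> V \<longrightarrow> V = U"
  proof (rule subset_Zorn_nonempty)
    show "Collect eigenset \<noteq> {}" by (auto simp: eigenset_def orthonormal_def intro!: exI[of _ "{}"])
    fix \<C> assume C: "\<C> \<noteq> {}" "subset.chain (Collect eigenset) \<C>"
    have E: "eigenset V" if "V \<in> \<C>" for V using C(2) that by (auto simp: subset.chain_def)
    have two: "\<exists>V\<in>\<C>. e \<in> V \<and> f \<in> V" if ef: "e \<in> \<Union>\<C>" "f \<in> \<Union>\<C>" for e f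
    proof -
      obtain V W where "V \<in> \<C>" "e \<in> V" "W \<in> \<C>" "f \<in> W" using ef by blast
      moreover from this have "V \<subseteq> W \<or> W \<subseteq> V" using C(2) unfolding subset.chain_def by blast
      ultimately show ?thesis by blast
    qed
    have "l2_inner M e f = (if e = f then 1 else 0)" if "e \<in> \<Union>\<C>" "f \<in> \<Union>\<C>" for e f
    proof -
      obtain V where "V \<in> \<C>" "e \<in> V" "f \<in> V" using two \<open>e \<in> \<Union>\<C>\<close> \<open>f \<in> \<Union>\<C>\<close> by blast
      then show ?thesis using E[of V] unfolding eigenset_def orthonormal_def by blast
    qed
    moreover have "\<Union>\<C> \<subseteq> L2 M" using E unfolding eigenset_def orthonormal_def by blast
    moreover have "\<forall>e\<in>\<Union>\<C>. \<exists>c u. trel (\<lambda>x. c * e x) e u" using E unfolding eigenset_def by blast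
    ultimately show "\<Union>\<C> \<in> Collect eigenset" unfolding eigenset_def orthonormal_def by simp
  qed
  then show ?thesis by auto
qed

text \<open>The Rayleigh quotient of the Green operator on the orthogonal complement of the eigenfunctions
  is maximised in the limit by an eigenfunction, hence vanishes.\<close>

lemma eigenset_complete:
  assumes pos: "\<And>h y u. trel h y u \<Longrightarrow> nsq M y \<le> Re (l2_inner M y h)"
    and U: "eigenset U" and max: "\<And>V. eigenset V \<Longrightarrow> U \<subseteq> V \<Longrightarrow> V = U"
    and f0: "f0 \<in> L2 M" "\<And>e. e \<in> U \<Longrightarrow> l2_inner M e f0 = 0"
  shows "AE x in M. f0 x = 0"
proof (rule ccontr)
  assume nz: "\<not> (AE x in M. f0 x = 0)"
  \<comment> \<open>A vanishing \<open>A0\<close> would produce an eigenfunction for the eigenvalue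
    0, contradicting \<open>pos\<close>.\<close>
  have A: "A0 \<noteq> 0"
  proof
    assume "A0 = 0"
    then obtain y u where y: "trel (\<lambda>_. 0) y u" "y \<noteq> (\<lambda>_. 0)" using trel_zero_exists by blast
    have "nsq M y \<le> 0" using pos[OF y(1)] by (simp add: l2_inner_def)
    then show False using nsq_zero_imp[of y] trel_L2_cases[OF y(1)] y(2) nsq_nonneg[of M y] by auto
  qed
  have UL: "\<And>e. e \<in> U \<Longrightarrow> e \<in> L2 M" using U by (auto simp: eigenset_def orthonormal_def)
  define V where "V = {f \<in> L2 M. \<forall>e\<in>U. l2_inner M e f = 0}"
  define q' where "q' = (\<lambda>h. Re (l2_inner M h (green h)))"
  note GL = green_L2[OF A]
  have VL: "f \<in> L2 M" if "f \<in> V" for f using that by (simp add: V_def)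
  have Vlin: "(\<lambda>x. c * f x + d * g x) \<in> V" if "f \<in> V" "g \<in> V" for c d f g
    using that UL by (auto simp: V_def L2_add L2_scale inner_add_right inner_scale_right)
  have GV: "green f \<in> V" if f: "f \<in> V" for f
  proof -
    have "l2_inner M e (green f) = 0" if e: "e \<in> U" for e
    proof -
      obtain c u where t: "trel (\<lambda>x. c * e x) e u" using U e by (auto simp: eigenset_def)
      have ne: "nsq M e = 1" using U e inner_self[of M e] by (auto simp: eigenset_def orthonormal_def)
      have "c \<noteq> 0" using pos[OF t] ne by (auto simp: inner_scale_right)
      obtain v where v: "trel f (green f) v" using green_trel[OF A VL[OF f]] by blast
      have "l2_inner M e f = cnj c * l2_inner M e (green f)"
        using trel_symmetric[OF t v] by (simp add: inner_scale_left)
      then show ?thesis using f e \<open>c \<noteq> 0\<close> by (simp add: V_def)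
    qed
    then show ?thesis using GL VL[OF f] by (simp add: V_def)
  qed
  \<comment> \<open>This is \<open>pos\<close> read for the Green operator; it makes
    \<open>q'\<close> nonnegative and lets \<open>q'\<close> control the norm of
    \<open>green h\<close>.\<close>
  have qn: "nsq M (green h) \<le> q' h" if hL: "h \<in> L2 M" for h
  proof -
    obtain u where "trel h (green h) u" using green_trel[OF A hL] by blast
    from pos[OF this] show ?thesis unfolding q'_def by (subst inner_cnj) simp
  qed
  have q0: "0 \<le> q' h" if "h \<in> L2 M" for h using qn[OF that] nsq_nonneg[of M "green h"] by linarith
  have q1: "q' h \<le> nsq M h" if h: "h \<in> L2 M" for h
  proof (cases "q' h = 0")
    case False
    have "(q' h)\<^sup>2 \<le> (norm (l2_inner M h (green h)))\<^sup>2"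
      unfolding q'_def by (metis abs_Re_le_cmod abs_ge_zero power2_abs power_mono)
    also have "\<dots> \<le> nsq M h * nsq M (green h)" by (rule Cauchy_Schwarz_L2[OF h GL[OF h]])
    also have "\<dots> \<le> nsq M h * q' h" by (intro mult_left_mono qn h nsq_nonneg)
    finally show ?thesis using False q0[OF h] by (simp add: power2_eq_square)
  qed (simp add: nsq_nonneg)
  have qscale: "q' (\<lambda>x. of_real c * h x) = c\<^sup>2 * q' h" if "h \<in> L2 M" for c h
    using green_linear[OF A that that, of "of_real c" 0]
    by (simp add: q'_def inner_scale_left inner_scale_right power2_eq_square)
  define S where "S = {q' h | h. h \<in> V \<and> nsq M h \<le> 1}"
  \<comment> \<open>The supremum of the Rayleigh quotient on the complement \<open>V\<close>; the
    aim is an eigenfunction of \<open>green\<close> with eigenvalue \<open>m\<close>.\<close>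
  define m where "m = Sup S"
  have bdd: "bdd_above S" unfolding bdd_above_def S_def using q1 VL by (intro exI[of _ 1]) force
  have "nsq M f0 \<noteq> 0" using nsq_eq_0_iff[OF f0(1)] nz by simp
  then have nf0: "nsq M f0 > 0" using nsq_nonneg[of M f0] by simp
  have normalize: "(\<lambda>x. of_real (1 / sqrt (nsq M f)) * f x) \<in> V \<and> nsq M (\<lambda>x. of_real (1 / sqrt (nsq M f)) * f x) = 1"
    if "f \<in> V" "nsq M f > 0" for f
  proof
    show "(\<lambda>x. of_real (1 / sqrt (nsq M f)) * f x) \<in> V"
      using Vlin[OF that(1) that(1), of "of_real (1 / sqrt (nsq M f))" 0] by simp
    show "nsq M (\<lambda>x. of_real (1 / sqrt (nsq M f)) * f x) = 1"
      unfolding nsq_scale norm_of_real using that(2) by (simp add: power_divide)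
  qed
  have f0V: "f0 \<in> V" using f0 by (simp add: V_def)
  have m0: "m > 0"
  proof -
    define f1 where "f1 = (\<lambda>x. of_real (1 / sqrt (nsq M f0)) * f0 x)"
    have f1: "f1 \<in> V" "nsq M f1 = 1" using normalize[OF f0V nf0] by (auto simp: f1_def)
    obtain u where u: "trel f1 (green f1) u" using green_trel[OF A VL[OF f1(1)]] by blast
    have "nsq M (green f1) \<noteq> 0"
    proof
      assume "nsq M (green f1) = 0"
      then have "green f1 = (\<lambda>_. 0)" using trel_L2_cases[OF u] by (intro nsq_zero_imp) auto
      then have "AE x in M. f1 x = 0" using trel_y_zero u by metis
      then show False using nsq_eq_0_iff[OF VL[OF f1(1)]] f1(2) by simp
    qed
    then have "q' f1 > 0" using qn[OF VL[OF f1(1)]] nsq_nonneg[of M "green f1"] by linarith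
    moreover have "q' f1 \<le> m" unfolding m_def using f1 by (intro cSup_upper bdd) (auto simp: S_def)
    ultimately show ?thesis by simp
  qed
  have qm: "q' h \<le> m * nsq M h" if h: "h \<in> V" for h
  proof (cases "nsq M h = 0")
    case True
    then show ?thesis using q1[OF VL[OF h]] by simp
  next
    case False
    then have nh: "nsq M h > 0" using nsq_nonneg[of M h] by simp
    have "q' (\<lambda>x. of_real (1 / sqrt (nsq M h)) * h x) \<le> m"
      unfolding m_def using normalize[OF h nh] by (intro cSup_upper bdd) (auto simp: S_def)
    then have "(1 / sqrt (nsq M h))\<^sup>2 * q' h \<le> m" unfolding qscale[OF VL[OF h]] .
    then show ?thesis using nh by (simp add: power_divide field_simps)
  qed
  have "\<exists>f. f \<in> V \<and> nsq M f \<le> 1 \<and> q' f > m - 1 / (real n + 1)" for n :: nat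
  proof -
    have "m - 1 / (real n + 1) < m" by simp
    moreover have "S \<noteq> {}" using m0 f0V normalize[OF f0V nf0] by (auto simp: S_def)
    ultimately obtain s where "s \<in> S" "m - 1 / (real n + 1) < s" unfolding m_def using less_cSup_iff[OF _ bdd] by blast
    then show ?thesis by (auto simp: S_def)
  qed
  then obtain f where f: "\<And>n. f n \<in> V" "\<And>n. nsq M (f n) \<le> 1" "\<And>n. q' (f n) > m - 1 / (real n + 1)" by metis
  define d where "d = (\<lambda>n x. of_real m * f n x + (-1) * green (f n) x)"
  have dV: "d n \<in> V" for n unfolding d_def by (rule Vlin[OF f(1) GV[OF f(1)]])
  have dn: "nsq M (d n) \<le> m / (real n + 1)" for n
  proof -
    \<comment> \<open>A step of size \<open>1 / m\<close> against the residual \<open>d n\<close>.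
      Inserting \<open>w\<close> into \<open>q' w \<le> m * nsq M w\<close>, the quadratic term is
      at most half of the linear one, so \<open>nsq M (d n)\<close> is bounded by \<open>m\<close>
      times the gap to the supremum.\<close>
    define s where "s = 1 / m"
    define w where "w = (\<lambda>x. 1 * f n x + of_real (- s) * d n x)"
    have wV: "w \<in> V" unfolding w_def by (rule Vlin[OF f(1) dV])
    note fL = VL[OF f(1), of n] and dL = VL[OF dV, of n]
    note GfL = GL[OF fL] and GdL = GL[OF dL]
    have rd: "Re (l2_inner M (f n) (green (d n))) = Re (l2_inner M (d n) (green (f n)))"
      using green_symmetric[OF A dL fL] by (subst inner_cnj) simp
    have Gw: "green w = (\<lambda>x. 1 * green (f n) x + of_real (- s) * green (d n) x)"
      unfolding w_def by (rule green_linear[OF A fL dL])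
    have E1: "q' w = q' (f n) - 2 * s * Re (l2_inner M (d n) (green (f n))) + s\<^sup>2 * q' (d n)"
      unfolding q'_def Gw unfolding w_def using fL dL GfL GdL rd
      by (simp add: inner_add_right inner_scale_left inner_scale_right L2_scale L2_add
          inner_diff_left inner_diff_right L2_diff power2_eq_square algebra_simps)
    have E2: "nsq M w = nsq M (f n) - 2 * s * Re (l2_inner M (d n) (f n)) + s\<^sup>2 * nsq M (d n)"
    proof -
      have "Re (l2_inner M (f n) (d n)) = Re (l2_inner M (d n) (f n))" by (subst inner_cnj) simp
      then show ?thesis
        using nsq_diff[OF fL L2_scale[OF dL, of "of_real s"]] by (simp add: w_def inner_scale_right nsq_scale)
    qed
    have E3: "m * Re (l2_inner M (d n) (f n)) - Re (l2_inner M (d n) (green (f n))) = nsq M (d n)"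
    proof -
      have "complex_of_real (nsq M (d n)) = l2_inner M (d n) (\<lambda>x. of_real m * f n x + (-1) * green (f n) x)"
        unfolding inner_self[symmetric] by (subst (2) d_def) simp
      also have "\<dots> = of_real m * l2_inner M (d n) (f n) + (-1) * l2_inner M (d n) (green (f n))"
        unfolding inner_add_right[OF dL L2_scale[OF fL] L2_scale[OF GfL]] inner_scale_right by (rule refl)
      finally have "Re (complex_of_real (nsq M (d n))) = Re (of_real m * l2_inner M (d n) (f n) + (-1) * l2_inner M (d n) (green (f n)))" by simp
      then show ?thesis by simp
    qed
    have "m * nsq M w - q' w = (m * nsq M (f n) - q' (f n))
        - 2 * s * (m * Re (l2_inner M (d n) (f n)) - Re (l2_inner M (d n) (green (f n)))) + s\<^sup>2 * (m * nsq M (d n) - q' (d n))"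
      unfolding E1 E2 by (simp add: algebra_simps)
    then have "m * nsq M w - q' w = (m * nsq M (f n) - q' (f n)) - 2 * s * nsq M (d n) + s\<^sup>2 * (m * nsq M (d n) - q' (d n))"
      unfolding E3 .
    moreover have "0 \<le> m * nsq M w - q' w" using qm[OF wV] by simp
    moreover have "s\<^sup>2 * (m * nsq M (d n) - q' (d n)) \<le> s * nsq M (d n)"
    proof -
      have "s\<^sup>2 * (m * nsq M (d n) - q' (d n)) \<le> s\<^sup>2 * (m * nsq M (d n))"
        using q0[OF dL] by (intro mult_left_mono) auto
      also have "\<dots> = s * nsq M (d n)" using m0 by (simp add: s_def power2_eq_square)
      finally show ?thesis .
    qed
    ultimately have "s * nsq M (d n) \<le> m * nsq M (f n) - q' (f n)" by linarith
    also have "\<dots> \<le> m * 1 - (m - 1 / (real n + 1))"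
      using f(2,3)[of n] m0 by (intro diff_mono mult_left_mono) auto
    finally have "s * nsq M (d n) \<le> 1 / (real n + 1)" by simp
    then have "m * (s * nsq M (d n)) \<le> m * (1 / (real n + 1))" using m0 by (intro mult_left_mono) auto
    then show ?thesis using m0 by (simp add: s_def)
  qed
  obtain \<kappa> where \<kappa>: "\<kappa> > 0" "\<And>h x. h \<in> L2 M \<Longrightarrow> norm (green h x) \<le> \<kappa> * sqrt (nsq M h)"
    using green_sup_bound by blast
  have fL: "f n \<in> L2 M" for n by (rule VL[OF f(1)])
  \<comment> \<open>The maximising sequence itself may fail to converge, but its image under the
    compact operator does converge along a subsequence.\<close>
  obtain g k where g: "continuous_on {a..b} g" and k: "strict_mono (k :: nat \<Rightarrow> nat)"
    and lim: "\<And>e. 0 < e \<Longrightarrow> \<exists>n0. \<forall>n x. n \<ge> n0 \<and> x \<in> {a..b} \<longrightarrow> norm (green (f (k n)) x - g x) < e"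
  proof (rule Arzela_Ascoli[of "{a..b}" "\<lambda>n. green (f n)" \<kappa>])
    show "norm (green (f n) x) \<le> \<kappa>" for n x
    proof -
      have "norm (green (f n) x) \<le> \<kappa> * sqrt (nsq M (f n))" by (rule \<kappa>(2)[OF fL])
      also have "\<dots> \<le> \<kappa> * 1" using \<kappa>(1) f(2)[of n] by (intro mult_left_mono) auto
      finally show ?thesis by simp
    qed
    show "\<exists>d>0. \<forall>n y. y \<in> {a..b} \<and> norm (x - y) < d \<longrightarrow> norm (green (f n) x - green (f n) y) < e"
      if "x \<in> {a..b}" "0 < e" for x e
      using green_equicontinuous[OF that(2,1)] fL f(2) by meson
  qed auto
  define g' where "g' = trunc g"
  have gc: "continuous_on {a..b} g'" using g by (subst continuous_on_cong[OF refl, of _ _ g]) (auto simp: g'_def)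
  have gL: "g' \<in> L2 M" by (rule L2_continuous[OF gc])
  define \<rho> where "\<rho> = (\<integral>t. r t \<partial>N)"
  have \<rho>0: "\<rho> \<ge> 0" unfolding \<rho>_def by (rule integral_nonneg_AE[OF r_nonneg])
  have close: "nsq M (\<lambda>x. green (f (k n)) x - g' x) \<le> e\<^sup>2 * \<rho>"
    if "\<And>x. x \<in> {a..b} \<Longrightarrow> norm (green (f (k n)) x - g x) < e" for n e
  proof -
    have L: "(\<lambda>x. green (f (k n)) x - g' x) \<in> L2 M" by (intro L2_diff GL fL gL)
    have "nsq M (\<lambda>x. green (f (k n)) x - g' x) \<le> (\<integral>t. e\<^sup>2 * r t \<partial>N)"
      unfolding nsq_M(1)[OF L]
    proof (rule integral_mono_AE[OF nsq_M(2)[OF L] integrable_mult_right[OF r_integrable]])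
      show "AE t in N. r t * (norm (green (f (k n)) t - g' t))\<^sup>2 \<le> e\<^sup>2 * r t"
        using r_pos AE_in
      proof eventually_elim
        case (elim t)
        have "(norm (green (f (k n)) t - g' t))\<^sup>2 \<le> e\<^sup>2"
          using that[of t] elim by (intro power_mono) (auto simp: g'_def)
        then show ?case using elim by (subst mult.commute) (auto intro: mult_right_mono)
      qed
    qed
    then show ?thesis by (simp add: \<rho>_def)
  qed
  have conv: "(\<lambda>n. nsq M (\<lambda>x. green (f (k n)) x - g' x)) \<longlonglongrightarrow> 0"
  proof (rule LIMSEQ_I)
    fix \<epsilon> :: real assume \<epsilon>: "\<epsilon> > 0"
    define e where "e = sqrt (\<epsilon> / (\<rho> + 1))"
    have e: "e > 0" using \<epsilon> \<rho>0 by (simp add: e_def)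
    have e2: "e\<^sup>2 * (\<rho> + 1) = \<epsilon>" using \<epsilon> \<rho>0 by (simp add: e_def)
    obtain n0 where n0: "\<And>n x. n \<ge> n0 \<Longrightarrow> x \<in> {a..b} \<Longrightarrow> norm (green (f (k n)) x - g x) < e" using lim[OF e] by blast
    have "norm (nsq M (\<lambda>x. green (f (k n)) x - g' x) - 0) < \<epsilon>" if "n \<ge> n0" for n
    proof -
      have "nsq M (\<lambda>x. green (f (k n)) x - g' x) \<le> e\<^sup>2 * \<rho>" by (rule close) (use n0 that in auto)
      also have "\<dots> < e\<^sup>2 * (\<rho> + 1)" using e by simp
      finally show ?thesis using e2 nsq_nonneg by simp
    qed
    then show "\<exists>n0. \<forall>n\<ge>n0. norm (nsq M (\<lambda>x. green (f (k n)) x - g' x) - 0) < \<epsilon>" by blast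
  qed
  have sconv: "(\<lambda>n. c * sqrt (nsq M (\<lambda>x. green (f (k n)) x - g' x))) \<longlonglongrightarrow> 0" for c
    using tendsto_mult[OF tendsto_const tendsto_real_sqrt[OF conv], of c] by simp
  have inv0: "(\<lambda>n. 1 / (real n + 1)) \<longlonglongrightarrow> 0"
    using LIMSEQ_inverse_real_of_nat by (simp add: inverse_eq_divide add.commute)
  have dconv: "(\<lambda>n. \<kappa> * sqrt (nsq M (d (k n)))) \<longlonglongrightarrow> 0"
  proof -
    have "(\<lambda>n. m / (real n + 1)) \<longlonglongrightarrow> 0" using tendsto_mult[OF tendsto_const inv0, of m] by simp
    then have "(\<lambda>n. nsq M (d n)) \<longlonglongrightarrow> 0"
      by (rule tendsto_sandwich[OF _ _ tendsto_const, rotated 2]) (auto simp: dn nsq_nonneg)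
    then have "(\<lambda>n. nsq M (d (k n))) \<longlonglongrightarrow> 0" using LIMSEQ_subseq_LIMSEQ[OF _ k] by (auto simp: o_def)
    from tendsto_mult[OF tendsto_const tendsto_real_sqrt[OF this], of \<kappa>] show ?thesis by simp
  qed
  \<comment> \<open>Apply \<open>green\<close> to \<open>d n = m f - green f\<close>: the left side
    tends to 0 and the other two terms converge, which leaves the eigenvalue equation for the
    limit.\<close>
  have Gg: "green g' x = of_real m * g' x" for x
  proof (cases "x \<in> {a..b}")
    case True
    have "(\<lambda>n. green (f (k n)) x) \<longlonglongrightarrow> g x"
    proof (rule LIMSEQ_I)
      fix e :: real assume "e > 0"
      then show "\<exists>n0. \<forall>n\<ge>n0. norm (green (f (k n)) x - g x) < e" using lim[of e] True by blast
    qed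
    then have l1: "(\<lambda>n. of_real m * green (f (k n)) x) \<longlonglongrightarrow> of_real m * g' x"
      using True by (intro tendsto_mult tendsto_const) (simp add: g'_def)
    have "(\<lambda>n. green (green (f (k n))) x - green g' x) \<longlonglongrightarrow> 0"
    proof (rule Lim_null_comparison[OF _ sconv[of \<kappa>]], rule always_eventually, rule allI)
      fix n
      have eq: "green (green (f (k n))) x - green g' x = green (\<lambda>x. green (f (k n)) x - g' x) x"
        using green_linear[OF A GL[OF fL] gL, where c=1 and d="-1"] by (simp add: fun_eq_iff)
      show "norm (green (green (f (k n))) x - green g' x) \<le> \<kappa> * sqrt (nsq M (\<lambda>x. green (f (k n)) x - g' x))"
        unfolding eq by (intro \<kappa>(2) L2_diff GL fL gL)
    qed
    then have l2: "(\<lambda>n. green (green (f (k n))) x) \<longlonglongrightarrow> green g' x" by (rule LIM_zero_cancel)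
    have "(\<lambda>n. of_real m * green (f (k n)) x - green (green (f (k n))) x) \<longlonglongrightarrow> 0"
    proof (rule Lim_null_comparison[OF _ dconv], rule always_eventually, rule allI)
      fix n
      have eq: "of_real m * green (f (k n)) x - green (green (f (k n))) x = green (d (k n)) x"
        using green_linear[OF A fL GL[OF fL], where c="of_real m" and d="-1"] by (simp add: d_def fun_eq_iff)
      show "norm (of_real m * green (f (k n)) x - green (green (f (k n))) x) \<le> \<kappa> * sqrt (nsq M (d (k n)))"
        unfolding eq by (intro \<kappa>(2) VL dV)
    qed
    then have "of_real m * g' x - green g' x = 0"
      using tendsto_diff[OF l1 l2] LIMSEQ_unique by blast
    then show ?thesis by simp
  next
    case False
    then have "green g' x = 0" "g' x = 0" unfolding green_def g'_def trunc_def by (rule if_not_P)+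
    then show ?thesis by simp
  qed
  have gV: "g' \<in> V"
  proof -
    have "l2_inner M e g' = 0" if e: "e \<in> U" for e
    proof -
      have "norm (l2_inner M e g') \<le> sqrt (nsq M e) * sqrt (nsq M (\<lambda>x. green (f (k n)) x - g' x))" for n
      proof -
        have "l2_inner M e (\<lambda>x. green (f (k n)) x - g' x) = - l2_inner M e g'"
          using GV[OF f(1)] e by (simp add: inner_diff_right[OF UL[OF e] GL[OF fL] gL] V_def)
        then show ?thesis using norm_inner_le[OF UL[OF e] L2_diff[OF GL[OF fL] gL], of "k n"] by simp
      qed
      then have "norm (l2_inner M e g') \<le> 0"
        by (intro tendsto_lowerbound[OF sconv[of "sqrt (nsq M e)"]]) auto
      then show ?thesis by simp
    qed
    then show ?thesis using gL by (simp add: V_def)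
  qed
  \<comment> \<open>The limit cannot vanish, since \<open>q' (f (k n))\<close> stays near
    \<open>m > 0\<close> and is at most the norm of \<open>green (f (k n))\<close>.\<close>
  have ng: "nsq M g' > 0"
  proof (rule ccontr)
    assume "\<not> nsq M g' > 0"
    then have "nsq M g' = 0" using nsq_nonneg[of M g'] by simp
    then have "g' = (\<lambda>_. 0)" by (intro nsq_zero_imp gc) (simp add: g'_def)
    then have c0: "(\<lambda>n. 1 * sqrt (nsq M (green (f (k n))))) \<longlonglongrightarrow> 0" using sconv[of 1] by simp
    have "m - 1 / (real n + 1) \<le> 1 * sqrt (nsq M (green (f (k n))))" for n
    proof -
      have "real n \<le> real (k n)" using strict_mono_imp_increasing[OF k, of n] by simp
      then have "1 / (real (k n) + 1) \<le> 1 / (real n + 1)" by (intro divide_left_mono) auto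
      then have "m - 1 / (real n + 1) \<le> q' (f (k n))" using f(3)[of "k n"] by linarith
      also have "\<dots> \<le> norm (l2_inner M (f (k n)) (green (f (k n))))" unfolding q'_def by (rule complex_Re_le_cmod)
      also have "\<dots> \<le> sqrt (nsq M (f (k n))) * sqrt (nsq M (green (f (k n))))" by (rule norm_inner_le[OF fL GL[OF fL]])
      also have "\<dots> \<le> 1 * sqrt (nsq M (green (f (k n))))" using f(2) by (intro mult_right_mono) (auto simp: nsq_nonneg)
      finally show ?thesis .
    qed
    moreover have "(\<lambda>n. m - 1 / (real n + 1)) \<longlonglongrightarrow> m"
      using tendsto_diff[OF tendsto_const inv0, of m] by simp
    ultimately have "m \<le> 0" by (intro LIMSEQ_le[OF _ c0]) auto
    then show False using m0 by simp
  qed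
  \<comment> \<open>The normalised limit is an eigenfunction orthogonal to \<open>U\<close>, so it
    could be added to the maximal set.\<close>
  define w where "w = (\<lambda>x. of_real (1 / sqrt (nsq M g')) * g' x)"
  have w: "w \<in> V" "nsq M w = 1" using normalize[OF gV ng] by (auto simp: w_def)
  obtain u where u: "trel g' (green g') u" using green_trel[OF A gL] by blast
  have geq: "green g' = (\<lambda>x. of_real m * g' x)" using Gg by (rule ext)
  have "trel (\<lambda>x. of_real (1 / m) * g' x) (\<lambda>x. of_real (1 / m) * (of_real m * g' x)) (\<lambda>x. of_real (1 / m) * u x)"
    using u unfolding geq by (rule trel_cmult)
  then have "trel (\<lambda>x. of_real (1 / m) * g' x) g' (\<lambda>x. of_real (1 / m) * u x)" using m0 by simp
  from trel_cmult[OF this, of "of_real (1 / sqrt (nsq M g'))"]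
  have tw: "\<exists>c u. trel (\<lambda>x. c * w x) w u" unfolding w_def
    by (intro exI[of _ "of_real (1/m)"] exI[of _ "\<lambda>x. of_real (1 / sqrt (nsq M g')) * (of_real (1 / m) * u x)"]) (simp add: mult_ac)
  have wU: "l2_inner M e w = 0" "l2_inner M w e = 0" if "e \<in> U" for e
    using w(1) that inner_cnj[of M w e] by (auto simp: V_def)
  have "eigenset (insert w U)"
    using U tw wU w VL[OF w(1)] inner_self[of M w] by (auto simp: eigenset_def orthonormal_def)
  then have "w \<in> U" using max by blast
  then have "l2_inner M w w = 0" using wU by blast
  then show False using w(2) inner_self[of M w] by simp
qed

end

lemma has_sum_finite_sum:
  fixes f :: "'i \<Rightarrow> 'a \<Rightarrow> 'b::topological_comm_monoid_add"
  assumes "\<And>i. i \<in> I \<Longrightarrow> (f i has_sum s i) A"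
  shows "((\<lambda>x. \<Sum>i\<in>I. f i x) has_sum (\<Sum>i\<in>I. s i)) A"
  using assms by (induction I rule: infinite_finite_induct) (auto intro: has_sum_add)

context coupled begin

lemma eigenset_shift:
  fixes \<mu> :: real
  shows "coupled.eigenset a b p (\<lambda>x. q x - \<mu> * r x) r \<alpha> R U \<longleftrightarrow> eigenset U"
proof -
  interpret S: coupled a b p "\<lambda>x. q x - \<mu> * r x" r \<alpha> R by (rule shift_coupled)
  have *: "S.trel (\<lambda>x. (c - \<mu>) * e x) e u \<longleftrightarrow> trel (\<lambda>x. c * e x) e u" for c :: complex and e u
    using trel_shift[of \<mu> "\<lambda>x. c * e x" e u] by (simp add: left_diff_distrib)
  have "(\<exists>c u. S.trel (\<lambda>x. c * e x) e u) \<longleftrightarrow> (\<exists>c u. trel (\<lambda>x. c * e x) e u)" for e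
  proof
    assume "\<exists>c u. S.trel (\<lambda>x. c * e x) e u"
    then obtain c :: complex and u where "S.trel (\<lambda>x. ((c + \<mu>) - \<mu>) * e x) e u" by auto
    then show "\<exists>c u. trel (\<lambda>x. c * e x) e u" unfolding * by blast
  next
    assume "\<exists>c u. trel (\<lambda>x. c * e x) e u"
    then obtain c u where "trel (\<lambda>x. c * e x) e u" by blast
    then show "\<exists>c u. S.trel (\<lambda>x. c * e x) e u" unfolding *[symmetric] by blast
  qed
  then show ?thesis unfolding eigenset_def S.eigenset_def by simp
qed

text \<open>After the shift by \<open>c - 1\<close> the form is bounded below by 1, as the
  completeness argument demands. Measure and eigenfunctions are unaffected by the shift, so the
  basis serves the original operator.\<close>

theorem eigenbasis_exists: "\<exists>U. orthonormal_basis M U \<and> eigenset U"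
proof -
  obtain c where c: "\<And>h y u. trel h y u \<Longrightarrow> c * nsq M y \<le> Re (l2_inner M y h)" using lower_bound by blast
  define \<mu> where "\<mu> = c - 1"
  interpret S: coupled a b p "\<lambda>x. q x - \<mu> * r x" r \<alpha> R by (rule shift_coupled)
  have pos: "nsq M y \<le> Re (l2_inner M y h)" if t: "S.trel h y u" for h y u
  proof -
    have t': "trel (\<lambda>x. h x + \<mu> * y x) y u" using trel_shift[of \<mu> "\<lambda>x. h x + \<mu> * y x" y u] t by simp
    have L: "h \<in> L2 M" "y \<in> L2 M" using S.trel_L2[OF t] by auto
    have "c * nsq M y \<le> Re (l2_inner M y h) + \<mu> * nsq M y"
      using c[OF t'] L by (simp add: inner_add_right L2_scale inner_scale_right inner_self)
    then show ?thesis by (simp add: \<mu>_def algebra_simps)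
  qed
  obtain U where U: "eigenset U" "\<And>V. eigenset V \<Longrightarrow> U \<subseteq> V \<Longrightarrow> V = U" using maximal_eigenset by blast
  have "AE x in M. f x = 0" if "f \<in> L2 M" "\<And>e. e \<in> U \<Longrightarrow> l2_inner M e f = 0" for f
    using S.eigenset_complete[of U f] pos U that unfolding eigenset_shift by blast
  then have "orthonormal_basis M U" using U(1) by (auto simp: orthonormal_basis_iff eigenset_def)
  then show ?thesis using U(1) by blast
qed

section \<open>The trace formula\<close>

lemma set_integral_N:
  fixes F :: "real \<Rightarrow> 'a::{banach, second_countable_topology}"
  assumes "a \<le> u" "v \<le> b"
  shows "(LINT t:{u<..<v}|lebesgue. F t) = (\<integral>t. indicator {u<..<v} t *\<^sub>R F t \<partial>N)"
  unfolding set_lebesgue_integral_def using assms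
  by (subst integral_restrict_space) (auto intro!: Bochner_Integration.integral_cong split: split_indicator)

lemma integrable_indicator_N:
  fixes F :: "real \<Rightarrow> 'a::{banach, second_countable_topology}"
  assumes F: "integrable N F" and "a \<le> u" "v \<le> b"
  shows "integrable N (\<lambda>t. indicator {u<..<v} t *\<^sub>R F t)"
proof (rule integrable_mult_indicator[OF _ F])
  have "{a<..<b} \<inter> {u<..<v} \<in> sets N" unfolding sets_restrict_space by (rule imageI) simp
  moreover have "{a<..<b} \<inter> {u<..<v} = {u<..<v}" using assms by auto
  ultimately show "{u<..<v} \<in> sets N" by simp
qed

section \<open>Averages over the cells of a partition\<close>

definition chi :: "real \<Rightarrow> real \<Rightarrow> real \<Rightarrow> complex" where
  "chi u v t = of_real (indicator {u<..<v} t)"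

definition wt :: "real \<Rightarrow> real \<Rightarrow> real" where
  "wt u v = (LINT t:{u<..<v}|lebesgue. r t)"

context
  fixes u v :: real
  assumes uv: "a \<le> u" "u < v" "v \<le> b"
begin

lemma chi_L2: "chi u v \<in> L2 M"
proof (rule L2_bounded)
  have "{a<..<b} \<inter> {u<..<v} \<in> sets N" unfolding sets_restrict_space by (rule imageI) simp
  moreover have "{a<..<b} \<inter> {u<..<v} = {u<..<v}" using uv by auto
  ultimately have [measurable]: "{u<..<v} \<in> sets N" by simp
  show "chi u v \<in> borel_measurable N" unfolding chi_def by measurable
  show "norm (chi u v x) \<le> 1" for x by (simp add: chi_def indicator_def)
qed

lemma chi_mult_L2: assumes "continuous_on {a..b} e" shows "(\<lambda>x. e x * chi u v x) \<in> L2 M"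
proof -
  obtain C where C: "C > 0" "\<And>x. x \<in> {a..b} \<Longrightarrow> norm (e x) \<le> C" using continuous_on_Icc_bounded[OF assms] by blast
  show ?thesis
  proof (rule L2_bounded)
    show "(\<lambda>x. e x * chi u v x) \<in> borel_measurable N"
      using continuous_on_measurable_lebesgue_on[OF assms] L2_integrable(2)[OF chi_L2] by measurable
    show "norm (e x * chi u v x) \<le> C" if "x \<in> {a<..<b}" for x
      using C(2)[of x] C(1) that by (simp add: chi_def norm_mult indicator_def)
  qed
qed

lemma nsq_chi: "nsq M (chi u v) = wt u v" "wt u v > 0"
proof -
  show "nsq M (chi u v) = wt u v"
    unfolding nsq_M(1)[OF chi_L2] wt_def set_integral_N[OF uv(1,3)]
    by (rule Bochner_Integration.integral_cong) (auto simp: chi_def indicator_def)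
  have "wt u v = (LINT t:{u<..<v}|lebesgue. \<bar>r t\<bar>)"
    unfolding wt_def set_integral_N[OF uv(1,3)]
    by (rule integral_cong_AE)
      (use integrable_indicator_N[OF r_integrable uv(1,3)] integrable_indicator_N[OF integrable_abs[OF r_integrable] uv(1,3)] r_pos
        in \<open>auto elim!: eventually_mono\<close>)
  then show "wt u v > 0" using set_integral_r_pos[OF uv] by simp
qed

lemma nsq_chi_mult:
  assumes "continuous_on {a..b} e"
  shows "nsq M (\<lambda>x. e x * chi u v x) = (LINT t:{u<..<v}|lebesgue. r t * (norm (e t))\<^sup>2)"
  unfolding nsq_M(1)[OF chi_mult_L2[OF assms]] set_integral_N[OF uv(1,3)]
  by (rule Bochner_Integration.integral_cong) (auto simp: chi_def indicator_def norm_mult)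

lemma inner_chi_mult: "l2_inner M (\<lambda>x. e x * chi u v x) (chi u v) = l2_inner M e (chi u v)"
  unfolding l2_inner_def by (rule Bochner_Integration.integral_cong) (auto simp: chi_def indicator_def)

text \<open>Cauchy-Schwarz on the cell: the left side is the squared norm of the projection of
  \<open>e\<close> onto the line spanned by \<open>chi u v\<close>.\<close>

lemma chi_upper:
  assumes e: "continuous_on {a..b} e"
  shows "(norm (l2_inner M e (chi u v)))\<^sup>2 / wt u v \<le> (LINT t:{u<..<v}|lebesgue. r t * (norm (e t))\<^sup>2)"
  using Cauchy_Schwarz_L2[OF chi_mult_L2[OF e] chi_L2] nsq_chi
  by (simp add: inner_chi_mult nsq_chi_mult[OF e] pos_divide_le_eq)

text \<open>On the cell \<open>e\<close> differs from its midpoint value by at most \<omega>, so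
  \<open>e * chi u v\<close> is close to a multiple of \<open>chi u v\<close>. Expanding the square
  and estimating the mixed term by the arithmetic-geometric mean eliminates the midpoint
  value.\<close>

lemma chi_lower:
  assumes e: "continuous_on {a..b} e" and \<omega>: "\<And>x t. x \<in> {u<..<v} \<Longrightarrow> t \<in> {u<..<v} \<Longrightarrow> norm (e x - e t) \<le> \<omega>"
  shows "(LINT t:{u<..<v}|lebesgue. r t * (norm (e t))\<^sup>2) - \<omega>\<^sup>2 * wt u v \<le> (norm (l2_inner M e (chi u v)))\<^sup>2 / wt u v"
proof -
  define c where "c = e ((u + v) / 2)"
  define s where "s = l2_inner M e (chi u v)"
  define w where "w = wt u v"
  have w: "w > 0" unfolding w_def by (rule nsq_chi(2))
  have L: "(\<lambda>x. e x * chi u v x - c * chi u v x) \<in> L2 M" by (intro L2_diff L2_scale chi_L2 chi_mult_L2 e)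
  have "nsq M (\<lambda>x. e x * chi u v x - c * chi u v x) \<le> (\<integral>t. \<omega>\<^sup>2 * (indicator {u<..<v} t *\<^sub>R r t) \<partial>N)"
    unfolding nsq_M(1)[OF L]
  proof (rule integral_mono_AE[OF nsq_M(2)[OF L] integrable_mult_right[OF integrable_indicator_N[OF r_integrable uv(1,3)]]])
    show "AE t in N. r t * (norm (e t * chi u v t - c * chi u v t))\<^sup>2 \<le> \<omega>\<^sup>2 * (indicator {u<..<v} t *\<^sub>R r t)"
      using r_pos
    proof eventually_elim
      case (elim t)
      show ?case
      proof (cases "t \<in> {u<..<v}")
        case True
        have "(norm (e t - c))\<^sup>2 \<le> \<omega>\<^sup>2" unfolding c_def using \<omega>[OF True] uv by (intro power_mono) auto
        then show ?thesis using True elim by (simp add: chi_def mult.commute mult_right_mono)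
      qed (simp add: chi_def)
    qed
  qed
  also have "(\<integral>t. \<omega>\<^sup>2 * (indicator {u<..<v} t *\<^sub>R r t) \<partial>N) = \<omega>\<^sup>2 * w"
    unfolding w_def wt_def set_integral_N[OF uv(1,3)] by simp
  finally have le: "nsq M (\<lambda>x. e x * chi u v x) - 2 * Re (c * s) + (norm c)\<^sup>2 * w \<le> \<omega>\<^sup>2 * w"
    unfolding nsq_diff[OF chi_mult_L2[OF e] L2_scale[OF chi_L2]] inner_scale_right inner_chi_mult nsq_scale nsq_chi(1)
    by (simp add: s_def w_def)
  have "Re (c * s) \<le> norm c * norm s" using complex_Re_le_cmod[of "c * s"] by (simp add: norm_mult)
  moreover have "2 * (norm c * norm s) \<le> (norm s)\<^sup>2 / w + (norm c)\<^sup>2 * w"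
  proof -
    have "2 * (norm c * norm s) * w \<le> (norm s)\<^sup>2 + (norm c * w)\<^sup>2"
      using sum_squares_bound[of "norm s" "norm c * w"] by (simp add: mult_ac)
    then show ?thesis using w by (simp add: field_simps power2_eq_square)
  qed
  ultimately have "nsq M (\<lambda>x. e x * chi u v x) - \<omega>\<^sup>2 * w \<le> (norm s)\<^sup>2 / w" using le by linarith
  then show ?thesis by (simp add: nsq_chi_mult[OF e] s_def w_def)
qed

text \<open>Replacing \<open>green_kernel x t\<close> by its diagonal value costs \<omega> under the
  double integral over the cell; division by \<open>wt u v\<close> then turns this double integral
  into a single one along the diagonal.\<close>

lemma chi_green:
  assumes A: "A0 \<noteq> 0" and \<omega>: "\<And>x t. x \<in> {u<..<v} \<Longrightarrow> t \<in> {u<..<v} \<Longrightarrow> norm (green_kernel x t - green_kernel x x) \<le> \<omega>"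
  shows "norm (l2_inner M (chi u v) (green (chi u v)) / wt u v - (LINT x:{u<..<v}|lebesgue. green_kernel x x * of_real (r x))) \<le> \<omega> * wt u v"
proof -
  define w where "w = wt u v"
  have w: "w > 0" unfolding w_def by (rule nsq_chi(2))
  note ri = integrable_indicator_N[OF r_integrable uv(1,3)]
  have sub: "{u<..<v} \<subseteq> {a<..<b}" using uv by auto
  have \<omega>0: "\<omega> \<ge> 0" using \<omega>[of "(u+v)/2" "(u+v)/2"] uv by simp
  have rc: "integrable N (\<lambda>t. complex_of_real (r t) * chi u v t)" by (rule L2_integrable(1)[OF chi_L2])
  have wc: "(\<integral>t. complex_of_real (r t) * chi u v t \<partial>N) = of_real w"
    unfolding w_def wt_def set_integral_N[OF uv(1,3)] integral_complex_of_real[symmetric]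
    by (rule Bochner_Integration.integral_cong) (auto simp: chi_def)
  have pt: "norm (green (chi u v) x - of_real w * green_kernel x x) \<le> \<omega> * w" if x: "x \<in> {u<..<v}" for x
  proof -
    have xab: "x \<in> {a..b}" using x uv by auto
    have i1: "integrable N (\<lambda>t. green_kernel x t * (of_real (r t) * chi u v t))"
      by (rule integrable_continuous_mult[OF rc kernel_continuous_snd[OF xab]])
    have i2: "integrable N (\<lambda>t. green_kernel x x * (of_real (r t) * chi u v t))" by (rule integrable_mult_right[OF rc])
    have eq: "green (chi u v) x - of_real w * green_kernel x x = (\<integral>t. (green_kernel x t - green_kernel x x) * (of_real (r t) * chi u v t) \<partial>N)"
      unfolding left_diff_distrib Bochner_Integration.integral_diff[OF i1 i2]
      using xab wc by (simp add: green_def mult.commute)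
    have "norm (\<integral>t. (green_kernel x t - green_kernel x x) * (of_real (r t) * chi u v t) \<partial>N) \<le> (\<integral>t. norm ((green_kernel x t - green_kernel x x) * (of_real (r t) * chi u v t)) \<partial>N)"
      by (rule integral_norm_bound)
    also have "\<dots> \<le> (\<integral>t. \<omega> * (indicator {u<..<v} t *\<^sub>R r t) \<partial>N)"
    proof (rule integral_mono_AE[OF _ integrable_mult_right[OF ri]])
      show "integrable N (\<lambda>t. norm ((green_kernel x t - green_kernel x x) * (of_real (r t) * chi u v t)))"
        unfolding left_diff_distrib by (intro integrable_norm Bochner_Integration.integrable_diff i1 i2)
      show "AE t in N. norm ((green_kernel x t - green_kernel x x) * (of_real (r t) * chi u v t)) \<le> \<omega> * (indicator {u<..<v} t *\<^sub>R r t)"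
        using r_pos by eventually_elim (use \<omega>[OF x] in \<open>auto simp: chi_def norm_mult indicator_def intro!: mult_right_mono\<close>)
    qed
    also have "\<dots> = \<omega> * w" unfolding w_def wt_def set_integral_N[OF uv(1,3)] by simp
    finally show ?thesis unfolding eq .
  qed
  have diag: "continuous_on {a..b} (\<lambda>x. green_kernel x x)"
    using continuous_on_compose2[OF kernel_continuous continuous_on_Pair[OF continuous_on_id continuous_on_id], of "{a..b}"] by (force simp: image_subset_iff)
  have GL: "green (chi u v) \<in> L2 M" by (rule green_L2[OF A chi_L2])
  note i3 = inner_M(2)[OF chi_L2 GL]
  have i4: "integrable N (\<lambda>x. of_real w * (indicator {u<..<v} x *\<^sub>R (green_kernel x x * of_real (r x))))"
    using mult_r_integrable[OF diag] by (intro integrable_mult_right integrable_indicator_N uv) (simp add: mult.commute)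
  have eq: "l2_inner M (chi u v) (green (chi u v)) - of_real w * (LINT x:{u<..<v}|lebesgue. green_kernel x x * of_real (r x))
    = (\<integral>x. of_real (r x) * (cnj (chi u v x) * green (chi u v) x) - of_real w * (indicator {u<..<v} x *\<^sub>R (green_kernel x x * of_real (r x))) \<partial>N)"
    unfolding inner_M(1)[OF chi_L2 GL] set_integral_N[OF uv(1,3)] Bochner_Integration.integral_diff[OF i3 i4]
    by (simp only: integral_mult_right_zero)
  have bd: "norm (\<integral>x. of_real (r x) * (cnj (chi u v x) * green (chi u v) x) - of_real w * (indicator {u<..<v} x *\<^sub>R (green_kernel x x * of_real (r x))) \<partial>N)
     \<le> (\<integral>x. (\<omega> * w) * (indicator {u<..<v} x *\<^sub>R r x) \<partial>N)"
  proof (rule order_trans[OF integral_norm_bound], rule integral_mono_AE[OF _ integrable_mult_right[OF ri]])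
    show "integrable N (\<lambda>x. norm (of_real (r x) * (cnj (chi u v x) * green (chi u v) x) - of_real w * (indicator {u<..<v} x *\<^sub>R (green_kernel x x * of_real (r x)))))"
      by (intro integrable_norm Bochner_Integration.integrable_diff i3 i4)
    show "AE x in N. norm (of_real (r x) * (cnj (chi u v x) * green (chi u v) x) - of_real w * (indicator {u<..<v} x *\<^sub>R (green_kernel x x * of_real (r x))))
       \<le> (\<omega> * w) * (indicator {u<..<v} x *\<^sub>R r x)"
      using r_pos
    proof eventually_elim
      case (elim x)
      show ?case
      proof (cases "x \<in> {u<..<v}")
        case True
        then have "of_real (r x) * (cnj (chi u v x) * green (chi u v) x) - of_real w * (indicator {u<..<v} x *\<^sub>R (green_kernel x x * of_real (r x)))
           = of_real (r x) * (green (chi u v) x - of_real w * green_kernel x x)" by (simp add: chi_def algebra_simps)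
        then show ?thesis using pt[OF True] True elim
          by (simp add: norm_mult mult_left_mono mult.commute)
      qed (simp add: chi_def)
    qed
  qed
  have ww: "(\<integral>x. (\<omega> * w) * (indicator {u<..<v} x *\<^sub>R r x) \<partial>N) = \<omega> * w * w"
    unfolding w_def wt_def set_integral_N[OF uv(1,3)] integral_mult_right_zero ..
  from bd have "norm (l2_inner M (chi u v) (green (chi u v)) - of_real w * (LINT x:{u<..<v}|lebesgue. green_kernel x x * of_real (r x))) \<le> \<omega> * w * w"
    unfolding eq ww .
  moreover have "l2_inner M (chi u v) (green (chi u v)) / w - (LINT x:{u<..<v}|lebesgue. green_kernel x x * of_real (r x))
    = (l2_inner M (chi u v) (green (chi u v)) - of_real w * (LINT x:{u<..<v}|lebesgue. green_kernel x x * of_real (r x))) / of_real w"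
    using w by (simp add: field_simps)
  ultimately show ?thesis unfolding w_def[symmetric] using w by (simp add: norm_divide pos_divide_le_eq)
qed

end

lemma integral_partition:
  fixes F :: "real \<Rightarrow> complex"
  assumes F: "integrable N F" and X: "\<And>i. i < n \<Longrightarrow> X i \<le> X (Suc i)" "\<And>i. i \<le> n \<Longrightarrow> a \<le> X i \<and> X i \<le> b" "X 0 = a" "X n = b"
  shows "(\<Sum>i<n. LINT t:{X i<..<X (Suc i)}|lebesgue. F t) = (\<integral>t. F t \<partial>N)"
proof -
  note P = prim_indefinite[OF F, of 0]
  define f where "f = (\<lambda>x. 0 + (LINT t:{a<..<x}|lebesgue. F t))"
  have "(\<Sum>i<n. LINT t:{X i<..<X (Suc i)}|lebesgue. F t) = (\<Sum>i<n. f (X (Suc i)) - f (X i))"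
    unfolding f_def by (intro sum.cong refl prim_diff[OF P, symmetric]) (use X in auto)
  also have "\<dots> = f b - f a" using sum_lessThan_telescope[of "\<lambda>i. f (X i)" n] X by simp
  also have "\<dots> = (\<integral>t. F t \<partial>N)" using prim_integral[OF P] ab by (simp add: f_def)
  finally show ?thesis .
qed

text \<open>\<open>Suc n\<close> cells of equal length, so that there is at least one cell for every
  \<open>n\<close>.\<close>

definition mesh :: "nat \<Rightarrow> nat \<Rightarrow> real" where
  "mesh n i = a + (b - a) * (real i / real (Suc n))"

lemma mesh:
  "mesh n 0 = a" "mesh n (Suc n) = b" "mesh n i < mesh n (Suc i)"
  "i \<le> Suc n \<Longrightarrow> a \<le> mesh n i \<and> mesh n i \<le> b" "mesh n (Suc i) - mesh n i = (b - a) / real (Suc n)"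
proof -
  show "mesh n (Suc i) - mesh n i = (b - a) / real (Suc n)"
    unfolding mesh_def of_nat_Suc[of i] add_divide_distrib distrib_left by simp
  moreover have "(b - a) / real (Suc n) > 0" using ab by simp
  ultimately show "mesh n i < mesh n (Suc i)" by linarith
  show "a \<le> mesh n i \<and> mesh n i \<le> b" if "i \<le> Suc n"
  proof -
    have "0 \<le> real i / real (Suc n)" "real i / real (Suc n) \<le> 1" using that by auto
    then have "0 \<le> (b - a) * (real i / real (Suc n))" "(b - a) * (real i / real (Suc n)) \<le> (b - a) * 1"
      using ab by (simp, intro mult_left_mono) auto
    then show ?thesis by (simp add: mesh_def)
  qed
  have "real (Suc n) / real (Suc n) = 1" by (rule divide_self) simp
  then show "mesh n (Suc n) = b" by (simp only: mesh_def mult_1_right)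
qed (simp add: mesh_def)

lemma mesh_partition:
  fixes F :: "real \<Rightarrow> complex"
  assumes F: "integrable N F"
  shows "(\<Sum>i<Suc n. LINT t:{mesh n i<..<mesh n (Suc i)}|lebesgue. F t) = (\<integral>t. F t \<partial>N)"
  by (rule integral_partition[OF F]) (simp_all only: mesh less_imp_le)

lemma mesh_fine:
  assumes "d > 0"
  shows "\<exists>n0. \<forall>n\<ge>n0. \<forall>i. \<forall>x\<in>{mesh n i<..<mesh n (Suc i)}. \<forall>t\<in>{mesh n i<..<mesh n (Suc i)}. \<bar>x - t\<bar> < d"
proof -
  obtain n0 where n0: "real n0 > (b - a) / d" using reals_Archimedean2 by blast
  show ?thesis
  proof (intro exI[of _ n0] allI impI ballI)
    fix n i x t assume n: "n0 \<le> n" and x: "x \<in> {mesh n i<..<mesh n (Suc i)}" "t \<in> {mesh n i<..<mesh n (Suc i)}"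
    have "\<bar>x - t\<bar> < (b - a) / real (Suc n)" using x mesh(5)[of n i] by (auto simp: abs_if)
    also have "\<dots> \<le> d"
    proof -
      have "(b - a) / d < real (Suc n)" using n n0 by linarith
      then show ?thesis using assms by (simp add: field_simps)
    qed
    finally show "\<bar>x - t\<bar> < d" .
  qed
qed

text \<open>Averages over the cells of a fine partition compute the trace of the Green operator, once as the
  integral of the kernel over the diagonal and once through the eigenfunction expansion.\<close>

theorem trace_positive:
  assumes U: "orthonormal_basis M U" and A: "A0 \<noteq> 0"
    and ev: "\<And>e. e \<in> U \<Longrightarrow> \<exists>u. trel (\<lambda>x. of_real (l e) * e x) e u" and l: "\<And>e. e \<in> U \<Longrightarrow> l e > 0"
  shows "((\<lambda>e. 1 / complex_of_real (l e)) has_sum - bc_coeff a b p q r \<alpha> R 1 / A0) U"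
proof -
  have UL: "e \<in> L2 M" "nsq M e = 1" if "e \<in> U" for e
    using U that inner_self[of M e] by (auto simp: orthonormal_basis_iff orthonormal_def)
  have Uc: "continuous_on {a..b} e" if "e \<in> U" for e
    using ev[OF that] trel_L2_cases by blast
  \<comment> \<open>The form of the Green operator in the eigenbasis; symmetry moves the eigenvalue
    onto the basis vector.\<close>
  have quad: "((\<lambda>e. complex_of_real ((norm (l2_inner M e f))\<^sup>2 / l e)) has_sum l2_inner M f (green f)) U" if f: "f \<in> L2 M" for f
  proof -
    have "cnj (l2_inner M e f) * l2_inner M e (green f) = complex_of_real ((norm (l2_inner M e f))\<^sup>2 / l e)" if e: "e \<in> U" for e
    proof -
      obtain u u' where t: "trel (\<lambda>x. of_real (l e) * e x) e u" "trel f (green f) u'"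
        using ev[OF e] green_trel[OF A f] by blast
      have "l2_inner M e f = of_real (l e) * l2_inner M e (green f)"
        using trel_symmetric[OF t] by (simp add: inner_scale_left)
      then have "l2_inner M e (green f) = l2_inner M e f / of_real (l e)" using l[OF e] by simp
      then show ?thesis using complex_norm_square[of "l2_inner M e f"] by (simp add: mult.commute)
    qed
    then show ?thesis using Parseval_inner[OF U f green_L2[OF A f]] has_sum_cong by force
  qed
  define X where "X = mesh"
  define c where "c = (\<lambda>n i. chi (X n i) (X n (Suc i)))"
  define w where "w = (\<lambda>n i. wt (X n i) (X n (Suc i)))"
  have cell: "a \<le> X n i" "X n i < X n (Suc i)" "X n (Suc i) \<le> b" if "i < Suc n" for n i
    using mesh(3)[of n i] mesh(4)[of "Suc i" n] mesh(4)[of i n] that by (auto simp: X_def)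
  have w0: "w n i > 0" if "i < Suc n" for n i unfolding w_def by (rule nsq_chi(2)[OF cell[OF that]])
  define \<rho> where "\<rho> = (\<integral>t. r t \<partial>N)"
  have real_partition: "(\<Sum>i<Suc n. LINT t:{X n i<..<X n (Suc i)}|lebesgue. F t) = (\<integral>t. F t \<partial>N)" if F: "integrable N F" for F :: "real \<Rightarrow> real" and n
  proof -
    have "complex_of_real (\<Sum>i<Suc n. LINT t:{X n i<..<X n (Suc i)}|lebesgue. F t) = complex_of_real (\<integral>t. F t \<partial>N)"
      using mesh_partition[OF integrable_of_real[OF F], of n, folded X_def]
      unfolding set_integral_complex_of_real integral_complex_of_real of_real_sum .
    then show ?thesis by (simp only: of_real_eq_iff)
  qed
  have wsum: "(\<Sum>i<Suc n. w n i) = \<rho>" for n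
    unfolding w_def wt_def \<rho>_def by (rule real_partition[OF r_integrable])
  have \<rho>0: "\<rho> > 0" using wsum[of 0] w0[of 0 0] by simp
  \<comment> \<open>The trace of \<open>green\<close> compressed to the span of the cell
    indicators.\<close>
  define T where "T = (\<lambda>n. \<Sum>i<Suc n. l2_inner M (c n i) (green (c n i)) / of_real (w n i))"
  define \<tau> where "\<tau> = (\<integral>x. green_kernel x x * of_real (r x) \<partial>N)"
  have diag: "continuous_on {a..b} (\<lambda>x. green_kernel x x)"
    using continuous_on_compose2[OF kernel_continuous continuous_on_Pair[OF continuous_on_id continuous_on_id], of "{a..b}"] by (force simp: image_subset_iff)
  have Tlim: "T \<longlonglongrightarrow> \<tau>"
  proof (rule LIMSEQ_I)
    fix \<epsilon> :: real assume \<epsilon>: "\<epsilon> > 0"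
    \<comment> \<open>The errors \<open>\<omega> * w n i\<close> of the cells add up to
      \<open>\<omega> * \<rho>\<close>, which is \<open>\<epsilon> / 2\<close>.\<close>
    define \<omega> where "\<omega> = \<epsilon> / (2 * \<rho>)"
    have \<omega>: "\<omega> > 0" using \<epsilon> \<rho>0 by (simp add: \<omega>_def)
    have "uniformly_continuous_on ({a..b} \<times> {a..b}) (\<lambda>z. green_kernel (fst z) (snd z))"
      by (intro compact_uniformly_continuous kernel_continuous compact_Times compact_Icc)
    then obtain d where d: "d > 0" "\<And>z z'. \<lbrakk>z \<in> {a..b} \<times> {a..b}; z' \<in> {a..b} \<times> {a..b}; dist z' z < d\<rbrakk> \<Longrightarrow>
        dist (green_kernel (fst z') (snd z')) (green_kernel (fst z) (snd z)) < \<omega>"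
      unfolding uniformly_continuous_on_def using \<omega> by metis
    obtain n0 where n0: "\<And>n i x t. n \<ge> n0 \<Longrightarrow> x \<in> {X n i<..<X n (Suc i)} \<Longrightarrow> t \<in> {X n i<..<X n (Suc i)} \<Longrightarrow> \<bar>x - t\<bar> < d"
      using mesh_fine[OF d(1)] unfolding X_def by blast
    have "norm (T n - \<tau>) < \<epsilon>" if n: "n \<ge> n0" for n
    proof -
      have "\<tau> = (\<Sum>i<Suc n. LINT x:{X n i<..<X n (Suc i)}|lebesgue. green_kernel x x * of_real (r x))"
        unfolding \<tau>_def X_def by (rule mesh_partition[symmetric])
          (use mult_r_integrable[OF diag] in \<open>simp add: mult.commute\<close>)
      then have eq: "T n - \<tau> = (\<Sum>i<Suc n. l2_inner M (c n i) (green (c n i)) / of_real (w n i) - (LINT x:{X n i<..<X n (Suc i)}|lebesgue. green_kernel x x * of_real (r x)))"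
        unfolding T_def by (simp only: sum_subtractf)
      have "norm (T n - \<tau>) \<le> (\<Sum>i<Suc n. \<omega> * w n i)"
        unfolding eq
      proof (rule sum_norm_le)
        fix i assume i: "i \<in> {..<Suc n}"
        then have i': "i < Suc n" by simp
        show "norm (l2_inner M (c n i) (green (c n i)) / of_real (w n i) - (LINT x:{X n i<..<X n (Suc i)}|lebesgue. green_kernel x x * of_real (r x))) \<le> \<omega> * w n i"
          unfolding c_def w_def
        proof (rule chi_green[OF cell[OF i'] A])
          fix x t assume xt: "x \<in> {X n i<..<X n (Suc i)}" "t \<in> {X n i<..<X n (Suc i)}"
          have "x \<in> {a..b}" "t \<in> {a..b}" using xt cell[OF i'] by auto
          then show "norm (green_kernel x t - green_kernel x x) \<le> \<omega>"
            using d(2)[of "(x, x)" "(x, t)"] n0[OF n xt] by (auto simp: dist_Pair_Pair dist_norm abs_minus_commute)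
        qed
      qed
      also have "\<dots> = \<omega> * \<rho>" by (simp only: sum_distrib_left[symmetric] wsum)
      also have "\<dots> < \<epsilon>" using \<epsilon> \<rho>0 by (simp add: \<omega>_def)
      finally show ?thesis .
    qed
    then show "\<exists>n0. \<forall>n\<ge>n0. norm (T n - \<tau>) < \<epsilon>" by blast
  qed
  \<comment> \<open>The squared norm of the projection of \<open>e\<close> onto the span of the cell
    indicators: at most 1, and tending to 1 by uniform continuity of \<open>e\<close>.\<close>
  define W where "W = (\<lambda>n e. \<Sum>i<Suc n. (norm (l2_inner M e (c n i)))\<^sup>2 / w n i)"
  have W0: "W n e \<ge> 0" for n e unfolding W_def by (intro sum_nonneg) (use w0 in \<open>auto intro!: divide_nonneg_nonneg simp: less_imp_le\<close>)
  have Qsum: "(\<Sum>i<Suc n. LINT t:{X n i<..<X n (Suc i)}|lebesgue. r t * (norm (e t))\<^sup>2) = 1" if e: "e \<in> U" for n e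
    using real_partition[OF nsq_M(2)[OF UL(1)[OF e]], of n] nsq_M(1)[OF UL(1)[OF e]] UL(2)[OF e] by simp
  have W1: "W n e \<le> 1" if e: "e \<in> U" for n e
    unfolding Qsum[OF e, of n, symmetric] W_def c_def w_def
    by (intro sum_mono chi_upper cell Uc e) auto
  have Wlim: "(\<lambda>n. W n e) \<longlonglongrightarrow> 1" if e: "e \<in> U" for e
  proof (rule LIMSEQ_I)
    fix \<epsilon> :: real assume \<epsilon>: "\<epsilon> > 0"
    define \<omega> where "\<omega> = sqrt (\<epsilon> / (2 * \<rho>))"
    have \<omega>: "\<omega> > 0" using \<epsilon> \<rho>0 by (simp add: \<omega>_def)
    have \<omega>2: "\<omega>\<^sup>2 * \<rho> = \<epsilon> / 2" using \<epsilon> \<rho>0 by (simp add: \<omega>_def)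
    have "uniformly_continuous_on {a..b} e"
      by (intro compact_uniformly_continuous Uc e compact_Icc)
    then obtain d where d: "d > 0" "\<And>z z'. \<lbrakk>z \<in> {a..b}; z' \<in> {a..b}; dist z' z < d\<rbrakk> \<Longrightarrow> dist (e z') (e z) < \<omega>"
      unfolding uniformly_continuous_on_def using \<omega> by metis
    obtain n0 where n0: "\<And>n i x t. n \<ge> n0 \<Longrightarrow> x \<in> {X n i<..<X n (Suc i)} \<Longrightarrow> t \<in> {X n i<..<X n (Suc i)} \<Longrightarrow> \<bar>x - t\<bar> < d"
      using mesh_fine[OF d(1)] unfolding X_def by blast
    have "norm (W n e - 1) < \<epsilon>" if n: "n \<ge> n0" for n
    proof -
      have "1 - \<omega>\<^sup>2 * \<rho> = (\<Sum>i<Suc n. (LINT t:{X n i<..<X n (Suc i)}|lebesgue. r t * (norm (e t))\<^sup>2) - \<omega>\<^sup>2 * w n i)"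
        by (simp only: sum_subtractf Qsum[OF e] sum_distrib_left[symmetric] wsum)
      also have "\<dots> \<le> W n e" unfolding W_def
      proof (rule sum_mono)
        fix i assume i: "i \<in> {..<Suc n}"
        then have i': "i < Suc n" by simp
        show "(LINT t:{X n i<..<X n (Suc i)}|lebesgue. r t * (norm (e t))\<^sup>2) - \<omega>\<^sup>2 * w n i \<le> (norm (l2_inner M e (c n i)))\<^sup>2 / w n i"
          unfolding c_def w_def
        proof (rule chi_lower[OF cell[OF i'] Uc[OF e]])
          fix x t assume xt: "x \<in> {X n i<..<X n (Suc i)}" "t \<in> {X n i<..<X n (Suc i)}"
          have "x \<in> {a..b}" "t \<in> {a..b}" using xt cell[OF i'] by auto
          then show "norm (e x - e t) \<le> \<omega>" using d(2)[of t x] n0[OF n xt] by (auto simp: dist_norm)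
        qed
      qed
      finally show ?thesis using W1[OF e, of n] \<omega>2 \<epsilon> by (simp add: abs_if)
    qed
    then show "\<exists>n0. \<forall>n\<ge>n0. norm (W n e - 1) < \<epsilon>" by blast
  qed
  have Tsum: "((\<lambda>e. complex_of_real (W n e / l e)) has_sum T n) U" for n
  proof -
    have "((\<lambda>e. \<Sum>i<Suc n. complex_of_real ((norm (l2_inner M e (c n i)))\<^sup>2 / l e) / of_real (w n i)) has_sum T n) U"
      unfolding T_def
    proof (rule has_sum_finite_sum)
      fix i assume i: "i \<in> {..<Suc n}"
      have "c n i \<in> L2 M" unfolding c_def using i by (intro chi_L2 cell) auto
      from has_sum_cmult_right[OF quad[OF this], of "inverse (of_real (w n i))"]
      show "((\<lambda>e. complex_of_real ((norm (l2_inner M e (c n i)))\<^sup>2 / l e) / of_real (w n i)) has_sum l2_inner M (c n i) (green (c n i)) / of_real (w n i)) U"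
        by (simp only: divide_inverse mult.commute)
    qed
    moreover have "(\<lambda>e. \<Sum>i<Suc n. complex_of_real ((norm (l2_inner M e (c n i)))\<^sup>2 / l e) / of_real (w n i)) = (\<lambda>e. complex_of_real (W n e / l e))"
      unfolding W_def sum_divide_distrib of_real_sum by (intro ext sum.cong) (auto simp: mult.commute)
    ultimately show ?thesis by simp
  qed
  have TR: "((\<lambda>e. W n e / l e) has_sum Re (T n)) U" for n
    using has_sum_Re[OF Tsum[of n]] by simp
  have TI: "Im (T n) = 0" for n
  proof -
    have "((\<lambda>e. 0::real) has_sum Im (T n)) U" using has_sum_Im[OF Tsum[of n]] by simp
    then show ?thesis using has_sum_unique[OF _ has_sum_0] by blast
  qed
  have Rlim: "(\<lambda>n. Re (T n)) \<longlonglongrightarrow> Re \<tau>" by (rule tendsto_Re[OF Tlim])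
  have "(\<lambda>n. Im (T n)) \<longlonglongrightarrow> Im \<tau>" by (rule tendsto_Im[OF Tlim])
  then have I0: "Im \<tau> = 0" unfolding TI using LIMSEQ_unique tendsto_const by blast
  \<comment> \<open>Positivity of the eigenvalues lets a finite part of the sum for
    \<open>T n\<close> be kept and \<open>n\<close> tend to infinity in that part alone. The reverse
    inequality comes from \<open>W n e \<le> 1\<close> for every \<open>n\<close>.\<close>
  have fin: "(\<Sum>e\<in>F. 1 / l e) \<le> Re \<tau>" if F: "finite F" "F \<subseteq> U" for F
  proof (rule LIMSEQ_le[OF _ Rlim])
    show "(\<lambda>n. \<Sum>e\<in>F. W n e / l e) \<longlonglongrightarrow> (\<Sum>e\<in>F. 1 / l e)"
    proof (rule tendsto_sum)
      fix e assume e: "e \<in> F"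
      then have "l e \<noteq> 0" using l F by force
      then show "(\<lambda>n. W n e / l e) \<longlonglongrightarrow> 1 / l e" using Wlim[of e] e F by (intro tendsto_divide tendsto_const) auto
    qed
    show "\<exists>N. \<forall>n\<ge>N. (\<Sum>e\<in>F. W n e / l e) \<le> Re (T n)"
      by (intro exI[of _ 0] allI impI finite_sum_le_has_sum[OF TR] F) (use W0 l in \<open>auto intro!: divide_nonneg_nonneg simp: less_imp_le\<close>)
  qed
  have s: "(\<lambda>e. 1 / l e) summable_on U"
    by (rule nonneg_bdd_above_summable_on) (use fin l in \<open>auto simp: bdd_above_def less_imp_le\<close>)
  define L where "L = infsum (\<lambda>e. 1 / l e) U"
  have hL: "((\<lambda>e. 1 / l e) has_sum L) U" using s by (simp add: L_def)
  have "L \<le> Re \<tau>" unfolding L_def by (rule infsum_le_finite_sums[OF s fin])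
  moreover have "Re \<tau> \<le> L"
  proof (rule LIMSEQ_le_const2[OF Rlim])
    show "\<exists>N. \<forall>n\<ge>N. Re (T n) \<le> L"
      by (intro exI[of _ 0] allI impI has_sum_mono[OF TR hL]) (use W1 l in \<open>auto intro!: divide_right_mono simp: less_imp_le\<close>)
  qed
  ultimately have "\<tau> = of_real L" using I0 by (simp add: complex_eq_iff)
  moreover have "((\<lambda>e. complex_of_real (1 / l e)) has_sum of_real L) U" by (rule has_sum_of_real[OF hL])
  ultimately show ?thesis using kernel_trace[OF A] by (simp add: \<tau>_def)
qed

end

section \<open>The logarithmic derivative of the characteristic function\<close>

text \<open>For each \<open>e\<close> this is a geometric series in
  \<open>(z - m) / (l e - m)\<close>. The ratios are bounded by one number \<open>t < 1\<close>, so
  the double family is absolutely summable and the order of summation may be exchanged. Absolute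
  values admit centres with \<open>l e\<close> on both sides, such as 0.\<close>

lemma resolvent_power_series:
  fixes l :: "'a \<Rightarrow> real" and m \<rho> :: real and z :: complex
  assumes s: "(\<lambda>e. 1 / \<bar>l e - m\<bar>) summable_on V" and \<rho>: "\<And>e. e \<in> V \<Longrightarrow> \<rho> \<le> \<bar>l e - m\<bar>"
    and z: "norm (z - of_real m) < \<rho>"
  shows "(\<lambda>e. 1 / (of_real (l e) - z)) summable_on V"
    and "(\<lambda>k. (z - of_real m) ^ k * (\<Sum>\<^sub>\<infinity>e\<in>V. 1 / of_real (l e - m) ^ Suc k)) sums (\<Sum>\<^sub>\<infinity>e\<in>V. 1 / (of_real (l e) - z))"
proof -
  define d where "d = z - of_real m"
  define t where "t = norm d / \<rho>"
  have \<rho>0: "\<rho> > 0" using z norm_ge_zero[of "z - of_real m"] by linarith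
  have t: "0 \<le> t" "t < 1" using z \<rho>0 by (auto simp: t_def d_def)
  define x where "x = (\<lambda>e. complex_of_real (l e - m))"
  have nx: "norm (x e) = \<bar>l e - m\<bar>" for e unfolding x_def norm_of_real ..
  have dx: "norm (d / x e) \<le> t" if "e \<in> V" for e
    unfolding norm_divide nx t_def using \<rho>[OF that] \<rho>0 by (intro divide_left_mono) auto
  define f where "f = (\<lambda>(e, k::nat). d ^ k / x e ^ Suc k)"
  have fe: "f (e, k) = 1 / x e * (d / x e) ^ k" for e k
    by (simp add: f_def power_divide)
  have row: "((\<lambda>k. f (e, k)) has_sum (1 / (of_real (l e) - z))) UNIV" if e: "e \<in> V" for e
  proof -
    have x0: "x e \<noteq> 0" using nx[of e] \<rho>[OF e] \<rho>0 by auto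
    have n1: "norm (d / x e) < 1" using dx[OF e] t by linarith
    have "summable (\<lambda>k. norm (f (e, k)))" unfolding fe norm_mult norm_power
      by (intro summable_mult summable_geometric) (use n1 in simp)
    moreover have "(\<lambda>k. f (e, k)) sums (1 / x e * (1 / (1 - d / x e)))"
      unfolding fe by (intro sums_mult geometric_sums n1)
    moreover have "1 / x e * (1 / (1 - d / x e)) = 1 / (x e - d)"
      using x0 n1 by (auto simp: divide_simps algebra_simps)
    moreover have "x e - d = of_real (l e) - z" by (simp add: x_def d_def)
    ultimately show ?thesis using norm_summable_imp_has_sum by force
  qed
  have nrow: "((\<lambda>k. norm (f (e, k))) has_sum (1 / norm (x e) * (1 / (1 - norm (d / x e))))) UNIV" if e: "e \<in> V" for e
  proof -
    have n1: "norm (d / x e) < 1" using dx[OF e] t by linarith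
    have "(\<lambda>k. norm (f (e, k))) sums (1 / norm (x e) * (1 / (1 - norm (d / x e))))"
      unfolding fe norm_mult norm_power norm_divide[of 1] norm_one by (intro sums_mult geometric_sums) (use n1 in simp)
    then show ?thesis by (intro sums_nonneg_imp_has_sum) auto
  qed
  have "(\<lambda>p. norm (f p)) summable_on V \<times> UNIV"
  proof (rule summable_on_SigmaI)
    show "((\<lambda>k. norm (f (e, k))) has_sum (1 / norm (x e) * (1 / (1 - norm (d / x e))))) UNIV" if "e \<in> V" for e by (rule nrow[OF that])
    show "(\<lambda>e. 1 / norm (x e) * (1 / (1 - norm (d / x e)))) summable_on V"
    proof (rule summable_on_comparison_test)
      show "(\<lambda>e. 1 / \<bar>l e - m\<bar> * (1 / (1 - t))) summable_on V" by (rule summable_on_cmult_left[OF s])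
      fix e assume e: "e \<in> V"
      show "1 / norm (x e) * (1 / (1 - norm (d / x e))) \<le> 1 / \<bar>l e - m\<bar> * (1 / (1 - t))"
        unfolding nx using dx[OF e] t by (intro mult_left_mono divide_left_mono) auto
      show "0 \<le> 1 / norm (x e) * (1 / (1 - norm (d / x e)))" using dx[OF e] t by (intro mult_nonneg_nonneg) auto
    qed
  qed auto
  then have fs: "f summable_on V \<times> UNIV" by (rule abs_summable_summable)
  then obtain s0 where s0: "(f has_sum s0) (V \<times> UNIV)" by (auto simp: summable_on_def)
  have S: "((\<lambda>e. 1 / (of_real (l e) - z)) has_sum s0) V"
    by (rule has_sum_SigmaD[OF s0]) (use row in auto)
  then show "(\<lambda>e. 1 / (of_real (l e) - z)) summable_on V" by (auto simp: summable_on_def)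
  have S': "((\<lambda>(k, e). f (e, k)) has_sum s0) (UNIV \<times> V)"
    using s0 has_sum_swap[of f V UNIV s0] by simp
  have col: "((\<lambda>e. f (e, k)) has_sum (d ^ k * (\<Sum>\<^sub>\<infinity>e\<in>V. 1 / x e ^ Suc k))) V" for k
  proof -
    have "(\<lambda>e. inverse (x e) ^ Suc k) summable_on V"
    proof (rule abs_summable_summable, rule summable_on_comparison_test)
      show "(\<lambda>e. (1 / \<bar>l e - m\<bar>) * (1 / \<rho> ^ k)) summable_on V" by (rule summable_on_cmult_left[OF s])
      fix e assume e: "e \<in> V"
      have "1 / \<bar>l e - m\<bar> ^ k \<le> 1 / \<rho> ^ k" using \<rho>[OF e] \<rho>0
        by (intro divide_left_mono power_mono mult_pos_pos zero_less_power) auto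
      then show "norm (inverse (x e) ^ Suc k) \<le> (1 / \<bar>l e - m\<bar>) * (1 / \<rho> ^ k)"
        unfolding power_Suc norm_mult norm_power norm_inverse nx
        using \<rho>[OF e] \<rho>0 by (intro mult_mono) (auto simp: divide_inverse power_inverse)
    qed auto
    then have "(\<lambda>e. 1 / x e ^ Suc k) summable_on V" by (simp add: divide_inverse power_inverse)
    from has_sum_cmult_right[OF has_sum_infsum[OF this], of "d ^ k"]
    show ?thesis by (simp add: f_def)
  qed
  have "((\<lambda>k. d ^ k * (\<Sum>\<^sub>\<infinity>e\<in>V. 1 / x e ^ Suc k)) has_sum s0) UNIV"
    by (rule has_sum_SigmaD[OF S']) (use col in auto)
  then have "(\<lambda>k. d ^ k * (\<Sum>\<^sub>\<infinity>e\<in>V. 1 / x e ^ Suc k)) sums s0" by (rule has_sum_imp_sums)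
  then show "(\<lambda>k. (z - of_real m) ^ k * (\<Sum>\<^sub>\<infinity>e\<in>V. 1 / of_real (l e - m) ^ Suc k)) sums (\<Sum>\<^sub>\<infinity>e\<in>V. 1 / (of_real (l e) - z))"
    using infsumI[OF S] by (simp add: d_def x_def)
qed

context coupled begin

abbreviation F :: "complex \<Rightarrow> complex" where "F \<equiv> char_fun a b p q r \<alpha> R"

definition char_coeff :: "nat \<Rightarrow> complex" where
  "char_coeff k = bc_coeff a b p q r \<alpha> R k + (if k = 0 then cis (2 * \<alpha>) + 1 else 0)"

lemma char_fun_sums': "(\<lambda>k. char_coeff k * z ^ k) sums F z"
  using char_fun_sums[of z \<alpha> R] by (simp add: char_coeff_def mult.commute)

lemma char_fun_fps: "F has_fps_expansion Abs_fps char_coeff"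
  by (rule has_fps_expansionI) (simp add: char_fun_sums')

lemma char_fun_holomorphic: "F holomorphic_on UNIV"
proof -
  have "F holomorphic_on ball 0 (norm z + 1)" for z
    by (rule power_series_holomorphic[of 0 _ char_coeff]) (simp add: char_fun_sums')
  then have "F field_differentiable at z" for z
    by (rule holomorphic_on_imp_differentiable_at[of _ "ball 0 (norm z + 1)"]) auto
  then show ?thesis by (simp add: holomorphic_on_def field_differentiable_at_within)
qed

lemma deriv_char_fun_0: "deriv F 0 = bc_coeff a b p q r \<alpha> R 1"
  using has_fps_expansion_imp_0_eq_fps_nth_0[OF has_fps_expansion_deriv[OF char_fun_fps]]
  by (simp add: char_coeff_def)

lemma spectral_basis:
  obtains U l c where "orthonormal_basis M U" "\<And>e. e \<in> U \<Longrightarrow> \<exists>u. trel (\<lambda>x. of_real (l e) * e x) e u"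
    "\<And>e. e \<in> U \<Longrightarrow> c \<le> l e" "\<And>h y u. trel h y u \<Longrightarrow> c * nsq M y \<le> Re (l2_inner M y h)"
proof -
  obtain U where B: "orthonormal_basis M U" and U: "eigenset U" using eigenbasis_exists by blast
  obtain c where c: "\<And>h y u. trel h y u \<Longrightarrow> c * nsq M y \<le> Re (l2_inner M y h)" using lower_bound by blast
  have UL: "e \<in> L2 M" "nsq M e = 1" if "e \<in> U" for e
    using B that inner_self[of M e] by (auto simp: orthonormal_basis_iff orthonormal_def)
  have "\<exists>l u. trel (\<lambda>x. complex_of_real l * e x) e u" if e: "e \<in> U" for e
  proof -
    obtain d u where t: "trel (\<lambda>x. d * e x) e u" using U e by (auto simp: eigenset_def)
    have "e \<noteq> (\<lambda>_. 0)" using UL(2)[OF e] by (auto simp: nsq_def)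
    from eigen_real[OF t this] obtain l where "d = complex_of_real l" by (auto elim: Reals_cases)
    then show ?thesis using t by auto
  qed
  then obtain l where l: "\<And>e. e \<in> U \<Longrightarrow> \<exists>u. trel (\<lambda>x. complex_of_real (l e) * e x) e u" by metis
  have "c \<le> l e" if e: "e \<in> U" for e
  proof -
    obtain u where t: "trel (\<lambda>x. complex_of_real (l e) * e x) e u" using l[OF e] by blast
    show ?thesis using c[OF t] UL[OF e] by (simp add: inner_scale_right inner_self)
  qed
  then show ?thesis using that B l c by blast
qed

text \<open>Shifting by \<mu> makes all eigenvalues positive, so the trace formula applies, and the
  shifted characteristic function is a translate of \<open>F\<close>. A zero of \<open>F\<close> at
  \<mu> would give an eigenfunction below the lower bound.\<close>

lemma log_deriv_below:
  fixes \<mu> :: real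
  assumes B: "orthonormal_basis M U" and l: "\<And>e. e \<in> U \<Longrightarrow> \<exists>u. trel (\<lambda>x. of_real (l e) * e x) e u"
    and cl: "\<And>e. e \<in> U \<Longrightarrow> c \<le> l e" and c: "\<And>h y u. trel h y u \<Longrightarrow> c * nsq M y \<le> Re (l2_inner M y h)"
    and \<mu>: "\<mu> < c"
  shows "F \<mu> \<noteq> 0" and "((\<lambda>e. 1 / complex_of_real (l e - \<mu>)) has_sum - deriv F \<mu> / F \<mu>) U"
proof -
  interpret S: coupled a b p "\<lambda>x. q x - \<mu> * r x" r \<alpha> R by (rule shift_coupled)
  have Fs: "S.F = (\<lambda>z::complex. F (z + of_real \<mu>))" by (rule ext) (rule char_fun_shift)
  have A0: "S.A0 = F \<mu>" using S.char_fun_0 Fs by (metis add_0)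
  have d: "bc_coeff a b p (\<lambda>x. q x - \<mu> * r x) r \<alpha> R 1 = deriv F \<mu>"
  proof -
    have "(F has_field_derivative deriv F \<mu>) (at (0 + complex_of_real \<mu>))"
      using holomorphic_derivI[OF char_fun_holomorphic open_UNIV UNIV_I] by simp
    then have "((\<lambda>z::complex. F (z + of_real \<mu>)) has_field_derivative deriv F \<mu>) (at 0)" unfolding DERIV_shift by simp
    then show ?thesis using DERIV_imp_deriv S.deriv_char_fun_0 Fs by metis
  qed
  show F0: "F \<mu> \<noteq> 0"
  proof
    assume "F \<mu> = 0"
    then obtain y u where y: "S.trel (\<lambda>_. 0) y u" "y \<noteq> (\<lambda>_. 0)" using S.trel_zero_exists A0 by auto
    have t: "trel (\<lambda>x. \<mu> * y x) y u" using trel_shift[of \<mu> "\<lambda>x. \<mu> * y x" y u] y(1) by simp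
    have "nsq M y \<noteq> 0" using nsq_zero_imp[of y] y(2) trel_L2_cases[OF t] by auto
    then have "nsq M y > 0" using nsq_nonneg[of M y] by linarith
    moreover have "c * nsq M y \<le> \<mu> * nsq M y" using c[OF t] by (simp add: inner_scale_right inner_self)
    ultimately show False using \<mu> by simp
  qed
  have "((\<lambda>e. 1 / complex_of_real (l e - \<mu>)) has_sum - bc_coeff a b p (\<lambda>x. q x - \<mu> * r x) r \<alpha> R 1 / S.A0) U"
  proof (rule S.trace_positive[OF B])
    show "S.A0 \<noteq> 0" using F0 A0 by simp
    fix e assume e: "e \<in> U"
    show "l e - \<mu> > 0" using cl[OF e] \<mu> by simp
    obtain u where "trel (\<lambda>x. of_real (l e) * e x) e u" using l[OF e] by blast
    then have "S.trel (\<lambda>x. of_real (l e - \<mu>) * e x) e u"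
      using trel_shift[of \<mu> "\<lambda>x. of_real (l e) * e x" e u] by (simp add: left_diff_distrib)
    then show "\<exists>u. S.trel (\<lambda>x. of_real (l e - \<mu>) * e x) e u" by blast
  qed
  then show "((\<lambda>e. 1 / complex_of_real (l e - \<mu>)) has_sum - deriv F \<mu> / F \<mu>) U" unfolding A0 d .
qed

text \<open>Below the lower bound \<open>c\<close> of the spectrum the identity \<open>F' + F \<Sum> 1 / (\<lambda> - z) = 0\<close> is \<open>log_deriv_below\<close>.
  It extends to a disc around some \<open>m < c\<close> that contains a neighbourhood of \<open>0\<close>; the finitely many
  eigenvalues at most \<open>1\<close> are split off to make the rest of the sum holomorphic there.\<close>

theorem log_deriv_at_0:
  fixes l :: "(real \<Rightarrow> complex) \<Rightarrow> real" and c :: real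
  assumes B: "orthonormal_basis M U" and l: "\<And>e. e \<in> U \<Longrightarrow> \<exists>u. trel (\<lambda>x. of_real (l e) * e x) e u"
    and cl: "\<And>e. e \<in> U \<Longrightarrow> c \<le> l e" and c: "\<And>h y u. trel h y u \<Longrightarrow> c * nsq M y \<le> Re (l2_inner M y h)"
  defines "Z \<equiv> {e \<in> U. l e = 0}"
  defines "T \<equiv> \<lambda>z. \<Sum>\<^sub>\<infinity>e\<in>U - Z. 1 / (complex_of_real (l e) - z)"
  shows "\<And>B. finite {e \<in> U. l e \<le> B}" and "(\<lambda>e. 1 / \<bar>l e\<bar>) summable_on (U - Z)"
    and "\<exists>\<rho>>0. (\<forall>e\<in>U - Z. \<rho> \<le> \<bar>l e\<bar>) \<and>
      (\<forall>z. norm z < \<rho> \<longrightarrow> (\<lambda>k. (\<Sum>\<^sub>\<infinity>e\<in>U - Z. 1 / complex_of_real (l e) ^ Suc k) * z ^ k) sums T z) \<and>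
      (\<forall>z. norm z < \<rho> \<longrightarrow> z * deriv F z = of_nat (card Z) * F z - z * F z * T z)"
proof -
  have below: "F \<mu> \<noteq> 0" "((\<lambda>e. 1 / complex_of_real (l e - \<mu>)) has_sum - deriv F \<mu> / F \<mu>) U" if \<mu>: "\<mu> < c" for \<mu> :: real
    by (rule log_deriv_below[OF B _ _ _ \<mu>, where l = l]; fact l cl c)+
  \<comment> \<open>A real point below the spectrum that is also at most \<open>-1\<close>: the disc
    of radius \<open>1 - m\<close> about it ends at 1, the threshold for splitting off eigenvalues,
    and contains the unit disc.\<close>
  define m where "m = min (c - 1) (- 1)"
  have m: "m < c" "m \<le> - 1" by (auto simp: m_def)
  have lm: "l e - m > 0" if "e \<in> U" for e using cl[OF that] m by simp
  have "(\<lambda>e. 1 / (l e - m)) summable_on U"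
  proof -
    have "(\<lambda>e. Re (1 / complex_of_real (l e - m))) = (\<lambda>e. 1 / (l e - m))"
      by (rule ext) (metis Re_complex_of_real of_real_1 of_real_divide)
    with has_sum_imp_summable[OF has_sum_Re[OF below(2)[OF m(1)]]] show ?thesis by simp
  qed
  then have sm: "(\<lambda>e. 1 / \<bar>l e - m\<bar>) summable_on U"
    by (rule summable_on_cong[THEN iffD1, rotated]) (use lm in force)
  \<comment> \<open>Infinitely many eigenvalues up to \<open>B\<close> would contribute terms
    bounded away from 0 to a convergent sum.\<close>
  show fin: "finite {e \<in> U. l e \<le> B}" for B
  proof -
    define S where "S = {e \<in> U. l e \<le> B}"
    have "(\<lambda>e. 1 / \<bar>l e - m\<bar>) summable_on S" by (rule summable_on_subset_banach[OF sm]) (auto simp: S_def)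
    moreover have "1 / (\<bar>B - m\<bar> + 1) \<le> 1 / \<bar>l e - m\<bar>" if "e \<in> S" for e
    proof -
      have "0 < l e - m" "l e \<le> B" using that lm[of e] by (simp_all add: S_def)
      then show ?thesis by (intro frac_le) linarith+
    qed
    ultimately have "(\<lambda>e. 1 / (\<bar>B - m\<bar> + 1)) summable_on S"
      by (rule summable_on_comparison_test) simp_all
    then obtain s where s: "((\<lambda>e. 1 / (\<bar>B - m\<bar> + 1)) has_sum s) S" unfolding summable_on_def by blast
    have "finite S"
    proof (rule ccontr)
      assume inf: "infinite S"
      obtain n :: nat where n: "s * (\<bar>B - m\<bar> + 1) < real n" using reals_Archimedean2 by blast
      obtain G where G: "finite G" "card G = n" "G \<subseteq> S" using infinite_arbitrarily_large[OF inf] by blast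
      have "(\<Sum>e\<in>G. 1 / (\<bar>B - m\<bar> + 1)) \<le> s" by (rule finite_sum_le_has_sum[OF s G(1,3)]) simp
      then have "real n \<le> s * (\<bar>B - m\<bar> + 1)" using G by (simp add: field_simps)
      then show False using n by simp
    qed
    then show ?thesis by (simp add: S_def)
  qed
  define Fn V where "Fn = {e \<in> U. l e \<le> 1}" and "V = U - Fn"
  have Fn: "finite Fn" "Fn \<subseteq> U" using fin[of 1] by (auto simp: Fn_def)
  have ZF: "Z \<subseteq> Fn" by (auto simp: Z_def Fn_def)
  then have "finite Z" using Fn(1) by (rule finite_subset)
  \<comment> \<open>The entry 1 keeps the disc of radius \<rho> inside \<open>D0\<close>; together
    with the other entries it keeps the disc free of nonzero eigenvalues.\<close>
  define \<rho> where "\<rho> = Min (insert 1 ((\<lambda>e. \<bar>l e\<bar>) ` (Fn - Z)))"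
  have \<rho>0: "\<rho> > 0" "\<rho> \<le> 1" using Fn by (auto simp: \<rho>_def Z_def Fn_def)
  have \<rho>l: "\<rho> \<le> \<bar>l e\<bar>" if "e \<in> U - Z" for e
  proof (cases "e \<in> Fn")
    case True
    then show ?thesis unfolding \<rho>_def using Fn that by (intro Min_le) auto
  next
    case False
    then have "1 \<le> \<bar>l e\<bar>" using that by (auto simp: Fn_def)
    then show ?thesis using \<rho>0 by simp
  qed
  \<comment> \<open>Since \<open>\<bar>l e\<bar>\<close> stays above \<rho>,
    \<open>\<bar>l e - m\<bar>\<close> is at most a constant times \<open>\<bar>l e\<bar>\<close>,
    so summability at \<open>m\<close> carries over to 0.\<close>
  show s0: "(\<lambda>e. 1 / \<bar>l e\<bar>) summable_on (U - Z)"
  proof (rule summable_on_comparison_test)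
    show "(\<lambda>e. (1 / \<bar>l e - m\<bar>) * (1 + \<bar>m\<bar> / \<rho>)) summable_on (U - Z)"
      by (rule summable_on_cmult_left, rule summable_on_subset_banach[OF sm]) auto
    fix e assume e: "e \<in> U - Z"
    have "\<bar>m\<bar> * 1 \<le> \<bar>m\<bar> * (\<bar>l e\<bar> / \<rho>)" using \<rho>l[OF e] \<rho>0 by (intro mult_left_mono) auto
    then have "\<bar>l e - m\<bar> \<le> \<bar>l e\<bar> * (1 + \<bar>m\<bar> / \<rho>)" by (simp add: distrib_left mult.commute)
    moreover have "\<bar>l e\<bar> > 0" "\<bar>l e - m\<bar> > 0" using \<rho>l[OF e] \<rho>0 lm[of e] e by auto
    ultimately show "1 / \<bar>l e\<bar> \<le> (1 / \<bar>l e - m\<bar>) * (1 + \<bar>m\<bar> / \<rho>)" by (simp add: divide_simps mult.commute)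
  qed auto
  define H where "H = (\<lambda>z. \<Sum>\<^sub>\<infinity>e\<in>V. 1 / (complex_of_real (l e) - z))"
  have Vm: "1 - m \<le> \<bar>l e - m\<bar>" if "e \<in> V" for e using that m by (auto simp: V_def Fn_def)
  have smV: "(\<lambda>e. 1 / \<bar>l e - m\<bar>) summable_on V" by (rule summable_on_subset_banach[OF sm]) (auto simp: V_def)
  note HV = resolvent_power_series[OF smV Vm]
  define D0 where "D0 = ball (complex_of_real m) (1 - m)"
  have HD: "H holomorphic_on D0"
    unfolding D0_def
    by (rule power_series_holomorphic[of _ _ "\<lambda>k. \<Sum>\<^sub>\<infinity>e\<in>V. 1 / complex_of_real (l e - m) ^ Suc k"])
      (use HV(2) in \<open>simp add: H_def dist_norm norm_minus_commute mult.commute\<close>)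
  \<comment> \<open>Removing finitely many points leaves the disc connected, so the identity theorem
    can go around the poles at eigenvalues up to 1.\<close>
  define D where "D = D0 - (\<lambda>e. complex_of_real (l e)) ` Fn"
  have cD0: "connected D0" "open D0" by (auto simp: D0_def convex_connected)
  have D: "open D" "connected D" unfolding D_def
    using cD0 Fn by (auto intro!: open_Diff finite_imp_closed connected_open_delete_finite)
  define Q where "Q = (\<lambda>z. deriv F z + F z * ((\<Sum>e\<in>Fn. 1 / (complex_of_real (l e) - z)) + H z))"
  have QD: "Q holomorphic_on D"
    unfolding Q_def
    by (intro holomorphic_intros holomorphic_on_subset[OF char_fun_holomorphic] holomorphic_on_subset[OF HD]
        holomorphic_deriv D) (auto simp: D_def)
  have split: "(\<Sum>\<^sub>\<infinity>e\<in>U. 1 / (complex_of_real (l e) - z)) = (\<Sum>e\<in>Fn. 1 / (complex_of_real (l e) - z)) + H z"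
    and sumU: "(\<lambda>e. 1 / (complex_of_real (l e) - z)) summable_on U" if z: "z \<in> D0" for z
  proof -
    have "(\<lambda>e. 1 / (complex_of_real (l e) - z)) summable_on V"
      by (rule HV(1)) (use z in \<open>auto simp: D0_def dist_norm norm_minus_commute\<close>)
    moreover have "(\<lambda>e. 1 / (complex_of_real (l e) - z)) summable_on Fn" using Fn by simp
    moreover have "U = Fn \<union> V" "Fn \<inter> V = {}" using Fn by (auto simp: V_def)
    ultimately show "(\<Sum>\<^sub>\<infinity>e\<in>U. 1 / (complex_of_real (l e) - z)) = (\<Sum>e\<in>Fn. 1 / (complex_of_real (l e) - z)) + H z"
      "(\<lambda>e. 1 / (complex_of_real (l e) - z)) summable_on U"
      using Fn by (auto simp: H_def infsum_Un_disjoint intro: summable_on_Un_disjoint)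
  qed
  \<comment> \<open>The real points between \<open>m\<close> and \<open>c\<close> accumulate at
    \<open>m\<close>, which lies in \<open>D\<close> because every eigenvalue exceeds
    \<open>m\<close>.\<close>
  define X where "X = complex_of_real ` {m<..<c}"
  have XQ: "Q z = 0" if z: "z \<in> X \<inter> D" for z
  proof -
    obtain \<mu> where \<mu>: "z = complex_of_real \<mu>" "\<mu> < c" using z by (auto simp: X_def)
    note ld = below[OF \<mu>(2)]
    have "(\<Sum>\<^sub>\<infinity>e\<in>U. 1 / (complex_of_real (l e) - z)) = - deriv F z / F z"
      using infsumI[OF ld(2)] by (simp add: \<mu>)
    then have "Q z = deriv F z + F z * (- deriv F z / F z)" unfolding Q_def using split[of z] z by (simp add: D_def)
    then show ?thesis using ld(1) by (simp add: \<mu>)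
  qed
  have mD: "complex_of_real m \<in> D"
    using lm m Fn by (force simp: D_def D0_def)
  have lim: "complex_of_real m islimpt (X \<inter> D)"
  proof -
    have "m islimpt {m<..<c}" using m by (simp add: islimpt_greaterThanLessThan1)
    then have "complex_of_real m islimpt X" unfolding X_def
      by (rule islimpt_isCont_image) (auto simp: eventually_at_filter)
    moreover have "eventually (\<lambda>z. z \<in> D) (at (complex_of_real m))"
      using D(1) mD by (auto intro: eventually_at_in_open')
    ultimately show ?thesis by (metis islimpt_Int_eventually)
  qed
  have Q0: "Q z = 0" if "z \<in> D" for z
    by (rule analytic_continuation[OF QD D, of "X \<inter> D" "complex_of_real m"]) (use XQ mD lim that in auto)
  have \<rho>l': "\<And>e. e \<in> U - Z \<Longrightarrow> \<rho> \<le> \<bar>l e - 0\<bar>" using \<rho>l by simp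
  have s0': "(\<lambda>e. 1 / \<bar>l e - 0\<bar>) summable_on (U - Z)" using s0 by simp
  note RP = resolvent_power_series[OF s0' \<rho>l']
  have main: "z * deriv F z = of_nat (card Z) * F z - z * F z * T z" if z: "norm z < \<rho>" "z \<noteq> 0" for z
  proof -
    have "norm (z - of_real m) \<le> norm z + \<bar>m\<bar>" using norm_triangle_ineq4[of z "of_real m"] by simp
    then have zD0: "z \<in> D0" using z \<rho>0 m by (auto simp: D0_def dist_norm norm_minus_commute)
    have "z \<noteq> complex_of_real (l e)" if e: "e \<in> Fn" for e
    proof (cases "e \<in> Z")
      case True then show ?thesis using z by (simp add: Z_def)
    next
      case False then show ?thesis using \<rho>l[of e] e Fn z by auto
    qed
    then have zD: "z \<in> D" using zD0 by (auto simp: D_def)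
    have sZ: "(\<lambda>e. 1 / (complex_of_real (l e) - z)) summable_on (U - Z)"
      by (rule summable_on_subset_banach[OF sumU[OF zD0]]) auto
    have "(\<Sum>\<^sub>\<infinity>e\<in>U. 1 / (complex_of_real (l e) - z)) = (\<Sum>\<^sub>\<infinity>e\<in>Z \<union> (U - Z). 1 / (complex_of_real (l e) - z))"
      using ZF(1) Fn(2) by (intro arg_cong2[where f = infsum]) auto
    also have "\<dots> = (\<Sum>e\<in>Z. 1 / (complex_of_real (l e) - z)) + T z"
      unfolding T_def using \<open>finite Z\<close> sZ by (subst infsum_Un_disjoint) auto
    also have "(\<Sum>e\<in>Z. 1 / (complex_of_real (l e) - z)) = of_nat (card Z) * (- 1 / z)"
      unfolding sum_constant[symmetric] by (rule sum.cong) (auto simp: Z_def)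
    finally have "deriv F z + F z * (of_nat (card Z) * (- 1 / z) + T z) = 0"
      using Q0[OF zD] split[OF zD0] unfolding Q_def by simp
    moreover have "z * deriv F z - of_nat (card Z) * F z + z * F z * T z = z * (deriv F z + F z * (of_nat (card Z) * (- 1 / z) + T z))"
      using z(2) by (simp add: algebra_simps)
    ultimately show ?thesis by (simp add: algebra_simps)
  qed
  \<comment> \<open>The point \<open>z = 0\<close> was excluded above and is checked separately: an
    eigenfunction for the eigenvalue 0 forces \<open>F 0 = 0\<close>.\<close>
  have zero: "of_nat (card Z) * F 0 = 0"
  proof (rule ccontr)
    assume nz: "of_nat (card Z) * F 0 \<noteq> 0"
    then obtain e where e: "e \<in> Z" by (metis card.empty equals0I mult_zero_left of_nat_0)
    then obtain u where u: "trel (\<lambda>_. 0) e u" using l[of e] by (auto simp: Z_def)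
    have "F 0 \<noteq> 0" using nz by auto
    then have "e = (\<lambda>_. 0)" using trel_zero_unique[OF _ u] char_fun_0 by simp
    moreover have "l2_inner M e e = 1" using e B by (auto simp: orthonormal_basis_def Z_def)
    ultimately show False by (simp add: l2_inner_def)
  qed
  have "z * deriv F z = of_nat (card Z) * F z - z * F z * T z" if z: "norm z < \<rho>" for z
    using main[OF z] zero by (cases "z = 0") auto
  moreover have "(\<lambda>k. (\<Sum>\<^sub>\<infinity>e\<in>U - Z. 1 / complex_of_real (l e) ^ Suc k) * z ^ k) sums T z" if "norm z < \<rho>" for z
    using RP(2)[of z] that by (simp add: T_def mult.commute)
  ultimately show "\<exists>\<rho>>0. (\<forall>e\<in>U - Z. \<rho> \<le> \<bar>l e\<bar>) \<and>
      (\<forall>z. norm z < \<rho> \<longrightarrow> (\<lambda>k. (\<Sum>\<^sub>\<infinity>e\<in>U - Z. 1 / complex_of_real (l e) ^ Suc k) * z ^ k) sums T z) \<and>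
      (\<forall>z. norm z < \<rho> \<longrightarrow> z * deriv F z = of_nat (card Z) * F z - z * F z * T z)"
    using \<rho>0 \<rho>l by blast
qed

end

section \<open>Zeta function, residues and trace\<close>

lemma sum_fun_apply: "(\<Sum>i\<in>I. f i) x = (\<Sum>i\<in>I. f i x :: 'b :: comm_monoid_add)"
  by (induction I rule: infinite_finite_induct) auto

text \<open>Turns a sum over basis vectors into one over distinct eigenvalues weighted by
  multiplicity, the form in which the zeta function is defined.\<close>

lemma has_sum_fibres:
  fixes f :: "'c \<Rightarrow> complex"
  assumes s: "((\<lambda>e. f (g e)) has_sum S) V" and fin: "\<And>x. finite {e \<in> V. g e = x}"
  shows "((\<lambda>x. of_nat (card {e \<in> V. g e = x}) * f x) has_sum S) (g ` V)"
proof -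
  have "bij_betw (\<lambda>e. (g e, e)) V (Sigma (g ` V) (\<lambda>x. {e \<in> V. g e = x}))"
    by (rule bij_betwI[where g = snd]) auto
  from has_sum_reindex_bij_betw[OF this, of "\<lambda>p. f (fst p)" S]
  have "((\<lambda>p. f (fst p)) has_sum S) (Sigma (g ` V) (\<lambda>x. {e \<in> V. g e = x}))" using s by simp
  then show ?thesis
  proof (rule has_sum_SigmaD)
    fix x
    show "((\<lambda>y. f (fst (x, y))) has_sum of_nat (card {e \<in> V. g e = x}) * f x) {e \<in> V. g e = x}"
      using has_sum_finite[OF fin[of x], of "\<lambda>y. f x"] by simp
  qed
qed

section \<open>Eigenvalues and multiplicities in terms of the basis\<close>

context coupled begin

lemma eigenspace_eq: "eigenspace a b p q r \<alpha> R \<mu> = {g. \<exists>u. trel (\<lambda>x. \<mu> * g x) g u}"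
proof -
  have "g \<in> dom_coupled a b p q r \<alpha> R \<Longrightarrow> (\<lambda>x. \<mu> * g x) \<in> L2 M" for g
    by (auto simp: dom_coupled_def dom_max_def intro: L2_scale)
  moreover have "trel (\<lambda>x. \<mu> * g x) g u \<Longrightarrow> g \<in> dom_coupled a b p q r \<alpha> R \<and> (AE x in M. sl_tau a b p q r g x = \<mu> * g x)" for g u
    using trel_imp_dom by blast
  ultimately show ?thesis unfolding eigenspace_def using dom_coupled_iff[of "\<lambda>x. \<mu> * _ x"] by blast
qed

context
  fixes U and l :: "(real \<Rightarrow> complex) \<Rightarrow> real"
  assumes B: "orthonormal_basis M U" and l: "\<And>e. e \<in> U \<Longrightarrow> \<exists>u. trel (\<lambda>x. of_real (l e) * e x) e u"
    and fin: "\<And>c. finite {e \<in> U. l e \<le> c}"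
begin

lemma U_orthonormal: "orthonormal M U"
  using B by (simp add: orthonormal_basis_iff)

lemma finite_fibre: "finite {e \<in> U. complex_of_real (l e) = \<mu>}"
  by (rule finite_subset[OF _ fin[of "Re \<mu>"]]) auto

text \<open>By symmetry an eigenfunction is orthogonal to basis vectors with a different eigenvalue.
  Its difference from the finite sum is therefore orthogonal to the basis, and being continuous it
  vanishes identically, not only almost everywhere.\<close>

lemma eigenspace_expansion:
  assumes g: "g \<in> eigenspace a b p q r \<alpha> R \<mu>"
  shows "g = (\<lambda>x. \<Sum>e | e \<in> U \<and> complex_of_real (l e) = \<mu>. l2_inner M e g * e x)"
proof -
  define G where "G = {e \<in> U. complex_of_real (l e) = \<mu>}"
  define s where "s = (\<lambda>x. \<Sum>e\<in>G. l2_inner M e g * e x)"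
  obtain u where u: "trel (\<lambda>x. \<mu> * g x) g u" using g by (auto simp: eigenspace_eq)
  obtain v where v: "\<And>e. e \<in> U \<Longrightarrow> trel (\<lambda>x. of_real (l e) * e x) e (v e)" using l by metis
  have G: "finite G" "G \<subseteq> U" using finite_fibre by (auto simp: G_def)
  have ts: "trel (\<lambda>x. \<Sum>e\<in>G. l2_inner M e g * (of_real (l e) * e x)) s (\<lambda>x. \<Sum>e\<in>G. l2_inner M e g * v e x)"
    unfolding s_def by (rule trel_sum) (use G v in \<open>auto intro!: trel_cmult\<close>)
  note t = trel_diff[OF u ts]
  note gL = trel_L2(2)[OF u] and sL = trel_L2(2)[OF ts]
  have "l2_inner M e (\<lambda>x. g x - s x) = 0" if e: "e \<in> U" for e
  proof -
    have eL: "e \<in> L2 M" using trel_L2(2)[OF v[OF e]] .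
    have "l2_inner M e g = 0" if "e \<notin> G"
    proof -
      have "\<mu> * l2_inner M e g = of_real (l e) * l2_inner M e g"
        using trel_symmetric[OF v[OF e] u] by (simp add: inner_scale_left inner_scale_right)
      then show ?thesis using that e by (auto simp: G_def)
    qed
    moreover have "l2_inner M e s = (if e \<in> G then l2_inner M e g else 0)"
      unfolding s_def by (rule orthonormal_sum_inner[OF U_orthonormal G e])
    ultimately show ?thesis using inner_diff_right[OF eL gL sL] by auto
  qed
  then have "AE x in M. g x - s x = 0" using B trel_L2(2)[OF t] unfolding orthonormal_basis_def by blast
  then have "nsq M (\<lambda>x. g x - s x) = 0" using nsq_eq_0_iff[OF trel_L2(2)[OF t]] by simp
  then have "(\<lambda>x. g x - s x) = (\<lambda>_. 0)" using nsq_zero_imp[of "\<lambda>x. g x - s x"] trel_L2_cases[OF t] by simp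
  then show ?thesis unfolding s_def G_def by (simp add: fun_eq_iff)
qed

text \<open>Being finite, the fibre is an algebraic basis of the eigenspace, so
  \<open>cfun.dim\<close> is a genuine dimension and not its default value 0.\<close>

lemma eig_mult_eq: "eig_mult a b p q r \<alpha> R \<mu> = card {e \<in> U. complex_of_real (l e) = \<mu>}"
proof -
  define G where "G = {e \<in> U. complex_of_real (l e) = \<mu>}"
  have G: "finite G" "G \<subseteq> U" using finite_fibre by (auto simp: G_def)
  show ?thesis unfolding eig_mult_def G_def[symmetric]
  proof (rule cfun.dim_unique[of G])
    show "G \<subseteq> eigenspace a b p q r \<alpha> R \<mu>" using l by (auto simp: eigenspace_eq G_def)
    show "eigenspace a b p q r \<alpha> R \<mu> \<subseteq> cfun.span G"
    proof
      fix g assume "g \<in> eigenspace a b p q r \<alpha> R \<mu>"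
      from eigenspace_expansion[OF this] have "g = (\<Sum>e\<in>G. cfun_scale (l2_inner M e g) e)"
        by (simp add: G_def fun_eq_iff sum_fun_apply cfun_scale_def)
      then show "g \<in> cfun.span G" by (metis (no_types, lifting) cfun.span_base cfun.span_scale cfun.span_sum)
    qed
    show "cfun.independent G"
    proof (rule cfun.independent_if_scalars_zero[OF G(1)])
      fix f e assume s: "(\<Sum>e\<in>G. cfun_scale (f e) e) = 0" and e: "e \<in> G"
      have "(\<lambda>x. \<Sum>i\<in>G. f i * i x) = (\<lambda>_. 0)" using s by (simp add: fun_eq_iff sum_fun_apply cfun_scale_def)
      then show "f e = 0" using orthonormal_sum_inner[OF U_orthonormal G, of e f] e G by (auto simp: l2_inner_def)
    qed
  qed simp
qed

lemma eigenvalues_eq: "eigenvalues a b p q r \<alpha> R = (\<lambda>e. complex_of_real (l e)) ` U"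
proof (intro equalityI subsetI)
  fix \<mu> assume "\<mu> \<in> eigenvalues a b p q r \<alpha> R"
  then obtain g where g: "g \<in> eigenspace a b p q r \<alpha> R \<mu>" "g \<noteq> 0" by (auto simp: eigenvalues_def)
  have "{e. e \<in> U \<and> complex_of_real (l e) = \<mu>} \<noteq> {}"
  proof
    assume "{e. e \<in> U \<and> complex_of_real (l e) = \<mu>} = {}"
    then have "g = (\<lambda>_. 0)" using eigenspace_expansion[OF g(1)] by (simp only: sum.empty)
    then show False using g(2) by (simp add: zero_fun_def)
  qed
  then show "\<mu> \<in> (\<lambda>e. complex_of_real (l e)) ` U" by auto
next
  fix \<mu> assume "\<mu> \<in> (\<lambda>e. complex_of_real (l e)) ` U"
  then obtain e where e: "e \<in> U" "\<mu> = complex_of_real (l e)" by blast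
  have "l2_inner M e e = 1" using e B by (auto simp: orthonormal_basis_def)
  then have "e \<noteq> 0" by (auto simp: l2_inner_def)
  moreover have "e \<in> eigenspace a b p q r \<alpha> R \<mu>" using l[OF e(1)] e(2) by (simp add: eigenspace_eq)
  ultimately show "\<mu> \<in> eigenvalues a b p q r \<alpha> R" unfolding eigenvalues_def by blast
qed

lemma zeta_has_sum:
  assumes s: "((\<lambda>e. 1 / complex_of_real (l e) ^ n) has_sum S) (U - {e \<in> U. l e = 0})"
  shows "(zeta_term a b p q r \<alpha> R (of_nat n) has_sum S) (eigenvalues a b p q r \<alpha> R - {0})"
proof -
  define V where "V = U - {e \<in> U. l e = 0}"
  have im: "(\<lambda>e. complex_of_real (l e)) ` V = eigenvalues a b p q r \<alpha> R - {0}"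
    by (auto simp: V_def eigenvalues_eq)
  have "((\<lambda>\<mu>. of_nat (card {e \<in> V. complex_of_real (l e) = \<mu>}) * (1 / \<mu> ^ n)) has_sum S) ((\<lambda>e. complex_of_real (l e)) ` V)"
    by (rule has_sum_fibres) (use s in \<open>auto simp: V_def intro: finite_subset[OF _ finite_fibre]\<close>)
  moreover have "of_nat (card {e \<in> V. complex_of_real (l e) = \<mu>}) * (1 / \<mu> ^ n) = zeta_term a b p q r \<alpha> R (of_nat n) \<mu>"
    if \<mu>: "\<mu> \<noteq> 0" for \<mu>
  proof -
    have "{e \<in> V. complex_of_real (l e) = \<mu>} = {e \<in> U. complex_of_real (l e) = \<mu>}" using \<mu> by (auto simp: V_def)
    \<comment> \<open>For a natural exponent the complex power is the ordinary one, so the branch is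
      immaterial at negative eigenvalues.\<close>
    then show ?thesis using \<mu> by (simp add: zeta_term_def eig_mult_eq powr_minus powr_nat' divide_inverse)
  qed
  ultimately show ?thesis unfolding im by (subst has_sum_cong[where g = "\<lambda>\<mu>. of_nat (card {e \<in> V. complex_of_real (l e) = \<mu>}) * (1 / \<mu> ^ n)"]) auto
qed

end
end

text \<open>Newton's identities: \<open>rec\<close> isolates \<open>C 0 * \<zeta> n\<close>, and by
  induction the earlier \<open>\<zeta> j\<close> are \<open>- j * B j\<close>, which reproduces the
  recursion for \<open>B\<close> multiplied by \<open>- n\<close>.\<close>

lemma newton_recursion:
  fixes C \<zeta> B :: "nat \<Rightarrow> complex"
  assumes C0: "C 0 \<noteq> 0" and rec: "\<And>n. of_nat n * C n = - (\<Sum>j=1..n. C (n - j) * \<zeta> j)"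
    and B: "\<And>j. j \<ge> 1 \<Longrightarrow> B j = C j / C 0 - (\<Sum>l=1..j-1. of_nat l / of_nat j * (C (j - l) / C 0) * B l)"
    and n: "n \<ge> 1"
  shows "\<zeta> n = - of_nat n * B n"
  using n
proof (induction n rule: less_induct)
  case (less n)
  have "{1..n} = insert n {1..n-1}" using less.prems by auto
  then have "of_nat n * C n = - (C 0 * \<zeta> n) - (\<Sum>j=1..n-1. C (n - j) * \<zeta> j)"
    using rec[of n] less.prems by (simp add: sum.insert_if)
  moreover have "(\<Sum>j=1..n-1. C (n - j) * \<zeta> j) = (\<Sum>j=1..n-1. - (of_nat j * C (n - j) * B j))"
    by (rule sum.cong) (use less.IH in auto)
  ultimately have "C 0 * \<zeta> n = (\<Sum>j=1..n-1. of_nat j * C (n - j) * B j) - of_nat n * C n"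
    by (simp add: sum_negf)
  then have "\<zeta> n = (\<Sum>j=1..n-1. of_nat j * C (n - j) * B j) / C 0 - of_nat n * C n / C 0"
    using C0 by (simp add: field_simps)
  moreover have "of_nat n * (\<Sum>l=1..n-1. of_nat l / of_nat n * (C (n - l) / C 0) * B l) = (\<Sum>j=1..n-1. of_nat j * C (n - j) * B j) / C 0"
    unfolding sum_distrib_left sum_divide_distrib by (rule sum.cong) (use less.prems in auto)
  ultimately show ?case using B[OF less.prems] by (simp add: right_diff_distrib)
qed

context coupled begin

lemma char_fun_zero_eigenvalue:
  assumes "0 \<notin> eigenvalues a b p q r \<alpha> R" shows "A0 \<noteq> 0"
proof
  assume "A0 = 0"
  then obtain y u where y: "trel (\<lambda>_. 0) y u" "y \<noteq> (\<lambda>_. 0)" using trel_zero_exists by blast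
  then have "y \<in> eigenspace a b p q r \<alpha> R 0" by (auto simp: eigenspace_eq)
  then show False using assms y(2) unfolding eigenvalues_def zero_fun_def by blast
qed

text \<open>Collects the spectral facts in terms of power sums and Taylor coefficients, so that the
  eigenbasis stays local to this proof.\<close>

theorem zeta_sums:
  obtains \<zeta> where "\<And>n. n \<ge> 1 \<Longrightarrow> (zeta_term a b p q r \<alpha> R (of_nat n) has_sum \<zeta> n) (eigenvalues a b p q r \<alpha> R - {0})"
    and "\<And>k. (of_nat k - of_nat (eig_mult a b p q r \<alpha> R 0)) * char_coeff k = - (\<Sum>j=1..k. char_coeff (k - j) * \<zeta> j)"
    and "\<And>n. n \<ge> 1 \<Longrightarrow> residue (\<lambda>z. 1 / z ^ n * (deriv F z / F z)) 0 = - \<zeta> n"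
    and "\<exists>z. F z \<noteq> 0"
    and "eig_mult a b p q r \<alpha> R 0 = 0 \<Longrightarrow> char_coeff 0 \<noteq> 0"
proof -
  obtain U l c where B: "orthonormal_basis M U" and l: "\<And>e. e \<in> U \<Longrightarrow> \<exists>u. trel (\<lambda>x. of_real (l e) * e x) e u"
    and cl: "\<And>e. e \<in> U \<Longrightarrow> c \<le> l e" and c: "\<And>h y u. trel h y u \<Longrightarrow> c * nsq M y \<le> Re (l2_inner M y h)"
    using spectral_basis by metis
  define Z where "Z = {e \<in> U. l e = 0}"
  define T where "T = (\<lambda>z. \<Sum>\<^sub>\<infinity>e\<in>U - Z. 1 / (complex_of_real (l e) - z))"
  define \<zeta> where "\<zeta> = (\<lambda>n. \<Sum>\<^sub>\<infinity>e\<in>U - Z. 1 / complex_of_real (l e) ^ n)"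
  have fin: "finite {e \<in> U. l e \<le> d}" for d by (rule log_deriv_at_0(1)[OF B, where l = l and c = c]; fact l cl c)
  have s: "(\<lambda>e. 1 / \<bar>l e\<bar>) summable_on (U - Z)"
    unfolding Z_def by (rule log_deriv_at_0(2)[OF B, where l = l and c = c]; fact l cl c)
  have "\<exists>\<rho>>0. (\<forall>e\<in>U - Z. \<rho> \<le> \<bar>l e\<bar>) \<and>
      (\<forall>z. norm z < \<rho> \<longrightarrow> (\<lambda>k. (\<Sum>\<^sub>\<infinity>e\<in>U - Z. 1 / complex_of_real (l e) ^ Suc k) * z ^ k) sums T z) \<and>
      (\<forall>z. norm z < \<rho> \<longrightarrow> z * deriv F z = of_nat (card Z) * F z - z * F z * T z)"
    unfolding Z_def T_def by (rule log_deriv_at_0(3)[OF B, where l = l and c = c]; fact l cl c)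
  then obtain \<rho> where \<rho>: "\<rho> > 0" "\<And>e. e \<in> U - Z \<Longrightarrow> \<rho> \<le> \<bar>l e\<bar>"
    and Ts: "\<And>z. norm z < \<rho> \<Longrightarrow> (\<lambda>k. \<zeta> (Suc k) * z ^ k) sums T z"
    and FT: "\<And>z. norm z < \<rho> \<Longrightarrow> z * deriv F z = of_nat (card Z) * F z - z * F z * T z"
    unfolding \<zeta>_def by blast
  have near: "eventually (\<lambda>z::complex. norm z < \<rho>) (nhds 0)"
    using eventually_nhds_in_open[of "ball 0 \<rho>" "0::complex"] \<rho>(1) by simp
  have mult: "eig_mult a b p q r \<alpha> R 0 = card Z"
    using eig_mult_eq[OF B l fin, of 0] by (simp add: Z_def)
  have "F (complex_of_real (c - 1)) \<noteq> 0" by (rule log_deriv_below(1)[OF B, where l = l and c = c]) (fact l cl c | simp)+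
  then have nz: "\<exists>z. F z \<noteq> 0" by blast
  have zs: "(zeta_term a b p q r \<alpha> R (of_nat n) has_sum \<zeta> n) (eigenvalues a b p q r \<alpha> R - {0})" if n: "n \<ge> 1" for n
  proof (rule zeta_has_sum[OF B l fin])
    have "(\<lambda>e. 1 / complex_of_real (l e) ^ n) summable_on (U - Z)"
    proof (rule abs_summable_summable, rule summable_on_comparison_test)
      show "(\<lambda>e. (1 / \<bar>l e\<bar>) * (1 / \<rho> ^ (n - 1))) summable_on (U - Z)" by (rule summable_on_cmult_left[OF s])
      fix e assume e: "e \<in> U - Z"
      have "1 / \<bar>l e\<bar> ^ (n - 1) \<le> 1 / \<rho> ^ (n - 1)"
        using \<rho>(2)[OF e] \<rho>(1) by (intro divide_left_mono power_mono mult_pos_pos zero_less_power) auto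
      then have "(1 / \<bar>l e\<bar>) * (1 / \<bar>l e\<bar> ^ (n - 1)) \<le> (1 / \<bar>l e\<bar>) * (1 / \<rho> ^ (n - 1))" by (intro mult_left_mono) auto
      moreover have "\<bar>l e\<bar> ^ n = \<bar>l e\<bar> * \<bar>l e\<bar> ^ (n - 1)" using n by (simp add: power_eq_if)
      ultimately show "norm (1 / complex_of_real (l e) ^ n) \<le> (1 / \<bar>l e\<bar>) * (1 / \<rho> ^ (n - 1))"
        by (simp add: norm_divide norm_power)
    qed auto
    then show "((\<lambda>e. 1 / complex_of_real (l e) ^ n) has_sum \<zeta> n) (U - {e \<in> U. l e = 0})"
      unfolding \<zeta>_def Z_def by (rule has_sum_infsum)
  qed
  define \<Phi> where "\<Phi> = Abs_fps char_coeff"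
  define \<Theta> where "\<Theta> = Abs_fps (\<lambda>k. \<zeta> (Suc k))"
  have F\<Phi>: "F has_fps_expansion \<Phi>" unfolding \<Phi>_def by (rule char_fun_fps)
  have T\<Theta>: "T has_fps_expansion \<Theta>"
    by (rule has_fps_expansionI) (use near Ts in \<open>auto simp: \<Theta>_def elim!: eventually_mono\<close>)
  have e1: "(\<lambda>z. z * deriv F z) has_fps_expansion fps_X * fps_deriv \<Phi>"
    by (intro fps_expansion_intros F\<Phi>)
  have e2: "(\<lambda>z. of_nat (card Z) * F z - z * (T z * F z)) has_fps_expansion fps_const (of_nat (card Z)) * \<Phi> - fps_X * (\<Theta> * \<Phi>)"
    by (intro fps_expansion_intros F\<Phi> T\<Theta>)
  \<comment> \<open>The identity for \<open>deriv F\<close> holds near 0, so one function receives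
    two formal expansions, which must agree.\<close>
  have "(\<lambda>z. z * deriv F z) has_fps_expansion fps_const (of_nat (card Z)) * \<Phi> - fps_X * (\<Theta> * \<Phi>)"
    unfolding has_fps_expansion_def
  proof
    show "fps_conv_radius (fps_const (of_nat (card Z)) * \<Phi> - fps_X * (\<Theta> * \<Phi>)) > 0" using e2 by (simp add: has_fps_expansion_def)
    have "eventually (\<lambda>z. eval_fps (fps_const (of_nat (card Z)) * \<Phi> - fps_X * (\<Theta> * \<Phi>)) z = of_nat (card Z) * F z - z * (T z * F z)) (nhds 0)"
      using e2 by (simp add: has_fps_expansion_def)
    then show "eventually (\<lambda>z. eval_fps (fps_const (of_nat (card Z)) * \<Phi> - fps_X * (\<Theta> * \<Phi>)) z = z * deriv F z) (nhds 0)"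
      using near by eventually_elim (use FT in \<open>simp add: mult_ac\<close>)
  qed
  with e1 have "fps_X * fps_deriv \<Phi> = fps_const (of_nat (card Z)) * \<Phi> - fps_X * (\<Theta> * \<Phi>)"
    by (rule fps_expansion_unique_complex)
  then have co: "fps_nth (fps_X * fps_deriv \<Phi>) k = fps_nth (fps_const (of_nat (card Z)) * \<Phi> - fps_X * (\<Theta> * \<Phi>)) k" for k by simp
  have rec: "(of_nat k - of_nat (card Z)) * char_coeff k = - (\<Sum>j=1..k. char_coeff (k - j) * \<zeta> j)" for k
  proof (cases k)
    case 0
    then show ?thesis using co[of 0] by (simp add: \<Phi>_def)
  next
    case (Suc n)
    have "(\<Sum>i=0..n. \<zeta> (Suc i) * char_coeff (n - i)) = (\<Sum>j=Suc 0..Suc n. \<zeta> j * char_coeff (Suc n - j))"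
      unfolding sum.shift_bounds_cl_Suc_ivl by simp
    moreover have "fps_nth (\<Theta> * \<Phi>) n = (\<Sum>i=0..n. \<zeta> (Suc i) * char_coeff (n - i))"
      by (simp add: fps_mult_nth \<Phi>_def \<Theta>_def)
    moreover have "of_nat (Suc n) * char_coeff (Suc n) = of_nat (card Z) * char_coeff (Suc n) - fps_nth (\<Theta> * \<Phi>) n"
      using co[of "Suc n"] by (simp add: \<Phi>_def)
    ultimately show ?thesis using Suc by (simp add: left_diff_distrib mult.commute)
  qed
  have "\<Phi> \<noteq> 0"
  proof
    assume "\<Phi> = 0"
    then have "char_coeff k = 0" for k unfolding \<Phi>_def by (metis fps_nth_Abs_fps fps_zero_nth)
    then have "F z = 0" for z using char_fun_sums'[of z] sums_unique2[OF _ sums_zero] by simp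
    then show False using nz by blast
  qed
  \<comment> \<open>\<open>F\<close> does not vanish identically, so its zeros are isolated and
    \<open>F' / F\<close> may be computed in a punctured neighbourhood of 0.\<close>
  then have Fnz: "eventually (\<lambda>z. F z \<noteq> 0) (at 0)"
    using has_laurent_expansion_nonzero_imp_eventually_nonzero[OF has_laurent_expansion_fps[OF F\<Phi>]] by simp
  have res: "residue (\<lambda>z. 1 / z ^ n * (deriv F z / F z)) 0 = - \<zeta> n" if n: "n \<ge> 1" for n
  proof -
    have "eventually (\<lambda>z. norm z < \<rho>) (at (0::complex))" "eventually (\<lambda>z. z \<noteq> 0) (at (0::complex))"
      using near by (auto simp: eventually_at_filter elim: eventually_mono)
    \<comment> \<open>Here \<open>F' / F = m / z - T\<close> with \<open>m\<close> the multiplicity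
      of the eigenvalue 0. The residue picks the coefficient of order \<open>n \<ge> 1\<close> of
      \<open>m - z T\<close>, to which \<open>m\<close> does not contribute.\<close>
    then have "eventually (\<lambda>z. 1 / z ^ n * (deriv F z / F z) = (of_nat (card Z) - z * T z) / z ^ Suc n) (at 0)"
      using Fnz
    proof eventually_elim
      case (elim z)
      have "z * deriv F z = F z * (of_nat (card Z) - z * T z)" using FT[OF elim(1)] by (simp add: algebra_simps)
      then have "z * (deriv F z / F z) = of_nat (card Z) - z * T z" using elim by simp
      then show ?case using elim by (simp add: field_simps)
    qed
    then have "residue (\<lambda>z. 1 / z ^ n * (deriv F z / F z)) 0 = residue (\<lambda>z. (of_nat (card Z) - z * T z) / z ^ Suc n) 0"
      by (rule residue_cong) simp
    also have "\<dots> = fps_nth (fps_const (of_nat (card Z)) - fps_X * \<Theta>) n"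
      by (rule residue_fps_expansion_over_power_at_0) (intro fps_expansion_intros T\<Theta>)
    also have "\<dots> = - \<zeta> n" using n by (simp add: \<Theta>_def)
    finally show ?thesis .
  qed
  have m0: "char_coeff 0 \<noteq> 0" if "eig_mult a b p q r \<alpha> R 0 = 0"
  proof -
    have "finite Z" unfolding Z_def by (rule finite_subset[OF _ fin[of 0]]) auto
    then have "Z = {}" using that mult by simp
    then have "0 \<notin> eigenvalues a b p q r \<alpha> R" using eigenvalues_eq[OF B l fin] by (auto simp: Z_def)
    then show ?thesis using char_fun_zero_eigenvalue by (simp add: char_coeff_def add.assoc)
  qed
  show ?thesis by (rule that[of \<zeta>]; (fact zs res nz m0 | fact rec[folded mult]))
qed

text \<open>Dividing \<open>F\<close> by \<open>z ^ m\<close> moves the first nonzero Taylor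
  coefficient to index 0, which brings both cases under Newton's recursion.\<close>

lemma zeta_recursion:
  fixes A B :: "nat \<Rightarrow> complex"
  assumes A: "A = char_coeff" and m: "m = eig_mult a b p q r \<alpha> R 0" "m \<in> {0, 1}"
    and B: "\<And>j. j \<ge> 1 \<Longrightarrow> B j = A (j + m) / A m - (\<Sum>l=1..j-1. of_nat l / of_nat j * (A (j - l + m) / A m) * B l)"
    and n: "n \<ge> 1"
    and rec: "\<And>k. (of_nat k - of_nat m) * A k = - (\<Sum>j=1..k. A (k - j) * \<zeta> j)"
    and nz: "\<exists>z. F z \<noteq> 0" and m0: "m = 0 \<Longrightarrow> A 0 \<noteq> 0"
  shows "\<zeta> n = - of_nat n * B n"
proof (rule newton_recursion[where C = "\<lambda>k. A (k + m)"])
  \<comment> \<open>At \<open>k = 0\<close> the sum is empty and the recursion reads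
    \<open>- m * A 0 = 0\<close>.\<close>
  have A0: "A 0 = 0" if "m = 1" using rec[of 0] that by simp
  show "A (0 + m) \<noteq> 0"
  proof (cases "m = 0")
    case False
    then have m1: "m = 1" using m by simp
    \<comment> \<open>For \<open>m = 1\<close> the factor \<open>k - 1\<close> vanishes only at
      \<open>k = 1\<close>, so \<open>A 0 = A 1 = 0\<close> would propagate to all coefficients and
      \<open>F\<close> would be 0.\<close>
    have "A 1 \<noteq> 0"
    proof
      assume A1: "A 1 = 0"
      have "A k = 0" for k
      proof (induction k rule: less_induct)
        case (less k)
        show ?case
        proof (cases "k \<le> 1")
          case True
          then have "k = 0 \<or> k = 1" by auto
          then show ?thesis using A0 A1 m1 by auto
        next
          case False
          have "(\<Sum>j=1..k. A (k - j) * \<zeta> j) = 0" by (rule sum.neutral) (use less.IH False in auto)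
          then show ?thesis using rec[of k] m1 False by simp
        qed
      qed
      then have "F z = 0" for z using char_fun_sums'[of z] sums_unique2[OF _ sums_zero] by (simp add: A)
      then show False using nz by blast
    qed
    then show ?thesis using m1 by simp
  qed (use m0 in simp)
  fix n
  \<comment> \<open>For \<open>m = 1\<close> the extra term \<open>j = n + 1\<close> carries the
    factor \<open>A 0 = 0\<close>.\<close>
  have "(\<Sum>j=1..n+m. A (n + m - j) * \<zeta> j) = (\<Sum>j=1..n. A (n - j + m) * \<zeta> j)"
  proof (cases "m = 0")
    case False
    then show ?thesis using m A0 by (simp add: Suc_diff_le)
  qed simp
  then show "of_nat n * A (n + m) = - (\<Sum>j=1..n. A (n - j + m) * \<zeta> j)" using rec[of "n + m"] by simp
qed (use B n in auto)

section \<open>The inverse operator and its trace\<close>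

lemma op_inverse_eq:
  assumes A: "A0 \<noteq> 0" and f: "f \<in> L2 M"
  shows "\<exists>!g. g \<in> dom_coupled a b p q r \<alpha> R \<and> (AE x in M. sl_tau a b p q r g x = f x)"
    and "op_inverse a b p q r \<alpha> R f = green f"
proof -
  obtain u where u: "trel f (green f) u" using green_trel[OF A f] by blast
  have g: "green f \<in> dom_coupled a b p q r \<alpha> R \<and> (AE x in M. sl_tau a b p q r (green f) x = f x)"
    using trel_imp_dom(1,2)[OF u] by blast
  have un: "g = green f" if "g \<in> dom_coupled a b p q r \<alpha> R \<and> (AE x in M. sl_tau a b p q r g x = f x)" for g
    using that unfolding dom_coupled_iff[OF f] by (metis green_eq[OF A])
  show "\<exists>!g. g \<in> dom_coupled a b p q r \<alpha> R \<and> (AE x in M. sl_tau a b p q r g x = f x)"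
    by (rule ex1I[of _ "green f"]) (fact g, fact un)
  show "op_inverse a b p q r \<alpha> R f = green f"
    unfolding op_inverse_def by (rule the_equality) (fact g, fact un)
qed

text \<open>The measure is finite, so the pointwise bound on \<open>green h\<close> implies
  boundedness in the norm of \<open>L2\<close>.\<close>

lemma op_inverse_bounded:
  assumes A: "A0 \<noteq> 0"
  shows "bounded_operator M (op_inverse a b p q r \<alpha> R)"
proof -
  obtain D where D: "D > 0" "\<And>h x. h \<in> L2 M \<Longrightarrow> norm (green h x) \<le> D * sqrt (nsq M h)" using green_sup_bound by blast
  have "l2_norm M (green h) \<le> (D * sqrt (nsq M (\<lambda>_. 1))) * l2_norm M h" if h: "h \<in> L2 M" for h
  proof -
    define k where "k = D * sqrt (nsq M h)"
    have k0: "k \<ge> 0" using D nsq_nonneg[of M h] by (simp add: k_def)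
    have c: "(\<lambda>_. complex_of_real k) \<in> L2 M" by (rule L2_continuous) simp
    have "nsq M (green h) \<le> nsq M (\<lambda>_. complex_of_real k)"
      unfolding nsq_def
    proof (rule Bochner_Integration.integral_mono[OF L2D(2)[OF green_L2[OF A h]] L2D(2)[OF c]])
      fix x show "(norm (green h x))\<^sup>2 \<le> (norm (complex_of_real k))\<^sup>2"
        unfolding norm_of_real abs_of_nonneg[OF k0]
        using D(2)[OF h, of x] by (intro power_mono) (simp_all add: k_def)
    qed
    also have "\<dots> = k\<^sup>2 * nsq M (\<lambda>_. 1)" using nsq_scale[of M "complex_of_real k" "\<lambda>_. 1"] by simp
    finally have "sqrt (nsq M (green h)) \<le> sqrt (k\<^sup>2 * nsq M (\<lambda>_. 1))" by (rule real_sqrt_le_mono)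
    then show ?thesis using k0 by (simp add: l2_norm_eq real_sqrt_mult k_def mult_ac)
  qed
  then show ?thesis
    unfolding bounded_operator_def
    using op_inverse_eq(2)[OF A] green_L2[OF A] green_linear[OF A] by (auto simp: L2_add L2_scale)
qed

text \<open>The trace has to come out the same in every orthonormal basis \<open>E\<close>. The
  double family of \<open>(norm (l2_inner M e u))^2 / l u\<close> over \<open>U\<close> and
  \<open>E\<close> is absolutely summable; summed over \<open>E\<close> first, Parseval gives the
  sum of \<open>1 / l u\<close>, and summed over \<open>U\<close> first, the eigenfunction expansion
  gives the diagonal entries.\<close>

lemma op_inverse_trace:
  assumes A: "A0 \<noteq> 0" and B: "orthonormal_basis M U" and l: "\<And>e. e \<in> U \<Longrightarrow> \<exists>u. trel (\<lambda>x. of_real (l e) * e x) e u"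
    and l0: "\<And>e. e \<in> U \<Longrightarrow> l e \<noteq> 0" and s: "(\<lambda>e. 1 / \<bar>l e\<bar>) summable_on U"
  shows "has_trace M (op_inverse a b p q r \<alpha> R) (\<Sum>\<^sub>\<infinity>e\<in>U. 1 / complex_of_real (l e))"
  unfolding has_trace_def
proof (intro conjI allI impI op_inverse_bounded A)
  fix E assume E: "orthonormal_basis M E"
  have UL: "u \<in> L2 M" "nsq M u = 1" if "u \<in> U" for u
    using B that inner_self[of M u] by (auto simp: orthonormal_basis_def)
  have EL: "e \<in> L2 M" if "e \<in> E" for e using E that by (auto simp: orthonormal_basis_def)
  define f where "f = (\<lambda>(u, e). complex_of_real ((norm (l2_inner M e u))\<^sup>2) * (1 / complex_of_real (l u)))"
  have row: "((\<lambda>e. (norm (l2_inner M e u))\<^sup>2) has_sum 1) E" if "u \<in> U" for u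
    using Parseval[OF E UL(1)[OF that]] UL(2)[OF that] by simp
  have "(\<lambda>p. norm (f p)) summable_on U \<times> E"
  proof (rule summable_on_SigmaI)
    show "((\<lambda>e. norm (f (u, e))) has_sum 1 * (1 / \<bar>l u\<bar>)) E" if u: "u \<in> U" for u
      using has_sum_cmult_left[OF row[OF u], of "1 / \<bar>l u\<bar>"] by (simp add: f_def norm_mult norm_divide del: of_real_power)
    show "(\<lambda>u. 1 * (1 / \<bar>l u\<bar>)) summable_on U" using s by simp
  qed auto
  then have "f summable_on U \<times> E" by (rule abs_summable_summable)
  then obtain t where t: "(f has_sum t) (U \<times> E)" unfolding summable_on_def by blast
  have "((\<lambda>u. 1 * (1 / complex_of_real (l u))) has_sum t) U"
  proof (rule has_sum_SigmaD[OF t])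
    fix u assume u: "u \<in> U"
    have "((\<lambda>e. complex_of_real ((norm (l2_inner M e u))\<^sup>2)) has_sum of_real 1) E" by (rule has_sum_of_real[OF row[OF u]])
    from has_sum_cmult_left[OF this, of "1 / complex_of_real (l u)"]
    show "((\<lambda>e. f (u, e)) has_sum 1 * (1 / complex_of_real (l u))) E" by (simp add: f_def)
  qed
  then have tt: "t = (\<Sum>\<^sub>\<infinity>e\<in>U. 1 / complex_of_real (l e))" using infsumI by fastforce
  have "((\<lambda>(e, u). f (u, e)) has_sum t) (E \<times> U)" using t has_sum_swap[of f U E t] by simp
  then have "((\<lambda>e. l2_inner M e (op_inverse a b p q r \<alpha> R e)) has_sum t) E"
  proof (rule has_sum_SigmaD)
    fix e assume e: "e \<in> E"
    have tm: "cnj (l2_inner M u e) * l2_inner M u (green e) = f (u, e)" if u: "u \<in> U" for u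
    proof -
      obtain v where v: "trel (\<lambda>x. of_real (l u) * u x) u v" using l[OF u] by blast
      obtain w where w: "trel e (green e) w" using green_trel[OF A EL[OF e]] by blast
      have "l2_inner M u e = of_real (l u) * l2_inner M u (green e)"
        using trel_symmetric[OF v w] by (simp add: inner_scale_left)
      then have "l2_inner M u (green e) = l2_inner M u e / of_real (l u)" using l0[OF u] by simp
      moreover have "cnj (l2_inner M u e) * l2_inner M u e = complex_of_real ((norm (l2_inner M u e))\<^sup>2)"
        using complex_norm_square[of "l2_inner M u e"] by (simp add: mult.commute)
      moreover have "norm (l2_inner M u e) = norm (l2_inner M e u)" using inner_cnj[of M u e] by simp
      ultimately show ?thesis by (simp add: f_def)
    qed
    have "((\<lambda>u. cnj (l2_inner M u e) * l2_inner M u (green e)) has_sum l2_inner M e (green e)) U"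
      by (rule Parseval_inner[OF B EL[OF e] green_L2[OF A EL[OF e]]])
    then have "((\<lambda>u. f (u, e)) has_sum l2_inner M e (green e)) U"
      by (subst has_sum_cong[where g = "\<lambda>u. cnj (l2_inner M u e) * l2_inner M u (green e)"]) (simp_all add: tm)
    then show "((\<lambda>y. case (e, y) of (e, u) \<Rightarrow> f (u, e)) has_sum l2_inner M e (op_inverse a b p q r \<alpha> R e)) U"
      by (simp add: op_inverse_eq(2)[OF A EL[OF e]])
  qed
  then show "((\<lambda>e. l2_inner M e (op_inverse a b p q r \<alpha> R e)) has_sum (\<Sum>\<^sub>\<infinity>e\<in>U. 1 / complex_of_real (l e))) E"
    by (simp add: tt)
qed

lemma op_inverse_trace_zeta:
  assumes 0: "0 \<notin> eigenvalues a b p q r \<alpha> R"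
  shows "has_trace M (op_inverse a b p q r \<alpha> R) (spectral_zeta a b p q r \<alpha> R 1)"
proof -
  obtain U l c where B: "orthonormal_basis M U" and l: "\<And>e. e \<in> U \<Longrightarrow> \<exists>u. trel (\<lambda>x. of_real (l e) * e x) e u"
    and cl: "\<And>e. e \<in> U \<Longrightarrow> c \<le> l e" and c: "\<And>h y u. trel h y u \<Longrightarrow> c * nsq M y \<le> Re (l2_inner M y h)"
    using spectral_basis by metis
  have fin: "finite {e \<in> U. l e \<le> d}" for d by (rule log_deriv_at_0(1)[OF B, where l = l and c = c]; fact l cl c)
  have "(\<lambda>e. 1 / \<bar>l e\<bar>) summable_on (U - {e \<in> U. l e = 0})"
    by (rule log_deriv_at_0(2)[OF B, where l = l and c = c]; fact l cl c)
  moreover have l0: "l e \<noteq> 0" if "e \<in> U" for e using 0 that eigenvalues_eq[OF B l fin] by force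
  moreover have Z: "U - {e \<in> U. l e = 0} = U" using l0 by blast
  ultimately have s: "(\<lambda>e. 1 / \<bar>l e\<bar>) summable_on U" by simp
  have "(\<lambda>e. 1 / complex_of_real (l e)) summable_on U"
    by (rule abs_summable_summable) (use s in \<open>simp add: norm_divide\<close>)
  then have "((\<lambda>e. 1 / complex_of_real (l e) ^ 1) has_sum (\<Sum>\<^sub>\<infinity>e\<in>U. 1 / complex_of_real (l e))) (U - {e \<in> U. l e = 0})"
    unfolding Z power_one_right by (rule has_sum_infsum)
  from zeta_has_sum[OF B l fin this]
  have "spectral_zeta a b p q r \<alpha> R 1 = (\<Sum>\<^sub>\<infinity>e\<in>U. 1 / complex_of_real (l e))"
    unfolding spectral_zeta_def by (simp add: infsumI)
  then show ?thesis using op_inverse_trace[OF char_fun_zero_eigenvalue[OF 0] B l l0 s] by simp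
qed

end

theorem theorem4p7:
  fixes a b :: real and p q r :: "real \<Rightarrow> real" and \<phi> :: real and R :: "real^2^2"
    and A B :: "nat \<Rightarrow> complex" and m0 :: nat
  assumes "a < b"
    and "p \<in> borel_measurable (lebesgue_on {a<..<b})"
    and "q \<in> borel_measurable (lebesgue_on {a<..<b})"
    and "r \<in> borel_measurable (lebesgue_on {a<..<b})"
    and "AE x in lebesgue_on {a<..<b}. r x > 0"
    and "integrable (lebesgue_on {a<..<b}) r"
    and "AE x in lebesgue_on {a<..<b}. p x > 0"
    and "integrable (lebesgue_on {a<..<b}) (\<lambda>x. 1 / p x)"
    and "integrable (lebesgue_on {a<..<b}) q"
    and "0 \<le> \<phi>" and "\<phi> < pi"
    and "det R = 1"
    and "m0 = eig_mult a b p q r \<phi> R 0" and "m0 \<in> {0, 1}"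
    and "A 0 = bc_coeff a b p q r \<phi> R 0 + cis (2 * \<phi>) + 1"
    and "\<And>k. k \<ge> 1 \<Longrightarrow> A k = bc_coeff a b p q r \<phi> R k"
    and "m0 = 0 \<Longrightarrow> B 1 = A 1 / A 0"
    and "\<And>j. m0 = 0 \<Longrightarrow> j \<ge> 2 \<Longrightarrow>
           B j = A j / A 0 - (\<Sum>l=1..j-1. of_nat l / of_nat j * (A (j - l) / A 0) * B l)"
    and "m0 = 1 \<Longrightarrow> B 1 = A 2 / A 1"
    and "\<And>j. m0 = 1 \<Longrightarrow> j \<ge> 2 \<Longrightarrow>
           B j = A (j + 1) / A 1 - (\<Sum>l=1..j-1. of_nat l / of_nat j * (A (j - l + 1) / A 1) * B l)"
  shows "(\<forall>n::nat. n \<ge> 1 \<longrightarrow>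
           zeta_term a b p q r \<phi> R (of_nat n) summable_on (eigenvalues a b p q r \<phi> R - {0}) \<and>
           spectral_zeta a b p q r \<phi> R (of_nat n) =
             - residue (\<lambda>z. 1 / z ^ n *
                 (deriv (char_fun a b p q r \<phi> R) z / char_fun a b p q r \<phi> R z)) 0 \<and>
           spectral_zeta a b p q r \<phi> R (of_nat n) = - of_nat n * B n) \<and>
         (0 \<notin> eigenvalues a b p q r \<phi> R \<longrightarrow>
           (\<forall>f\<in>L2 (sl_measure a b r). \<exists>!g. g \<in> dom_coupled a b p q r \<phi> R \<and>
              (AE x in sl_measure a b r. sl_tau a b p q r g x = f x)) \<and>
           has_trace (sl_measure a b r) (op_inverse a b p q r \<phi> R)
             (spectral_zeta a b p q r \<phi> R 1) \<and>
           spectral_zeta a b p q r \<phi> R 1 =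
             - bc_coeff a b p q r \<phi> R 1 / (bc_coeff a b p q r \<phi> R 0 + cis (2 * \<phi>) + 1))"
proof -
  interpret coupled a b p q r \<phi> R
    by unfold_locales (fact assms)+
  have A: "A = char_coeff"
    using assms(15,16) by (auto simp: fun_eq_iff char_coeff_def)
  \<comment> \<open>One formula for both cases; at \<open>j = 1\<close> the sum is empty and
    \<open>A (1 + m0)\<close> is the stated numerator.\<close>
  have B: "B j = A (j + m0) / A m0 - (\<Sum>l=1..j-1. of_nat l / of_nat j * (A (j - l + m0) / A m0) * B l)" if "j \<ge> 1" for j
  proof (cases "j = 1")
    case True
    then show ?thesis using assms(14,17,19) by (auto simp: numeral_2_eq_2)
  next
    case False
    then have "j \<ge> 2" using that by simp
    then show ?thesis using assms(14) assms(18)[of j] assms(20)[of j] by auto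
  qed
  obtain \<zeta> where zs: "\<And>n. n \<ge> 1 \<Longrightarrow> (zeta_term a b p q r \<phi> R (of_nat n) has_sum \<zeta> n) (eigenvalues a b p q r \<phi> R - {0})"
    and rec: "\<And>k. (of_nat k - of_nat (eig_mult a b p q r \<phi> R 0)) * char_coeff k = - (\<Sum>j=1..k. char_coeff (k - j) * \<zeta> j)"
    and res: "\<And>n. n \<ge> 1 \<Longrightarrow> residue (\<lambda>z. 1 / z ^ n * (deriv F z / F z)) 0 = - \<zeta> n"
    and nz: "\<exists>z. F z \<noteq> 0" and m0: "eig_mult a b p q r \<phi> R 0 = 0 \<Longrightarrow> char_coeff 0 \<noteq> 0"
    by (rule zeta_sums, rule that) assumption+
  have \<zeta>B: "\<zeta> n = - of_nat n * B n" if n: "n \<ge> 1" for n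
    by (rule zeta_recursion[OF A assms(13,14) B n _ nz]) (use rec m0 in \<open>simp_all add: A assms(13)\<close>)
  have zeta: "spectral_zeta a b p q r \<phi> R (of_nat n) = \<zeta> n" if "n \<ge> 1" for n
    unfolding spectral_zeta_def by (rule infsumI[OF zs[OF that]])
  show ?thesis
  proof (intro conjI allI impI ballI)
    fix n :: nat assume n: "n \<ge> 1"
    show "zeta_term a b p q r \<phi> R (of_nat n) summable_on (eigenvalues a b p q r \<phi> R - {0})"
      using zs[OF n] by (rule has_sum_imp_summable)
    show "spectral_zeta a b p q r \<phi> R (of_nat n) = - residue (\<lambda>z. 1 / z ^ n * (deriv F z / F z)) 0"
      by (simp only: zeta[OF n] res[OF n] minus_minus)
    show "spectral_zeta a b p q r \<phi> R (of_nat n) = - of_nat n * B n"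
      by (simp only: zeta[OF n] \<zeta>B[OF n])
  next
    assume 0: "0 \<notin> eigenvalues a b p q r \<phi> R"
    note A0 = char_fun_zero_eigenvalue[OF 0]
    show "\<exists>!g. g \<in> dom_coupled a b p q r \<phi> R \<and> (AE x in M. sl_tau a b p q r g x = f x)" if "f \<in> L2 M" for f
      by (rule op_inverse_eq(1)[OF A0 that])
    show "has_trace M (op_inverse a b p q r \<phi> R) (spectral_zeta a b p q r \<phi> R 1)"
      by (rule op_inverse_trace_zeta[OF 0])
    have "A 0 \<noteq> 0" using A0 assms(15) by simp
    \<comment> \<open>The recursion at \<open>k = 0\<close> reads \<open>- m0 * A 0 = 0\<close>, so
      a nonzero \<open>A 0\<close> excludes \<open>m0 = 1\<close>.\<close>
    then have "m0 = 0" using rec[of 0] assms(13,14) A by auto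
    then have "\<zeta> 1 = - (A 1 / A 0)" using \<zeta>B[of 1] assms(17) by simp
    then show "spectral_zeta a b p q r \<phi> R 1 = - bc_coeff a b p q r \<phi> R 1 / (bc_coeff a b p q r \<phi> R 0 + cis (2 * \<phi>) + 1)"
      using zeta[of 1] assms(15) assms(16)[of 1] by simp
  qed
qed

end
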